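(* Let $\mathcal{F}=(V,\mathcal{A}\cup\mathcal{E})$ be a mixed hypergraph, $k\in\mathbb{Z}_+$, $f,g:V\rightarrow\mathbb{Z}_+$ functions and $w:\mathcal{A}\cup\mathcal{E}\rightarrow\mathbb{R}$ a weight function. Then a $(k,f,g)$-flexible packing of mixed hyperarborescences in $\mathcal{F}$ of minimum weight can be computed in polynomial time, if there exists one.
   Context: $\mathbb{Z}_+$ denotes the nonnegative integers. A mixed hypergraph is $\mathcal{F}=(V,\mathcal{A}\cup\mathcal{E})$, where $V$ is a finite nonempty set of vertices, $\mathcal{A}$ is a finite collection of dyperedges and $\mathcal{E}$ is a finite collection of hyperedges (parallel copies are allowed and regarded as distinct elements). A dyperedge is a tuple $a=(tail(a),head(a))$ with $head(a)\in V$ and $tail(a)$ a nonempty subset of $V-\{head(a)\}$; a hyperedge is a subset of $V$ of size at least two. An $r$-arborescence is a digraph containing the vertex $r$ whose underlying graph is a tree and in which every vertex except $r$ has exactly one entering arc; it is spanning if its vertex set is $V$. Trimming a dyperedge $a$ means replacing it by an arc $uv$ with $v=head(a)$ and $u\in tail(a)$; trimming a hyperedge $e$ means replacing it by an arc $uv$ with $u\neq v$, $u,v\in e$. A spanning mixed $r$-hyperarborescence of $\mathcal{F}$ is a sub-mixed-hypergraph $(V,\mathcal{A}'\cup\mathcal{E}')$ with $\mathcal{A}'\subseteq\mathcal{A}$, $\mathcal{E}'\subseteq\mathcal{E}$, together with a vertex $r\in V$ (its root), such that its dyperedges and hyperedges can be trimmed (each to one arc) to obtain a spanning $r$-arborescence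 on $V$. A packing is a collection of such objects that are pairwise disjoint in dyperedges and hyperedges. A packing of $k$ spanning mixed hyperarborescences (each with a specified root) is $(k,f,g)$-flexible if every $v\in V$ is the root of at least $f(v)$ and at most $g(v)$ of them. The weight of a packing is the sum of $w$ over all dyperedges and hyperedges contained in its members. *)

theory Defs
  imports
    Complex_Main
    "HOL-Computational_Algebra.Polynomial"
    "Graph_Theory.Digraph_Component"
begin

section \<open>Mixed hypergraphs\<close>

text \<open>
  Dyperedges and hyperedges are names drawn from one type; distinct names may carry the same
  tail, head or ends, so parallel copies are distinct elements.
\<close>

record ('v, 'e) mixed_hypergraph =
  mverts :: "'v set"
  dyperedges :: "'e set"
  dtail :: "'e \<Rightarrow> 'v set"
  dhead :: "'e \<Rightarrow> 'v"
  hyperedges :: "'e set"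
  ends :: "'e \<Rightarrow> 'v set"

definition wf_mixed_hypergraph :: "('v, 'e) mixed_hypergraph \<Rightarrow> bool" where
  "wf_mixed_hypergraph F \<longleftrightarrow>
     finite (mverts F) \<and> mverts F \<noteq> {} \<and>
     finite (dyperedges F) \<and> finite (hyperedges F) \<and> dyperedges F \<inter> hyperedges F = {} \<and>
     (\<forall>a\<in>dyperedges F. dhead F a \<in> mverts F \<and> dtail F a \<noteq> {} \<and>
                        dtail F a \<subseteq> mverts F - {dhead F a}) \<and>
     (\<forall>e\<in>hyperedges F. ends F e \<subseteq> mverts F \<and> 2 \<le> card (ends F e))"


section \<open>Arborescences and trimming\<close>

text \<open>
  A cycle of the underlying undirected multigraph: the arc \<open>es ! i\<close> joins \<open>vs ! i\<close> to its cyclic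
  successor, in either direction. Loops (length 1) and pairs of parallel or opposite arcs
  (length 2) count as cycles.
\<close>

definition underlying_cycle :: "('v, 'e) pre_digraph \<Rightarrow> 'e list \<Rightarrow> 'v list \<Rightarrow> bool" where
  "underlying_cycle D es vs \<longleftrightarrow>
     es \<noteq> [] \<and> length vs = length es \<and> distinct es \<and> distinct vs \<and> set es \<subseteq> arcs D \<and>
     (\<forall>i<length es. {tail D (es ! i), head D (es ! i)} = {vs ! i, vs ! (Suc i mod length es)})"

text \<open>
  The library predicate \<^const>\<open>tree\<close> only excludes directed cycles, so it does not say that
  the underlying graph of a digraph is a tree. The library's \<open>connected\<close> does refer to the
  symmetric closure; it is qualified to avoid the topological constant.
\<close>

definition underlying_tree :: "('v, 'e) pre_digraph \<Rightarrow> bool" where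
  "underlying_tree D \<longleftrightarrow>
     Digraph_Component.connected D \<and> (\<nexists>es vs. underlying_cycle D es vs)"

definition arborescence :: "'v \<Rightarrow> ('v, 'e) pre_digraph \<Rightarrow> bool" where
  "arborescence r D \<longleftrightarrow>
     fin_digraph D \<and> r \<in> verts D \<and> underlying_tree D \<and>
     (\<forall>v\<in>verts D - {r}. in_degree D v = 1)"

text \<open>Trimming turns the edge named \<open>e\<close> into an arc that keeps the name \<open>e\<close>.\<close>

definition is_trimming :: "('v, 'e) mixed_hypergraph \<Rightarrow> 'e set \<Rightarrow> ('v, 'e) pre_digraph \<Rightarrow> bool" where
  "is_trimming F B D \<longleftrightarrow>
     verts D = mverts F \<and> arcs D = B \<and>
     (\<forall>a\<in>B \<inter> dyperedges F. head D a = dhead F a \<and> tail D a \<in> dtail F a) \<and>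
     (\<forall>e\<in>B \<inter> hyperedges F. tail D e \<in> ends F e \<and> head D e \<in> ends F e \<and> tail D e \<noteq> head D e)"

text \<open>
  A sub-mixed-hypergraph on all vertices is given by its set \<open>B\<close> of dyperedges and hyperedges.
\<close>

definition spanning_mixed_hyperarborescence ::
    "('v, 'e) mixed_hypergraph \<Rightarrow> 'v \<Rightarrow> 'e set \<Rightarrow> bool" where
  "spanning_mixed_hyperarborescence F r B \<longleftrightarrow>
     r \<in> mverts F \<and> B \<subseteq> dyperedges F \<union> hyperedges F \<and>
     (\<exists>D. is_trimming F B D \<and> arborescence r D)"


section \<open>Flexible packings\<close>

type_synonym ('v, 'e) packing = "('v \<times> 'e set) list"

definition flexible_packing ::
    "('v, 'e) mixed_hypergraph \<Rightarrow> nat \<Rightarrow> ('v \<Rightarrow> nat) \<Rightarrow> ('v \<Rightarrow> nat) \<Rightarrow> ('v, 'e) packing \<Rightarrow> bool" where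
  "flexible_packing F k f g P \<longleftrightarrow>
     length P = k \<and>
     (\<forall>(r, B)\<in>set P. spanning_mixed_hyperarborescence F r B) \<and>
     (\<forall>i<length P. \<forall>j<length P. i \<noteq> j \<longrightarrow> snd (P ! i) \<inter> snd (P ! j) = {}) \<and>
     (\<forall>v\<in>mverts F. f v \<le> count_list (map fst P) v \<and> count_list (map fst P) v \<le> g v)"

definition packing_weight :: "('e \<Rightarrow> real) \<Rightarrow> ('v, 'e) packing \<Rightarrow> real" where
  "packing_weight w P = (\<Sum>(r, B)\<leftarrow>P. sum w B)"

definition min_weight_flexible_packing ::
    "('v, 'e) mixed_hypergraph \<Rightarrow> nat \<Rightarrow> ('v \<Rightarrow> nat) \<Rightarrow> ('v \<Rightarrow> nat) \<Rightarrow> ('e \<Rightarrow> real) \<Rightarrow>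
     ('v, 'e) packing \<Rightarrow> bool" where
  "min_weight_flexible_packing F k f g w P \<longleftrightarrow>
     flexible_packing F k f g P \<and>
     (\<forall>Q. flexible_packing F k f g Q \<longrightarrow> packing_weight w P \<le> packing_weight w Q)"


section \<open>Computation in polynomial time\<close>

text \<open>
  The machine model is a while language on binary trees whose leaves may carry real numbers.
  Trees are immutable, hence passed by reference, and only the root of a tree can be inspected
  in one step.

  Reals can be added, subtracted and compared at unit cost, and 1 is the only numeric constant.
  Multiplication is left out because repeated squaring at unit cost is not a reasonable
  operation; arbitrary real constants are left out because they could hold an infinite advice
  string. After \<open>t\<close> steps every number is an integer combination of 1 and the input
  numbers with coefficients of absolute value at most \<open>2 ^ t\<close>, so on rational data a
  polynomial number of steps is also a polynomial number of bit operations.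
\<close>

datatype data = Empty | Num real | Node data data

text \<open>\<open>IsNum\<close>, \<open>IsNode\<close> and \<open>Leq\<close> answer \<open>Num 1\<close> for true and \<open>Empty\<close> for false.\<close>

datatype expr =
    Var nat
  | ENil
  | EOne
  | ENode expr expr
  | Left expr
  | Right expr
  | IsNum expr
  | IsNode expr
  | Plus expr expr
  | Minus expr expr
  | Leq expr expr

datatype com =
    Skip
  | Assign nat expr
  | Seq com com
  | Cond expr com com
  | While expr com

type_synonym state = "nat \<Rightarrow> data"

definition of_bool_data :: "bool \<Rightarrow> data" where
  "of_bool_data b = (if b then Num 1 else Empty)"

text \<open>Operations applied to arguments of the wrong shape yield \<open>Empty\<close>.\<close>

fun exp_val :: "expr \<Rightarrow> state \<Rightarrow> data" where
  "exp_val (Var x) s = s x"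
| "exp_val ENil s = Empty"
| "exp_val EOne s = Num 1"
| "exp_val (ENode a b) s = Node (exp_val a s) (exp_val b s)"
| "exp_val (Left a) s = (case exp_val a s of Node l r \<Rightarrow> l | _ \<Rightarrow> Empty)"
| "exp_val (Right a) s = (case exp_val a s of Node l r \<Rightarrow> r | _ \<Rightarrow> Empty)"
| "exp_val (IsNum a) s = of_bool_data (case exp_val a s of Num _ \<Rightarrow> True | _ \<Rightarrow> False)"
| "exp_val (IsNode a) s = of_bool_data (case exp_val a s of Node _ _ \<Rightarrow> True | _ \<Rightarrow> False)"
| "exp_val (Plus a b) s =
     (case (exp_val a s, exp_val b s) of (Num x, Num y) \<Rightarrow> Num (x + y) | _ \<Rightarrow> Empty)"
| "exp_val (Minus a b) s =
     (case (exp_val a s, exp_val b s) of (Num x, Num y) \<Rightarrow> Num (x - y) | _ \<Rightarrow> Empty)"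
| "exp_val (Leq a b) s =
     (case (exp_val a s, exp_val b s) of (Num x, Num y) \<Rightarrow> of_bool_data (x \<le> y) | _ \<Rightarrow> Empty)"

fun cost :: "expr \<Rightarrow> nat" where
  "cost (Var x) = 1"
| "cost ENil = 1"
| "cost EOne = 1"
| "cost (ENode a b) = 1 + cost a + cost b"
| "cost (Left a) = 1 + cost a"
| "cost (Right a) = 1 + cost a"
| "cost (IsNum a) = 1 + cost a"
| "cost (IsNode a) = 1 + cost a"
| "cost (Plus a b) = 1 + cost a + cost b"
| "cost (Minus a b) = 1 + cost a + cost b"
| "cost (Leq a b) = 1 + cost a + cost b"

text \<open>
  \<open>exec c s t s'\<close>: started in state \<open>s\<close>, the command \<open>c\<close> halts after \<open>t\<close> elementary steps in
  state \<open>s'\<close>. A guard holds if its value is not \<open>Empty\<close>.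
\<close>

inductive exec :: "com \<Rightarrow> state \<Rightarrow> nat \<Rightarrow> state \<Rightarrow> bool" where
  Skip: "exec Skip s 1 s"
| Assign: "exec (Assign x a) s (1 + cost a) (s(x := exp_val a s))"
| Seq: "exec c1 s t1 s' \<Longrightarrow> exec c2 s' t2 s'' \<Longrightarrow> exec (Seq c1 c2) s (1 + t1 + t2) s''"
| CondTrue: "exp_val b s \<noteq> Empty \<Longrightarrow> exec c1 s t s' \<Longrightarrow> exec (Cond b c1 c2) s (1 + cost b + t) s'"
| CondFalse: "exp_val b s = Empty \<Longrightarrow> exec c2 s t s' \<Longrightarrow> exec (Cond b c1 c2) s (1 + cost b + t) s'"
| WhileFalse: "exp_val b s = Empty \<Longrightarrow> exec (While b c) s (1 + cost b) s"
| WhileTrue: "exp_val b s \<noteq> Empty \<Longrightarrow> exec c s t1 s' \<Longrightarrow> exec (While b c) s' t2 s'' \<Longrightarrow>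
              exec (While b c) s (1 + cost b + t1 + t2) s''"

lemma exec_deterministic:
  "exec c s t s' \<Longrightarrow> exec c s u s'' \<Longrightarrow> u = t \<and> s'' = s'"
proof (induction arbitrary: u s'' rule: exec.induct)
  case (Skip s)
  then show ?case by cases simp_all
next
  case (Assign x a s)
  then show ?case by cases simp_all
next
  case (Seq c1 s t1 s' c2 t2 r)
  from Seq.prems obtain t1' q t2' where
    "exec c1 s t1' q" "exec c2 q t2' s''" "u = 1 + t1' + t2'" by cases simp_all
  with Seq.IH show ?case by metis
next
  case (CondTrue b s c1 t s' c2)
  from CondTrue.prems CondTrue.hyps obtain t' where "exec c1 s t' s''" "u = 1 + cost b + t'"
    by cases simp_all
  with CondTrue.IH show ?case by metis
next
  case (CondFalse b s c2 t s' c1)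
  from CondFalse.prems CondFalse.hyps obtain t' where "exec c2 s t' s''" "u = 1 + cost b + t'"
    by cases simp_all
  with CondFalse.IH show ?case by metis
next
  case (WhileFalse b s c)
  from WhileFalse.prems WhileFalse.hyps show ?case by cases simp_all
next
  case (WhileTrue b s c t1 s' t2 r)
  from WhileTrue.prems WhileTrue.hyps obtain t1' q t2' where
    "exec c s t1' q" "exec (While b c) q t2' s''" "u = 1 + cost b + t1' + t2'" by cases simp_all
  with WhileTrue.IH show ?case by metis
qed

fun data_size :: "data \<Rightarrow> nat" where
  "data_size Empty = 1"
| "data_size (Num x) = 1"
| "data_size (Node l r) = 1 + data_size l + data_size r"

text \<open>
  One program, with one polynomial bound in the size of the encoded input, works for all
  instances. Input and output are held in variable 0.
\<close>

definition poly_time_solvable ::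
    "'i set \<Rightarrow> ('i \<Rightarrow> data) \<Rightarrow> ('i \<Rightarrow> data \<Rightarrow> bool) \<Rightarrow> bool" where
  "poly_time_solvable I enc correct \<longleftrightarrow>
     (\<exists>(c :: com) (p :: nat poly). \<forall>i\<in>I. \<exists>t s.
        exec c ((\<lambda>_. Empty)(0 := enc i)) t s \<and>
        t \<le> poly p (data_size (enc i)) \<and>
        correct i (s 0))"


section \<open>Encoding of instances and packings\<close>

definition enc_list :: "data list \<Rightarrow> data" where
  "enc_list ds = foldr Node ds Empty"

definition enc_nat :: "nat \<Rightarrow> data" where
  "enc_nat n = Num (real n)"

definition enc_set :: "nat set \<Rightarrow> data" where
  "enc_set S = enc_list (map enc_nat (sorted_list_of_set S))"

type_synonym 'i packing_instance =
  "('i, 'i) mixed_hypergraph \<times> nat \<times> ('i \<Rightarrow> nat) \<times> ('i \<Rightarrow> nat) \<times> ('i \<Rightarrow> real)"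

fun enc_instance :: "nat packing_instance \<Rightarrow> data" where
  "enc_instance (F, k, f, g, w) = enc_list
     [enc_list (map (\<lambda>v. enc_list [enc_nat v, enc_nat (f v), enc_nat (g v)])
        (sorted_list_of_set (mverts F))),
      enc_list (map (\<lambda>a. enc_list [enc_nat a, Num (w a), enc_nat (dhead F a), enc_set (dtail F a)])
        (sorted_list_of_set (dyperedges F))),
      enc_list (map (\<lambda>e. enc_list [enc_nat e, Num (w e), enc_set (ends F e)])
        (sorted_list_of_set (hyperedges F))),
      enc_nat k]"

text \<open>
  A packing is output as a list of entries \<open>(m, r, es)\<close>, each standing for \<open>m\<close> members with
  root \<open>r\<close> and edge set \<open>set es\<close>. If \<open>V\<close> is a singleton, all \<open>k\<close> members have an empty
  edge set, and writing them out one by one would take time exponential in the length of the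
  binary representation of \<open>k\<close>. In all other cases members are nonempty and disjoint, so
  \<open>m \<le> 1\<close>.
\<close>

definition represents_packing :: "data \<Rightarrow> (nat, nat) packing \<Rightarrow> bool" where
  "represents_packing y P \<longleftrightarrow>
     (\<exists>entries :: (nat \<times> nat \<times> nat list) list.
        (\<forall>(m, r, es)\<in>set entries. distinct es) \<and>
        y = enc_list (map (\<lambda>(m, r, es).
              enc_list [enc_nat m, enc_nat r, enc_list (map enc_nat es)]) entries) \<and>
        P = concat (map (\<lambda>(m, r, es). replicate m (r, set es)) entries))"

text \<open>
  \<open>Empty\<close> reports that there is no packing; a packing is wrapped in a one-element list, because
  the empty packing (\<open>k = 0\<close>) is itself encoded by \<open>Empty\<close>.
\<close>

fun correct_output :: "nat packing_instance \<Rightarrow> data \<Rightarrow> bool" where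
  "correct_output (F, k, f, g, w) y \<longleftrightarrow>
     (if \<exists>P. flexible_packing F k f g P
      then \<exists>P z. min_weight_flexible_packing F k f g w P \<and> represents_packing z P \<and>
                 y = enc_list [z]
      else y = Empty)"

end

theory Submission
  imports Defs "HOL-Library.Multiset"
begin

text \<open>
  If \<open>V\<close> is a singleton, there are no edges and the answer is immediate. Otherwise, by the theorem of
  Edmonds, a set of edges and \<open>k\<close> root arcs that leave an extra vertex can be trimmed and split into
  \<open>k\<close> spanning arborescences iff at most \<open>k (|X| - 1)\<close> of the edges are spanned by each nonempty
  \<open>X \<subseteq> V\<close> and the edges can be oriented such that, together with the root arcs, \<open>k\<close> arcs enter every
  vertex. At each vertex \<open>v\<close>, \<open>f v\<close> root arcs are mandatory and \<open>min k (g v) - f v\<close> further ones are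
  optional. Edges and optional root arcs are the elements of two matroids: the first bounds the number
  of spanned edges and the number of optional root arcs, the second asks for an orientation with at most
  \<open>k - f v\<close> arcs entering \<open>v\<close>. The packings correspond to the common independent sets of size
  \<open>\<Sum>v. k - f v\<close>, with the same weight, so weighted matroid intersection finds a best one. Independence
  in either matroid is Hall's condition for a family of sets of vertices and a multiset of slots at the
  vertices, and is tested by an auction. The common independent set is oriented by a matching
  and then decomposed greedily as in Lovasz' proof of Edmonds' theorem.
\<close>


section \<open>Polynomial bounds\<close>

text \<open>Edmonds' condition comes out of two counts. If \<open>k\<close> arcs enter every vertex
  and at most \<open>k (|X| - 1)\<close> edges are spanned by \<open>X\<close>, then at least
  \<open>k |X| - k (|X| - 1) = k\<close> arcs enter \<open>X\<close> from outside. For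
  \<open>X = V\<close> these can only be root arcs, and the limits on mandatory and optional root
  arcs add up to \<open>k\<close>. So there are exactly \<open>k\<close> of them and every
  arborescence takes one, whose head is its root; the bounds on the roots are thus settled before
  any arborescence is built. The machine has no arrays and no recursion. Hence every algorithm is a
  function on lists, composed of filters, maps, folds and iterations with a prescribed number of
  rounds, and its running time is derived along the structure of its definition. An auction,
  Bellman-Ford rounds and greedy choices by repeated testing fit this form. Polynomial time does not
  compose under iteration by itself: each loop has to come with a bound on all its intermediate
  values in terms of the original input.\<close>

definition pbound :: "'a set \<Rightarrow> ('a \<Rightarrow> nat) \<Rightarrow> ('a \<Rightarrow> nat) \<Rightarrow> bool" where
  "pbound X N h \<longleftrightarrow> (\<exists>d. \<forall>x\<in>X. h x \<le> (N x + 2) ^ d)"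

lemma pbound_mono:
  assumes "pbound X N h" "\<And>x. x \<in> X \<Longrightarrow> h' x \<le> h x"
  shows "pbound X N h'"
  using assms unfolding pbound_def by (meson order_trans)

lemma pbound_self: "pbound X N N"
  unfolding pbound_def by (intro exI[of _ 1]) simp

text \<open>The base \<open>N x + 2\<close> is at least 2 even where the measure vanishes, so a
  large exponent absorbs any constant. The same 2 absorbs a factor in the proof for sums.\<close>

lemma pbound_const: "pbound X N (\<lambda>_. c)"
proof -
  have "c \<le> (N x + 2) ^ c" for x
  proof -
    have "c \<le> 2 ^ c" by (simp add: less_imp_le)
    also have "\<dots> \<le> (N x + 2) ^ c" by (rule power_mono) auto
    finally show ?thesis .
  qed
  then show ?thesis unfolding pbound_def by blast
qed

lemma pbound_mult:
  assumes "pbound X N g" "pbound X N h"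
  shows "pbound X N (\<lambda>x. g x * h x)"
proof -
  from assms obtain d e where "\<forall>x\<in>X. g x \<le> (N x + 2) ^ d" "\<forall>x\<in>X. h x \<le> (N x + 2) ^ e"
    unfolding pbound_def by blast
  then have "\<forall>x\<in>X. g x * h x \<le> (N x + 2) ^ (d + e)"
    by (simp add: power_add mult_le_mono)
  then show ?thesis unfolding pbound_def by blast
qed

lemma pbound_add:
  assumes "pbound X N g" "pbound X N h"
  shows "pbound X N (\<lambda>x. g x + h x)"
proof -
  \<comment> \<open>This product dominates the sum even if one of the two values is 0, so closure
    under products can be reused.\<close>
  have "pbound X N (\<lambda>x. (g x + 1) * (h x + 1))"
  proof -
    have suc: "pbound X N (\<lambda>x. u x + 1)" if "pbound X N u" for u
    proof -
      from that obtain d where d: "\<forall>x\<in>X. u x \<le> (N x + 2) ^ d" unfolding pbound_def by blast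
      have "\<forall>x\<in>X. u x + 1 \<le> (N x + 2) ^ Suc d"
      proof
        fix x assume "x \<in> X"
        with d have "u x \<le> (N x + 2) ^ d" by blast
        moreover have "1 \<le> (N x + 2) ^ d" by simp
        ultimately have "u x + 1 \<le> 2 * (N x + 2) ^ d" by linarith
        also have "\<dots> \<le> (N x + 2) * (N x + 2) ^ d" by (rule mult_le_mono1) simp
        finally show "u x + 1 \<le> (N x + 2) ^ Suc d" by simp
      qed
      then show ?thesis unfolding pbound_def by blast
    qed
    from pbound_mult[OF suc[OF assms(1)] suc[OF assms(2)]] show ?thesis .
  qed
  then show ?thesis by (rule pbound_mono) (simp add: algebra_simps)
qed

lemma pbound_power: "pbound X N h \<Longrightarrow> pbound X N (\<lambda>x. h x ^ n)"
proof (induction n)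
  case (Suc n)
  then show ?case using pbound_mult[of X N h "\<lambda>x. h x ^ n"] by simp
qed (simp add: pbound_const)

lemma pbound_subset: "pbound X N h \<Longrightarrow> Y \<subseteq> X \<Longrightarrow> pbound Y N h"
  unfolding pbound_def by blast

text \<open>Polynomials compose; this replaces the measure of an inner situation by that of an outer
  one.\<close>

lemma pbound_trans:
  assumes "pbound X N M" "pbound X M h"
  shows "pbound X N h"
proof -
  from assms(2) obtain e where e: "\<forall>x\<in>X. h x \<le> (M x + 2) ^ e" unfolding pbound_def by blast
  have "pbound X N (\<lambda>x. (M x + 2) ^ e)"
    by (intro pbound_power pbound_add pbound_const assms(1))
  then show ?thesis by (rule pbound_mono) (use e in blast)
qed

lemma pbound_reindex:
  "pbound Y M h \<Longrightarrow> (\<And>x. x \<in> X \<Longrightarrow> p x \<in> Y) \<Longrightarrow> pbound X (\<lambda>x. M (p x)) (\<lambda>x. h (p x))"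
  unfolding pbound_def by blast

lemmas pbound_intros = pbound_add pbound_mult pbound_power pbound_const pbound_self


section \<open>Computability in polynomial time, relative to an index set\<close>

text \<open>
  Variable 0 holds the argument and then the result, variable 1 a stack that a program has to
  leave as it found it, and all other variables are scratch. The index \<open>x\<close> ranges over the
  situations in which the program is run; time and sizes are measured against \<open>N x\<close> and not
  against the size of the argument, so that programs compose inside loops.
\<close>

definition ptime :: "'a set \<Rightarrow> ('a \<Rightarrow> nat) \<Rightarrow> ('a \<Rightarrow> data) \<Rightarrow> ('a \<Rightarrow> data) \<Rightarrow> bool" where
  "ptime X N f g \<longleftrightarrow>
     pbound X N (\<lambda>x. data_size (f x)) \<and> pbound X N (\<lambda>x. data_size (g x)) \<and>
     (\<exists>c T. pbound X N T \<and>
       (\<forall>x\<in>X. \<forall>s. s 0 = f x \<longrightarrow>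
          (\<exists>t s'. exec c s t s' \<and> s' 0 = g x \<and> s' 1 = s 1 \<and> t \<le> T x)))"

lemma ptimeI:
  assumes "pbound X N (\<lambda>x. data_size (f x))" "pbound X N (\<lambda>x. data_size (g x))" "pbound X N T"
    "\<And>x (s::state). x \<in> X \<Longrightarrow> s 0 = f x \<Longrightarrow> \<exists>t s'. exec c s t s' \<and> s' 0 = g x \<and> s' 1 = s 1 \<and> t \<le> T x"
  shows "ptime X N f g"
  using assms unfolding ptime_def by blast

lemma ptimeE:
  assumes "ptime X N f g"
  obtains c T where "pbound X N (\<lambda>x. data_size (f x))" "pbound X N (\<lambda>x. data_size (g x))" "pbound X N T"
    "\<And>x (s::state). x \<in> X \<Longrightarrow> s 0 = f x \<Longrightarrow> \<exists>t s'. exec c s t s' \<and> s' 0 = g x \<and> s' 1 = s 1 \<and> t \<le> T x"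
  using assms unfolding ptime_def by blast

lemma ptime_size: "ptime X N f g \<Longrightarrow> pbound X N (\<lambda>x. data_size (g x))"
  unfolding ptime_def by blast

lemma ptime_size_in: "ptime X N f g \<Longrightarrow> pbound X N (\<lambda>x. data_size (f x))"
  unfolding ptime_def by blast

lemma ptime_cong:
  assumes "ptime X N f g" "\<And>x. x \<in> X \<Longrightarrow> f x = f' x" "\<And>x. x \<in> X \<Longrightarrow> g x = g' x"
  shows "ptime X N f' g'"
proof -
  from assms(1) show ?thesis
  proof (rule ptimeE)
    fix c T
    assume a: "pbound X N (\<lambda>x. data_size (f x))" "pbound X N (\<lambda>x. data_size (g x))" "pbound X N T"
      "\<And>x (s::state). x \<in> X \<Longrightarrow> s 0 = f x \<Longrightarrow> \<exists>t s'. exec c s t s' \<and> s' 0 = g x \<and> s' 1 = s 1 \<and> t \<le> T x"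
    show ?thesis
      by (rule ptimeI[OF _ _ a(3), where c = c]) (use a assms(2,3) in \<open>auto elim: pbound_mono\<close>)
  qed
qed

lemma ptime_out:
  "ptime X N f g \<Longrightarrow> (\<And>x. x \<in> X \<Longrightarrow> g' x = g x) \<Longrightarrow> ptime X N f g'"
  by (rule ptime_cong[of X N f g]) auto

lemma ptime_subset: "ptime X N f g \<Longrightarrow> Y \<subseteq> X \<Longrightarrow> ptime Y N f g"
  unfolding ptime_def by (meson pbound_subset subsetD)

text \<open>Reuse of a program as a subroutine: every situation \<open>x\<close> of the caller is
  mapped to a situation \<open>p x\<close> of the callee, and only the callee's measure has to be
  bounded in terms of the caller's. The program stays the same.\<close>

lemma ptime_reindex:
  assumes "ptime Y M f g" "\<And>x. x \<in> X \<Longrightarrow> p x \<in> Y" "pbound X N (\<lambda>x. M (p x))"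
  shows "ptime X N (\<lambda>x. f (p x)) (\<lambda>x. g (p x))"
  using assms(1)
proof (rule ptimeE)
  fix c T
  assume a: "pbound Y M (\<lambda>x. data_size (f x))" "pbound Y M (\<lambda>x. data_size (g x))" "pbound Y M T"
      "\<And>x (s::state). x \<in> Y \<Longrightarrow> s 0 = f x \<Longrightarrow> \<exists>t s'. exec c s t s' \<and> s' 0 = g x \<and> s' 1 = s 1 \<and> t \<le> T x"
  show ?thesis
  proof (rule ptimeI)
    show "pbound X N (\<lambda>x. data_size (f (p x)))"
      by (rule pbound_trans[OF assms(3) pbound_reindex[OF a(1) assms(2)]])
    show "pbound X N (\<lambda>x. data_size (g (p x)))"
      by (rule pbound_trans[OF assms(3) pbound_reindex[OF a(2) assms(2)]])
    show "pbound X N (\<lambda>x. T (p x))"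
      by (rule pbound_trans[OF assms(3) pbound_reindex[OF a(3) assms(2)]])
    show "\<exists>t s'. exec c s t s' \<and> s' 0 = g (p x) \<and> s' 1 = s 1 \<and> t \<le> T (p x)"
      if "x \<in> X" "s 0 = f (p x)" for x and s :: state
      using a(4)[OF assms(2)] that by blast
  qed
qed

lemma ptime_seq:
  assumes "ptime X N f g" "ptime X N g h"
  shows "ptime X N f h"
proof -
  from assms(1) obtain c1 T1 where 1: "pbound X N T1"
    "\<And>x (s::state). x \<in> X \<Longrightarrow> s 0 = f x \<Longrightarrow> \<exists>t s'. exec c1 s t s' \<and> s' 0 = g x \<and> s' 1 = s 1 \<and> t \<le> T1 x"
    by (rule ptimeE) blast
  from assms(2) obtain c2 T2 where 2: "pbound X N T2"
    "\<And>x (s::state). x \<in> X \<Longrightarrow> s 0 = g x \<Longrightarrow> \<exists>t s'. exec c2 s t s' \<and> s' 0 = h x \<and> s' 1 = s 1 \<and> t \<le> T2 x"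
    by (rule ptimeE) blast
  show ?thesis
  proof (rule ptimeI)
    show "pbound X N (\<lambda>x. data_size (f x))" using assms(1) by (rule ptime_size_in)
    show "pbound X N (\<lambda>x. data_size (h x))" using assms(2) by (rule ptime_size)
    show "pbound X N (\<lambda>x. 1 + T1 x + T2 x)" by (intro pbound_intros 1 2)
    fix x and s :: state assume x: "x \<in> X" "s 0 = f x"
    from 1(2)[of x s, OF x] obtain t s' where s': "exec c1 s t s'" "s' 0 = g x" "s' 1 = s 1" "t \<le> T1 x" by blast
    from 2(2)[of x s', OF x(1) s'(2)] obtain t' s'' where
      s'': "exec c2 s' t' s''" "s'' 0 = h x" "s'' 1 = s' 1" "t' \<le> T2 x" by blast
    show "\<exists>t s'. exec (Seq c1 c2) s t s' \<and> s' 0 = h x \<and> s' 1 = s 1 \<and> t \<le> 1 + T1 x + T2 x"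
      by (intro exI conjI, rule exec.Seq[OF s'(1) s''(1)]) (use s' s'' in auto)
  qed
qed

lemma ptime_expr:
  assumes "pbound X N (\<lambda>x. data_size (f x))" "pbound X N (\<lambda>x. data_size (g x))"
    "\<And>x (s::state). x \<in> X \<Longrightarrow> s 0 = f x \<Longrightarrow> exp_val a s = g x"
  shows "ptime X N f g"
proof (rule ptimeI[OF assms(1,2) pbound_const])
  show "\<exists>t s'. exec (Assign 0 a) s t s' \<and> s' 0 = g x \<and> s' 1 = s 1 \<and> t \<le> 1 + cost a"
    if "x \<in> X" "s 0 = f x" for x and s :: state
    using exec.Assign[of 0 a s] assms(3)[of x s] that by fastforce
qed

lemma ptime_id: "pbound X N (\<lambda>x. data_size (f x)) \<Longrightarrow> ptime X N f f"
  by (rule ptime_expr[where a = "Var 0"]) auto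

lemma ptime_self: "ptime X N f g \<Longrightarrow> ptime X N f f"
  by (rule ptime_id) (rule ptime_size_in)

lemma ptime_post_expr:
  assumes "ptime X N f g" "pbound X N (\<lambda>x. data_size (h x))"
    "\<And>x (s::state). x \<in> X \<Longrightarrow> s 0 = g x \<Longrightarrow> exp_val a s = h x"
  shows "ptime X N f h"
  by (rule ptime_seq[OF assms(1) ptime_expr[OF ptime_size[OF assms(1)] assms(2,3)]])

lemma ptime_Empty: "ptime X N f g \<Longrightarrow> ptime X N f (\<lambda>_. Empty)"
  by (erule ptime_post_expr[where a = ENil]) (auto intro: pbound_const)

lemma ptime_1: "ptime X N f g \<Longrightarrow> ptime X N f (\<lambda>_. Num 1)"
  by (erule ptime_post_expr[where a = EOne]) (auto intro: pbound_const)

lemma ptime_0: "ptime X N f g \<Longrightarrow> ptime X N f (\<lambda>_. Num 0)"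
  by (erule ptime_post_expr[where a = "Minus EOne EOne"]) (auto intro: pbound_const)

lemma ptime_m1: "ptime X N f g \<Longrightarrow> ptime X N f (\<lambda>_. Num (- 1))"
  by (erule ptime_post_expr[where a = "Minus (Minus EOne EOne) EOne"]) (auto intro: pbound_const)

lemma ptime_Left: "ptime X N f (\<lambda>x. Node (g x) (h x)) \<Longrightarrow> ptime X N f g"
  by (frule ptime_size, erule ptime_post_expr[where a = "Left (Var 0)"]) (auto elim: pbound_mono)

lemma ptime_Right: "ptime X N f (\<lambda>x. Node (g x) (h x)) \<Longrightarrow> ptime X N f h"
  by (frule ptime_size, erule ptime_post_expr[where a = "Right (Var 0)"]) (auto elim: pbound_mono)

lemma exec_Assign: "s' = s(x := exp_val a s) \<Longrightarrow> t = 1 + cost a \<Longrightarrow> exec (Assign x a) s t s'"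
  using exec.Assign by simp

text \<open>Both programs need the argument, but the first one overwrites variable 0. So the
  argument is pushed onto the stack; after the first run it is recovered from there and replaced by
  the first result, which waits on the stack during the second run.\<close>

lemma ptime_Node:
  assumes "ptime X N f g" "ptime X N f h"
  shows "ptime X N f (\<lambda>x. Node (g x) (h x))"
proof -
  from assms(1) obtain c1 T1 where 1: "pbound X N T1"
    "\<And>x (s::state). x \<in> X \<Longrightarrow> s 0 = f x \<Longrightarrow> \<exists>t s'. exec c1 s t s' \<and> s' 0 = g x \<and> s' 1 = s 1 \<and> t \<le> T1 x"
    by (rule ptimeE) blast
  from assms(2) obtain c2 T2 where 2: "pbound X N T2"
    "\<And>x (s::state). x \<in> X \<Longrightarrow> s 0 = f x \<Longrightarrow> \<exists>t s'. exec c2 s t s' \<and> s' 0 = h x \<and> s' 1 = s 1 \<and> t \<le> T2 x"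
    by (rule ptimeE) blast
  let ?c = "Seq (Assign 1 (ENode (Var 0) (Var 1))) (Seq c1 (Seq (Assign 2 (Left (Var 1)))
    (Seq (Assign 1 (ENode (Var 0) (Right (Var 1)))) (Seq (Assign 0 (Var 2)) (Seq c2
    (Seq (Assign 0 (ENode (Left (Var 1)) (Var 0))) (Assign 1 (Right (Var 1)))))))))"
  show ?thesis
  proof (rule ptimeI)
    show "pbound X N (\<lambda>x. data_size (f x))" using assms(1) by (rule ptime_size_in)
    show "pbound X N (\<lambda>x. data_size (Node (g x) (h x)))"
      unfolding data_size.simps by (intro pbound_intros ptime_size[OF assms(1)] ptime_size[OF assms(2)])
    show "pbound X N (\<lambda>x. 100 + T1 x + T2 x)" by (intro pbound_intros 1 2)
    fix x and s :: state assume x: "x \<in> X" "s 0 = f x"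
    let ?s1 = "s(1 := Node (f x) (s 1))"
    from 1(2)[of x ?s1] x obtain t1 s2 where s2: "exec c1 ?s1 t1 s2" "s2 0 = g x"
      "s2 1 = Node (f x) (s 1)" "t1 \<le> T1 x" by auto
    let ?s3 = "s2(2 := f x)"
    let ?s4 = "?s3(1 := Node (g x) (s 1))"
    let ?s5 = "?s4(0 := f x)"
    from 2(2)[of x ?s5] x obtain t2 s6 where s6: "exec c2 ?s5 t2 s6" "s6 0 = h x"
      "s6 1 = Node (g x) (s 1)" "t2 \<le> T2 x" by auto
    let ?s7 = "s6(0 := Node (g x) (h x))"
    let ?s8 = "?s7(1 := s 1)"
    have e: "exec (Assign 1 (ENode (Var 0) (Var 1))) s 4 ?s1"
      "exec (Assign 2 (Left (Var 1))) s2 3 ?s3"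
      "exec (Assign 1 (ENode (Var 0) (Right (Var 1)))) ?s3 5 ?s4"
      "exec (Assign 0 (Var 2)) ?s4 2 ?s5"
      "exec (Assign 0 (ENode (Left (Var 1)) (Var 0))) s6 5 ?s7"
      "exec (Assign 1 (Right (Var 1))) ?s7 3 ?s8"
      by (rule exec_Assign; simp add: x s2 s6 s2(3)[unfolded One_nat_def] s6(3)[unfolded One_nat_def])+
    have "exec ?c s (1 + 4 + (1 + t1 + (1 + 3 + (1 + 5 + (1 + 2 + (1 + t2 + (1 + 5 + 3))))))) ?s8"
      by (intro exec.Seq; (rule e s2 s6))
    then show "\<exists>t s'. exec ?c s t s' \<and> s' 0 = Node (g x) (h x) \<and> s' 1 = s 1 \<and> t \<le> 100 + T1 x + T2 x"
      using s2(4) s6(4) by (intro exI[of _ ?s8] exI conjI) auto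
  qed
qed

section \<open>Truth values, arithmetic and branching\<close>

abbreviation eB :: "bool \<Rightarrow> data" where "eB \<equiv> of_bool_data"

lemma eB_simps [simp]: "data_size (eB b) = 1" "eB True = Num 1" "eB False = Empty"
  "eB b = Empty \<longleftrightarrow> \<not> b" "(Empty = eB b) \<longleftrightarrow> \<not> b"
  by (auto simp: of_bool_data_def)

lemma ptime_add:
  assumes "ptime X N f (\<lambda>x. Num (a x))" "ptime X N f (\<lambda>x. Num (b x))"
  shows "ptime X N f (\<lambda>x. Num (a x + b x))"
  by (rule ptime_post_expr[OF ptime_Node[OF assms], where a = "Plus (Left (Var 0)) (Right (Var 0))"])
    (auto intro: pbound_const)

lemma ptime_diff:
  assumes "ptime X N f (\<lambda>x. Num (a x))" "ptime X N f (\<lambda>x. Num (b x))"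
  shows "ptime X N f (\<lambda>x. Num (a x - b x))"
  by (rule ptime_post_expr[OF ptime_Node[OF assms], where a = "Minus (Left (Var 0)) (Right (Var 0))"])
    (auto intro: pbound_const)

lemma ptime_le:
  assumes "ptime X N f (\<lambda>x. Num (a x))" "ptime X N f (\<lambda>x. Num (b x))"
  shows "ptime X N f (\<lambda>x. eB (a x \<le> b x))"
  by (rule ptime_post_expr[OF ptime_Node[OF assms], where a = "Leq (Left (Var 0)) (Right (Var 0))"])
    (auto intro: pbound_const)

lemma exec_Cond:
  assumes "v \<noteq> Empty \<Longrightarrow> exec c1 s t s'" "v = Empty \<Longrightarrow> exec c2 s t s'" "exp_val b s = v"
  shows "exec (Cond b c1 c2) s (1 + cost b + t) s'"
  using assms exec.CondTrue exec.CondFalse by (cases "v = Empty") auto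

text \<open>A branch has to work only for the indices that reach it, so it may rely on its guard.
  Its bounds then hold on a part of \<open>X\<close> only; the exponents are extracted to form one
  bound that is valid on all of \<open>X\<close>.\<close>

lemma ptime_if_data:
  assumes b: "ptime X N f (\<lambda>x. eB (b x))" and g: "ptime {x \<in> X. b x} N f g"
    and h: "ptime {x \<in> X. \<not> b x} N f h"
  shows "ptime X N f (\<lambda>x. if b x then g x else h x)"
proof -
  \<comment> \<open>The condition is paired with the argument, which the chosen branch then finds
    intact.\<close>
  have Nd: "ptime X N f (\<lambda>x. Node (eB (b x)) (f x))"
    by (rule ptime_Node[OF b ptime_self[OF b]])
  from g obtain c1 T1 where 1: "pbound {x \<in> X. b x} N T1"
    "\<And>x (s::state). x \<in> {x \<in> X. b x} \<Longrightarrow> s 0 = f x \<Longrightarrow> \<exists>t s'. exec c1 s t s' \<and> s' 0 = g x \<and> s' 1 = s 1 \<and> t \<le> T1 x"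
    by (rule ptimeE) blast
  from h obtain c2 T2 where 2: "pbound {x \<in> X. \<not> b x} N T2"
    "\<And>x (s::state). x \<in> {x \<in> X. \<not> b x} \<Longrightarrow> s 0 = f x \<Longrightarrow> \<exists>t s'. exec c2 s t s' \<and> s' 0 = h x \<and> s' 1 = s 1 \<and> t \<le> T2 x"
    by (rule ptimeE) blast
  from ptime_size[OF g] obtain d1 where d1: "\<forall>x\<in>{x \<in> X. b x}. data_size (g x) \<le> (N x + 2) ^ d1"
    unfolding pbound_def by blast
  from ptime_size[OF h] obtain d2 where d2: "\<forall>x\<in>{x \<in> X. \<not> b x}. data_size (h x) \<le> (N x + 2) ^ d2"
    unfolding pbound_def by blast
  from 1(1) obtain e1 where e1: "\<forall>x\<in>{x \<in> X. b x}. T1 x \<le> (N x + 2) ^ e1"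
    unfolding pbound_def by blast
  from 2(1) obtain e2 where e2: "\<forall>x\<in>{x \<in> X. \<not> b x}. T2 x \<le> (N x + 2) ^ e2"
    unfolding pbound_def by blast
  let ?c = "Seq (Assign 2 (Left (Var 0))) (Seq (Assign 0 (Right (Var 0))) (Cond (Var 2) c1 c2))"
  have "ptime X N (\<lambda>x. Node (eB (b x)) (f x)) (\<lambda>x. if b x then g x else h x)"
  proof (rule ptimeI)
    show "pbound X N (\<lambda>x. data_size (Node (eB (b x)) (f x)))" by (rule ptime_size[OF Nd])
    show "pbound X N (\<lambda>x. data_size (if b x then g x else h x))"
    proof (rule pbound_mono)
      show "pbound X N (\<lambda>x. (N x + 2) ^ d1 + (N x + 2) ^ d2)" by (intro pbound_intros)
    qed (use d1 d2 in \<open>auto simp: trans_le_add1 trans_le_add2\<close>)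
    show "pbound X N (\<lambda>x. 20 + (N x + 2) ^ e1 + (N x + 2) ^ e2)" by (intro pbound_intros)
    fix x and s :: state assume x: "x \<in> X" "s 0 = Node (eB (b x)) (f x)"
    let ?s1 = "s(2 := eB (b x))"
    let ?s2 = "?s1(0 := f x)"
    have "\<exists>t s'. (b x \<longrightarrow> exec c1 ?s2 t s') \<and> (\<not> b x \<longrightarrow> exec c2 ?s2 t s') \<and>
        s' 0 = (if b x then g x else h x) \<and> s' 1 = s 1 \<and> t \<le> (N x + 2) ^ e1 + (N x + 2) ^ e2"
    proof (cases "b x")
      case True
      from 1(2)[of x ?s2] True x obtain t s' where
        "exec c1 ?s2 t s'" "s' 0 = g x" "s' 1 = s 1" "t \<le> T1 x" by auto
      moreover have "T1 x \<le> (N x + 2) ^ e1" using e1 True x by blast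
      ultimately show ?thesis using True by (intro exI[of _ t] exI[of _ s']) auto
    next
      case False
      from 2(2)[of x ?s2] False x obtain t s' where
        "exec c2 ?s2 t s'" "s' 0 = h x" "s' 1 = s 1" "t \<le> T2 x" by auto
      moreover have "T2 x \<le> (N x + 2) ^ e2" using e2 False x by blast
      ultimately show ?thesis using False by (intro exI[of _ t] exI[of _ s']) auto
    qed
    then obtain t s' where s': "b x \<Longrightarrow> exec c1 ?s2 t s'" "\<not> b x \<Longrightarrow> exec c2 ?s2 t s'"
        "s' 0 = (if b x then g x else h x)" "s' 1 = s 1" "t \<le> (N x + 2) ^ e1 + (N x + 2) ^ e2" by blast
    have e: "exec (Assign 2 (Left (Var 0))) s 3 ?s1" "exec (Assign 0 (Right (Var 0))) ?s1 3 ?s2"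
      by (rule exec_Assign; simp add: x)+
    have "exec (Cond (Var 2) c1 c2) ?s2 (1 + cost (Var 2) + t) s'"
      by (rule exec_Cond[where v = "eB (b x)"]) (use s' in auto)
    with e have "exec ?c s (1 + 3 + (1 + 3 + (1 + cost (Var 2) + t))) s'"
      by (intro exec.Seq)
    then show "\<exists>t s'. exec ?c s t s' \<and> s' 0 = (if b x then g x else h x) \<and> s' 1 = s 1 \<and>
        t \<le> 20 + (N x + 2) ^ e1 + (N x + 2) ^ e2"
      using s' by (intro exI[of _ s'] exI conjI) auto
  qed
  then show ?thesis by (rule ptime_seq[OF Nd])
qed

lemma ptime_if:
  assumes b: "ptime X N f (\<lambda>x. eB (b x))"
    and g: "ptime {x \<in> X. b x} N f (\<lambda>x. e (g x))" and h: "ptime {x \<in> X. \<not> b x} N f (\<lambda>x. e (h x))"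
  shows "ptime X N f (\<lambda>x. e (if b x then g x else h x))"
  by (rule ptime_out[OF ptime_if_data[OF assms]]) auto

lemma ptime_If:
  assumes b: "ptime X N f (\<lambda>x. eB (b x))"
    and g: "ptime X N f (\<lambda>x. e (g x))" and h: "ptime X N f (\<lambda>x. e (h x))"
  shows "ptime X N f (\<lambda>x. e (if b x then g x else h x))"
  by (rule ptime_if[where e = e and g = g and h = h, OF b ptime_subset[OF g] ptime_subset[OF h]]) auto

lemma ptime_True: "ptime X N f g \<Longrightarrow> ptime X N f (\<lambda>_. eB True)"
  by (simp add: ptime_1)

lemma ptime_False: "ptime X N f g \<Longrightarrow> ptime X N f (\<lambda>_. eB False)"
  by (simp add: ptime_Empty)

lemma ptime_not: "ptime X N f (\<lambda>x. eB (b x)) \<Longrightarrow> ptime X N f (\<lambda>x. eB (\<not> b x))"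
  by (rule ptime_out[OF ptime_If[where e = eB and b = b, OF _ ptime_False ptime_True]]) auto

lemma ptime_and:
  "ptime X N f (\<lambda>x. eB (a x)) \<Longrightarrow> ptime X N f (\<lambda>x. eB (b x)) \<Longrightarrow> ptime X N f (\<lambda>x. eB (a x \<and> b x))"
  by (rule ptime_out[OF ptime_If[where e = eB and b = a and g = b, OF _ _ ptime_False]]) auto

lemma ptime_or:
  "ptime X N f (\<lambda>x. eB (a x)) \<Longrightarrow> ptime X N f (\<lambda>x. eB (b x)) \<Longrightarrow> ptime X N f (\<lambda>x. eB (a x \<or> b x))"
  by (rule ptime_out[OF ptime_If[where e = eB and b = a and h = b, OF _ ptime_True]]) auto

lemma ptime_less:
  assumes "ptime X N f (\<lambda>x. Num (a x))" "ptime X N f (\<lambda>x. Num (b x))"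
  shows "ptime X N f (\<lambda>x. eB (a x < b x))"
  by (rule ptime_out[OF ptime_not[OF ptime_le[OF assms(2,1)]]]) (simp add: not_le)

lemma ptime_eq:
  assumes "ptime X N f (\<lambda>x. Num (a x))" "ptime X N f (\<lambda>x. Num (b x))"
  shows "ptime X N f (\<lambda>x. eB (a x = b x))"
  by (rule ptime_out[OF ptime_and[OF ptime_le[OF assms] ptime_le[OF assms(2,1)]]])
    (simp add: order_eq_iff)

section \<open>Loops over lists\<close>

text \<open>The guard is the left component of the state, in applications the rest of a list. The
  body is one program for all pairs of an outer index and a round, measured by the outer index
  alone; hence one exponent bounds the time of every round and the total is the number of rounds
  times that bound.\<close>

lemma ptime_while:
  assumes guard: "\<And>x i. x \<in> X \<Longrightarrow> i < n x \<Longrightarrow> \<exists>a b. \<sigma> x i = Node a b \<and> a \<noteq> Empty"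
    and stop: "\<And>x. x \<in> X \<Longrightarrow> \<exists>b. \<sigma> x (n x) = Node Empty b"
    and init: "pbound X N (\<lambda>x. data_size (\<sigma> x 0))"
    and size: "pbound X N (\<lambda>x. data_size (\<sigma> x (n x)))"
    and n: "pbound X N n"
    and body: "ptime {(x, i). x \<in> X \<and> i < n x} (\<lambda>z. N (fst z)) (\<lambda>(x, i). \<sigma> x i) (\<lambda>(x, i). \<sigma> x (Suc i))"
  shows "ptime X N (\<lambda>x. \<sigma> x 0) (\<lambda>x. \<sigma> x (n x))"
proof -
  let ?Z = "{(x, i). x \<in> X \<and> i < n x}"
  from body obtain c T where T: "pbound ?Z (\<lambda>z. N (fst z)) T" and
    c: "\<And>z (s::state). z \<in> ?Z \<Longrightarrow> s 0 = (\<lambda>(x, i). \<sigma> x i) z \<Longrightarrow>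
      \<exists>t s'. exec c s t s' \<and> s' 0 = (\<lambda>(x, i). \<sigma> x (Suc i)) z \<and> s' 1 = s 1 \<and> t \<le> T z"
    by (rule ptimeE) blast
  from T obtain d where d: "\<And>x i. x \<in> X \<Longrightarrow> i < n x \<Longrightarrow> T (x, i) \<le> (N x + 2) ^ d"
    unfolding pbound_def by fastforce
  let ?b = "Left (Var 0)"
  have run: "\<exists>t s'. exec (While ?b c) s t s' \<and> s' 0 = \<sigma> x (n x) \<and> s' 1 = s 1 \<and>
      t \<le> 3 + (n x - i) * (3 + (N x + 2) ^ d)"
    if "x \<in> X" "i \<le> n x" "s 0 = \<sigma> x i" for x i and s :: state
    using that(2,3)
  proof (induction "n x - i" arbitrary: i s)
    case 0
    then have "i = n x" by simp
    with stop[OF that(1)] 0 have "exp_val ?b s = Empty" by auto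
    from exec.WhileFalse[OF this, of c] 0 \<open>i = n x\<close> show ?case by fastforce
  next
    case (Suc k)
    then have i: "i < n x" by simp
    with guard[OF that(1)] Suc have b: "exp_val ?b s \<noteq> Empty" by fastforce
    from c[of "(x, i)" s] i that(1) Suc.prems obtain t1 s1 where
      s1: "exec c s t1 s1" "s1 0 = \<sigma> x (Suc i)" "s1 1 = s 1" "t1 \<le> T (x, i)" by auto
    have k: "k = n x - Suc i" "Suc i \<le> n x" using Suc.hyps(2) i by auto
    from Suc.hyps(1)[of "Suc i" s1, OF k s1(2)] obtain t2 s2 where
      s2: "exec (While ?b c) s1 t2 s2" "s2 0 = \<sigma> x (n x)" "s2 1 = s1 1"
        "t2 \<le> 3 + (n x - Suc i) * (3 + (N x + 2) ^ d)" by blast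
    have "n x - i = Suc (n x - Suc i)" using i by simp
    then have "1 + cost ?b + t1 + t2 \<le> 3 + (n x - i) * (3 + (N x + 2) ^ d)"
      using s1(4) s2(4) d[OF that(1) i] by simp
    with exec.WhileTrue[OF b s1(1) s2(1)] s1 s2 show ?case by metis
  qed
  show ?thesis
  proof (rule ptimeI[OF init size])
    show "pbound X N (\<lambda>x. 3 + n x * (3 + (N x + 2) ^ d))" by (intro pbound_intros n)
    fix x and s :: state assume "x \<in> X" "s 0 = \<sigma> x 0"
    with run[of x 0 s] show "\<exists>t s'. exec (While ?b c) s t s' \<and> s' 0 = \<sigma> x (n x) \<and> s' 1 = s 1 \<and>
        t \<le> 3 + n x * (3 + (N x + 2) ^ d)" by simp
  qed
qed

definition eL :: "('b \<Rightarrow> data) \<Rightarrow> 'b list \<Rightarrow> data" where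
  "eL e xs = enc_list (map e xs)"

lemma eL_simps [simp]: "eL e [] = Empty" "eL e (y # ys) = Node (e y) (eL e ys)"
  by (simp_all add: eL_def enc_list_def)

lemma eL_eq_Empty [simp]: "Empty = eL e ys \<longleftrightarrow> ys = []"
  by (cases ys; simp)

lemma data_size_pos [simp]: "0 < data_size y"
  by (cases y) auto

lemma data_size_eL: "data_size (eL e ys) = 1 + (\<Sum>y\<leftarrow>ys. 1 + data_size (e y))"
  by (induction ys) auto

lemma data_size_eL_drop: "data_size (eL e (drop j ys)) \<le> data_size (eL e ys)"
  by (induction ys arbitrary: j) (auto simp: drop_Cons split: nat.split intro: le_SucI trans_le_add2)

lemma length_le_data_size: "length ys \<le> data_size (eL e ys)"
  by (induction ys) auto

lemma data_size_eL_le: "(\<And>y. y \<in> set ys \<Longrightarrow> data_size (e y) \<le> B) \<Longrightarrow> data_size (eL e ys) \<le> 1 + length ys * (1 + B)"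
proof (induction ys)
  case (Cons y ys)
  then have "data_size (eL e ys) \<le> 1 + length ys * (1 + B)" "data_size (e y) \<le> B" by auto
  then show ?case by simp
qed simp

lemma data_size_mem: "y \<in> set ys \<Longrightarrow> data_size (e y) \<le> data_size (eL e ys)"
  by (induction ys) auto

lemma ptime_length_bound: "ptime X N f (\<lambda>x. eL e (ys x)) \<Longrightarrow> pbound X N (\<lambda>x. length (ys x))"
  by (rule pbound_mono[OF ptime_size]) (auto intro: length_le_data_size)

text \<open>
  The states of a loop are indexed by triples of the outer index, the current list element and the
  current accumulator; facts about the outer index are lifted to triples.
\<close>

lemma ptime_fold:
  fixes X :: "'a set" and ys :: "'a \<Rightarrow> 'b list" and init :: "'a \<Rightarrow> 'c" and h :: "'a \<Rightarrow> 'b \<Rightarrow> 'c \<Rightarrow> 'c"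
  assumes ys: "ptime X N f (\<lambda>x. eL e (ys x))" and init: "ptime X N f (\<lambda>x. ea (init x))"
    and size: "pbound {(x, j). x \<in> X \<and> j \<le> length (ys x)} (\<lambda>z. N (fst z))
      (\<lambda>(x, j). data_size (ea (fold (h x) (take j (ys x)) (init x))))"
    and step: "\<And>Z u. Z = {(x, ys x ! j, fold (h x) (take j (ys x)) (init x)) | x j. x \<in> X \<and> j < length (ys x)} \<Longrightarrow>
      (\<And>g. ptime X N f g \<Longrightarrow> ptime Z (\<lambda>z. N (fst z)) u (\<lambda>z. g (fst z))) \<Longrightarrow>
      ptime Z (\<lambda>z. N (fst z)) u (\<lambda>z. e (fst (snd z))) \<Longrightarrow>
      ptime Z (\<lambda>z. N (fst z)) u (\<lambda>z. ea (snd (snd z))) \<Longrightarrow>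
      ptime Z (\<lambda>z. N (fst z)) u (\<lambda>z. ea (h (fst z) (fst (snd z)) (snd (snd z))))"
  shows "ptime X N f (\<lambda>x. ea (fold (h x) (ys x) (init x)))"
proof -
  define acc where "acc x j = fold (h x) (take j (ys x)) (init x)" for x j
  define Z where "Z = {(x, ys x ! j, acc x j) | x j. x \<in> X \<and> j < length (ys x)}"
  define u where "u z = Node (e (fst (snd z))) (Node (ea (snd (snd z))) (f (fst z)))" for z
  define M where "M = (\<lambda>z :: 'a \<times> 'b \<times> 'c. N (fst z))"
  \<comment> \<open>The argument \<open>f x\<close> travels next to the remaining list and the
    accumulator, since the body may depend on the outer index.\<close>
  define \<sigma> where "\<sigma> x j = Node (eL e (drop j (ys x))) (Node (ea (acc x j)) (f x))" for x j
  let ?W = "{(x, j). x \<in> X \<and> j < length (ys x)}"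
  let ?NW = "(\<lambda>z. N (fst z)) :: 'a \<times> nat \<Rightarrow> nat"
  from size obtain d where d: "\<And>x j. x \<in> X \<Longrightarrow> j \<le> length (ys x) \<Longrightarrow> data_size (ea (acc x j)) \<le> (N x + 2) ^ d"
    unfolding pbound_def acc_def by fastforce
  from ptime_size[OF ys] obtain d2 where
    d2: "\<And>x. x \<in> X \<Longrightarrow> data_size (eL e (ys x)) \<le> (N x + 2) ^ d2"
    unfolding pbound_def by blast
  from ptime_size_in[OF ys] obtain d3 where d3: "\<And>x. x \<in> X \<Longrightarrow> data_size (f x) \<le> (N x + 2) ^ d3"
    unfolding pbound_def by blast
  have uZ: "ptime Z M u u"
  proof (rule ptime_id, rule pbound_mono)
    show "pbound Z M (\<lambda>z. 2 + (M z + 2) ^ d2 + (M z + 2) ^ d + (M z + 2) ^ d3)"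
      by (intro pbound_intros)
    fix z assume "z \<in> Z"
    then obtain x j where z: "z = (x, ys x ! j, acc x j)" "x \<in> X" "j < length (ys x)"
      unfolding Z_def by blast
    have "data_size (e (ys x ! j)) \<le> (N x + 2) ^ d2"
      using data_size_mem[of "ys x ! j" "ys x" e] d2[OF z(2)] z(3) by (auto intro: order_trans)
    with d[OF z(2), of j] d3[OF z(2)] z
    show "data_size (u z) \<le> 2 + (M z + 2) ^ d2 + (M z + 2) ^ d + (M z + 2) ^ d3"
      by (auto simp: u_def M_def)
  qed
  have uZ': "ptime Z M u (\<lambda>z. Node (e (fst (snd z))) (Node (ea (snd (snd z))) (f (fst z))))"
    by (rule ptime_out[OF uZ]) (simp add: u_def)
  have e: "ptime Z M u (\<lambda>z. e (fst (snd z)))"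
    by (rule ptime_Left[OF uZ'])
  have acc: "ptime Z M u (\<lambda>z. ea (snd (snd z)))"
    by (rule ptime_Left[OF ptime_Right[OF uZ']])
  have env: "ptime Z M u (\<lambda>z. f (fst z))"
    by (rule ptime_Right[OF ptime_Right[OF uZ']])
  have lift: "ptime Z M u (\<lambda>z. g (fst z))" if "ptime X N f g" for g
    by (rule ptime_seq[OF env], rule ptime_reindex[OF that])
      (auto simp: Z_def M_def intro: pbound_self)
  have st: "ptime Z M u (\<lambda>z. ea (h (fst z) (fst (snd z)) (snd (snd z))))"
    using step[of Z u] lift e acc unfolding M_def Z_def acc_def by blast
  \<comment> \<open>Translates the number of a round into the triple for which the body was
    proved.\<close>
  define p where "p z = (fst z, ys (fst z) ! snd z, acc (fst z) (snd z))" for z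
  have st': "ptime ?W ?NW (\<lambda>z. u (p z))
      (\<lambda>z. ea (h (fst (p z)) (fst (snd (p z))) (snd (snd (p z)))))"
    by (rule ptime_reindex[OF st])
      (auto simp: Z_def M_def p_def intro: pbound_self)
  have sW: "ptime ?W ?NW (\<lambda>(x, j). \<sigma> x j) (\<lambda>(x, j). \<sigma> x j)"
  proof (rule ptime_id, rule pbound_mono)
    show "pbound ?W ?NW (\<lambda>z. 2 + (?NW z + 2) ^ d2 + (?NW z + 2) ^ d + (?NW z + 2) ^ d3)"
      by (intro pbound_intros)
    fix z assume "z \<in> ?W"
    then obtain x j where z: "z = (x, j)" "x \<in> X" "j < length (ys x)" by blast
    from data_size_eL_drop[of e j "ys x"] d[OF z(2), of j] d2[OF z(2)] d3[OF z(2)] z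
    show "data_size ((\<lambda>(x, j). \<sigma> x j) z) \<le> 2 + (?NW z + 2) ^ d2 + (?NW z + 2) ^ d + (?NW z + 2) ^ d3"
      by (auto simp: \<sigma>_def)
  qed
  have dr: "drop j l = l ! j # drop (Suc j) l" if "j < length l" for j and l :: "'b list"
    using that by (simp add: Cons_nth_drop_Suc)
  have parts: "ptime ?W ?NW (\<lambda>(x, j). \<sigma> x j) (\<lambda>z. Node (Node (e (fst (snd (p z)))) (eL e (drop (Suc (snd z)) (ys (fst z)))))
      (Node (ea (snd (snd (p z)))) (f (fst z))))"
    by (rule ptime_out[OF sW]) (auto simp: \<sigma>_def p_def dr)
  have uW: "ptime ?W ?NW (\<lambda>(x, j). \<sigma> x j) (\<lambda>z. u (p z))"
    by (rule ptime_out[OF ptime_Node[OF ptime_Left[OF ptime_Left[OF parts]] ptime_Right[OF parts]]])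
      (auto simp: u_def p_def)
  have body: "ptime ?W ?NW (\<lambda>(x, j). \<sigma> x j) (\<lambda>(x, j). \<sigma> x (Suc j))"
  proof (rule ptime_out)
    show "ptime ?W ?NW (\<lambda>(x, j). \<sigma> x j) (\<lambda>z. Node (eL e (drop (Suc (snd z)) (ys (fst z))))
        (Node (ea (h (fst (p z)) (fst (snd (p z))) (snd (snd (p z))))) (f (fst z))))"
      by (rule ptime_Node[OF ptime_Right[OF ptime_Left[OF parts]]
            ptime_Node[OF ptime_seq[OF uW st'] ptime_Right[OF ptime_Right[OF parts]]]])
    fix z assume "z \<in> ?W"
    then obtain x j where z: "z = (x, j)" "x \<in> X" "j < length (ys x)" by blast
    have "acc x (Suc j) = h x (ys x ! j) (acc x j)"
      unfolding acc_def using z by (simp add: take_Suc_conv_app_nth)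
    with z show "(\<lambda>(x, j). \<sigma> x (Suc j)) z = Node (eL e (drop (Suc (snd z)) (ys (fst z))))
        (Node (ea (h (fst (p z)) (fst (snd (p z))) (snd (snd (p z))))) (f (fst z)))"
      by (simp add: \<sigma>_def p_def)
  qed
  have start: "ptime X N f (\<lambda>x. \<sigma> x 0)"
    unfolding \<sigma>_def acc_def using ptime_Node[OF ys ptime_Node[OF init ptime_self[OF ys]]] by simp
  have fin: "pbound X N (\<lambda>x. data_size (\<sigma> x (length (ys x))))"
  proof (rule pbound_mono)
    show "pbound X N (\<lambda>x. 3 + (N x + 2) ^ d + (N x + 2) ^ d3)"
      by (intro pbound_intros)
    show "data_size (\<sigma> x (length (ys x))) \<le> 3 + (N x + 2) ^ d + (N x + 2) ^ d3" if "x \<in> X" for x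
      using d[OF that, of "length (ys x)"] d3[OF that] by (simp add: \<sigma>_def)
  qed
  have loop: "ptime X N (\<lambda>x. \<sigma> x 0) (\<lambda>x. \<sigma> x (length (ys x)))"
    by (rule ptime_while[OF _ _ ptime_size[OF start] fin ptime_length_bound[OF ys] body])
      (auto simp: \<sigma>_def dr)
  have "ptime X N f (\<lambda>x. Node (eL e (drop (length (ys x)) (ys x))) (Node (ea (acc x (length (ys x)))) (f x)))"
    using ptime_seq[OF start loop] unfolding \<sigma>_def .
  from ptime_Left[OF ptime_Right[OF this]] show ?thesis by (simp add: acc_def)
qed

text \<open>As for folds, the second branch is proved for an abstract input \<open>u\<close> from
  which the outer values, the head and the tail can be computed. Applications therefore never see
  how the environment is packed.\<close>

lemma ptime_case_list:
  fixes X :: "'a set" and l :: "'a \<Rightarrow> 'b list"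
  assumes l: "ptime X N f (\<lambda>x. eL e (l x))" and g: "ptime {x \<in> X. l x = []} N f (\<lambda>x. ec (g x))"
    and step: "\<And>Z u. Z = {(x, hd (l x), tl (l x)) | x. x \<in> X \<and> l x \<noteq> []} \<Longrightarrow>
      (\<And>g. ptime X N f g \<Longrightarrow> ptime Z (\<lambda>z. N (fst z)) u (\<lambda>z. g (fst z))) \<Longrightarrow>
      ptime Z (\<lambda>z. N (fst z)) u (\<lambda>z. e (fst (snd z))) \<Longrightarrow>
      ptime Z (\<lambda>z. N (fst z)) u (\<lambda>z. eL e (snd (snd z))) \<Longrightarrow>
      ptime Z (\<lambda>z. N (fst z)) u (\<lambda>z. ec (h (fst z) (fst (snd z)) (snd (snd z))))"
  shows "ptime X N f (\<lambda>x. ec (case l x of [] \<Rightarrow> g x | y # ys \<Rightarrow> h x y ys))"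
proof -
  let ?X = "{x \<in> X. l x \<noteq> []}"
  define p where "p x = (x, hd (l x), tl (l x))" for x
  define Z where "Z = {(x, hd (l x), tl (l x)) | x. x \<in> X \<and> l x \<noteq> []}"
  define u where "u z = Node (Node (e (fst (snd z))) (eL e (snd (snd z)))) (f (fst z))" for z
  define M where "M = (\<lambda>z :: 'a \<times> 'b \<times> 'b list. N (fst z))"
  have lf: "ptime X N f (\<lambda>x. Node (eL e (l x)) (f x))"
    by (rule ptime_Node[OF l ptime_self[OF l]])
  have Zx: "fst z \<in> X \<and> z = p (fst z) \<and> l (fst z) \<noteq> []" if "z \<in> Z" for z
    using that by (auto simp: Z_def p_def)
  have "pbound Z M (\<lambda>z. data_size (Node (eL e (l (fst z))) (f (fst z))))"
    unfolding M_def by (rule pbound_reindex[OF ptime_size[OF lf]]) (use Zx in auto)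
  then have uZ: "ptime Z M u u"
    by (intro ptime_id) (erule pbound_mono, auto simp: Z_def u_def neq_Nil_conv)
  have uZ': "ptime Z M u (\<lambda>z. Node (Node (e (fst (snd z))) (eL e (snd (snd z)))) (f (fst z)))"
    by (rule ptime_out[OF uZ]) (simp add: u_def)
  have env: "ptime Z M u (\<lambda>z. f (fst z))"
    by (rule ptime_Right[OF uZ'])
  have hd: "ptime Z M u (\<lambda>z. e (fst (snd z)))"
    by (rule ptime_Left[OF ptime_Left[OF uZ']])
  have tl: "ptime Z M u (\<lambda>z. eL e (snd (snd z)))"
    by (rule ptime_Right[OF ptime_Left[OF uZ']])
  have lift: "ptime Z M u (\<lambda>z. g (fst z))" if "ptime X N f g" for g
    by (rule ptime_seq[OF env], rule ptime_reindex[OF that])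
      (auto simp: M_def Zx intro: pbound_self)
  have st: "ptime Z M u (\<lambda>z. ec (h (fst z) (fst (snd z)) (snd (snd z))))"
    using step[of Z u] lift hd tl unfolding M_def Z_def by blast
  have st': "ptime ?X N (\<lambda>x. u (p x)) (\<lambda>x. ec (h (fst (p x)) (fst (snd (p x))) (snd (snd (p x)))))"
    by (rule ptime_reindex[OF st]) (auto simp: Z_def M_def p_def intro: pbound_self)
  have "ptime ?X N f (\<lambda>x. u (p x))"
    by (rule ptime_out[OF ptime_subset[OF lf]]) (auto simp: u_def p_def neq_Nil_conv)
  from ptime_seq[OF this st'] have ne: "ptime ?X N f (\<lambda>x. ec (h x (hd (l x)) (tl (l x))))"
    by (simp add: p_def)
  have b: "ptime X N f (\<lambda>x. eB (l x \<noteq> []))"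
  proof (rule ptime_post_expr[OF l, where a = "IsNode (Var 0)"])
    show "exp_val (IsNode (Var 0)) s = eB (l x \<noteq> [])" if "s 0 = eL e (l x)" for x and s :: state
      using that by (cases "l x") auto
  qed (simp add: pbound_const)
  show ?thesis
    by (rule ptime_out[OF ptime_if_data[OF b ne]])
      (use g in \<open>auto split: list.split\<close>)
qed

section \<open>Pairs and the list operations from which the programs are composed\<close>

definition eP :: "('b \<Rightarrow> data) \<Rightarrow> ('c \<Rightarrow> data) \<Rightarrow> 'b \<times> 'c \<Rightarrow> data" where
  "eP e1 e2 p = Node (e1 (fst p)) (e2 (snd p))"

lemma data_size_eP [simp]: "data_size (eP e1 e2 p) = 1 + data_size (e1 (fst p)) + data_size (e2 (snd p))"
  by (simp add: eP_def)

lemma ptime_fst: "ptime X N f (\<lambda>x. eP e1 e2 (p x)) \<Longrightarrow> ptime X N f (\<lambda>x. e1 (fst (p x)))"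
  unfolding eP_def by (rule ptime_Left)

lemma ptime_snd: "ptime X N f (\<lambda>x. eP e1 e2 (p x)) \<Longrightarrow> ptime X N f (\<lambda>x. e2 (snd (p x)))"
  unfolding eP_def by (rule ptime_Right)

lemma ptime_pair:
  "ptime X N f (\<lambda>x. e1 (a x)) \<Longrightarrow> ptime X N f (\<lambda>x. e2 (b x)) \<Longrightarrow> ptime X N f (\<lambda>x. eP e1 e2 (a x, b x))"
  unfolding eP_def fst_conv snd_conv by (rule ptime_Node)

lemma ptime_Nil: "ptime X N f g \<Longrightarrow> ptime X N f (\<lambda>x. eL e [])"
  by (simp add: ptime_Empty)

lemma ptime_Cons:
  "ptime X N f (\<lambda>x. e (y x)) \<Longrightarrow> ptime X N f (\<lambda>x. eL e (ys x)) \<Longrightarrow> ptime X N f (\<lambda>x. eL e (y x # ys x))"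
  by (simp add: ptime_Node)

lemma ptime_single: "ptime X N f (\<lambda>x. e (y x)) \<Longrightarrow> ptime X N f (\<lambda>x. eL e [y x])"
  by (rule ptime_Cons[OF _ ptime_Nil])

lemma ptime_is_Nil:
  assumes "ptime X N f (\<lambda>x. eL e (ys x))"
  shows "ptime X N f (\<lambda>x. eB (ys x = []))"
  using ptime_case_list[where ec = eB and g = "\<lambda>_. True" and h = "\<lambda>_ _ _. False", OF assms
      ptime_True[OF ptime_subset[OF assms]] ptime_False]
  by (rule ptime_out) (auto split: list.split)

lemma pbound_fold_size:
  assumes "pbound X N b"
    and "\<And>x j. x \<in> X \<Longrightarrow> j \<le> length (ys x) \<Longrightarrow> data_size (F x j) \<le> b x"
  shows "pbound {(x, j). x \<in> X \<and> j \<le> length (ys x)} (\<lambda>z. N (fst z)) (\<lambda>(x, j). data_size (F x j))"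
  by (rule pbound_mono[OF pbound_reindex[OF assms(1), of _ fst]]) (use assms(2) in auto)

lemma data_size_eL_append: "data_size (eL e (xs @ ys)) + 1 = data_size (eL e xs) + data_size (eL e ys)"
  by (induction xs) auto

lemma data_size_eL_rev [simp]: "data_size (eL e (rev ys)) = data_size (eL e ys)"
  unfolding data_size_eL by (simp add: rev_map[symmetric])

lemma data_size_eL_take: "data_size (eL e (take j ys)) \<le> data_size (eL e ys)"
  using data_size_eL_append[of e "take j ys" "drop j ys"] data_size_pos[of "eL e (drop j ys)"]
  by (simp del: data_size_pos)

text \<open>A list can be read and extended only at its front, so moving elements one by one
  reverses them. Reversal is the special case of an empty second list, and append needs two
  passes.\<close>

lemma ptime_fold_Cons:
  assumes "ptime X N f (\<lambda>x. eL e (ys x))" "ptime X N f (\<lambda>x. eL e (zs x))"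
  shows "ptime X N f (\<lambda>x. eL e (rev (ys x) @ zs x))"
proof -
  have eq: "fold (#) ys zs = rev ys @ zs" for ys zs :: "'b list"
    by (induction ys arbitrary: zs) auto
  have "ptime X N f (\<lambda>x. eL e (fold (#) (ys x) (zs x)))"
  proof (rule ptime_fold[where h = "\<lambda>_. (#)" and ys = ys and init = zs and e = e and ea = "eL e", OF assms])
    show "pbound {(x, j). x \<in> X \<and> j \<le> length (ys x)} (\<lambda>z. N (fst z))
       (\<lambda>(x, j). data_size (eL e (fold (#) (take j (ys x)) (zs x))))"
    proof (rule pbound_fold_size)
      show "pbound X N (\<lambda>x. data_size (eL e (ys x)) + data_size (eL e (zs x)))"
        by (intro pbound_add ptime_size[OF assms(1)] ptime_size[OF assms(2)])
      show "data_size (eL e (fold (#) (take j (ys x)) (zs x))) \<le> data_size (eL e (ys x)) + data_size (eL e (zs x))" for x j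
        using data_size_eL_append[of e "rev (take j (ys x))" "zs x"] data_size_eL_take[of e j "ys x"]
        by (simp add: eq)
    qed
  qed (rule ptime_Cons)
  then show ?thesis by (simp add: eq)
qed

lemma ptime_rev: "ptime X N f (\<lambda>x. eL e (ys x)) \<Longrightarrow> ptime X N f (\<lambda>x. eL e (rev (ys x)))"
  using ptime_fold_Cons[OF _ ptime_Nil, of X N f e ys f] ptime_self[of X N f] by simp

lemma ptime_append:
  "ptime X N f (\<lambda>x. eL e (ys x)) \<Longrightarrow> ptime X N f (\<lambda>x. eL e (zs x)) \<Longrightarrow> ptime X N f (\<lambda>x. eL e (ys x @ zs x))"
  using ptime_fold_Cons[OF ptime_rev, of X N f e ys zs] by simp

text \<open>Instantiates the abstract premise with a concrete input. This yields one program and one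
  bound on the output for all elements; the fold built around it needs that bound before its own
  index set is available.\<close>

lemma ptime_elem:
  fixes X :: "'a set" and ys :: "'a \<Rightarrow> 'b list"
  assumes ys: "ptime X N f (\<lambda>x. eL e (ys x))"
    and step: "\<And>Z u. Z = {(x, y). x \<in> X \<and> y \<in> set (ys x)} \<Longrightarrow>
      (\<And>g. ptime X N f g \<Longrightarrow> ptime Z (\<lambda>z. N (fst z)) u (\<lambda>z. g (fst z))) \<Longrightarrow>
      ptime Z (\<lambda>z. N (fst z)) u (\<lambda>z. e (snd z)) \<Longrightarrow>
      ptime Z (\<lambda>z. N (fst z)) u (\<lambda>z. h (fst z) (snd z))"
  shows "ptime {(x, y). x \<in> X \<and> y \<in> set (ys x)} (\<lambda>z. N (fst z))
    (\<lambda>z. Node (e (snd z)) (f (fst z))) (\<lambda>z. h (fst z) (snd z))"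
proof -
  let ?Z = "{(x, y). x \<in> X \<and> y \<in> set (ys x)}"
  let ?M = "\<lambda>z :: 'a \<times> 'b. N (fst z)"
  let ?u = "\<lambda>z. Node (e (snd z)) (f (fst z))"
  have "pbound ?Z ?M (\<lambda>z. 1 + data_size (eL e (ys (fst z))) + data_size (f (fst z)))"
    by (intro pbound_add pbound_const pbound_reindex[OF ptime_size[OF ys]]
        pbound_reindex[OF ptime_size_in[OF ys]]) auto
  then have u: "ptime ?Z ?M ?u ?u"
    by (intro ptime_id) (erule pbound_mono, auto simp: data_size_mem)
  show ?thesis
  proof (rule step[OF refl])
    show "ptime ?Z ?M ?u (\<lambda>z. g (fst z))" if "ptime X N f g" for g
      by (rule ptime_seq[OF ptime_Right[OF u] ptime_reindex[OF that]]) (auto intro: pbound_self)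
  qed (rule ptime_Left[OF u])
qed

lemma ptime_elem_app:
  assumes H: "ptime {(x, y). x \<in> X \<and> y \<in> set (ys x)} (\<lambda>z. N (fst z))
    (\<lambda>z. Node (e (snd z)) (f (fst z))) (\<lambda>z. h (fst z) (snd z))"
    and "ptime Z (\<lambda>z. N (p z)) u (\<lambda>z. e (q z))" "ptime Z (\<lambda>z. N (p z)) u (\<lambda>z. f (p z))"
    and "\<And>z. z \<in> Z \<Longrightarrow> p z \<in> X \<and> q z \<in> set (ys (p z))"
  shows "ptime Z (\<lambda>z. N (p z)) u (\<lambda>z. h (p z) (q z))"
proof -
  have "ptime Z (\<lambda>z. N (p z)) (\<lambda>z. Node (e (q z)) (f (p z))) (\<lambda>z. h (p z) (q z))"
    using ptime_reindex[OF H, of Z "\<lambda>z. (p z, q z)" "\<lambda>z. N (p z)"] assms(4)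
    by (auto intro: pbound_self)
  from ptime_seq[OF ptime_Node[OF assms(2,3)] this] show ?thesis .
qed

lemma ptime_concat_map:
  fixes X :: "'a set" and ys :: "'a \<Rightarrow> 'b list"
  assumes ys: "ptime X N f (\<lambda>x. eL e (ys x))"
    and step: "\<And>Z u. Z = {(x, y). x \<in> X \<and> y \<in> set (ys x)} \<Longrightarrow>
      (\<And>g. ptime X N f g \<Longrightarrow> ptime Z (\<lambda>z. N (fst z)) u (\<lambda>z. g (fst z))) \<Longrightarrow>
      ptime Z (\<lambda>z. N (fst z)) u (\<lambda>z. e (snd z)) \<Longrightarrow>
      ptime Z (\<lambda>z. N (fst z)) u (\<lambda>z. eL ec (h (fst z) (snd z)))"
  shows "ptime X N f (\<lambda>x. eL ec (concat (map (h x) (ys x))))"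
proof -
  note H = ptime_elem[OF ys, of "\<lambda>x y. eL ec (h x y)", OF step]
  from ptime_size[OF H] obtain d where
    d: "\<And>x y. x \<in> X \<Longrightarrow> y \<in> set (ys x) \<Longrightarrow> data_size (eL ec (h x y)) \<le> (N x + 2) ^ d"
    unfolding pbound_def by fastforce
  have eq: "fold (\<lambda>y a. h x y @ a) zs [] = concat (map (h x) (rev zs))" for x zs
    by (induction zs rule: rev_induct) auto
  have sz: "data_size (eL ec (concat (map (h x) zs))) \<le> 1 + length zs * (N x + 2) ^ d"
    if "x \<in> X" "set zs \<subseteq> set (ys x)" for x zs
    using that(2)
  proof (induction zs)
    case (Cons z zs)
    with data_size_eL_append[of ec "h x z" "concat (map (h x) zs)"] d[OF that(1), of z]
    show ?case by auto
  qed simp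
  \<comment> \<open>The list is reversed because each new result is put in front of the
    accumulator.\<close>
  have "ptime X N f (\<lambda>x. eL ec (fold (\<lambda>y a. h x y @ a) (rev (ys x)) []))"
  proof (rule ptime_fold[where h = "\<lambda>x y a. h x y @ a" and ys = "\<lambda>x. rev (ys x)" and init = "\<lambda>_. []"
        and e = e and ea = "eL ec", OF ptime_rev[OF ys] ptime_Nil[OF ys]])
    show "pbound {(x, j). x \<in> X \<and> j \<le> length (rev (ys x))} (\<lambda>z. N (fst z))
       (\<lambda>(x, j). data_size (eL ec (fold (\<lambda>y a. h x y @ a) (take j (rev (ys x))) [])))"
    proof (rule pbound_fold_size)
      show "pbound X N (\<lambda>x. 1 + length (ys x) * (N x + 2) ^ d)"
        by (intro pbound_intros ptime_length_bound[OF ys])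
      show "data_size (eL ec (fold (\<lambda>y a. h x y @ a) (take j (rev (ys x))) []))
          \<le> 1 + length (ys x) * (N x + 2) ^ d" if "x \<in> X" "j \<le> length (rev (ys x))" for x j
      proof -
        have "set (rev (take j (rev (ys x)))) \<subseteq> set (ys x)"
          using set_take_subset[of j "rev (ys x)"] by simp
        note sz[OF that(1) this]
        also have "1 + length (rev (take j (rev (ys x)))) * (N x + 2) ^ d \<le> 1 + length (ys x) * (N x + 2) ^ d"
          by (intro add_left_mono mult_right_mono) simp_all
        finally show ?thesis unfolding eq .
      qed
    qed
    fix Z :: "('a \<times> 'b \<times> 'c list) set" and u
    assume Z: "Z = {(x, rev (ys x) ! j, fold (\<lambda>y a. h x y @ a) (take j (rev (ys x))) []) |x j.
      x \<in> X \<and> j < length (rev (ys x))}"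
      and l: "\<And>g. ptime X N f g \<Longrightarrow> ptime Z (\<lambda>z. N (fst z)) u (\<lambda>z. g (fst z))"
      and y: "ptime Z (\<lambda>z. N (fst z)) u (\<lambda>z. e (fst (snd z)))"
      and a: "ptime Z (\<lambda>z. N (fst z)) u (\<lambda>z. eL ec (snd (snd z)))"
    have "rev (ys x) ! j \<in> set (ys x)" if "j < length (ys x)" for x j
      using nth_mem[of j "rev (ys x)"] that by simp
    then show "ptime Z (\<lambda>z. N (fst z)) u (\<lambda>z. eL ec (h (fst z) (fst (snd z)) @ snd (snd z)))"
      by (intro ptime_append a ptime_elem_app[OF H y l[OF ptime_self[OF ys]]]) (auto simp: Z)
  qed
  then show ?thesis by (simp add: eq)
qed

lemma ptime_map:
  fixes X :: "'a set" and ys :: "'a \<Rightarrow> 'b list"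
  assumes ys: "ptime X N f (\<lambda>x. eL e (ys x))"
    and step: "\<And>Z u. Z = {(x, y). x \<in> X \<and> y \<in> set (ys x)} \<Longrightarrow>
      (\<And>g. ptime X N f g \<Longrightarrow> ptime Z (\<lambda>z. N (fst z)) u (\<lambda>z. g (fst z))) \<Longrightarrow>
      ptime Z (\<lambda>z. N (fst z)) u (\<lambda>z. e (snd z)) \<Longrightarrow>
      ptime Z (\<lambda>z. N (fst z)) u (\<lambda>z. ec (h (fst z) (snd z)))"
  shows "ptime X N f (\<lambda>x. eL ec (map (h x) (ys x)))"
proof -
  have "ptime X N f (\<lambda>x. eL ec (concat (map (\<lambda>y. [h x y]) (ys x))))"
    by (rule ptime_concat_map[where h = "\<lambda>x y. [h x y]", OF ys])
      (intro ptime_Cons ptime_Nil; (rule step | rule ptime_self); assumption)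
  then show ?thesis by (simp add: concat_map_singleton)
qed

lemma ptime_filter:
  fixes X :: "'a set" and ys :: "'a \<Rightarrow> 'b list"
  assumes ys: "ptime X N f (\<lambda>x. eL e (ys x))"
    and step: "\<And>Z u. Z = {(x, y). x \<in> X \<and> y \<in> set (ys x)} \<Longrightarrow>
      (\<And>g. ptime X N f g \<Longrightarrow> ptime Z (\<lambda>z. N (fst z)) u (\<lambda>z. g (fst z))) \<Longrightarrow>
      ptime Z (\<lambda>z. N (fst z)) u (\<lambda>z. e (snd z)) \<Longrightarrow>
      ptime Z (\<lambda>z. N (fst z)) u (\<lambda>z. eB (P (fst z) (snd z)))"
  shows "ptime X N f (\<lambda>x. eL e (filter (P x) (ys x)))"
proof -
  have "ptime X N f (\<lambda>x. eL e (concat (map (\<lambda>y. if P x y then [y] else []) (ys x))))"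
    by (rule ptime_concat_map[where h = "\<lambda>x y. if P x y then [y] else []", OF ys],
        rule ptime_If[where e = "eL e"], rule step; assumption?)
      (intro ptime_Cons ptime_Nil; assumption)+
  moreover have "concat (map (\<lambda>y. if P x y then [y] else []) l) = filter (P x) l" for x l
    by (induction l) auto
  ultimately show ?thesis by simp
qed

lemma ptime_bex:
  fixes X :: "'a set" and ys :: "'a \<Rightarrow> 'b list"
  assumes ys: "ptime X N f (\<lambda>x. eL e (ys x))"
    and step: "\<And>Z u. Z = {(x, y). x \<in> X \<and> y \<in> set (ys x)} \<Longrightarrow>
      (\<And>g. ptime X N f g \<Longrightarrow> ptime Z (\<lambda>z. N (fst z)) u (\<lambda>z. g (fst z))) \<Longrightarrow>
      ptime Z (\<lambda>z. N (fst z)) u (\<lambda>z. e (snd z)) \<Longrightarrow>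
      ptime Z (\<lambda>z. N (fst z)) u (\<lambda>z. eB (P (fst z) (snd z)))"
  shows "ptime X N f (\<lambda>x. eB (\<exists>y\<in>set (ys x). P x y))"
proof -
  have "ptime X N f (\<lambda>x. eB (\<not> filter (P x) (ys x) = []))"
    by (intro ptime_not ptime_is_Nil[OF ptime_filter[OF ys step]])
  then show ?thesis by (rule ptime_out) (simp add: filter_empty_conv)
qed

lemma ptime_ball:
  fixes X :: "'a set" and ys :: "'a \<Rightarrow> 'b list"
  assumes ys: "ptime X N f (\<lambda>x. eL e (ys x))"
    and step: "\<And>Z u. Z = {(x, y). x \<in> X \<and> y \<in> set (ys x)} \<Longrightarrow>
      (\<And>g. ptime X N f g \<Longrightarrow> ptime Z (\<lambda>z. N (fst z)) u (\<lambda>z. g (fst z))) \<Longrightarrow>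
      ptime Z (\<lambda>z. N (fst z)) u (\<lambda>z. e (snd z)) \<Longrightarrow>
      ptime Z (\<lambda>z. N (fst z)) u (\<lambda>z. eB (P (fst z) (snd z)))"
  shows "ptime X N f (\<lambda>x. eB (\<forall>y\<in>set (ys x). P x y))"
  by (rule ptime_out[OF ptime_not[OF ptime_bex[where P = "\<lambda>x y. \<not> P x y", OF ys ptime_not[OF step]]]])
    auto

lemma ptime_mem:
  assumes "ptime X N f (\<lambda>x. Num (a x))" "ptime X N f (\<lambda>x. eL Num (l x))"
  shows "ptime X N f (\<lambda>x. eB (a x \<in> set (l x)))"
proof -
  have "ptime X N f (\<lambda>x. eB (\<exists>y\<in>set (l x). a x = y))"
    apply (rule ptime_bex[where P = "\<lambda>x y. a x = y", OF assms(2)])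
    subgoal premises p for Z u by (rule ptime_eq[OF p(2)[OF assms(1)] p(3)])
    done
  then show ?thesis by simp
qed

lemma ptime_sum_list:
  fixes X :: "'a set" and ys :: "'a \<Rightarrow> 'b list"
  assumes ys: "ptime X N f (\<lambda>x. eL e (ys x))"
    and step: "\<And>Z u. Z = {(x, y). x \<in> X \<and> y \<in> set (ys x)} \<Longrightarrow>
      (\<And>g. ptime X N f g \<Longrightarrow> ptime Z (\<lambda>z. N (fst z)) u (\<lambda>z. g (fst z))) \<Longrightarrow>
      ptime Z (\<lambda>z. N (fst z)) u (\<lambda>z. e (snd z)) \<Longrightarrow>
      ptime Z (\<lambda>z. N (fst z)) u (\<lambda>z. Num (h (fst z) (snd z)))"
  shows "ptime X N f (\<lambda>x. Num (\<Sum>y\<leftarrow>ys x. h x y))"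
proof -
  have eq: "fold (+) l a = a + sum_list l" for l and a :: real
    by (induction l arbitrary: a) auto
  have "ptime X N f (\<lambda>x. Num (fold (+) (map (h x) (ys x)) 0))"
    by (rule ptime_fold[where h = "\<lambda>_. (+)" and e = Num and ea = Num and ys = "\<lambda>x. map (h x) (ys x)" and init = "\<lambda>_. 0", OF ptime_map[where ec = Num and h = h, OF ys step] ptime_0[OF ys]])
      (use pbound_const[of _ _ 1] in \<open>simp_all add: case_prod_beta' ptime_add\<close>)
  then show ?thesis by (simp add: eq)
qed

lemma fold_const: "fold (\<lambda>_. g) l = g ^^ length l"
  by (induction l) (auto simp: funpow_swap1 fun_eq_iff)

text \<open>The list \<open>ys\<close> is a clock: only its length counts. The body may assume that
  its input is an actual iterate, so invariants of the iteration can be used to bound sizes.\<close>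

lemma ptime_iterate:
  fixes X :: "'a set" and ys :: "'a \<Rightarrow> 'b list" and init :: "'a \<Rightarrow> 'c" and h :: "'a \<Rightarrow> 'c \<Rightarrow> 'c"
  assumes ys: "ptime X N f (\<lambda>x. eL e (ys x))" and init: "ptime X N f (\<lambda>x. ea (init x))"
    and b: "pbound X N b"
    and size: "\<And>x j. x \<in> X \<Longrightarrow> j \<le> length (ys x) \<Longrightarrow> data_size (ea ((h x ^^ j) (init x))) \<le> b x"
    and step: "\<And>(Z :: ('a \<times> 'b \<times> 'c) set) u.
      (\<And>z. z \<in> Z \<Longrightarrow> fst z \<in> X \<and> (\<exists>j < length (ys (fst z)). snd (snd z) = (h (fst z) ^^ j) (init (fst z)))) \<Longrightarrow>
      (\<And>g. ptime X N f g \<Longrightarrow> ptime Z (\<lambda>z. N (fst z)) u (\<lambda>z. g (fst z))) \<Longrightarrow>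
      ptime Z (\<lambda>z. N (fst z)) u (\<lambda>z. ea (snd (snd z))) \<Longrightarrow>
      ptime Z (\<lambda>z. N (fst z)) u (\<lambda>z. ea (h (fst z) (snd (snd z))))"
  shows "ptime X N f (\<lambda>x. ea ((h x ^^ length (ys x)) (init x)))"
proof -
  have "ptime X N f (\<lambda>x. ea (fold (\<lambda>_. h x) (ys x) (init x)))"
  proof (rule ptime_fold[where h = "\<lambda>x _. h x" and ys = ys and init = init and e = e and ea = ea, OF ys init])
    show "pbound {(x, j). x \<in> X \<and> j \<le> length (ys x)} (\<lambda>z. N (fst z))
     (\<lambda>(x, j). data_size (ea (fold (\<lambda>_. h x) (take j (ys x)) (init x))))"
      by (rule pbound_fold_size[OF b]) (use size in \<open>auto simp: fold_const min_def\<close>)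
    fix Z :: "('a \<times> 'b \<times> 'c) set" and u
    assume Z: "Z = {(x, ys x ! j, fold (\<lambda>_. h x) (take j (ys x)) (init x)) |x j. x \<in> X \<and> j < length (ys x)}"
      and l: "\<And>g. ptime X N f g \<Longrightarrow> ptime Z (\<lambda>z. N (fst z)) u (\<lambda>z. g (fst z))"
      and a: "ptime Z (\<lambda>z. N (fst z)) u (\<lambda>z. ea (snd (snd z)))"
    show "ptime Z (\<lambda>z. N (fst z)) u (\<lambda>z. ea (h (fst z) (snd (snd z))))"
      by (rule step[OF _ l a]) (auto simp: Z fold_const)
  qed
  then show ?thesis by (simp add: fold_const)
qed

definition enum :: "'b list \<Rightarrow> (real \<times> 'b) list" where
  "enum ys = zip (map real [0..<length ys]) ys"

lemma enum_snoc: "enum (ys @ [y]) = enum ys @ [(real (length ys), y)]"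
  by (simp add: enum_def)

lemma ptime_enum:
  assumes "ptime X N f (\<lambda>x. eL e (ys x))"
  shows "ptime X N f (\<lambda>x. eL (eP Num e) (enum (ys x)))"
proof -
  let ?h = "\<lambda>y (p :: real \<times> (real \<times> 'b) list). (fst p + 1, (fst p, y) # snd p)"
  let ?ea = "eP Num (eL (eP Num e))"
  have eq: "fold ?h zs (0, []) = (real (length zs), rev (enum zs))" for zs
    by (induction zs rule: rev_induct) (auto simp: enum_snoc enum_def[of "[]"])
  have sz: "data_size (eL (eP Num e) (enum zs)) \<le> 3 * data_size (eL e zs)" for zs
  proof (induction zs rule: rev_induct)
    case (snoc z zs)
    then show ?case
      using data_size_eL_append[of "eP Num e" "enum zs" "[(real (length zs), z)]"]
        data_size_eL_append[of e zs "[z]"] data_size_pos[of "e z"]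
      by (simp add: enum_snoc del: data_size_pos)
  qed (simp add: enum_def)
  have "ptime X N f (\<lambda>x. ?ea (fold ?h (ys x) (0, [])))"
  proof (rule ptime_fold[where h = "\<lambda>_. ?h" and ys = ys and init = "\<lambda>_. (0, [])" and e = e and ea = ?ea, OF assms])
    show "ptime X N f (\<lambda>x. ?ea (0, []))"
      by (intro ptime_pair ptime_0[OF assms] ptime_Nil[OF assms])
    show "pbound {(x, j). x \<in> X \<and> j \<le> length (ys x)} (\<lambda>z. N (fst z))
     (\<lambda>(x, j). data_size (?ea (fold ?h (take j (ys x)) (0, []))))"
    proof (rule pbound_fold_size)
      show "pbound X N (\<lambda>x. 2 + 3 * data_size (eL e (ys x)))"
        by (intro pbound_intros ptime_size[OF assms])
      show "data_size (?ea (fold ?h (take j (ys x)) (0, []))) \<le> 2 + 3 * data_size (eL e (ys x))" for x j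
        using sz[of "take j (ys x)"] data_size_eL_take[of e j "ys x"]
        by (simp add: eq)
    qed
    fix Z :: "('a \<times> 'b \<times> real \<times> (real \<times> 'b) list) set" and u
    assume y: "ptime Z (\<lambda>z. N (fst z)) u (\<lambda>z. e (fst (snd z)))"
      and a: "ptime Z (\<lambda>z. N (fst z)) u (\<lambda>z. ?ea (snd (snd z)))"
    show "ptime Z (\<lambda>z. N (fst z)) u (\<lambda>z. ?ea (?h (fst (snd z)) (snd (snd z))))"
      by (intro ptime_pair ptime_Cons ptime_add y ptime_fst[OF a] ptime_1[OF y]
          ptime_snd[OF a])
  qed
  from ptime_rev[OF ptime_snd[OF this]] show ?thesis by (simp add: eq)
qed

section \<open>Choosing a least element\<close>

text \<open>The result is a list of at most one element, so an empty list of candidates requires no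
  default value.\<close>

definition best :: "('b \<Rightarrow> 'b \<Rightarrow> bool) \<Rightarrow> 'b list \<Rightarrow> 'b list" where
  "best le ys = fold (\<lambda>y a. case a of [] \<Rightarrow> [y] | z # _ \<Rightarrow> if le z y then [z] else [y]) ys []"

lemma best_snoc:
  "best le (ys @ [y]) = (case best le ys of [] \<Rightarrow> [y] | z # _ \<Rightarrow> if le z y then [z] else [y])"
  by (simp add: best_def)

lemma best_cases:
  assumes tot: "\<And>a b. a \<in> A \<Longrightarrow> b \<in> A \<Longrightarrow> le a b \<or> le b a"
    and tr: "\<And>a b c. a \<in> A \<Longrightarrow> b \<in> A \<Longrightarrow> c \<in> A \<Longrightarrow> le a b \<Longrightarrow> le b c \<Longrightarrow> le a c"
    and "set ys \<subseteq> A"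
  shows "ys = [] \<and> best le ys = [] \<or> (\<exists>z\<in>set ys. best le ys = [z] \<and> (\<forall>y\<in>set ys. le z y))"
  using assms(3)
proof (induction ys rule: rev_induct)
  case (snoc y ys)
  then have y: "y \<in> A" "set ys \<subseteq> A" by auto
  from tot[OF y(1) y(1)] have yy: "le y y" by blast
  from snoc.IH[OF y(2)] consider "ys = []" "best le ys = []" |
    z where "z \<in> set ys" "z \<in> A" "best le ys = [z]" "\<forall>y\<in>set ys. le z y"
    using y(2) by blast
  then show ?case
  proof cases
    case 1
    then show ?thesis using yy by (simp add: best_def)
  next
    case (2 z)
    show ?thesis
    proof (cases "le z y")
      case True
      then show ?thesis using 2 by (simp add: best_snoc)
    next
      case False
      then have "le y z" using tot[OF 2(2) y(1)] by blast
      then have "le y y'" if "y' \<in> set ys" for y'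
        using tr[OF y(1) 2(2), of y'] 2(4) that y(2) by blast
      then show ?thesis using 2 False yy by (simp add: best_snoc)
    qed
  qed
qed (simp add: best_def)

lemma set_best: "set (best le ys) \<subseteq> set ys"
  by (induction ys rule: rev_induct) (auto simp: best_snoc best_def[of _ "[]"] split: list.splits if_splits)

lemma length_best: "length (best le ys) \<le> 1"
  by (induction ys rule: rev_induct) (auto simp: best_snoc best_def[of _ "[]"] split: list.splits if_splits)

lemma ptime_best:
  fixes X :: "'a set" and ys :: "'a \<Rightarrow> 'b list"
  assumes ys: "ptime X N f (\<lambda>x. eL e (ys x))"
    and le: "\<And>(Z :: (('a \<times> 'b \<times> 'b list) \<times> 'b \<times> 'b list) set) M u a b. ptime Z M u (\<lambda>z. e (a z)) \<Longrightarrow>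
      ptime Z M u (\<lambda>z. e (b z)) \<Longrightarrow> ptime Z M u (\<lambda>z. eB (le (a z) (b z)))"
  shows "ptime X N f (\<lambda>x. eL e (best le (ys x)))"
proof -
  let ?h = "\<lambda>y a. case a of [] \<Rightarrow> [y] | z # _ \<Rightarrow> if le z y then [z] else [y]"
  have "ptime X N f (\<lambda>x. eL e (fold ?h (ys x) []))"
  proof (rule ptime_fold[where h = "\<lambda>_. ?h" and ys = ys and init = "\<lambda>_. []" and e = e and ea = "eL e",
        OF ys ptime_Nil[OF ys]])
    show "pbound {(x, j). x \<in> X \<and> j \<le> length (ys x)} (\<lambda>z. N (fst z))
       (\<lambda>(x, j). data_size (eL e (fold ?h (take j (ys x)) [])))"
    proof (rule pbound_fold_size)
      show "pbound X N (\<lambda>x. 1 + 1 * (1 + data_size (eL e (ys x))))"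
        by (intro pbound_intros ptime_size[OF ys])
      show "data_size (eL e (fold ?h (take j (ys x)) [])) \<le> 1 + 1 * (1 + data_size (eL e (ys x)))" for x j
      proof -
        have "data_size (eL e (best le (take j (ys x)))) \<le>
            1 + length (best le (take j (ys x))) * (1 + data_size (eL e (ys x)))"
          by (rule data_size_eL_le)
            (meson data_size_mem in_set_takeD set_best subset_iff)
        also have "\<dots> \<le> 1 + 1 * (1 + data_size (eL e (ys x)))"
          by (intro add_left_mono mult_right_mono length_best) simp
        finally show ?thesis unfolding best_def .
      qed
    qed
    fix Z :: "('a \<times> 'b \<times> 'b list) set" and u
    assume y: "ptime Z (\<lambda>z. N (fst z)) u (\<lambda>z. e (fst (snd z)))"
      and a: "ptime Z (\<lambda>z. N (fst z)) u (\<lambda>z. eL e (snd (snd z)))"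
    show "ptime Z (\<lambda>z. N (fst z)) u (\<lambda>z. eL e (?h (fst (snd z)) (snd (snd z))))"
      apply (rule ptime_case_list[where ec = "eL e" and e = e and l = "\<lambda>z. snd (snd z)"
            and g = "\<lambda>z. [fst (snd z)]" and h = "\<lambda>w z _. if le z (fst (snd w)) then [z] else [fst (snd w)]", OF a])
       apply (rule ptime_subset, rule ptime_single, rule y, blast)
      subgoal premises p for Z u
        by (rule ptime_If, rule le[OF p(3) p(2)[OF y]], rule ptime_single, rule p(3),
            rule ptime_single, rule p(2)[OF y])
      done
  qed
  then show ?thesis by (simp add: best_def)
qed


section \<open>Weighted matroid intersection\<close>

locale matroid =
  fixes S :: "'a set" and ind :: "'a set \<Rightarrow> bool"
  assumes finite_ground: "finite S"
    and ind_ground: "ind A \<Longrightarrow> A \<subseteq> S"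
    and ind_empty: "ind {}"
    and ind_subset: "ind A \<Longrightarrow> B \<subseteq> A \<Longrightarrow> ind B"
    and augment: "ind A \<Longrightarrow> ind B \<Longrightarrow> card A < card B \<Longrightarrow> \<exists>b\<in>B - A. ind (insert b A)"
begin

lemma ind_finite: "ind A \<Longrightarrow> finite A"
  using ind_ground finite_ground finite_subset by blast

text \<open>Exchange a heaviest \<open>y\<close> of \<open>J - I\<close> for some \<open>x\<close>
  of \<open>I\<close>. If \<open>x\<close> is no heavier than \<open>y\<close>, the new set is
  closer to \<open>I\<close> and no heavier than \<open>J\<close>. Otherwise some \<open>z\<close>
  in \<open>J - I\<close> can replace \<open>x\<close> in \<open>I\<close>, and
  \<open>w x \<le> w z \<le> w y\<close> by local optimality and the choice of \<open>y\<close>, a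
  contradiction.\<close>

lemma local_optimum:
  fixes w :: "'a \<Rightarrow> real"
  assumes I: "ind I"
    and loc: "\<And>x y. x \<in> I \<Longrightarrow> y \<in> S - I \<Longrightarrow> ind (insert y (I - {x})) \<Longrightarrow> w x \<le> w y"
    and J: "ind J" "card J = card I"
  shows "sum w I \<le> sum w J"
  using J
proof (induction "card (J - I)" arbitrary: J rule: less_induct)
  case less
  have fin: "finite I" "finite J" using I less.prems ind_finite by auto
  show ?case
  proof (cases "J \<subseteq> I")
    case True
    then have "J = I" using card_subset_eq[OF fin(1)] less.prems by simp
    then show ?thesis by simp
  next
    case False
    then have "finite (w ` (J - I))" "w ` (J - I) \<noteq> {}" using fin by auto
    then have "Max (w ` (J - I)) \<in> w ` (J - I)" "\<forall>z\<in>J - I. w z \<le> Max (w ` (J - I))"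
      by auto
    then obtain y where y: "y \<in> J - I" and ymax: "\<And>z. z \<in> J - I \<Longrightarrow> w z \<le> w y"
      by (metis imageE)
    have "card (J - {y}) < card I" using y fin less.prems(2)
      by (metis DiffD1 card_Diff1_less)
    from augment[OF ind_subset[OF less.prems(1)] I this]
    obtain x where x: "x \<in> I - (J - {y})" "ind (insert x (J - {y}))" by auto
    with y have xJ: "x \<in> I" "x \<notin> J" by auto
    let ?J = "insert x (J - {y})"
    have cJ: "card ?J = card I" using xJ y fin less.prems(2)
      card_Suc_Diff1[OF fin(2), of y] by (simp del: card_Diff_insert)
    show ?thesis
    proof (cases "w x \<le> w y")
      case True
      have "?J - I = (J - I) - {y}" using xJ by auto
      then have "card (?J - I) < card (J - I)" using y fin
        by (simp add: card_Diff1_less del: card_Diff_insert)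
      from less.hyps[OF this x(2) cJ] have "sum w I \<le> sum w ?J" .
      also have "\<dots> = w x + (sum w J - w y)"
        using xJ y fin by (simp add: sum_diff1)
      finally show ?thesis using True by simp
    next
      case False
      have "card (I - {x}) < card J" using xJ fin less.prems(2)
        by (metis card_Diff1_less)
      from augment[OF ind_subset[OF I] less.prems(1) this]
      obtain z where z: "z \<in> J - (I - {x})" "ind (insert z (I - {x}))" by auto
      then have zI: "z \<in> J - I" using xJ by auto
      moreover have "z \<in> S" using z ind_ground less.prems(1) by blast
      ultimately have "w x \<le> w z" using loc[of x z] xJ z by auto
      with ymax[OF zI] False show ?thesis by simp
    qed
  qed
qed

text \<open>A set \<open>J\<close> of the next size contains some \<open>z\<close> that extends
  \<open>I\<close>; what remains of \<open>J\<close> has the size of \<open>I\<close>. This is the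
  reason why greedy choices stay optimal.\<close>

lemma optimum_step:
  fixes w :: "'a \<Rightarrow> real"
  assumes "ind I" and opt: "\<And>J. ind J \<Longrightarrow> card J = card I \<Longrightarrow> sum w I \<le> sum w J"
    and mu: "\<And>y. y \<in> S - I \<Longrightarrow> ind (insert y I) \<Longrightarrow> \<mu> \<le> w y"
    and J: "ind J" "card J = Suc (card I)"
  shows "sum w I + \<mu> \<le> sum w J"
proof -
  from augment[of I J] assms obtain z where z: "z \<in> J - I" "ind (insert z I)" by auto
  with ind_ground[OF J(1)] have "\<mu> \<le> w z" using mu by blast
  moreover have "sum w I \<le> sum w (J - {z})"
    using z J ind_finite[OF J(1)] by (intro opt) (auto elim: ind_subset)
  moreover have "sum w J = w z + sum w (J - {z})"
    using z ind_finite[OF J(1)] by (simp add: sum.remove)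
  ultimately show ?thesis by simp
qed

text \<open>The set \<open>insert b A\<close> is enlarged by elements of \<open>I\<close> until it
  has the size of \<open>I\<close>. It then contains all of \<open>I\<close> except one element, and
  that element lies outside \<open>A\<close>.\<close>

lemma complete_exchange:
  assumes I: "ind I" and "A \<subseteq> I" "b \<notin> I" "ind (insert b A)" "\<not> ind (insert b I)"
  shows "\<exists>x\<in>I - A. ind (insert b (I - {x}))"
  using assms(2-)
proof (induction "card (I - A)" arbitrary: A rule: less_induct)
  case less
  have fin: "finite I" "finite A" using I less.prems ind_finite finite_subset by blast+
  have "b \<notin> A" using less.prems by blast
  then have cA: "card (insert b A) = Suc (card A)" using fin by simp
  show ?case
  proof (cases "Suc (card A) < card I")
    case True
    with augment[OF less.prems(3) I] cA obtain z where z: "z \<in> I - insert b A" "ind (insert z (insert b A))"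
      by auto
    have "card (I - insert z A) < card (I - A)" using z fin by (intro psubset_card_mono) auto
    from less.hyps[OF this] z less.prems have "\<exists>x\<in>I - insert z A. ind (insert b (I - {x}))"
      by (auto simp: insert_commute)
    then show ?thesis by auto
  next
    case False
    have "A \<noteq> I" using less.prems by auto
    then obtain x where x: "x \<in> I - A" using less.prems by auto
    then have "card (I - {x}) \<le> card A" using False fin by simp
    then have "A = I - {x}" using x less.prems fin by (intro card_seteq) auto
    then show ?thesis using x less.prems by auto
  qed
qed

lemma card_exchange:
  assumes "finite I" "finite T" "inj_on x T" "inj_on y T" "x ` T \<subseteq> I" "y ` T \<inter> I = {}"
  shows "card (I - x ` T \<union> y ` T) = card I"
proof -
  have "card (I - x ` T \<union> y ` T) = card (I - x ` T) + card (y ` T)"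
    using assms by (intro card_Un_disjoint) auto
  also have "\<dots> = card I - card T + card T"
    using assms by (simp add: card_Diff_subset card_image)
  also have "card T \<le> card I"
    using assms by (metis card_image card_mono)
  then have "card I - card T + card T = card I" by simp
  finally show ?thesis .
qed

text \<open>
  The pair \<open>m\<close> is exchanged last: all other new elements are spanned by \<open>I - {x m}\<close>, hence so is
  everything that the other exchanges leave of the set apart from \<open>x m\<close>.
\<close>

lemma triangular_exchange:
  fixes x y :: "'b \<Rightarrow> 'a"
  assumes I: "ind I" and "finite T" "inj_on x T" "inj_on y T" "x ` T \<subseteq> I" "y ` T \<inter> I = {}"
    and ex: "\<And>i. i \<in> T \<Longrightarrow> ind (insert (y i) (I - {x i}))"
    and last: "\<And>T'. T' \<subseteq> T \<Longrightarrow> T' \<noteq> {} \<Longrightarrow>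
      \<exists>m\<in>T'. \<forall>i\<in>T' - {m}. \<not> ind (insert (y i) (I - {x m}))"
  shows "ind (I - x ` T \<union> y ` T)"
  using assms(2-)
proof (induction "card T" arbitrary: T)
  case 0
  then show ?case using I by simp
next
  case (Suc n)
  have fI: "finite I" using I ind_finite by blast
  from Suc.hyps(2) have "T \<noteq> {}" by auto
  with Suc.prems(7)[of T] obtain m where m: "m \<in> T"
    "\<And>i. i \<in> T - {m} \<Longrightarrow> \<not> ind (insert (y i) (I - {x m}))" by auto
  let ?T = "T - {m}"
  let ?K = "I - x ` ?T \<union> y ` ?T"
  have inj: "inj_on x ?T" "inj_on y ?T" "x ` ?T \<subseteq> I" "y ` ?T \<inter> I = {}"
    using Suc.prems by (auto intro: inj_on_subset)
  have K: "ind ?K"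
  proof (rule Suc.hyps(1))
    show "n = card ?T" using Suc.hyps(2) m(1) Suc.prems(1) by simp
    show "\<exists>m\<in>T'. \<forall>i\<in>T' - {m}. \<not> ind (insert (y i) (I - {x m}))" if "T' \<subseteq> ?T" "T' \<noteq> {}" for T'
      using Suc.prems(7)[of T'] that by blast
  qed (use Suc.prems inj in auto)
  have mem: "x m \<in> x ` T" "y m \<in> y ` T" using m(1) by auto
  have nm: "x m \<notin> x ` ?T" "y m \<notin> y ` ?T"
    using Suc.prems(2,3) m(1) by (auto dest: inj_onD)
  have "x m \<in> I" using Suc.prems(4) mem by blast
  moreover have "x m \<notin> y ` T" using Suc.prems(5) calculation by blast
  ultimately have xm: "x m \<in> I" "x m \<in> ?K" "x m \<notin> y ` T" using nm by auto
  have "y m \<notin> I" using Suc.prems(5) mem by blast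
  with nm xm have ym: "y m \<notin> I" "y m \<notin> ?K" "y m \<noteq> x m" by auto
  have cK: "card ?K = card I"
    using card_exchange[OF fI _ inj] Suc.prems(1) by simp
  have fK: "finite ?K" using K ind_finite by blast
  have "card (?K - {x m}) < card (insert (y m) (I - {x m}))"
  proof -
    have "card (?K - {x m}) < card ?K" using xm fK by (rule_tac card_Diff1_less)
    also have "\<dots> = card (insert (y m) (I - {x m}))"
      using ym(1) fI card_Suc_Diff1[OF fI xm(1)] by (simp add: cK del: card_Diff_insert)
    finally show ?thesis .
  qed
  from augment[OF ind_subset[OF K] Suc.prems(6)[OF m(1)] this]
  obtain z where z: "z \<in> insert (y m) (I - {x m}) - (?K - {x m})" "ind (insert z (?K - {x m}))" by auto
  have "z = y m"
  proof (rule ccontr)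
    assume "z \<noteq> y m"
    with z xm have zI: "z \<in> I" "z \<noteq> x m" "z \<notin> ?K" by auto
    have "card (I - {x m}) < card (insert z (?K - {x m}))"
    proof -
      have "card (I - {x m}) < card ?K" unfolding cK using xm(1) fI by (rule_tac card_Diff1_less)
      also have "card ?K = Suc (card (?K - {x m}))" using card_Suc_Diff1[OF fK xm(2)] by simp
      also have "\<dots> = card (insert z (?K - {x m}))"
        using zI(3) fK by (subst card_insert_disjoint) auto
      finally show ?thesis .
    qed
    from augment[OF ind_subset[OF I] z(2) this]
    obtain b where b: "b \<in> insert z (?K - {x m}) - (I - {x m})" "ind (insert b (I - {x m}))" by auto
    then obtain i where "i \<in> ?T" "b = y i" using zI by auto
    with m(2) b(2) show False by blast
  qed
  moreover have "insert (y m) (?K - {x m}) = I - x ` T \<union> y ` T"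
    using xm m(1) by auto
  ultimately show ?case using z(2) by simp
qed

text \<open>Elements at even positions enter and those at odd positions leave. The pairs formed by
  an odd position and its successor satisfy the triangularity condition because shortcuts are
  excluded between elements of equal value \<open>v\<close>, while local optimality controls the
  elements of different value. The element \<open>P ! 0\<close> is the surplus and is added at the
  end.\<close>

lemma exchange_path:
  fixes v :: "'a \<Rightarrow> real"
  assumes I: "ind I" and odd: "odd (length P)" and dist: "distinct P"
    and out: "\<And>i. i < length P \<Longrightarrow> even i \<Longrightarrow> P ! i \<notin> I"
    and inn: "\<And>i. i < length P \<Longrightarrow> odd i \<Longrightarrow> P ! i \<in> I"
    and arc: "\<And>i. Suc i < length P \<Longrightarrow> odd i \<Longrightarrow> ind (insert (P ! Suc i) (I - {P ! i}))"
    and tight: "\<And>i. Suc i < length P \<Longrightarrow> odd i \<Longrightarrow> v (P ! Suc i) = v (P ! i)"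
    and short: "\<And>i j. Suc i < j \<Longrightarrow> j < length P \<Longrightarrow> odd i \<Longrightarrow> even j \<Longrightarrow>
      ind (insert (P ! j) (I - {P ! i})) \<Longrightarrow> v (P ! i) \<noteq> v (P ! j)"
    and src: "ind (insert (P ! 0) I)"
    and src_short: "\<And>j. 0 < j \<Longrightarrow> j < length P \<Longrightarrow> even j \<Longrightarrow> ind (insert (P ! j) I) \<Longrightarrow> v (P ! j) \<noteq> v (P ! 0)"
    and loc: "\<And>x y. x \<in> I \<Longrightarrow> y \<notin> I \<Longrightarrow> ind (insert y (I - {x})) \<Longrightarrow> v x \<le> v y"
    and src_min: "\<And>y. y \<notin> I \<Longrightarrow> ind (insert y I) \<Longrightarrow> v (P ! 0) \<le> v y"
  shows "ind (I - set P \<union> (set P - I)) \<and> card (I - set P \<union> (set P - I)) = Suc (card I) \<and>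
    sum v (I - set P \<union> (set P - I)) = sum v I + v (P ! 0)"
proof -
  have fI: "finite I" using I ind_finite by blast
  from odd obtain t where t: "length P = Suc (2 * t)" by (auto elim: oddE)
  let ?T = "{1..t}"
  define x where "x i = P ! (2 * i - 1)" for i
  define y where "y i = P ! (2 * i)" for i
  have inj: "inj_on x ?T" "inj_on y ?T"
    using dist by (auto simp: inj_on_def x_def y_def t nth_eq_iff_index_eq)
  have xI: "x ` ?T \<subseteq> I" using inn by (auto simp: x_def t)
  have yI: "y ` ?T \<inter> I = {}" using out by (auto simp: y_def t)
  have xy: "ind (insert (y i) (I - {x i}))" "v (y i) = v (x i)" if "i \<in> ?T" for i
    using arc[of "2 * i - 1"] tight[of "2 * i - 1"] that by (auto simp: x_def y_def t Suc_diff_le)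
  have y0: "P ! 0 \<notin> I" "P ! 0 \<notin> y ` ?T"
    using out[of 0] dist by (auto simp: t y_def nth_eq_iff_index_eq)
  have sP: "set P = insert (P ! 0) (x ` ?T \<union> y ` ?T)"
  proof
    show "set P \<subseteq> insert (P ! 0) (x ` ?T \<union> y ` ?T)"
    proof
      fix z assume "z \<in> set P"
      then obtain i where i: "i < length P" "z = P ! i" by (auto simp: in_set_conv_nth)
      show "z \<in> insert (P ! 0) (x ` ?T \<union> y ` ?T)"
      proof (cases "even i")
        case True
        then obtain j where "i = 2 * j" by blast
        with i t show ?thesis by (cases "j = 0") (auto simp: y_def)
      next
        case False
        then obtain j where "i = 2 * j + 1" by (blast elim: oddE)
        with i t have "z = x (Suc j)" "Suc j \<in> ?T" by (auto simp: x_def)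
        then show ?thesis by blast
      qed
    qed
  qed (auto simp: x_def y_def t)
  let ?K = "I - x ` ?T \<union> y ` ?T"
  have K: "ind ?K"
  proof (rule triangular_exchange[OF I _ inj xI yI xy(1)])
    fix T' assume T': "T' \<subseteq> ?T" "T' \<noteq> {}"
    then have fT: "finite T'" using finite_subset by blast
    \<comment> \<open>Among the given pairs take those of greatest value and of these the earliest
      one, \<open>m\<close>. If \<open>y i\<close> could replace \<open>x m\<close>, then
      \<open>v (x m) \<le> v (y i) \<le> M = v (x m)\<close>; so \<open>i\<close> attains the
      maximum too, comes after \<open>m\<close>, and the pair is a forbidden shortcut.\<close>
    define M where "M = Max ((\<lambda>i. v (y i)) ` T')"
    define m where "m = Min {i \<in> T'. v (y i) = M}"
    have "M \<in> (\<lambda>i. v (y i)) ` T'" unfolding M_def using fT T' by (intro Max_in) auto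
    then have "{i \<in> T'. v (y i) = M} \<noteq> {}" by auto
    with fT have m: "m \<in> {i \<in> T'. v (y i) = M}" unfolding m_def by (intro Min_in) auto
    have mmin: "m \<le> i" if "i \<in> T'" "v (y i) = M" for i
      unfolding m_def using that fT by (intro Min_le) auto
    have "\<not> ind (insert (y i) (I - {x m}))" if i: "i \<in> T' - {m}" for i
    proof
      assume a: "ind (insert (y i) (I - {x m}))"
      have "v (x m) \<le> v (y i)" using loc[OF _ _ a] xI yI T' m i by blast
      moreover have "v (y i) \<le> M" unfolding M_def using fT i by (intro Max_ge) auto
      ultimately have eq: "v (y i) = M" "v (x m) = v (y i)" using xy(2)[of m] m T' by auto
      with mmin[of i] i have "m < i" by fastforce
      moreover have "1 \<le> m" "i \<le> t" using m i T' by auto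
      ultimately show False
        using short[of "2 * m - 1" "2 * i"] a eq(2) by (auto simp: x_def y_def t)
    qed
    with m show "\<exists>m\<in>T'. \<forall>i\<in>T' - {m}. \<not> ind (insert (y i) (I - {x m}))" by blast
  qed auto
  have cK: "card ?K = card I" by (rule card_exchange[OF fI _ inj xI yI]) simp
  have fK: "finite ?K" using K ind_finite by blast
  have "card ?K < card (insert (P ! 0) I)" using y0 fI cK by simp
  from augment[OF K src this] obtain z where z: "z \<in> insert (P ! 0) I - ?K" "ind (insert z ?K)" by auto
  \<comment> \<open>An old element \<open>z\<close> would make \<open>insert z ?K\<close> larger
    than \<open>I\<close>, so some \<open>y i\<close> would extend \<open>I\<close>. Its value is
    then at most that of \<open>P ! 0\<close> by local optimality and at least that value by
    minimality, which \<open>src_short\<close> excludes.\<close>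
  have "z = P ! 0"
  proof (rule ccontr)
    assume "z \<noteq> P ! 0"
    with z have zI: "z \<in> I" "z \<notin> ?K" by auto
    then have "card I < card (insert z ?K)" using fK cK by simp
    from augment[OF I z(2) this] obtain b where b: "b \<in> insert z ?K - I" "ind (insert b I)" by auto
    with zI obtain i where i: "i \<in> ?T" "b = y i" by auto
    have "ind (insert (P ! 0) (I - {x i}))" using src by (rule ind_subset) blast
    moreover have "x i \<in> I" using xI i(1) by blast
    ultimately have "v (y i) \<le> v (P ! 0)" using loc[OF _ y0(1)] xy(2)[OF i(1)] by metis
    moreover have "v (P ! 0) \<le> v (y i)" using src_min[of b] b yI i by auto
    ultimately show False using src_short[of "2 * i"] b i by (auto simp: y_def t)
  qed
  moreover have eq: "I - set P \<union> (set P - I) = insert (P ! 0) ?K"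
  proof -
    have "A - insert p (B \<union> C) \<union> (insert p (B \<union> C) - A) = insert p (A - B \<union> C)"
      if "B \<subseteq> A" "C \<inter> A = {}" "p \<notin> A" for A B C and p :: 'a using that by auto
    from this[OF xI yI y0(1)] show ?thesis unfolding sP .
  qed
  ultimately have 1: "ind (I - set P \<union> (set P - I))" using z(2) by simp
  have y0K: "P ! 0 \<notin> ?K" using y0 by auto
  have 2: "card (I - set P \<union> (set P - I)) = Suc (card I)"
    unfolding eq using y0K fK cK by simp
  have "sum v ?K = sum v (I - x ` ?T) + sum v (y ` ?T)"
    using fI yI by (intro sum.union_disjoint) auto
  also have "sum v (y ` ?T) = sum v (x ` ?T)"
    using inj xy(2) by (simp add: sum.reindex)
  also have "sum v (I - x ` ?T) + sum v (x ` ?T) = sum v I"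
    using fI xI by (metis sum.subset_diff)
  finally have "sum v (I - set P \<union> (set P - I)) = sum v I + v (P ! 0)"
    unfolding eq using y0K fK by simp
  with 1 2 show ?thesis by blast
qed

end


subsection \<open>Lexicographically shortest walks\<close>

type_synonym 'a label = "'a \<times> real \<times> real \<times> 'a list"

text \<open>Ties in cost are broken by the number of nodes: a cheapest walk with fewest nodes has no
  shortcut of equal cost, which is what the exchange argument asks for.\<close>

definition lab_le :: "'a label \<Rightarrow> 'a label \<Rightarrow> bool" where
  "lab_le l m \<longleftrightarrow> fst (snd l) < fst (snd m) \<or>
     fst (snd l) = fst (snd m) \<and> fst (snd (snd l)) \<le> fst (snd (snd m))"

text \<open>
  A label \<open>(v, c, h, q)\<close> stands for the walk \<open>rev q\<close> to \<open>v\<close> with cost \<open>c\<close> and \<open>h\<close> nodes. Costs are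
  those of the nodes.
\<close>

definition cands ::
    "('a \<Rightarrow> 'a \<Rightarrow> bool) \<Rightarrow> ('a \<Rightarrow> bool) \<Rightarrow> ('a \<Rightarrow> real) \<Rightarrow> 'a label list \<Rightarrow> 'a \<Rightarrow> 'a label list" where
  "cands E src \<omega> L v = (if src v then [(v, \<omega> v, 1, [v])] else []) @
      concat (map (\<lambda>l. if E (fst l) v
        then [(v, fst (snd l) + \<omega> v, fst (snd (snd l)) + 1, v # snd (snd (snd l)))] else []) L)"

text \<open>One round of the Bellman-Ford algorithm. The old label of a node is dropped, but
  one-node walks are offered anew in every round, so that round \<open>t\<close> accounts for all
  walks of at most \<open>t\<close> nodes.\<close>

definition relax ::
    "('a \<Rightarrow> 'a \<Rightarrow> bool) \<Rightarrow> ('a \<Rightarrow> bool) \<Rightarrow> ('a \<Rightarrow> real) \<Rightarrow> 'a list \<Rightarrow> 'a label list \<Rightarrow> 'a label list" where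
  "relax E src \<omega> S L = concat (map (\<lambda>v. best lab_le (cands E src \<omega> L v)) S)"

definition labels ::
    "('a \<Rightarrow> 'a \<Rightarrow> bool) \<Rightarrow> ('a \<Rightarrow> bool) \<Rightarrow> ('a \<Rightarrow> real) \<Rightarrow> 'a list \<Rightarrow> 'a label list" where
  "labels E src \<omega> S = (relax E src \<omega> S ^^ length S) []"

lemma best_lab_cases:
  "ys = [] \<and> best lab_le ys = [] \<or> (\<exists>z\<in>set ys. best lab_le ys = [z] \<and> (\<forall>y\<in>set ys. lab_le z y))"
proof (rule best_cases[where A = UNIV])
  show "lab_le a b \<or> lab_le b a" for a b :: "'a label"
    unfolding lab_le_def by linarith
  show "lab_le a b \<Longrightarrow> lab_le b c \<Longrightarrow> lab_le a c" for a b c :: "'a label"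
    unfolding lab_le_def by (elim disjE conjE) simp_all
qed simp

locale walks =
  fixes E :: "'a \<Rightarrow> 'a \<Rightarrow> bool" and src :: "'a \<Rightarrow> bool" and \<omega> :: "'a \<Rightarrow> real" and S :: "'a list"
begin

definition walk :: "'a list \<Rightarrow> bool" where
  "walk P \<longleftrightarrow> P \<noteq> [] \<and> src (hd P) \<and> successively E P \<and> set P \<subseteq> set S"

definition wcost :: "'a list \<Rightarrow> real" where
  "wcost P = (\<Sum>v\<leftarrow>P. \<omega> v)"

definition lex :: "real \<Rightarrow> nat \<Rightarrow> 'a list \<Rightarrow> bool" where
  "lex c h P \<longleftrightarrow> c < wcost P \<or> c = wcost P \<and> h \<le> length P"

lemma wcost_append [simp]: "wcost (A @ B) = wcost A + wcost B"
  by (simp add: wcost_def)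

lemma wcost_Cons [simp]: "wcost (a # B) = \<omega> a + wcost B"
  by (simp add: wcost_def)

lemma wcost_rev [simp]: "wcost (rev B) = wcost B"
  by (simp add: wcost_def rev_map[symmetric])

lemma wcost_Nil [simp]: "wcost [] = 0"
  by (simp add: wcost_def)

lemma walk_snoc: "walk P \<Longrightarrow> E (last P) v \<Longrightarrow> v \<in> set S \<Longrightarrow> walk (P @ [v])"
  by (auto simp: walk_def successively_append_iff hd_append)

lemma set_cands:
  "l \<in> set (cands E src \<omega> L v) \<longleftrightarrow> src v \<and> l = (v, \<omega> v, 1, [v]) \<or>
    (\<exists>u c h q. (u, c, h, q) \<in> set L \<and> E u v \<and> l = (v, c + \<omega> v, h + 1, v # q))"
proof -
  have "l \<in> set (cands E src \<omega> L v) \<longleftrightarrow> src v \<and> l = (v, \<omega> v, 1, [v]) \<or>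
    (\<exists>m\<in>set L. E (fst m) v \<and> l = (v, fst (snd m) + \<omega> v, fst (snd (snd m)) + 1, v # snd (snd (snd m))))"
    unfolding cands_def by (simp split: if_splits) blast
  then show ?thesis by (simp add: Bex_def split_paired_Ex)
qed

lemma relax_cases:
  assumes "l \<in> set (relax E src \<omega> S L)"
  shows "\<exists>v\<in>set S. l \<in> set (cands E src \<omega> L v)"
  using assms set_best unfolding relax_def by fastforce

lemma relax_best:
  assumes "v \<in> set S" "m \<in> set (cands E src \<omega> L v)"
  shows "\<exists>c h q. (v, c, h, q) \<in> set (relax E src \<omega> S L) \<and> lab_le (v, c, h, q) m"
proof -
  from best_lab_cases[of "cands E src \<omega> L v"] assms(2) obtain z where
    z: "z \<in> set (cands E src \<omega> L v)" "best lab_le (cands E src \<omega> L v) = [z]" "lab_le z m"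
    by auto
  have "z \<in> set (best lab_le (cands E src \<omega> L v))" using z(2) by simp
  then have "z \<in> set (relax E src \<omega> S L)" unfolding relax_def using assms(1) by auto
  moreover obtain c h q where "z = (v, c, h, q)" using z(1) unfolding set_cands by blast
  ultimately show ?thesis using z(3) by blast
qed

lemma relax_sound:
  assumes "(v, c, h, q) \<in> set ((relax E src \<omega> S ^^ t) [])"
  shows "q \<noteq> []" "hd q = v" "walk (rev q)" "c = wcost q" "h = real (length q)" "length q \<le> t"
proof -
  have "q \<noteq> [] \<and> hd q = v \<and> walk (rev q) \<and> c = wcost q \<and> h = real (length q) \<and> length q \<le> t"
    using assms
  proof (induction t arbitrary: v c h q)
    case (Suc t)
    let ?L = "(relax E src \<omega> S ^^ t) []"
    from Suc.prems have "(v, c, h, q) \<in> set (relax E src \<omega> S ?L)" by simp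
    from relax_cases[OF this] obtain v' where v': "v' \<in> set S" "(v, c, h, q) \<in> set (cands E src \<omega> ?L v')"
      by blast
    then consider
      "v \<in> set S" "src v" "c = \<omega> v" "h = 1" "q = [v]" |
      u c' h' q' where "v \<in> set S" "(u, c', h', q') \<in> set ?L" "E u v" "c = c' + \<omega> v" "h = h' + 1" "q = v # q'"
      unfolding set_cands by blast
    then show ?case
    proof cases
      case 1
      then show ?thesis by (simp add: walk_def)
    next
      case (2 u c' h' q')
      from Suc.IH[OF 2(2)] have IH: "q' \<noteq> []" "hd q' = u" "walk (rev q')" "c' = wcost q'"
        "h' = real (length q')" "length q' \<le> t" by auto
      have "walk (rev q' @ [v])" by (rule walk_snoc) (use IH 2 in \<open>auto simp: last_rev\<close>)
      then show ?thesis using 2 IH by simp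
    qed
  qed simp
  then show "q \<noteq> []" "hd q = v" "walk (rev q)" "c = wcost q" "h = real (length q)" "length q \<le> t"
    by auto
qed

text \<open>The label found for the last but one node is lexicographically no worse than the walk
  without its last node; one more arc adds the same cost and one node to both.\<close>

lemma relax_complete:
  assumes "walk P" "length P \<le> t"
  shows "\<exists>c h q. (last P, c, h, q) \<in> set ((relax E src \<omega> S ^^ t) []) \<and> lex c (length q) P"
  using assms
proof (induction t arbitrary: P)
  case 0
  then show ?case by (auto simp: walk_def)
next
  case (Suc t)
  let ?L = "(relax E src \<omega> S ^^ t) []"
  have L: "(relax E src \<omega> S ^^ Suc t) [] = relax E src \<omega> S ?L" by simp
  from Suc.prems obtain Q v where P: "P = Q @ [v]" by (cases P rule: rev_cases) (auto simp: walk_def)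
  have v: "v \<in> set S" using Suc.prems(1) by (simp add: P walk_def)
  have ex: "\<exists>c h q. (v, c, h, q) \<in> set (relax E src \<omega> S ?L) \<and> lab_le (v, c, h, q) (v, wcost P, real (length P), q)"
  proof (cases "Q = []")
    case True
    with Suc.prems(1) have "src v" by (simp add: P walk_def)
    then have "(v, \<omega> v, 1, [v]) \<in> set (cands E src \<omega> ?L v)" unfolding set_cands by blast
    from relax_best[OF v this] True show ?thesis by (simp add: P lab_le_def)
  next
    case False
    with Suc.prems(1) have Q: "walk Q" "E (last Q) v"
      by (auto simp: P walk_def successively_append_iff)
    from Suc.IH[OF Q(1)] Suc.prems(2) obtain c h q where
      q: "(last Q, c, h, q) \<in> set ?L" "lex c (length q) Q" by (auto simp: P)
    from relax_sound(5)[OF q(1)] have h: "h = real (length q)" .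
    have "(v, c + \<omega> v, h + 1, v # q) \<in> set (cands E src \<omega> ?L v)"
      unfolding set_cands using q(1) Q(2) by blast
    from relax_best[OF v this] obtain c' h' q' where
      q': "(v, c', h', q') \<in> set (relax E src \<omega> S ?L)" "lab_le (v, c', h', q') (v, c + \<omega> v, h + 1, v # q)"
      by blast
    have "lab_le (v, c', h', q') (v, wcost P, real (length P), q')"
      using q'(2) q(2) h by (auto simp: lab_le_def lex_def P)
    with q'(1) show ?thesis by blast
  qed
  then obtain c h q where q: "(v, c, h, q) \<in> set (relax E src \<omega> S ?L)"
    "lab_le (v, c, h, q) (v, wcost P, real (length P), q)" by blast
  from relax_sound(5)[of v c h q "Suc t"] q have "h = real (length q)" by (simp only: L)
  with q(2) have "lex c (length q) P" by (auto simp: lab_le_def lex_def)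
  with q(1) show ?case unfolding L by (auto simp: P)
qed

end

text \<open>Costs may be negative, but a potential makes every closed part of a walk cost at least
  0, so repeated nodes can be cut out. Paying for an arc means paying for its end
  \<open>b\<close>.\<close>

locale conservative_walks = walks +
  fixes \<phi> :: "'a \<Rightarrow> real"
  assumes potential: "E a b \<Longrightarrow> a \<in> set S \<Longrightarrow> b \<in> set S \<Longrightarrow> \<phi> b - \<phi> a \<le> \<omega> b"
begin

lemma chain_cost:
  "successively E (u # R) \<Longrightarrow> set (u # R) \<subseteq> set S \<Longrightarrow> \<phi> (last (u # R)) - \<phi> u \<le> wcost R"
proof (induction R arbitrary: u)
  case (Cons r R)
  then have "\<phi> (last (r # R)) - \<phi> r \<le> wcost R" "\<phi> r - \<phi> u \<le> \<omega> r"
    using potential[of u r] by auto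
  then show ?case by simp
qed simp

lemma shortcut:
  assumes "walk P" "\<not> distinct P"
  shows "\<exists>Q. walk Q \<and> last Q = last P \<and> wcost Q \<le> wcost P \<and> length Q < length P"
proof -
  from not_distinct_decomp[OF assms(2)] obtain A B C y where P: "P = A @ [y] @ B @ [y] @ C" by blast
  from assms(1) have s: "successively E (A @ ([y] @ B @ [y]) @ C)" "set ([y] @ B @ [y]) \<subseteq> set S"
    unfolding walk_def P by auto
  then have "successively E ([y] @ B @ [y])"
    using successively_append_iff[of E A "([y] @ B @ [y]) @ C"]
      successively_append_iff[of E "[y] @ B @ [y]" C] by simp
  from chain_cost[of y "B @ [y]"] this s(2) have c: "0 \<le> wcost (B @ [y])" by simp
  have "walk (A @ [y] @ C)"
    using assms(1) unfolding walk_def P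
    by (auto simp: successively_append_iff successively_Cons hd_append split: if_splits)
  moreover have "last (A @ [y] @ C) = last P" by (simp add: P)
  moreover have "wcost (A @ [y] @ C) \<le> wcost P" using c by (simp add: P)
  ultimately show ?thesis by (intro exI[of _ "A @ [y] @ C"]) (simp add: P)
qed

lemma distinct_walk:
  assumes "walk P"
  shows "\<exists>Q. walk Q \<and> distinct Q \<and> last Q = last P \<and> wcost Q \<le> wcost P \<and> length Q \<le> length P"
  using assms
proof (induction "length P" arbitrary: P rule: less_induct)
  case less
  show ?case
  proof (cases "distinct P")
    case False
    from shortcut[OF less.prems this] obtain Q where
      Q: "walk Q" "last Q = last P" "wcost Q \<le> wcost P" "length Q < length P" by blast
    from less.hyps[OF Q(4,1)] Q show ?thesis by (metis order.trans less_imp_le)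
  qed (use less.prems in auto)
qed

text \<open>A walk without repeated nodes has at most \<open>length S\<close> nodes, which is the
  number of rounds of \<open>labels\<close>.\<close>

lemma labels_complete:
  assumes "walk P"
  shows "\<exists>c h q. (last P, c, h, q) \<in> set (labels E src \<omega> S) \<and> lex c (length q) P"
proof -
  from distinct_walk[OF assms] obtain Q where
    Q: "walk Q" "distinct Q" "last Q = last P" "wcost Q \<le> wcost P" "length Q \<le> length P" by blast
  have "length Q \<le> length S"
    using Q(1,2) by (metis walk_def card_length card_mono distinct_card le_trans finite_set)
  from relax_complete[OF Q(1) this] Q show ?thesis
    unfolding labels_def lex_def by (smt (verit) le_trans)
qed

definition reach :: "'a \<Rightarrow> bool" where
  "reach v \<longleftrightarrow> (\<exists>P. walk P \<and> last P = v)"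

definition dist :: "'a \<Rightarrow> real" where
  "dist v = (SOME c. (\<exists>P. walk P \<and> last P = v \<and> wcost P = c) \<and>
     (\<forall>P. walk P \<longrightarrow> last P = v \<longrightarrow> c \<le> wcost P))"

text \<open>There may be infinitely many walks to \<open>v\<close>, but each is matched or beaten by
  one of the finitely many labels, and every label stands for a walk. Hence the minimum is
  attained.\<close>

lemma dist_props:
  assumes "reach v"
  shows "(\<exists>P. walk P \<and> last P = v \<and> wcost P = dist v) \<and>
     (\<forall>P. walk P \<longrightarrow> last P = v \<longrightarrow> dist v \<le> wcost P)"
  unfolding dist_def
proof (rule someI_ex)
  let ?C = "{c. \<exists>h q. (v, c, h, q) \<in> set (labels E src \<omega> S)}"
  have "?C \<subseteq> (\<lambda>l. fst (snd l)) ` set (labels E src \<omega> S)" by force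
  then have fin: "finite ?C" by (rule finite_subset) simp
  have below: "\<exists>c\<in>?C. c \<le> wcost P" if "walk P" "last P = v" for P
    using labels_complete[OF that(1)] that(2) unfolding lex_def by fastforce
  with assms have "?C \<noteq> {}" unfolding reach_def by blast
  define M where "M = Min ?C"
  from Min_in[OF fin \<open>?C \<noteq> {}\<close>] obtain h q where "(v, M, h, q) \<in> set (labels E src \<omega> S)"
    unfolding M_def by blast
  from relax_sound[OF this[unfolded labels_def]]
  have "walk (rev q)" "last (rev q) = v" "wcost (rev q) = M" by (auto simp: last_rev)
  moreover have "M \<le> wcost P" if "walk P" "last P = v" for P
    using below[OF that] Min_le[OF fin] unfolding M_def by (meson order_trans)
  ultimately show "\<exists>c. (\<exists>P. walk P \<and> last P = v \<and> wcost P = c) \<and> (\<forall>P. walk P \<longrightarrow> last P = v \<longrightarrow> c \<le> wcost P)"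
    by blast
qed

lemma dist_le: "walk P \<Longrightarrow> dist (last P) \<le> wcost P"
  using dist_props reach_def by blast

lemma dist_attained: "reach v \<Longrightarrow> \<exists>P. walk P \<and> last P = v \<and> wcost P = dist v"
  using dist_props by blast

lemma reach_src: "src v \<Longrightarrow> v \<in> set S \<Longrightarrow> reach v \<and> dist v \<le> \<omega> v"
  using dist_le[of "[v]"] by (auto simp: reach_def walk_def intro: exI[of _ "[v]"])

lemma reach_arc:
  assumes "reach u" "E u v" "v \<in> set S"
  shows "reach v \<and> dist v \<le> dist u + \<omega> v"
proof -
  from dist_attained[OF assms(1)] obtain P where P: "walk P" "last P = u" "wcost P = dist u" by blast
  have "walk (P @ [v])" by (rule walk_snoc) (use P assms in auto)
  with dist_le[OF this] P show ?thesis unfolding reach_def by fastforce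
qed

end

locale shortest_walk = conservative_walks +
  fixes snk :: "'a \<Rightarrow> bool" and P :: "'a list"
  assumes P: "walk P" "snk (last P)"
    and least: "\<And>Q. walk Q \<Longrightarrow> snk (last Q) \<Longrightarrow> lex (wcost P) (length P) Q"
begin

lemma least_cost: "walk Q \<Longrightarrow> snk (last Q) \<Longrightarrow> wcost P \<le> wcost Q"
  using least[of Q] by (auto simp: lex_def)

lemma least_length: "walk Q \<Longrightarrow> snk (last Q) \<Longrightarrow> wcost Q = wcost P \<Longrightarrow> length P \<le> length Q"
  using least[of Q] by (auto simp: lex_def)

lemma walk_take: "i < length P \<Longrightarrow> walk (take (Suc i) P) \<and> last (take (Suc i) P) = P ! i"
  using P(1) set_take_subset[of "Suc i" P]
  by (auto simp: walk_def hd_take successively_conv_nth) (simp add: take_Suc_conv_app_nth)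

lemma walk_drop:
  assumes "walk Q" "E (last Q) (P ! j)" "j < length P"
  shows "walk (Q @ drop j P)" "last (Q @ drop j P) = last P"
proof -
  have "set (drop j P) \<subseteq> set S" using P(1) set_drop_subset[of j P] by (auto simp: walk_def)
  moreover have "successively E (drop j P)"
    using P(1) by (auto simp: walk_def successively_conv_nth)
  ultimately show "walk (Q @ drop j P)"
    using assms by (auto simp: walk_def successively_append_iff hd_append hd_drop_conv_nth)
  show "last (Q @ drop j P) = last P" using assms(3) by simp
qed

text \<open>A cheaper walk to an inner node could be continued along the rest of \<open>P\<close>
  and would beat \<open>P\<close>. The combined walk may repeat nodes, which walks are free to
  do.\<close>

lemma dist_nth: "i < length P \<Longrightarrow> dist (P ! i) = wcost (take (Suc i) P)"
proof (rule antisym)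
  assume i: "i < length P"
  show "dist (P ! i) \<le> wcost (take (Suc i) P)" using dist_le walk_take[OF i] by metis
  have "reach (P ! i)" unfolding reach_def using walk_take[OF i] by blast
  from dist_attained[OF this] obtain Q where Q: "walk Q" "last Q = P ! i" "wcost Q = dist (P ! i)" by blast
  show "wcost (take (Suc i) P) \<le> dist (P ! i)"
  proof (cases "Suc i < length P")
    case True
    have "E (last Q) (P ! Suc i)" using P(1) Q(2) True by (auto simp: walk_def successively_conv_nth)
    from walk_drop[OF Q(1) this True] have "wcost P \<le> wcost Q + wcost (drop (Suc i) P)"
      using least_cost P(2) by (metis wcost_append)
    moreover have "wcost P = wcost (take (Suc i) P) + wcost (drop (Suc i) P)"
      by (metis append_take_drop_id wcost_append)
    ultimately show ?thesis using Q(3) by simp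
  next
    case False
    with i have "i = length P - 1" "P \<noteq> []" by auto
    then have "take (Suc i) P = P" "last Q = last P" using Q(2) by (auto simp: last_conv_nth[of P])
    then show ?thesis using least_cost[OF Q(1)] P(2) Q(3) by simp
  qed
qed

lemma dist_Suc: "Suc i < length P \<Longrightarrow> dist (P ! Suc i) = dist (P ! i) + \<omega> (P ! Suc i)"
  by (simp add: dist_nth take_Suc_conv_app_nth)

lemma dist_0: "dist (P ! 0) = \<omega> (P ! 0)"
  using P(1) by (simp add: dist_nth walk_def take_Suc_conv_app_nth)

lemma wcost_from: "j < length P \<Longrightarrow> wcost P = dist (P ! j) - \<omega> (P ! j) + wcost (drop j P)"
proof -
  assume j: "j < length P"
  have "wcost (take (Suc j) P) = wcost (take j P) + \<omega> (P ! j)" using j by (simp add: take_Suc_conv_app_nth)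
  moreover have "wcost P = wcost (take j P) + wcost (drop j P)"
    by (metis append_take_drop_id wcost_append)
  ultimately show ?thesis using dist_nth[OF j] by simp
qed

text \<open>A tight arc that skips nodes would give an equally cheap walk with fewer nodes. This and
  the next two lemmas supply the exclusions required by \<open>exchange_path\<close> for the first
  and, with the walk reversed, for the second matroid.\<close>

lemma no_shortcut:
  assumes "Suc i < j" "j < length P" "E (P ! i) (P ! j)"
  shows "dist (P ! j) \<noteq> dist (P ! i) + \<omega> (P ! j)"
proof
  assume eq: "dist (P ! j) = dist (P ! i) + \<omega> (P ! j)"
  have i: "i < length P" using assms by simp
  let ?Q = "take (Suc i) P @ drop j P"
  have Q: "walk ?Q" "last ?Q = last P"
    using walk_drop[of "take (Suc i) P" j] walk_take[OF i] assms by auto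
  have "wcost ?Q = wcost P" using dist_nth[OF i] eq wcost_from[OF assms(2)] by simp
  from least_length[OF Q(1) _ this] Q(2) P(2) have "length P \<le> length ?Q" by simp
  then show False using assms by simp
qed

lemma no_late_source:
  assumes "0 < j" "j < length P" "src (P ! j)"
  shows "dist (P ! j) \<noteq> \<omega> (P ! j)"
proof
  assume eq: "dist (P ! j) = \<omega> (P ! j)"
  have Q: "walk (drop j P)" "last (drop j P) = last P"
    using P(1) set_drop_subset[of j P] assms by (auto simp: walk_def successively_conv_nth hd_drop_conv_nth)
  have "wcost (drop j P) = wcost P" using eq wcost_from[OF assms(2)] by simp
  from least_length[OF Q(1) _ this] Q(2) P(2) have "length P \<le> length (drop j P)" by simp
  then show False using assms by simp
qed

lemma no_early_sink:
  assumes "Suc i < length P" "snk (P ! i)"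
  shows "dist (P ! i) \<noteq> dist (last P)"
proof
  assume eq: "dist (P ! i) = dist (last P)"
  have i: "i < length P" using assms by simp
  have "wcost (take (Suc i) P) = wcost P"
    using eq dist_nth[OF i] dist_nth[of "length P - 1"] assms(1)
    by (cases "P = []") (simp_all add: last_conv_nth[of P])
  from least_length[OF _ _ this] walk_take[OF i] assms show False by (simp add: min_def split: if_splits)
qed

lemma distinct_P: "distinct P"
proof (rule ccontr)
  assume "\<not> distinct P"
  from shortcut[OF P(1) this] obtain Q where
    Q: "walk Q" "last Q = last P" "wcost Q \<le> wcost P" "length Q < length P" by blast
  with least[OF Q(1)] P(2) show False by (auto simp: lex_def)
qed

lemma sink_dist: "reach v \<Longrightarrow> snk v \<Longrightarrow> dist (last P) \<le> dist v"
proof -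
  assume v: "reach v" "snk v"
  from dist_attained[OF v(1)] obtain Q where "walk Q" "last Q = v" "wcost Q = dist v" by blast
  with least_cost[of Q] v(2) dist_le[OF P(1)] show ?thesis by simp
qed

end


subsection \<open>Augmentation along shortest exchange walks\<close>

definition exch :: "('a list \<Rightarrow> bool) \<Rightarrow> ('a list \<Rightarrow> bool) \<Rightarrow> 'a list \<Rightarrow> 'a \<Rightarrow> 'a \<Rightarrow> bool" where
  "exch i1 i2 I u v \<longleftrightarrow> (if u \<in> set I then v \<notin> set I \<and> i1 (v # filter (\<lambda>e. e \<noteq> u) I)
     else v \<in> set I \<and> i2 (u # filter (\<lambda>e. e \<noteq> v) I))"

definition signed :: "('a \<Rightarrow> real) \<Rightarrow> 'a list \<Rightarrow> 'a \<Rightarrow> real" where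
  "signed w I v = (if v \<in> set I then 0 - w v else w v)"

definition aug :: "('a list \<Rightarrow> bool) \<Rightarrow> ('a list \<Rightarrow> bool) \<Rightarrow> ('a \<Rightarrow> real) \<Rightarrow> 'a list \<Rightarrow> 'a list \<Rightarrow> 'a list" where
  "aug i1 i2 w S I =
     (case best lab_le (filter (\<lambda>l. fst l \<notin> set I \<and> i2 (fst l # I))
        (labels (exch i1 i2 I) (\<lambda>v. v \<notin> set I \<and> i1 (v # I)) (signed w I) S)) of
        [] \<Rightarrow> I
      | l # _ \<Rightarrow> filter (\<lambda>e. (e \<in> set I) \<noteq> (e \<in> set (snd (snd (snd l))))) S)"

definition common_opt :: "('a list \<Rightarrow> bool) \<Rightarrow> ('a list \<Rightarrow> bool) \<Rightarrow> ('a \<Rightarrow> real) \<Rightarrow> 'a list \<Rightarrow> 'a list" where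
  "common_opt i1 i2 w S = (aug i1 i2 w S ^^ length S) []"

locale two_matroids = m1: matroid "set S" ind1 + m2: matroid "set S" ind2
  for S :: "'a list" and ind1 ind2 +
  fixes i1 i2 :: "'a list \<Rightarrow> bool" and w :: "'a \<Rightarrow> real"
  assumes distinct_S: "distinct S"
    and i1: "distinct A \<Longrightarrow> set A \<subseteq> set S \<Longrightarrow> i1 A \<longleftrightarrow> ind1 (set A)"
    and i2: "distinct A \<Longrightarrow> set A \<subseteq> set S \<Longrightarrow> i2 A \<longleftrightarrow> ind2 (set A)"
begin

text \<open>A weight splitting certifies that \<open>I\<close> is lightest among the common independent sets of its size.\<close>

definition split :: "'a set \<Rightarrow> ('a \<Rightarrow> real) \<Rightarrow> ('a \<Rightarrow> real) \<Rightarrow> bool" where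
  "split I w1 w2 \<longleftrightarrow> (\<forall>e\<in>set S. w e = w1 e + w2 e) \<and>
     (\<forall>J. ind1 J \<longrightarrow> card J = card I \<longrightarrow> sum w1 I \<le> sum w1 J) \<and>
     (\<forall>J. ind2 J \<longrightarrow> card J = card I \<longrightarrow> sum w2 I \<le> sum w2 J)"

definition extreme :: "'a list \<Rightarrow> bool" where
  "extreme I \<longleftrightarrow> distinct I \<and> set I \<subseteq> set S \<and> ind1 (set I) \<and> ind2 (set I) \<and> (\<exists>w1 w2. split (set I) w1 w2)"

definition maximal :: "'a list \<Rightarrow> bool" where
  "maximal I \<longleftrightarrow> (\<forall>J. ind1 J \<longrightarrow> ind2 J \<longrightarrow> card J \<le> card (set I))"

lemma extreme_Nil: "extreme []"
proof -
  have "split {} w (\<lambda>_. 0)"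
    using m1.ind_finite by (auto simp: split_def)
  then show ?thesis unfolding extreme_def using m1.ind_empty m2.ind_empty by auto
qed

end

section \<open>The exchange graph of a common independent set with a weight splitting\<close>

locale augmentation = two_matroids +
  fixes I :: "'a list" and w1 w2 :: "'a \<Rightarrow> real"
  assumes I: "distinct I" "set I \<subseteq> set S" "ind1 (set I)" "ind2 (set I)"
    and split: "split (set I) w1 w2"
begin

abbreviation "src v \<equiv> v \<notin> set I \<and> i1 (v # I)"
abbreviation "snk v \<equiv> v \<notin> set I \<and> i2 (v # I)"

lemma src_iff: "v \<in> set S \<Longrightarrow> src v \<longleftrightarrow> v \<notin> set I \<and> ind1 (insert v (set I))"
  using i1[of "v # I"] I by auto

lemma snk_iff: "v \<in> set S \<Longrightarrow> snk v \<longleftrightarrow> v \<notin> set I \<and> ind2 (insert v (set I))"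
  using i2[of "v # I"] I by auto

lemma exch1: "x \<in> set I \<Longrightarrow> y \<in> set S \<Longrightarrow>
    exch i1 i2 I x y \<longleftrightarrow> y \<notin> set I \<and> ind1 (insert y (set I - {x}))"
proof -
  assume "x \<in> set I" "y \<in> set S"
  moreover have "set (filter (\<lambda>e. e \<noteq> x) I) = set I - {x}" by auto
  ultimately show ?thesis
    using i1[of "y # filter (\<lambda>e. e \<noteq> x) I"] I by (auto simp: exch_def)
qed

lemma exch2: "y \<notin> set I \<Longrightarrow> y \<in> set S \<Longrightarrow>
    exch i1 i2 I y x \<longleftrightarrow> x \<in> set I \<and> ind2 (insert y (set I - {x}))"
proof -
  assume "y \<notin> set I" "y \<in> set S"
  moreover have "set (filter (\<lambda>e. e \<noteq> x) I) = set I - {x}" by auto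
  ultimately show ?thesis
    using i2[of "y # filter (\<lambda>e. e \<noteq> x) I"] I by (auto simp: exch_def)
qed

lemma w_split: "e \<in> set S \<Longrightarrow> w e = w1 e + w2 e"
  using split by (simp add: split_def)

lemma local1: "x \<in> set I \<Longrightarrow> y \<in> set S - set I \<Longrightarrow> ind1 (insert y (set I - {x})) \<Longrightarrow> w1 x \<le> w1 y"
proof -
  assume a: "x \<in> set I" "y \<in> set S - set I" "ind1 (insert y (set I - {x}))"
  let ?J = "insert y (set I - {x})"
  have "card ?J = card (set I)"
    using a card_Suc_Diff1[of "set I" x] by (subst card_insert_disjoint) auto
  with split a(3) have "sum w1 (set I) \<le> sum w1 ?J" by (simp add: split_def)
  also have "sum w1 ?J = w1 y + (sum w1 (set I) - w1 x)" using a by (simp add: sum_diff1)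
  finally show ?thesis by simp
qed

lemma local2: "x \<in> set I \<Longrightarrow> y \<in> set S - set I \<Longrightarrow> ind2 (insert y (set I - {x})) \<Longrightarrow> w2 x \<le> w2 y"
proof -
  assume a: "x \<in> set I" "y \<in> set S - set I" "ind2 (insert y (set I - {x}))"
  let ?J = "insert y (set I - {x})"
  have "card ?J = card (set I)"
    using a card_Suc_Diff1[of "set I" x] by (subst card_insert_disjoint) auto
  with split a(3) have "sum w2 (set I) \<le> sum w2 ?J" by (simp add: split_def)
  also have "sum w2 ?J = w2 y + (sum w2 (set I) - w2 x)" using a by (simp add: sum_diff1)
  finally show ?thesis by simp
qed

text \<open>The old splitting provides the potential. Since each part is locally optimal at
  \<open>I\<close>, an arc from \<open>a\<close> in \<open>I\<close> satisfies
  \<open>w1 a \<le> w1 b\<close>, and an arc to \<open>b\<close> in \<open>I\<close> satisfies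
  \<open>w2 b \<le> w2 a\<close>; adding the other part of \<open>w b\<close> gives the
  inequality.\<close>

sublocale conservative_walks "exch i1 i2 I" src "signed w I" S
  "\<lambda>v. if v \<in> set I then - w1 v else w2 v"
proof
  fix a b assume ab: "exch i1 i2 I a b" "a \<in> set S" "b \<in> set S"
  show "(if b \<in> set I then - w1 b else w2 b) - (if a \<in> set I then - w1 a else w2 a) \<le> signed w I b"
  proof (cases "a \<in> set I")
    case True
    with exch1 ab have b: "b \<notin> set I" "ind1 (insert b (set I - {a}))" by auto
    with local1[of a b] True ab w_split[of b] show ?thesis by (simp add: signed_def)
  next
    case False
    with exch2 ab have b: "b \<in> set I" "ind2 (insert a (set I - {b}))" by auto
    with local2[of b a] False ab w_split[of b] show ?thesis by (simp add: signed_def)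
  qed
qed

text \<open>The reachable set \<open>R\<close> is the certificate of the min-max theorem for matroid
  intersection: \<open>I - R\<close> is a largest \<open>ind1\<close> subset of the complement of
  \<open>R\<close>, and the rest of \<open>I\<close> a largest \<open>ind2\<close> subset of
  \<open>R\<close>. Otherwise there would be a source outside \<open>R\<close>, a sink in
  \<open>R\<close> or an exchange arc that leaves \<open>R\<close>.\<close>

lemma maximal_if_unreachable:
  assumes "\<And>v. reach v \<Longrightarrow> \<not> snk v"
  shows "maximal I"
proof -
  let ?R = "{v. reach v}"
  have max1: "card (J - ?R) \<le> card (set I - ?R)" if J: "ind1 J" for J
  proof (rule ccontr)
    assume "\<not> ?thesis"
    then obtain b where b: "b \<in> (J - ?R) - (set I - ?R)" "ind1 (insert b (set I - ?R))"
      using m1.augment[of "set I - ?R" "J - ?R"] m1.ind_subset[OF J] m1.ind_subset[OF I(3)] by auto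
    then have b': "b \<notin> set I" "\<not> reach b" "b \<in> set S" using m1.ind_ground[OF J] by auto
    have "\<not> ind1 (insert b (set I))" using b' reach_src[of b] src_iff[of b] by auto
    from m1.complete_exchange[OF I(3) _ b'(1) b(2) this] obtain x where
      "x \<in> set I" "reach x" "ind1 (insert b (set I - {x}))" by auto
    with reach_arc[of x b] exch1[of x b] b' show False by auto
  qed
  have max2: "card (J \<inter> ?R) \<le> card (set I \<inter> ?R)" if J: "ind2 J" for J
  proof (rule ccontr)
    assume "\<not> ?thesis"
    then obtain b where b: "b \<in> (J \<inter> ?R) - (set I \<inter> ?R)" "ind2 (insert b (set I \<inter> ?R))"
      using m2.augment[of "set I \<inter> ?R" "J \<inter> ?R"] m2.ind_subset[OF J] m2.ind_subset[OF I(4)] by auto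
    then have b': "b \<notin> set I" "reach b" "b \<in> set S" using m2.ind_ground[OF J] by auto
    have "\<not> ind2 (insert b (set I))" using b' assms[of b] snk_iff[of b] by auto
    from m2.complete_exchange[OF I(4) _ b'(1) b(2) this] obtain x where
      "x \<in> set I" "\<not> reach x" "ind2 (insert b (set I - {x}))" by auto
    with reach_arc[of b x] exch2[of b x] b' I(2) show False by auto
  qed
  have dec: "card A = card (A - ?R) + card (A \<inter> ?R)" if "finite A" for A
    using card_Int_Diff[OF that, of ?R] by simp
  show ?thesis unfolding maximal_def
  proof (intro allI impI)
    fix J assume J: "ind1 J" "ind2 J"
    from max1[OF J(1)] max2[OF J(2)] dec[OF m1.ind_finite[OF J(1)]] dec[of "set I"]
    show "card J \<le> card (set I)" by simp
  qed
qed

lemma parity: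
  assumes "walk P" "i < length P"
  shows "P ! i \<notin> set I \<longleftrightarrow> even i"
  using assms(2)
proof (induction i)
  case 0
  then show ?case using assms(1) by (auto simp: walk_def hd_conv_nth)
next
  case (Suc i)
  have "exch i1 i2 I (P ! i) (P ! Suc i)"
    using assms(1) Suc.prems by (auto simp: walk_def successively_conv_nth)
  then show ?case using Suc by (auto simp: exch_def split: if_splits)
qed

text \<open>The distances from the sources define a new splitting. By the triangle inequality both
  of its parts are still locally optimal at \<open>I\<close>, and they are tight along the shortest
  walk. A set with one more element costs at least 0 more in the first part and at least the
  distance of the sink more in the second; the augmented set attains both bounds.\<close>

lemma split_augment:
  assumes P: "walk P" "snk (last P)"
    and least: "\<And>Q. walk Q \<Longrightarrow> snk (last Q) \<Longrightarrow> lex (wcost P) (length P) Q"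
  shows "\<exists>v1 v2. split (set I - set P \<union> (set P - set I)) v1 v2"
    "ind1 (set I - set P \<union> (set P - set I))" "ind2 (set I - set P \<union> (set P - set I))"
    "card (set I - set P \<union> (set P - set I)) = Suc (card (set I))"
proof -
  interpret shortest_walk "exch i1 i2 I" src "signed w I" S
    "\<lambda>v. if v \<in> set I then - w1 v else w2 v" snk P
    by unfold_locales (fact P least)+
  let ?L = "dist (last P)"
  let ?len = "length P"
  have ne: "P \<noteq> []" and PS: "set P \<subseteq> set S" using P(1) by (auto simp: walk_def)
  have nS: "P ! i \<in> set S" if "i < ?len" for i using that PS nth_mem by blast
  have par: "P ! i \<notin> set I \<longleftrightarrow> even i" if "i < ?len" for i using parity[OF P(1) that] .
  have arc: "exch i1 i2 I (P ! i) (P ! Suc i)" if "Suc i < ?len" for i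
    using P(1) that by (auto simp: walk_def successively_conv_nth)
  have last: "last P = P ! (?len - 1)" using ne by (simp add: last_conv_nth)
  have odd: "odd ?len"
  proof -
    have "even (?len - 1)" using par[of "?len - 1"] P(2) ne last by simp
    then show ?thesis using ne by (cases "?len") auto
  qed
  \<comment> \<open>The three terms serve the exchanges of the first matroid, those of the second,
    and the sinks, in each case where an unreached node is involved.\<close>
  define C where "C = Max ((\<lambda>v. max (max (dist v - w2 v) (dist v + w1 v)) (?L - w2 v)) ` set S)"
  have C: "dist v - w2 v \<le> C" "dist v + w1 v \<le> C" "?L - w2 v \<le> C" if "v \<in> set S" for v
  proof -
    have "max (max (dist v - w2 v) (dist v + w1 v)) (?L - w2 v) \<le> C"
      unfolding C_def using that by (intro Max_ge) auto
    then show "dist v - w2 v \<le> C" "dist v + w1 v \<le> C" "?L - w2 v \<le> C" by auto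
  qed
  text \<open>Nodes that cannot be reached are treated as if they were very far away.\<close>
  define c where "c v = (if reach v then dist v else if v \<in> set I then C - w1 v else C + w2 v)" for v
  \<comment> \<open>On unreached nodes the resulting pair is the old splitting shifted by
    \<open>C\<close>, namely \<open>w1 v - C\<close> and \<open>w2 v + C\<close>. So exchanges among
    them inherit the old inequalities.\<close>
  define v1 where "v1 v = (if v \<in> set I then - c v else w v - c v)" for v
  define v2 where "v2 v = (if v \<in> set I then w v + c v else c v)" for v
  have v12: "w v = v1 v + v2 v" for v by (simp add: v1_def v2_def)
  have rP: "reach (P ! i)" if "i < ?len" for i
    unfolding reach_def using walk_take[OF that] by blast
  have cP: "c (P ! i) = dist (P ! i)" if "i < ?len" for i using rP[OF that] by (simp add: c_def)
  have sgn: "signed w I (P ! i) = (if even i then w (P ! i) else - w (P ! i))" if "i < ?len" for i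
    using par[OF that] by (auto simp: signed_def)
  have v1P: "v1 (P ! i) = (if even i then w (P ! i) - dist (P ! i) else - dist (P ! i))" if "i < ?len" for i
    using par[OF that] cP[OF that] by (auto simp: v1_def)
  have v2P: "v2 (P ! i) = (if even i then dist (P ! i) else w (P ! i) + dist (P ! i))" if "i < ?len" for i
    using par[OF that] cP[OF that] by (auto simp: v2_def)
  have loc1: "v1 x \<le> v1 y" if "x \<in> set I" "y \<in> set S - set I" "ind1 (insert y (set I - {x}))" for x y
  proof -
    have x: "x \<in> set S" using that I(2) by blast
    have E: "exch i1 i2 I x y" using exch1[of x y] that by auto
    note r = reach_arc[OF _ E]
    show ?thesis
    proof (cases "reach x")
      case True
      with r that show ?thesis by (auto simp: v1_def c_def signed_def)
    next
      case False
      then show ?thesis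
        using that local1[OF that] C(1)[of y] w_split[of y] by (auto simp: v1_def c_def)
    qed
  qed
  have loc2: "v2 x \<le> v2 y" if "x \<in> set I" "y \<in> set S - set I" "ind2 (insert y (set I - {x}))" for x y
  proof -
    have x: "x \<in> set S" using that I(2) by blast
    have E: "exch i1 i2 I y x" using exch2[of y x] that by auto
    note r = reach_arc[OF _ E x]
    show ?thesis
    proof (cases "reach y")
      case True
      with r that show ?thesis by (auto simp: v2_def c_def signed_def)
    next
      case False
      then show ?thesis
        using that local2[OF that] C(2)[of x] w_split[of x] x by (auto simp: v2_def c_def)
    qed
  qed
  have src0: "v1 (P ! 0) = 0" using v1P[of 0] sgn[of 0] dist_0 ne by simp
  have src_min: "0 \<le> v1 y" if "y \<in> set S - set I" "ind1 (insert y (set I))" for y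
    using reach_src[of y] src_iff[of y] that by (auto simp: v1_def c_def signed_def)
  have snk0: "v2 (last P) = ?L" using v2P[of "?len - 1"] last ne odd by simp
  have snk_min: "?L \<le> v2 y" if "y \<in> set S - set I" "ind2 (insert y (set I))" for y
    using sink_dist[of y] snk_iff[of y] that C(3)[of y] by (auto simp: v2_def c_def)
  have A: "ind1 (set I - set P \<union> (set P - set I)) \<and>
    card (set I - set P \<union> (set P - set I)) = Suc (card (set I)) \<and>
    sum v1 (set I - set P \<union> (set P - set I)) = sum v1 (set I) + v1 (P ! 0)"
  proof (rule m1.exchange_path[of "set I" P v1])
    show "ind1 (insert (P ! Suc i) (set I - {P ! i}))" if "Suc i < ?len" "odd i" for i
      using exch1[of "P ! i" "P ! Suc i"] arc[OF that(1)] par[of i] nS[OF that(1)] that by auto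
    show "v1 (P ! Suc i) = v1 (P ! i)" if "Suc i < ?len" "odd i" for i
      using v1P[of i] v1P[of "Suc i"] dist_Suc[OF that(1)] sgn[of "Suc i"] that by auto
    show "v1 (P ! i) \<noteq> v1 (P ! j)"
      if a: "Suc i < j" "j < ?len" "odd i" "even j" "ind1 (insert (P ! j) (set I - {P ! i}))" for i j
    proof -
      have "exch i1 i2 I (P ! i) (P ! j)"
        using exch1[of "P ! i" "P ! j"] par[of i] par[of j] nS[of j] a by auto
      from no_shortcut[OF a(1,2) this] show ?thesis using v1P[of i] v1P[of j] sgn[of j] a by auto
    qed
    show "v1 (P ! j) \<noteq> v1 (P ! 0)" if a: "0 < j" "j < ?len" "even j" "ind1 (insert (P ! j) (set I))" for j
      using no_late_source[OF a(1,2)] src_iff[OF nS[OF a(2)]] par[OF a(2)] a(3,4) v1P[OF a(2)] sgn[OF a(2)] src0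
      by auto
    show "ind1 (insert (P ! 0) (set I))"
      using P(1) src_iff[of "P ! 0"] nS[of 0] by (auto simp: walk_def hd_conv_nth)
    show "v1 x \<le> v1 y" if "x \<in> set I" "y \<notin> set I" "ind1 (insert y (set I - {x}))" for x y
      using loc1[of x y] m1.ind_ground that by auto
    show "v1 (P ! 0) \<le> v1 y" if "y \<notin> set I" "ind1 (insert y (set I))" for y
      using src_min[of y] src0 m1.ind_ground that by auto
  qed (use I odd distinct_P par in auto)
  \<comment> \<open>The second matroid sees the walk backwards, with the sink as surplus element.
    The length is odd, so reversal preserves the parity of positions.\<close>
  define R where "R = rev P"
  have R: "R ! i = P ! (?len - Suc i)" "even (?len - Suc i) \<longleftrightarrow> even i" if "i < ?len" for i
    using that odd by (auto simp: R_def rev_nth)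
  have lR: "length R = ?len" "set R = set P" "R ! 0 = last P"
    using ne by (auto simp: R_def rev_nth last_conv_nth)
  have B: "ind2 (set I - set R \<union> (set R - set I)) \<and>
    card (set I - set R \<union> (set R - set I)) = Suc (card (set I)) \<and>
    sum v2 (set I - set R \<union> (set R - set I)) = sum v2 (set I) + v2 (R ! 0)"
  proof (rule m2.exchange_path[of "set I" R v2])
    show "R ! i \<notin> set I" if "i < length R" "even i" for i
      using that par[of "?len - Suc i"] R[of i] by (simp add: lR)
    show "R ! i \<in> set I" if "i < length R" "odd i" for i
      using that par[of "?len - Suc i"] R[of i] by (simp add: lR)
    show "ind2 (insert (R ! Suc i) (set I - {R ! i}))" if a: "Suc i < length R" "odd i" for i
    proof -
      have e: "Suc (?len - Suc (Suc i)) = ?len - Suc i" using a by (simp add: lR)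
      have "exch i1 i2 I (R ! Suc i) (R ! i)"
        using arc[of "?len - Suc (Suc i)"] R(1)[of i] R(1)[of "Suc i"] a e by (simp add: lR)
      then show ?thesis
        using exch2[of "R ! Suc i" "R ! i"] par[of "?len - Suc (Suc i)"] nS[of "?len - Suc (Suc i)"]
          R[of "Suc i"] a by (simp add: lR)
    qed
    show "v2 (R ! Suc i) = v2 (R ! i)" if a: "Suc i < length R" "odd i" for i
    proof -
      let ?j = "?len - Suc (Suc i)"
      have e: "Suc ?j = ?len - Suc i" "Suc ?j < ?len" using a by (simp_all add: lR)
      have "v2 (P ! ?j) = v2 (P ! Suc ?j)"
        using v2P[of ?j] v2P[of "Suc ?j"] dist_Suc[OF e(2)] sgn[of "Suc ?j"] R(2)[of "Suc i"] a e(2)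
        by (simp add: lR)
      then show ?thesis using R(1)[of i] R(1)[of "Suc i"] a e by (simp add: lR)
    qed
    show "v2 (R ! i) \<noteq> v2 (R ! j)"
      if a: "Suc i < j" "j < length R" "odd i" "even j" "ind2 (insert (R ! j) (set I - {R ! i}))" for i j
    proof -
      let ?i = "?len - Suc i" and ?j = "?len - Suc j"
      have l: "Suc ?j < ?i" "?i < ?len" "?j < ?len" using a by (auto simp: lR)
      have p: "odd ?i" "even ?j" using R(2)[of i] R(2)[of j] a by (simp_all add: lR)
      have nth: "R ! i = P ! ?i" "R ! j = P ! ?j" using R(1)[of i] R(1)[of j] a by (simp_all add: lR)
      have "exch i1 i2 I (P ! ?j) (P ! ?i)"
        using exch2[of "P ! ?j" "P ! ?i"] par[of ?i] par[of ?j] nS[of ?j] a(5) l p nth by auto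
      from no_shortcut[OF l(1,2) this] show ?thesis
        using v2P[of ?i] v2P[of ?j] sgn[of ?i] l p nth by auto
    qed
    show "v2 (R ! j) \<noteq> v2 (R ! 0)"
      if a: "0 < j" "j < length R" "even j" "ind2 (insert (R ! j) (set I))" for j
    proof -
      let ?j = "?len - Suc j"
      have l: "Suc ?j < ?len" using a by (auto simp: lR)
      have p: "even ?j" using R(2)[of j] a by (simp add: lR)
      have nth: "R ! j = P ! ?j" using R(1)[of j] a by (simp add: lR)
      have "snk (P ! ?j)" using snk_iff[of "P ! ?j"] nS[of ?j] par[of ?j] a(4) l p nth by auto
      from no_early_sink[OF l this] show ?thesis using v2P[of ?j] snk0 l p nth lR by auto
    qed
    show "ind2 (insert (R ! 0) (set I))"
      using P(2) snk_iff[OF subsetD[OF PS last_in_set[OF ne]]] by (auto simp: lR)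
    show "v2 x \<le> v2 y" if "x \<in> set I" "y \<notin> set I" "ind2 (insert y (set I - {x}))" for x y
      using loc2[of x y] m2.ind_ground that by auto
    show "v2 (R ! 0) \<le> v2 y" if "y \<notin> set I" "ind2 (insert y (set I))" for y
      using snk_min[of y] snk0 m2.ind_ground that by (auto simp: lR)
  qed (use I odd distinct_P in \<open>auto simp: lR(1)\<close>, simp add: R_def)
  let ?J = "set I - set P \<union> (set P - set I)"
  have "split ?J v1 v2" unfolding split_def
  proof (intro conjI ballI allI impI)
    show "w e = v1 e + v2 e" for e by (rule v12)
    show "sum v1 ?J \<le> sum v1 J" if J: "ind1 J" "card J = card ?J" for J
    proof -
      have "sum v1 (set I) + 0 \<le> sum v1 J"
      proof (rule m1.optimum_step[OF I(3) _ _ J(1)])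
        show "sum v1 (set I) \<le> sum v1 J" if "ind1 J" "card J = card (set I)" for J
          by (rule m1.local_optimum[OF I(3) loc1 that])
        show "0 \<le> v1 y" if "y \<in> set S - set I" "ind1 (insert y (set I))" for y by (rule src_min[OF that])
        show "card J = Suc (card (set I))" using A J(2) by simp
      qed
      then show ?thesis using A src0 by simp
    qed
    show "sum v2 ?J \<le> sum v2 J" if J: "ind2 J" "card J = card ?J" for J
    proof -
      have "sum v2 (set I) + ?L \<le> sum v2 J"
      proof (rule m2.optimum_step[OF I(4) _ _ J(1)])
        show "sum v2 (set I) \<le> sum v2 J" if "ind2 J" "card J = card (set I)" for J
          by (rule m2.local_optimum[OF I(4) loc2 that])
        show "?L \<le> v2 y" if "y \<in> set S - set I" "ind2 (insert y (set I))" for y by (rule snk_min[OF that])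
        show "card J = Suc (card (set I))" using A J(2) by simp
      qed
      then show ?thesis using B snk0 lR by simp
    qed
  qed
  then show "\<exists>v1 v2. split ?J v1 v2" by blast
  show "ind1 ?J" "card ?J = Suc (card (set I))" using A by auto
  show "ind2 ?J" using B unfolding lR(2) by blast
qed

end

context two_matroids
begin

lemma aug_step:
  assumes "extreme I"
  shows "extreme (aug i1 i2 w S I) \<and>
    (maximal I \<and> aug i1 i2 w S I = I \<or> card (set (aug i1 i2 w S I)) = Suc (card (set I)))"
proof -
  from assms obtain w1 w2 where "split (set I) w1 w2" unfolding extreme_def by blast
  with assms interpret augmentation S ind1 ind2 i1 i2 w I w1 w2
    by unfold_locales (auto simp: extreme_def)
  let ?ls = "filter (\<lambda>l. fst l \<notin> set I \<and> i2 (fst l # I)) (labels (exch i1 i2 I) src (signed w I) S)"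
  from best_lab_cases[of ?ls] show ?thesis
  proof
    assume e: "?ls = [] \<and> best lab_le ?ls = []"
    then have same: "aug i1 i2 w S I = I" unfolding aug_def by (simp add: best_def)
    have "maximal I"
    proof (rule maximal_if_unreachable)
      fix v assume "reach v"
      then obtain P where "walk P" "last P = v" unfolding reach_def by blast
      with labels_complete[of P] e show "\<not> snk v"
        unfolding filter_empty_conv by fastforce
    qed
    with same assms show ?thesis by simp
  next
    assume "\<exists>z\<in>set ?ls. best lab_le ?ls = [z] \<and> (\<forall>y\<in>set ?ls. lab_le z y)"
    then obtain v c h q where z: "(v, c, h, q) \<in> set ?ls" "best lab_le ?ls = [(v, c, h, q)]"
      "\<forall>y\<in>set ?ls. lab_le (v, c, h, q) y" by fastforce
    from z(1) have zl: "(v, c, h, q) \<in> set (labels (exch i1 i2 I) src (signed w I) S)" "snk v" by auto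
    note q = relax_sound[OF zl(1)[unfolded labels_def]]
    let ?P = "rev q"
    have P: "walk ?P" "snk (last ?P)" using q zl(2) by (auto simp: last_rev)
    have "lex (wcost ?P) (length ?P) Q" if "walk Q" "snk (last Q)" for Q
    proof -
      from labels_complete[OF that(1)] obtain c' h' q' where
        q': "(last Q, c', h', q') \<in> set (labels (exch i1 i2 I) src (signed w I) S)" "lex c' (length q') Q"
        by blast
      with that(2) have "(last Q, c', h', q') \<in> set ?ls" by simp
      with z(3) have "lab_le (v, c, h, q) (last Q, c', h', q')" by blast
      moreover have "h' = real (length q')" by (rule relax_sound(5)[OF q'(1)[unfolded labels_def]])
      ultimately show ?thesis using q'(2) q by (auto simp: lex_def lab_le_def)
    qed
    note A = split_augment[OF P this]
    have "aug i1 i2 w S I = filter (\<lambda>e. (e \<in> set I) \<noteq> (e \<in> set q)) S"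
      using z(2) by (simp add: aug_def)
    moreover have "set (filter (\<lambda>e. (e \<in> set I) \<noteq> (e \<in> set q)) S) = set I - set ?P \<union> (set ?P - set I)"
      using I(2) P(1) by (auto simp: walk_def)
    ultimately show ?thesis
      using A distinct_S I unfolding extreme_def by auto
  qed
qed

theorem common_opt:
  defines "I \<equiv> common_opt i1 i2 w S"
  shows "distinct I" "set I \<subseteq> set S" "ind1 (set I)" "ind2 (set I)"
    "\<And>J. ind1 J \<Longrightarrow> ind2 J \<Longrightarrow> card J \<le> card (set I)"
    "\<And>J. ind1 J \<Longrightarrow> ind2 J \<Longrightarrow> card J = card (set I) \<Longrightarrow> sum w (set I) \<le> sum w J"
proof -
  \<comment> \<open>A round either adds an element or finds the set maximal; after
    \<open>length S\<close> rounds the set is maximal or as large as the ground set, which is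
    maximal as well.\<close>
  have *: "extreme ((aug i1 i2 w S ^^ t) []) \<and>
    (maximal ((aug i1 i2 w S ^^ t) []) \<or> t \<le> card (set ((aug i1 i2 w S ^^ t) [])))" for t
  proof (induction t)
    case 0
    then show ?case by (simp add: extreme_Nil)
  next
    case (Suc t)
    with aug_step[of "(aug i1 i2 w S ^^ t) []"] show ?case
      by (auto simp: maximal_def)
  qed
  from *[of "length S"] have I: "extreme I" "maximal I \<or> length S \<le> card (set I)"
    by (simp_all add: I_def common_opt_def)
  then show "distinct I" "set I \<subseteq> set S" "ind1 (set I)" "ind2 (set I)" by (auto simp: extreme_def)
  show "card J \<le> card (set I)" if "ind1 J" "ind2 J" for J
  proof -
    have "card J \<le> card (set S)" using m1.ind_ground[OF that(1)] by (simp add: card_mono)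
    also have "\<dots> \<le> length S" by (rule card_length)
    finally show ?thesis using I(2) that by (auto simp: maximal_def)
  qed
  show "sum w (set I) \<le> sum w J" if J: "ind1 J" "ind2 J" "card J = card (set I)" for J
  proof -
    \<comment> \<open>The set minimises each part of the splitting separately, hence also their
      sum.\<close>
    from I(1) obtain w1 w2 where sp: "split (set I) w1 w2" "set I \<subseteq> set S" unfolding extreme_def by blast
    have eq: "sum w A = sum w1 A + sum w2 A" if "A \<subseteq> set S" for A
    proof -
      have "sum w A = (\<Sum>e\<in>A. w1 e + w2 e)"
        using sp(1) that by (intro sum.cong) (auto simp: split_def)
      then show ?thesis by (simp add: sum.distrib)
    qed
    have "sum w1 (set I) \<le> sum w1 J" "sum w2 (set I) \<le> sum w2 J"
      using sp(1) J by (auto simp: split_def)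
    then show ?thesis using eq[OF sp(2)] eq[OF m1.ind_ground[OF J(1)]] by simp
  qed
qed

end


section \<open>Assigning sets to slots\<close>

type_synonym 'p slot = "real \<times> real \<times> real \<times> ('p \<times> real list) list"

abbreviation sid :: "'p slot \<Rightarrow> real" where "sid s \<equiv> fst s"
abbreviation svert :: "'p slot \<Rightarrow> real" where "svert s \<equiv> fst (snd s)"
abbreviation slab :: "'p slot \<Rightarrow> real" where "slab s \<equiv> fst (snd (snd s))"
abbreviation socc :: "'p slot \<Rightarrow> ('p \<times> real list) list" where "socc s \<equiv> snd (snd (snd s))"

text \<open>
  A slot is a tuple of its number, its vertex, its price and its occupant, if any. The next item in
  the queue takes over a cheapest slot at one of its vertices, which raises the price of that slot
  by one, and the former occupant joins the queue. When an item can only find slots of price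
  greater than the number of slots, some price is not in use; the slots above it and their occupants
  together with the item violate Hall's condition.
\<close>

definition bid :: "real \<Rightarrow> ('p \<times> real list) list \<times> 'p slot list \<Rightarrow> ('p \<times> real list) list \<times> 'p slot list" where
  "bid n st = (case fst st of [] \<Rightarrow> st | it # q \<Rightarrow>
     (case best (\<lambda>s t. slab s \<le> slab t) (filter (\<lambda>s. svert s \<in> set (snd it)) (snd st)) of [] \<Rightarrow> st
      | b # _ \<Rightarrow> if slab b \<le> n
          then (socc b @ q, map (\<lambda>s. if sid s = sid b then (sid s, svert s, slab s + 1, [it]) else s) (snd st))
          else st))"

text \<open>
  Bids raise the sum of the prices, which never exceeds \<open>n (n + 1)\<close> for \<open>n\<close> slots. The list of
  length \<open>(n + 1)\<^sup>2\<close> only counts the rounds.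
\<close>

definition hall :: "('p \<times> real list) list \<Rightarrow> real list \<Rightarrow> ('p \<times> real list) list \<times> 'p slot list" where
  "hall items slots = (bid (real (length slots)) ^^ (length (concat (map (\<lambda>_. 0 # slots) (0 # slots)))))
     (items, map (\<lambda>p. (fst p, snd p, 0, [])) (enum slots))"

text \<open>The last condition is the approximate complementary slackness of auctions: an occupant
  has paid at most one more than the present price of any slot that it could use instead. Prices are
  integers stored as reals, and an empty slot still has price 0.\<close>

definition slot_ok :: "real \<Rightarrow> 'p slot list \<Rightarrow> 'p slot \<Rightarrow> bool" where
  "slot_ok n sl s \<longleftrightarrow> (\<exists>k. slab s = real k) \<and> slab s \<le> n + 1 \<and>
     (socc s = [] \<and> slab s = 0 \<or>
      (\<exists>it. socc s = [it] \<and> slab s \<ge> 1 \<and> svert s \<in> set (snd it) \<and>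
         (\<forall>t\<in>set sl. svert t \<in> set (snd it) \<longrightarrow> slab s \<le> slab t + 1)))"

definition hall_inv :: "('p \<times> real list) list \<Rightarrow> real list \<Rightarrow> ('p \<times> real list) list \<times> 'p slot list \<Rightarrow> bool" where
  "hall_inv items slots st \<longleftrightarrow>
     distinct (map sid (snd st)) \<and> map svert (snd st) = slots \<and>
     mset (fst st @ concat (map socc (snd st))) = mset items \<and>
     (\<forall>s\<in>set (snd st). slot_ok (real (length slots)) (snd st) s)"

lemma slot_okE:
  assumes "slot_ok n sl s"
  obtains k where "slab s = real k" "slab s \<le> n + 1"
    "socc s = [] \<and> k = 0 \<or> (\<exists>it. socc s = [it] \<and> k \<ge> 1 \<and> svert s \<in> set (snd it) \<and>
         (\<forall>t\<in>set sl. svert t \<in> set (snd it) \<longrightarrow> slab s \<le> slab t + 1))"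
  using assms unfolding slot_ok_def by fastforce

text \<open>Rising prices elsewhere only weaken what is demanded of an occupant.\<close>

lemma slot_ok_mono:
  assumes "slot_ok n sl s"
    and "\<And>t. t \<in> set sl' \<Longrightarrow> \<exists>t'\<in>set sl. svert t' = svert t \<and> slab t' \<le> slab t"
  shows "slot_ok n sl' s"
proof -
  have "\<forall>t\<in>set sl'. svert t \<in> A \<longrightarrow> c \<le> slab t + 1"
    if "\<forall>t\<in>set sl. svert t \<in> A \<longrightarrow> c \<le> slab t + 1" for A c
  proof (intro ballI impI)
    fix t assume "t \<in> set sl'" "svert t \<in> A"
    with assms(2) obtain t' where "t' \<in> set sl" "svert t' = svert t" "slab t' \<le> slab t" by blast
    with that \<open>svert t \<in> A\<close> have "c \<le> slab t' + 1" by simp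
    then show "c \<le> slab t + 1" using \<open>slab t' \<le> slab t\<close> by linarith
  qed
  with assms(1) show ?thesis unfolding slot_ok_def by blast
qed

lemma hall_inv_init: "hall_inv items slots (items, map (\<lambda>p. (fst p, snd p, 0, [])) (enum slots))"
proof -
  have "map fst (enum slots) = map real [0..<length slots]" "map snd (enum slots) = slots"
    by (simp_all add: enum_def)
  then show ?thesis
    by (auto simp: hall_inv_def slot_ok_def comp_def distinct_map inj_on_def)
qed

lemma best_key_cases:
  fixes key :: "'b \<Rightarrow> real"
  shows "ys = [] \<and> best (\<lambda>s t. key s \<le> key t) ys = [] \<or>
    (\<exists>z\<in>set ys. best (\<lambda>s t. key s \<le> key t) ys = [z] \<and> (\<forall>y\<in>set ys. key z \<le> key y))"
  by (rule best_cases[where A = UNIV]) auto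

text \<open>Slot numbers are distinct, so a successful bid edits one position of the list. In the
  case \<open>stop\<close> all slots at the vertices of the item cost more than \<open>n\<close>,
  possibly because there are none.\<close>

lemma bid_cases:
  assumes inv: "hall_inv items slots (it # q, sl)"
  obtains (stop) "bid (real (length slots)) (it # q, sl) = (it # q, sl)"
      "\<And>t. t \<in> set sl \<Longrightarrow> svert t \<in> set (snd it) \<Longrightarrow> real (length slots) < slab t"
  | (move) l1 i v k oc l2 where "sl = l1 @ (i, v, real k, oc) # l2" "k \<le> length slots" "v \<in> set (snd it)"
      "\<And>t. t \<in> set sl \<Longrightarrow> svert t \<in> set (snd it) \<Longrightarrow> real k \<le> slab t"
      "bid (real (length slots)) (it # q, sl) = (oc @ q, l1 @ (i, v, real (Suc k), [it]) # l2)"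
proof -
  let ?n = "real (length slots)"
  let ?ys = "filter (\<lambda>s. svert s \<in> set (snd it)) sl"
  let ?b = "best (\<lambda>s t. slab s \<le> slab t) ?ys"
  from best_key_cases[of ?ys slab] consider "?ys = []" "?b = []" |
    b where "b \<in> set ?ys" "?b = [b]" "\<forall>y\<in>set ?ys. slab b \<le> slab y" by blast
  then show thesis
  proof cases
    case 1
    then have "bid ?n (it # q, sl) = (it # q, sl)" by (simp only: bid_def fst_conv snd_conv list.case)
    moreover have "svert t \<notin> set (snd it)" if "t \<in> set sl" for t
      using 1(1) that unfolding filter_empty_conv by blast
    ultimately show thesis using stop by blast
  next
    case (2 b)
    then have b: "b \<in> set sl" "svert b \<in> set (snd it)" by auto
    have least: "slab b \<le> slab t" if "t \<in> set sl" "svert t \<in> set (snd it)" for t 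
      using bspec[OF 2(3), of t] that by simp
    show thesis
    proof (cases "slab b \<le> ?n")
      case False
      have "bid ?n (it # q, sl) = (it # q, sl)"
        using False 2(2) by (simp only: bid_def fst_conv snd_conv list.case if_False)
      moreover have "?n < slab t" if "t \<in> set sl" "svert t \<in> set (snd it)" for t
        using least[OF that] False by linarith
      ultimately show thesis using stop by blast
    next
      case True
      from inv b(1) have "slot_ok ?n sl b" unfolding hall_inv_def by simp
      then obtain k where k: "slab b = real k" by (rule slot_okE)
      obtain i v oc where bb: "b = (i, v, real k, oc)" using k by (metis prod.collapse)
      from split_list[OF b(1)] obtain l1 l2 where sl: "sl = l1 @ b # l2" by blast
      have "distinct (map sid sl)" using inv unfolding hall_inv_def by simp
      then have "sid b \<notin> sid ` set l1" "sid b \<notin> sid ` set l2" unfolding sl by auto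
      then have ne: "sid s \<noteq> sid b" if "s \<in> set l1 \<union> set l2" for s
        using that by (metis UnE image_eqI)
      then have "map (\<lambda>s. if sid s = sid b then (sid s, svert s, slab s + 1, [it]) else s) l1 = l1"
        "map (\<lambda>s. if sid s = sid b then (sid s, svert s, slab s + 1, [it]) else s) l2 = l2"
        by (simp_all add: map_idI)
      then have "map (\<lambda>s. if sid s = sid b then (sid s, svert s, slab s + 1, [it]) else s) sl =
          l1 @ (i, v, real (Suc k), [it]) # l2"
        unfolding sl bb by (simp add: add.commute)
      moreover have "bid ?n (it # q, sl) =
          (socc b @ q, map (\<lambda>s. if sid s = sid b then (sid s, svert s, slab s + 1, [it]) else s) sl)"
        using True 2(2) by (simp only: bid_def fst_conv snd_conv list.case if_True)
      ultimately show thesis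
        using move[of l1 i v k oc l2] sl True k least b(2) by (simp add: bb)
    qed
  qed
qed

lemma hall_inv_bid:
  assumes inv: "hall_inv items slots st"
  shows "hall_inv items slots (bid (real (length slots)) st)"
proof (cases "fst st")
  case Nil
  then show ?thesis using inv by (simp add: bid_def)
next
  case (Cons it q)
  then obtain sl where st: "st = (it # q, sl)" by (metis prod.collapse)
  from inv[unfolded st] show ?thesis
  proof (cases rule: bid_cases)
    case stop
    then show ?thesis using inv st by simp
  next
    case (move l1 i v k oc l2)
    let ?sl = "l1 @ (i, v, real (Suc k), [it]) # l2"
    note I = inv[unfolded hall_inv_def st fst_conv snd_conv]
    have up: "\<exists>t'\<in>set sl. svert t' = svert t \<and> slab t' \<le> slab t" if "t \<in> set ?sl" for t
    proof (cases "t = (i, v, real (Suc k), [it])")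
      case True
      then show ?thesis by (intro bexI[of _ "(i, v, real k, oc)"]) (simp_all add: move(1))
    next
      case False
      with that have "t \<in> set sl" unfolding move(1) by simp
      then show ?thesis by blast
    qed
    have new: "slot_ok (real (length slots)) ?sl s" if "s \<in> set ?sl" for s
    proof (cases "s = (i, v, real (Suc k), [it])")
      case True
      have "real (Suc k) \<le> slab t + 1" if t: "t \<in> set ?sl" "svert t \<in> set (snd it)" for t
      proof -
        from up[OF t(1)] obtain t' where "t' \<in> set sl" "svert t' = svert t" "slab t' \<le> slab t" by blast
        with move(4)[of t'] t(2) show ?thesis by simp
      qed
      moreover have "\<exists>k'. slab s = real k'" unfolding True fst_conv snd_conv by blast
      ultimately show ?thesis using move(2,3) unfolding slot_ok_def True by simp
    next
      case False
      with that have "s \<in> set sl" unfolding move(1) by simp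
      with I have "slot_ok (real (length slots)) sl s" by blast
      then show ?thesis by (rule slot_ok_mono) (rule up)
    qed
    have "hall_inv items slots (oc @ q, ?sl)"
      unfolding hall_inv_def fst_conv snd_conv
    proof (intro conjI)
      show "\<forall>s\<in>set ?sl. slot_ok (real (length slots)) ?sl s" using new by blast
    qed (use I in \<open>simp_all add: move(1) ac_simps\<close>)
    then show ?thesis using move(5) st by simp
  qed
qed

definition stuck :: "real \<Rightarrow> ('p \<times> real list) list \<times> 'p slot list \<Rightarrow> bool" where
  "stuck n st \<longleftrightarrow> bid n st = st"

lemma stuck_funpow: "stuck n st \<Longrightarrow> (bid n ^^ j) st = st"
  by (induction j) (auto simp: stuck_def)

lemma price_sum:
  assumes "hall_inv items slots st" "\<not> stuck (real (length slots)) st"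
  shows "(\<Sum>s\<leftarrow>snd (bid (real (length slots)) st). slab s) = (\<Sum>s\<leftarrow>snd st. slab s) + 1"
proof (cases "fst st")
  case Nil
  then show ?thesis using assms by (simp add: bid_def stuck_def)
next
  case (Cons it q)
  then obtain sl where st: "st = (it # q, sl)" by (metis prod.collapse)
  from assms(1)[unfolded st] show ?thesis
    by (cases rule: bid_cases) (use assms(2) st in \<open>auto simp: stuck_def\<close>)
qed

lemma price_sum_le:
  assumes "hall_inv items slots st"
  shows "(\<Sum>s\<leftarrow>snd st. slab s) \<le> real (length slots * (length slots + 1))"
proof -
  have "(\<Sum>s\<leftarrow>snd st. slab s) \<le> (\<Sum>s\<leftarrow>snd st. real (length slots) + 1)"
    using assms by (intro sum_list_mono) (simp add: hall_inv_def slot_ok_def)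
  also have "\<dots> = real (length (snd st)) * (real (length slots) + 1)" by (simp add: sum_list_triv)
  also have "length (snd st) = length slots" using assms by (metis hall_inv_def length_map)
  finally show ?thesis by (simp add: algebra_simps)
qed

lemma hall_result:
  "hall_inv items slots (hall items slots)" "stuck (real (length slots)) (hall items slots)"
proof -
  let ?n = "length slots"
  let ?s0 = "(items, map (\<lambda>p. (fst p, snd p, 0, [])) (enum slots))"
  let ?st = "\<lambda>j. (bid (real ?n) ^^ j) ?s0"
  have inv: "hall_inv items slots (?st j)" for j
    by (induction j) (auto intro: hall_inv_init hall_inv_bid)
  have len: "length (concat (map (\<lambda>_. 0 # slots) (0 # slots))) = Suc ?n * Suc ?n"
    by (simp add: length_concat comp_def sum_list_triv)
  show "hall_inv items slots (hall items slots)" unfolding hall_def by (rule inv)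
  have prog: "(\<exists>i\<le>j. stuck (real ?n) (?st i)) \<or> real j \<le> (\<Sum>s\<leftarrow>snd (?st j). slab s)" for j
  proof (induction j)
    case 0
    have "(\<Sum>s\<leftarrow>snd (?st 0). slab s) = 0" by (simp add: comp_def)
    then show ?case by simp
  next
    case (Suc j)
    then show ?case using price_sum[OF inv[of j]] by (cases "stuck (real ?n) (?st j)") (auto intro: le_SucI)
  qed
  have "\<not> real (Suc ?n * Suc ?n) \<le> (\<Sum>s\<leftarrow>snd (?st (Suc ?n * Suc ?n)). slab s)"
    using price_sum_le[OF inv[of "Suc ?n * Suc ?n"]] by (simp add: algebra_simps)
  with prog obtain i where i: "i \<le> Suc ?n * Suc ?n" "stuck (real ?n) (?st i)" by blast
  have "?st (Suc ?n * Suc ?n) = (bid (real ?n) ^^ (Suc ?n * Suc ?n - i)) (?st i)"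
    using i(1) by (simp add: funpow_add[symmetric, THEN fun_cong, unfolded comp_def] del: mult_Suc mult_Suc_right)
  with stuck_funpow[OF i(2)] i(2) show "stuck (real ?n) (hall items slots)"
    unfolding hall_def len by simp
qed

section \<open>Hall's condition and the outcome of the auction\<close>

abbreviation inside :: "'v set \<Rightarrow> ('p \<times> 'v list) list \<Rightarrow> nat" where
  "inside X items \<equiv> length (filter (\<lambda>it. set (snd it) \<subseteq> X) items)"

abbreviation slots_in :: "'v set \<Rightarrow> 'v list \<Rightarrow> nat" where
  "slots_in X slots \<equiv> length (filter (\<lambda>v. v \<in> X) slots)"

lemma length_filter_mset: "mset xs = mset ys \<Longrightarrow> length (filter P xs) = length (filter P ys)"
  by (metis mset_filter size_mset)

lemma occupants_le:
  assumes "\<And>s. s \<in> set sl \<Longrightarrow> socc s = [] \<or> (\<exists>it. socc s = [it] \<and> (P it \<longrightarrow> Q s))"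
  shows "length (filter P (concat (map socc sl))) \<le> length (filter Q sl)"
  using assms
proof (induction sl)
  case (Cons s sl)
  then have "length (filter P (concat (map socc sl))) \<le> length (filter Q sl)" by simp
  moreover from Cons.prems[of s] have "length (filter P (socc s)) \<le> (if Q s then 1 else 0)" by auto
  ultimately show ?case by auto
qed simp

lemma occupants_ge:
  assumes "\<And>s. s \<in> set sl \<Longrightarrow> Q s \<Longrightarrow> \<exists>it. socc s = [it] \<and> P it"
  shows "length (filter Q sl) \<le> length (filter P (concat (map socc sl)))"
  using assms
proof (induction sl)
  case (Cons s sl)
  then have "length (filter Q sl) \<le> length (filter P (concat (map socc sl)))" by simp
  moreover from Cons.prems[of s] have "Q s \<Longrightarrow> length (filter P (socc s)) = 1" by auto
  ultimately show ?case by auto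
qed simp

lemma slots_in_eq: "map svert sl = slots \<Longrightarrow> slots_in X slots = length (filter (\<lambda>s. svert s \<in> X) sl)"
  by (auto simp: filter_map comp_def)

lemma length_filter_mono: "(\<And>x. x \<in> set xs \<Longrightarrow> P x \<Longrightarrow> Q x) \<Longrightarrow> length (filter P xs) \<le> length (filter Q xs)"
  by (induction xs) (auto intro: le_SucI)

lemma hall_success:
  assumes "fst (hall items slots) = []"
  defines "sl \<equiv> snd (hall items slots)"
  shows "map svert sl = slots" "mset (concat (map socc sl)) = mset items"
    "\<And>s. s \<in> set sl \<Longrightarrow> socc s = [] \<or> (\<exists>it. socc s = [it] \<and> svert s \<in> set (snd it))"
proof -
  note I = hall_result(1)[of items slots, unfolded hall_inv_def assms(1), folded sl_def]
  from I show "map svert sl = slots" "mset (concat (map socc sl)) = mset items" by simp_all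
  show "socc s = [] \<or> (\<exists>it. socc s = [it] \<and> svert s \<in> set (snd it))" if "s \<in> set sl" for s
    using I that by (blast elim: slot_okE)
qed

lemma hall_iff:
  "fst (hall items slots) = [] \<longleftrightarrow> (\<forall>X. inside X items \<le> slots_in X slots)"
proof
  assume a: "fst (hall items slots) = []"
  note s = hall_success[OF a]
  show "\<forall>X. inside X items \<le> slots_in X slots"
  proof
    fix X
    have "inside X items = inside X (concat (map socc (snd (hall items slots))))"
      using s(2) by (intro length_filter_mset) simp
    also have "\<dots> \<le> length (filter (\<lambda>s. svert s \<in> X) (snd (hall items slots)))"
      by (rule occupants_le) (use s(3) in blast)
    finally show "inside X items \<le> slots_in X slots" using slots_in_eq[OF s(1)] by simp
  qed
next
  assume H: "\<forall>X. inside X items \<le> slots_in X slots"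
  let ?n = "length slots"
  show "fst (hall items slots) = []"
  proof (rule ccontr)
    assume "fst (hall items slots) \<noteq> []"
    then obtain it q sl where st: "hall items slots = (it # q, sl)" by (metis neq_Nil_conv prod.collapse)
    note inv = hall_result(1)[of items slots, unfolded st]
    note I = inv[unfolded hall_inv_def fst_conv snd_conv]
    have high: "real ?n < slab t" if "t \<in> set sl" "svert t \<in> set (snd it)" for t
      using inv
    proof (cases rule: bid_cases)
      case stop
      then show ?thesis using that by blast
    next
      case (move l1 i v k oc l2)
      have "bid (real ?n) (it # q, sl) = (it # q, sl)"
        using hall_result(2)[where items = items and slots = slots] unfolding stuck_def st .
      with move have "l1 @ (i, v, real k, oc) # l2 = l1 @ (i, v, real (Suc k), [it]) # l2" by simp
      then show ?thesis by simp
    qed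
    have lsl: "length sl = ?n" using I by (metis length_map)
    \<comment> \<open>The \<open>n\<close> slots cannot exhibit all of the \<open>n + 1\<close>
      prices from 1 to \<open>n + 1\<close>. The slots open to the waiting item cost at least
      \<open>n + 1\<close>, hence more than a price that is missing.\<close>
    have "\<exists>j\<le>Suc ?n. 1 \<le> j \<and> (\<forall>s\<in>set sl. slab s \<noteq> real j) \<and> (\<forall>t\<in>set sl. svert t \<in> set (snd it) \<longrightarrow> real j < slab t)"
    proof (rule ccontr)
      assume no: "\<not> ?thesis"
      have "real ` {1..Suc ?n} \<subseteq> slab ` set sl"
      proof
        fix r assume "r \<in> real ` {1..Suc ?n}"
        then obtain j where j: "r = real j" "1 \<le> j" "j \<le> Suc ?n" by auto
        show "r \<in> slab ` set sl"
        proof (rule ccontr)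
          assume "r \<notin> slab ` set sl"
          then have ne: "\<forall>s\<in>set sl. slab s \<noteq> real j" unfolding j(1) by (metis image_eqI)
          have "real j < slab t" if t: "t \<in> set sl" "svert t \<in> set (snd it)" for t
          proof -
            from I t(1) have "slot_ok (real ?n) sl t" by blast
            then obtain k where k: "slab t = real k" by (rule slot_okE)
            with high[OF t] j(3) have "real j \<le> slab t" by simp
            moreover have "slab t \<noteq> real j" using ne t(1) by blast
            ultimately show ?thesis by linarith
          qed
          with ne j(2,3) no show False by blast
        qed
      qed
      then have "card (real ` {1..Suc ?n}) \<le> card (slab ` set sl)" by (intro card_mono) auto
      also have "\<dots> \<le> length sl" by (metis card_image_le card_length finite_set le_trans)
      finally show False using lsl by (simp add: card_image)
    qed
    then obtain j where j: "1 \<le> j" "\<forall>s\<in>set sl. slab s \<noteq> real j"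
      "\<forall>t\<in>set sl. svert t \<in> set (snd it) \<longrightarrow> real j < slab t" by blast
    define X where "X = {v. \<forall>t\<in>set sl. svert t = v \<longrightarrow> real j < slab t}"
    \<comment> \<open>An alternative of an occupant above price \<open>j\<close> costs at least
      \<open>j\<close> by the slackness condition and integrality; as price \<open>j\<close> does
      not occur, it costs more. So the occupant cannot use any slot outside
      \<open>X\<close>.\<close>
    have occ: "\<exists>it'. socc s = [it'] \<and> set (snd it') \<subseteq> X" if s: "s \<in> set sl" "real j < slab s" for s
    proof -
      from I s have ok: "slot_ok (real ?n) sl s" by blast
      then obtain it' where it': "socc s = [it']"
        "\<forall>t\<in>set sl. svert t \<in> set (snd it') \<longrightarrow> slab s \<le> slab t + 1"
        using s(2) by (auto elim!: slot_okE)
      have "real j < slab t" if t: "t \<in> set sl" "svert t \<in> set (snd it')" for t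
      proof -
        from I t(1) have "slot_ok (real ?n) sl t" by blast
        with ok obtain a b where ab: "slab s = real a" "slab t = real b" by (metis slot_okE)
        have "slab s \<le> slab t + 1" "slab t \<noteq> real j" using it'(2) j(2) t by auto
        then show ?thesis using s(2) by (simp add: ab)
      qed
      then have "set (snd it') \<subseteq> X" unfolding X_def by blast
      with it'(1) show ?thesis by blast
    qed
    have itX: "set (snd it) \<subseteq> X" using j(3) unfolding X_def by blast
    have "slots_in X slots = length (filter (\<lambda>s. svert s \<in> X) sl)"
      using slots_in_eq I by blast
    also have "\<dots> \<le> length (filter (\<lambda>s. real j < slab s) sl)"
      by (rule length_filter_mono) (auto simp: X_def)
    also have "\<dots> \<le> inside X (concat (map socc sl))"
      by (rule occupants_ge) (use occ in blast)
    also have "\<dots> < inside X ((it # q) @ concat (map socc sl))" using itX by simp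
    also have "\<dots> = inside X items" using I by (intro length_filter_mset) blast
    finally show False using H by (metis not_less)
  qed
qed


section \<open>Arborescences\<close>

text \<open>Iteration in a finite set returns to a value; taking the least period of that value
  makes the iterates within one period distinct.\<close>

lemma functional_cycle:
  fixes p :: "'v \<Rightarrow> 'v"
  assumes "finite X" "X \<noteq> {}" "p ` X \<subseteq> X"
  shows "\<exists>y\<in>X. \<exists>n>0. (p ^^ n) y = y \<and> inj_on (\<lambda>m. (p ^^ m) y) {..<n}"
proof -
  from assms(2) obtain x where x: "x \<in> X" by blast
  have orb: "(p ^^ m) y \<in> X" if "y \<in> X" for m y using that assms(3) by (induction m) auto
  have "\<not> inj (\<lambda>m. (p ^^ m) x)"
    using finite_subset[of "range (\<lambda>m. (p ^^ m) x)" X] assms(1) orb[OF x]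
    by (metis finite_imageD image_subset_iff infinite_UNIV_nat)
  then obtain a b where ab: "a < b" "(p ^^ a) x = (p ^^ b) x"
    unfolding inj_def by (metis nat_neq_iff)
  define y where "y = (p ^^ a) x"
  have "(p ^^ (b - a)) y = y"
    using ab unfolding y_def by (metis add.commute comp_apply funpow_add le_add_diff_inverse less_imp_le)
  then have ex: "\<exists>n. 0 < n \<and> (p ^^ n) y = y" using ab by (intro exI[of _ "b - a"]) simp
  define n where "n = (LEAST n. 0 < n \<and> (p ^^ n) y = y)"
  from LeastI_ex[OF ex] have n: "0 < n" "(p ^^ n) y = y" by (simp_all add: n_def)
  have minimal: "n \<le> m" if "0 < m" "(p ^^ m) y = y" for m
    unfolding n_def using that by (intro Least_le) simp
  have "(p ^^ c) y \<noteq> (p ^^ d) y" if cd: "c < d" "d < n" for c d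
  proof
    assume eq: "(p ^^ c) y = (p ^^ d) y"
    have "(p ^^ (n - d + c)) y = (p ^^ (n - d)) ((p ^^ c) y)" by (simp add: funpow_add)
    also have "\<dots> = (p ^^ (n - d + d)) y" unfolding eq by (simp add: funpow_add)
    also have "\<dots> = y" using cd n by simp
    finally show False using minimal[of "n - d + c"] cd by simp
  qed
  then have "inj_on (\<lambda>m. (p ^^ m) y) {..<n}"
    unfolding inj_on_def by (metis lessThan_iff nat_neq_iff)
  with n orb[OF x] show ?thesis unfolding y_def by blast
qed

text \<open>Choose an entering arc at each vertex of \<open>X\<close> and follow these arcs from
  head to tail. The chosen arcs differ because their heads do, and the vertices of the cycle are
  listed against the direction of the arcs.\<close>

lemma cycle_of_in_arcs:
  assumes "finite X" "X \<noteq> {}"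
    and arc: "\<And>v. v \<in> X \<Longrightarrow> \<exists>e\<in>arcs D. head D e = v \<and> tail D e \<in> X"
  shows "\<exists>es vs. underlying_cycle D es vs"
proof -
  from arc obtain a where a: "\<And>v. v \<in> X \<Longrightarrow> a v \<in> arcs D \<and> head D (a v) = v \<and> tail D (a v) \<in> X"
    by metis
  let ?p = "\<lambda>v. tail D (a v)"
  have "?p ` X \<subseteq> X" using a by auto
  from functional_cycle[OF assms(1,2) this] obtain y n where
    y: "y \<in> X" "0 < n" "(?p ^^ n) y = y" "inj_on (\<lambda>m. (?p ^^ m) y) {..<n}" by blast
  have orb: "(?p ^^ m) y \<in> X" for m using y(1) a by (induction m) auto
  define vs where "vs = map (\<lambda>m. (?p ^^ m) y) [0..<n]"
  define es where "es = map a vs"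
  have vs: "set vs \<subseteq> X" "length vs = n" using orb by (auto simp: vs_def)
  have dvs: "distinct vs" using y(4) by (simp add: vs_def distinct_map lessThan_atLeast0)
  have inj: "inj_on a X" using a by (metis inj_onI)
  have "underlying_cycle D es vs"
    unfolding underlying_cycle_def
  proof (intro conjI allI impI)
    show "es \<noteq> []" using y(2) by (simp add: es_def vs_def)
    show "length vs = length es" by (simp add: es_def)
    show "distinct es" using dvs inj vs by (auto simp: es_def distinct_map intro: inj_on_subset)
    show "distinct vs" by (rule dvs)
    show "set es \<subseteq> arcs D" using a vs by (auto simp: es_def)
    fix i assume "i < length es"
    then have i: "i < n" by (simp add: es_def vs)
    have e: "es ! i = a (vs ! i)" "vs ! i = (?p ^^ i) y" using i by (simp_all add: es_def vs_def)
    have "vs ! (Suc i mod n) = ?p (vs ! i)"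
    proof (cases "Suc i = n")
      case True
      then have "?p ((?p ^^ i) y) = (?p ^^ n) y" by auto
      with True y(2,3) e show ?thesis by (simp add: vs_def)
    next
      case False
      with i e show ?thesis by (simp add: vs_def)
    qed
    moreover have "head D (es ! i) = vs ! i" using a[OF orb[of i]] e by simp
    moreover have "length es = n" by (simp add: es_def vs)
    ultimately show "{tail D (es ! i), head D (es ! i)} = {vs ! i, vs ! (Suc i mod length es)}"
      using e by auto
  qed
  then show ?thesis by blast
qed

lemma in_degree_1:
  assumes "in_degree D v = 1"
  shows "\<exists>!e. e \<in> arcs D \<and> head D e = v"
proof -
  from assms obtain e where "in_arcs D v = {e}" unfolding in_degree_def by (auto simp: card_1_singleton_iff)
  then have "e' \<in> arcs D \<and> head D e' = v \<longleftrightarrow> e' = e" for e'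
    by (metis in_in_arcs_conv singleton_iff)
  then show ?thesis by auto
qed

lemma arborescence_no_cycle: "arborescence r D \<Longrightarrow> \<not> underlying_cycle D es vs"
  by (auto simp: arborescence_def underlying_tree_def)

lemma arborescence_wf: "arborescence r D \<Longrightarrow> e \<in> arcs D \<Longrightarrow> tail D e \<in> verts D \<and> head D e \<in> verts D"
  by (simp add: arborescence_def fin_digraph_def wf_digraph_def)

lemma arborescence_finite: "arborescence r D \<Longrightarrow> finite (arcs D) \<and> finite (verts D)"
  by (simp add: arborescence_def fin_digraph_def fin_digraph_axioms_def)

lemma arborescence_in_arc:
  assumes "arborescence r D" "v \<in> verts D" "v \<noteq> r"
  shows "\<exists>!e. e \<in> arcs D \<and> head D e = v"
  using assms in_degree_1[of D v] by (simp add: arborescence_def)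

text \<open>In-degrees are prescribed only at the other vertices. If an arc entered the root, every
  vertex would have an entering arc and there would be a cycle.\<close>

lemma arborescence_root:
  assumes "arborescence r D" "e \<in> arcs D"
  shows "head D e \<noteq> r"
proof
  assume eq: "head D e = r"
  have "\<exists>e\<in>arcs D. head D e = v \<and> tail D e \<in> verts D" if "v \<in> verts D" for v
  proof (cases "v = r")
    case True
    then show ?thesis using eq assms(2) arborescence_wf[OF assms] by blast
  next
    case False
    then show ?thesis using arborescence_in_arc[OF assms(1) that] arborescence_wf[OF assms(1)] by blast
  qed
  moreover have "verts D \<noteq> {}" using assms(1) by (auto simp: arborescence_def)
  ultimately show False
    using cycle_of_in_arcs[of "verts D" D] arborescence_finite[OF assms(1)] arborescence_no_cycle[OF assms(1)]
    by blast
qed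

lemma arborescence_inj_head:
  assumes "arborescence r D"
  shows "inj_on (head D) (arcs D)"
proof (rule inj_onI)
  fix e e' assume e: "e \<in> arcs D" "e' \<in> arcs D" "head D e = head D e'"
  from arborescence_in_arc[OF assms, of "head D e"] arborescence_wf[OF assms e(1)]
    arborescence_root[OF assms e(1)] e show "e = e'" by auto
qed

lemma arborescence_head_image:
  assumes "arborescence r D"
  shows "head D ` arcs D = verts D - {r}"
proof
  show "head D ` arcs D \<subseteq> verts D - {r}"
    using arborescence_wf[OF assms] arborescence_root[OF assms] by auto
  show "verts D - {r} \<subseteq> head D ` arcs D"
    using arborescence_in_arc[OF assms] by force
qed

lemma arborescence_card:
  assumes "arborescence r D"
  shows "card (arcs D) = card (verts D) - 1"
proof -
  have "card (arcs D) = card (verts D - {r})"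
    using card_image[OF arborescence_inj_head[OF assms]] arborescence_head_image[OF assms] by simp
  then show ?thesis using assms arborescence_finite[OF assms] by (simp add: arborescence_def)
qed

text \<open>Some vertex of \<open>X\<close> has no entering arc from within \<open>X\<close>, as
  there is no cycle. Each of the others accounts for at most one arc, since heads are
  distinct.\<close>

lemma arborescence_sparse:
  assumes D: "arborescence r D" and X: "X \<subseteq> verts D" "X \<noteq> {}"
  shows "card {e \<in> arcs D. tail D e \<in> X \<and> head D e \<in> X} \<le> card X - 1"
proof -
  let ?A = "{e \<in> arcs D. tail D e \<in> X \<and> head D e \<in> X}"
  have fin: "finite X" using X arborescence_finite[OF D] finite_subset by blast
  have "\<exists>v\<in>X. \<not> (\<exists>e\<in>arcs D. head D e = v \<and> tail D e \<in> X)"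
    using cycle_of_in_arcs[OF fin X(2), of D] arborescence_no_cycle[OF D] by blast
  then obtain v where v: "v \<in> X" "\<not> (\<exists>e\<in>arcs D. head D e = v \<and> tail D e \<in> X)" by blast
  have "card ?A = card (head D ` ?A)"
    by (rule card_image[symmetric]) (rule inj_on_subset[OF arborescence_inj_head[OF D]], blast)
  also have "\<dots> \<le> card (X - {v})" using v fin by (intro card_mono) auto
  finally show ?thesis using v(1) fin by simp
qed

text \<open>A rank that grows along arcs replaces the combinatorics of trees. On a cycle of the
  underlying graph, both arcs at a vertex of greatest rank would enter it, against injectivity of
  heads; and each vertex is joined to the root by induction on its rank.\<close>

lemma arborescenceI:
  assumes "finite (verts D)" "finite (arcs D)" "r \<in> verts D"
    and wf: "\<And>e. e \<in> arcs D \<Longrightarrow> tail D e \<in> verts D \<and> head D e \<in> verts D - {r}"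
    and inj: "inj_on (head D) (arcs D)" and surj: "verts D - {r} \<subseteq> head D ` arcs D"
    and rank: "\<And>e. e \<in> arcs D \<Longrightarrow> t (tail D e) < (t (head D e) :: nat)"
  shows "arborescence r D"
  unfolding arborescence_def underlying_tree_def
proof (intro conjI ballI)
  have wfd: "wf_digraph D" by unfold_locales (use wf in auto)
  then show "fin_digraph D" using assms(1,2) by (intro wf_digraph.fin_digraphI)
  show "r \<in> verts D" by fact
  show "in_degree D v = 1" if "v \<in> verts D - {r}" for v
  proof -
    from surj that obtain e where "e \<in> arcs D" "head D e = v" by blast
    then have "in_arcs D v = {e}" using inj by (auto dest: inj_onD)
    then show ?thesis by (simp add: in_degree_def)
  qed
  show "\<nexists>es vs. underlying_cycle D es vs"
  proof
    assume "\<exists>es vs. underlying_cycle D es vs"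
    then obtain es vs where c: "es \<noteq> []" "length vs = length es" "distinct es" "distinct vs"
      "set es \<subseteq> arcs D"
      "\<And>i. i < length es \<Longrightarrow> {tail D (es ! i), head D (es ! i)} = {vs ! i, vs ! (Suc i mod length es)}"
      unfolding underlying_cycle_def by blast
    let ?n = "length es"
    have "Max (t ` set vs) \<in> t ` set vs" using c(1,2) by (intro Max_in) auto
    then obtain i where i: "i < ?n" "t (vs ! i) = Max (t ` set vs)"
      using c(2) by (auto simp: in_set_conv_nth)
    have top: "t (vs ! j) \<le> t (vs ! i)" if "j < ?n" for j
      unfolding i(2) using that c(2) by (intro Max_ge) auto
    have hd: "head D (es ! j) = vs ! i" if "j < ?n" "vs ! i \<in> {tail D (es ! j), head D (es ! j)}" for j
    proof -
      have "es ! j \<in> arcs D" using c(5) that(1) by auto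
      from rank[OF this] have lt: "t (tail D (es ! j)) < t (head D (es ! j))" .
      have "head D (es ! j) \<in> {vs ! j, vs ! (Suc j mod ?n)}" using c(6)[OF that(1)] by blast
      moreover have "Suc j mod ?n < ?n" using i(1) by (intro mod_less_divisor) linarith
      ultimately have "t (head D (es ! j)) \<le> t (vs ! i)" using top[of j] top[of "Suc j mod ?n"] that(1) by auto
      with lt that(2) show ?thesis by auto
    qed
    \<comment> \<open>The cyclic predecessor of \<open>i\<close>. The arcs at positions
      \<open>i\<close> and \<open>?j\<close> are those that meet the top vertex.\<close>
    let ?j = "(i + (?n - 1)) mod ?n"
    have j: "?j < ?n" using i(1) by (intro mod_less_divisor) linarith
    have "Suc ?j mod ?n = Suc (i + (?n - 1)) mod ?n" by (rule mod_Suc_eq)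
    also have "Suc (i + (?n - 1)) = i + ?n" using i(1) by simp
    finally have Sj: "Suc ?j mod ?n = i" using i(1) by simp
    have "vs ! i \<in> {tail D (es ! i), head D (es ! i)}" using c(6)[OF i(1)] by auto
    from hd[OF i(1) this] have hi: "head D (es ! i) = vs ! i" .
    have "vs ! i \<in> {tail D (es ! ?j), head D (es ! ?j)}" using c(6)[OF j] Sj by auto
    from hd[OF j this] have hj: "head D (es ! ?j) = vs ! i" .
    have "es ! i \<in> arcs D" "es ! ?j \<in> arcs D" using c(5) i(1) j by auto
    with inj hi hj have "es ! i = es ! ?j" by (metis inj_onD)
    \<comment> \<open>The two arcs can coincide only on a cycle of length 1, a loop, which the rank
      excludes.\<close>
    with c(3) i(1) j have "i = ?j" by (simp add: nth_eq_iff_index_eq)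
    with Sj have "Suc i mod ?n = i" by simp
    with i(1) have "?n = 1" by (metis Suc_lessI mod_less mod_self n_not_Suc_n One_nat_def)
    with i(1) c(6)[OF i(1)] have "tail D (es ! i) = head D (es ! i)" by auto
    with rank[of "es ! i"] \<open>es ! i \<in> arcs D\<close> show False by simp
  qed
  show "Digraph_Component.connected D"
    unfolding connected_def
  proof (rule strongly_connectedI)
    let ?S = "mk_symmetric D"
    interpret S: pair_wf_digraph ?S by (rule wf_digraph.wellformed_mk_symmetric[OF wfd])
    have adj: "tail D e \<rightarrow>\<^bsub>?S\<^esub> head D e" "head D e \<rightarrow>\<^bsub>?S\<^esub> tail D e" if "e \<in> arcs D" for e
      using that by (auto simp: parcs_mk_symmetric)
    have rt: "r \<rightarrow>\<^sup>*\<^bsub>?S\<^esub> v \<and> v \<rightarrow>\<^sup>*\<^bsub>?S\<^esub> r" if "v \<in> verts D" for v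
      using that
    proof (induction "t v" arbitrary: v rule: less_induct)
      case less
      show ?case
      proof (cases "v = r")
        case True
        then show ?thesis using less.prems by auto
      next
        case False
        with less.prems surj obtain e where e: "e \<in> arcs D" "head D e = v" by blast
        from less.hyps[of "tail D e"] rank[OF e(1)] wf[OF e(1)] e(2)
        have "r \<rightarrow>\<^sup>*\<^bsub>?S\<^esub> tail D e" "tail D e \<rightarrow>\<^sup>*\<^bsub>?S\<^esub> r" by auto
        with adj[OF e(1)] e(2) show ?thesis
          using S.reachable_adj_trans[of r "tail D e" v] S.adj_reachable_trans[of v "tail D e" r] by simp
      qed
    qed
    show "verts (with_proj ?S) \<noteq> {}" using assms(3) by auto
    show "u \<rightarrow>\<^sup>*\<^bsub>?S\<^esub> v" if "u \<in> verts (with_proj ?S)" "v \<in> verts (with_proj ?S)" for u v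
      using rt[of u] rt[of v] that by (auto intro: S.reachable_trans)
  qed
qed

section \<open>What a packing provides\<close>

definition span_set :: "('v, 'e) mixed_hypergraph \<Rightarrow> 'e \<Rightarrow> 'v set" where
  "span_set F e = (if e \<in> dyperedges F then insert (dhead F e) (dtail F e) else ends F e)"

definition head_set :: "('v, 'e) mixed_hypergraph \<Rightarrow> 'e \<Rightarrow> 'v set" where
  "head_set F e = (if e \<in> dyperedges F then {dhead F e} else ends F e)"

lemma count_list_card: "count_list xs v = card {i. i < length xs \<and> xs ! i = v}"
proof -
  have "count_list xs v = length (filter (\<lambda>x. x = v) xs)"
    by (induction xs) auto
  then show ?thesis by (simp add: length_filter_conv_card)
qed

lemma trimming_in_span:
  assumes "is_trimming F B D" "B \<subseteq> dyperedges F \<union> hyperedges F" "e \<in> B"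
  shows "tail D e \<in> span_set F e" "head D e \<in> span_set F e" "head D e \<in> head_set F e"
  using assms unfolding is_trimming_def span_set_def head_set_def by auto

text \<open>The necessity of all conditions. A trimmed edge keeps its ends in its span, so edges
  spanned by \<open>X\<close> become arcs inside \<open>X\<close> and every member has at most
  \<open>|X| - 1\<close> of them. At a vertex each member contributes either an entering arc or its
  root.\<close>

lemma packing_counts:
  assumes wf: "wf_mixed_hypergraph F" and P: "flexible_packing F k f g P"
  defines "Z \<equiv> \<Union>i<k. snd (P ! i)"
  shows "Z \<subseteq> dyperedges F \<union> hyperedges F"
    and "card Z = k * (card (mverts F) - 1)"
    and "sum w Z = packing_weight w P"
    and "\<And>X. X \<subseteq> mverts F \<Longrightarrow> X \<noteq> {} \<Longrightarrow> card {e \<in> Z. span_set F e \<subseteq> X} \<le> k * (card X - 1)"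
    and "\<exists>h. (\<forall>e\<in>Z. h e \<in> head_set F e) \<and>
      (\<forall>v\<in>mverts F. card {e \<in> Z. h e = v} + count_list (map fst P) v = k)"
    and "(\<Sum>v\<in>mverts F. count_list (map fst P) v) = k"
proof -
  let ?V = "mverts F"
  define B where "B i = snd (P ! i)" for i
  define r where "r i = fst (P ! i)" for i
  have len: "length P = k" using P by (simp add: flexible_packing_def)
  have finE: "finite (dyperedges F \<union> hyperedges F)" and finV: "finite ?V"
    using wf by (auto simp: wf_mixed_hypergraph_def)
  have sp: "spanning_mixed_hyperarborescence F (r i) (B i)" if "i < k" for i
  proof -
    have "P ! i \<in> set P" using that len by simp
    then show ?thesis using P unfolding flexible_packing_def B_def r_def by (auto split: prod.splits)
  qed
  have disj: "B i \<inter> B j = {}" if "i < k" "j < k" "i \<noteq> j" for i j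
    using P that len unfolding flexible_packing_def B_def by blast
  have BE: "B i \<subseteq> dyperedges F \<union> hyperedges F" "r i \<in> ?V" if "i < k" for i
    using sp[OF that] by (auto simp: spanning_mixed_hyperarborescence_def)
  then have finB: "finite (B i)" if "i < k" for i using finite_subset[OF _ finE] that by blast
  have Z: "Z = (\<Union>i\<in>{..<k}. B i)" by (simp add: Z_def B_def)
  show "Z \<subseteq> dyperedges F \<union> hyperedges F" using BE Z by auto
  have "\<exists>D. \<forall>i<k. is_trimming F (B i) (D i) \<and> arborescence (r i) (D i)"
    using sp unfolding spanning_mixed_hyperarborescence_def by metis
  then obtain D where D: "\<And>i. i < k \<Longrightarrow> is_trimming F (B i) (D i)" "\<And>i. i < k \<Longrightarrow> arborescence (r i) (D i)"
    by blast
  have DV: "verts (D i) = ?V" "arcs (D i) = B i" if "i < k" for i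
    using D(1)[OF that] by (auto simp: is_trimming_def)
  have part: "card {e \<in> Z. Q e} = (\<Sum>i<k. card {e \<in> B i. Q e})" for Q
  proof -
    have "{e \<in> Z. Q e} = (\<Union>i\<in>{..<k}. {e \<in> B i. Q e})" unfolding Z by blast
    also have "card \<dots> = (\<Sum>i<k. card {e \<in> B i. Q e})"
      using disj finB by (intro card_UN_disjoint) (auto intro: finite_subset)
    finally show ?thesis .
  qed
  have "card Z = (\<Sum>i<k. card (B i))" using part[of "\<lambda>_. True"] by simp
  also have "\<dots> = (\<Sum>i<k. card ?V - 1)"
    using arborescence_card[OF D(2)] DV by (intro sum.cong) auto
  finally show "card Z = k * (card ?V - 1)" by simp
  have "sum w Z = (\<Sum>i<k. sum w (B i))"
    unfolding Z using disj finB by (intro sum.UNION_disjoint) auto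
  also have "\<dots> = packing_weight w P"
    unfolding packing_weight_def B_def len[symmetric]
    by (subst sum_list_sum_nth) (simp add: case_prod_beta lessThan_atLeast0)
  finally show "sum w Z = packing_weight w P" .
  show "card {e \<in> Z. span_set F e \<subseteq> X} \<le> k * (card X - 1)" if X: "X \<subseteq> ?V" "X \<noteq> {}" for X
  proof -
    have "card {e \<in> Z. span_set F e \<subseteq> X} = (\<Sum>i<k. card {e \<in> B i. span_set F e \<subseteq> X})" by (rule part)
    also have "\<dots> \<le> (\<Sum>i<k. card X - 1)"
    proof (rule sum_mono)
      fix i assume "i \<in> {..<k}"
      then have i: "i < k" by simp
      have "card {e \<in> B i. span_set F e \<subseteq> X} \<le> card {e \<in> arcs (D i). tail (D i) e \<in> X \<and> head (D i) e \<in> X}"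
        using trimming_in_span[OF D(1)[OF i] BE(1)[OF i]] finB[OF i] DV[OF i]
        by (intro card_mono) auto
      also have "\<dots> \<le> card X - 1" using arborescence_sparse[OF D(2)[OF i]] X DV[OF i] by simp
      finally show "card {e \<in> B i. span_set F e \<subseteq> X} \<le> card X - 1" .
    qed
    finally show ?thesis by simp
  qed
  have cnt: "count_list (map fst P) v = card {i. i < k \<and> r i = v}" for v
    unfolding count_list_card r_def len[symmetric]
    by (rule arg_cong[of _ _ card]) auto
  \<comment> \<open>The member that uses \<open>e\<close>. Members are disjoint, so it is determined
    for the edges in \<open>Z\<close>; other edges are not looked up.\<close>
  define ix where "ix e = (THE i. i < k \<and> e \<in> B i)" for e
  have ix: "ix e = i" if "i < k" "e \<in> B i" for e i
    unfolding ix_def using that disj by (intro the_equality) auto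
  define h where "h e = head (D (ix e)) e" for e
  have "card {e \<in> Z. h e = v} + count_list (map fst P) v = k" if v: "v \<in> ?V" for v
  proof -
    have "card {e \<in> B i. h e = v} = (if r i = v then 0 else 1)" if i: "i < k" for i
    proof -
      have eq: "{e \<in> B i. h e = v} = {e \<in> arcs (D i). head (D i) e = v}"
        using ix[OF i] DV[OF i] by (auto simp: h_def)
      show ?thesis
      proof (cases "r i = v")
        case True
        then have "{e \<in> arcs (D i). head (D i) e = v} = {}"
          using arborescence_root[OF D(2)[OF i]] by auto
        with True show ?thesis unfolding eq by (simp only: card.empty simp_thms if_True)
      next
        case False
        from arborescence_in_arc[OF D(2)[OF i], of v] v False DV(1)[OF i]
        obtain e where "e \<in> arcs (D i) \<and> head (D i) e = v"
          "\<And>e'. e' \<in> arcs (D i) \<and> head (D i) e' = v \<Longrightarrow> e' = e" by (auto elim!: ex1E)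
        then have "{e \<in> arcs (D i). head (D i) e = v} = {e}" by blast
        with False show ?thesis unfolding eq by simp
      qed
    qed
    then have "card {e \<in> Z. h e = v} = (\<Sum>i<k. if r i = v then 0 else 1)"
      unfolding part by (intro sum.cong) auto
    moreover have "count_list (map fst P) v = (\<Sum>i<k. if r i = v then 1 else 0)"
      unfolding cnt by (simp add: sum.If_cases Int_def lessThan_def)
    ultimately have "card {e \<in> Z. h e = v} + count_list (map fst P) v =
        (\<Sum>i<k. (if r i = v then 0 else 1) + (if r i = v then 1 else 0))"
      by (simp only: sum.distrib)
    also have "\<dots> = (\<Sum>i<k. 1)" by (intro sum.cong) auto
    finally show ?thesis by simp
  qed
  moreover have "h e \<in> head_set F e" if "e \<in> Z" for e
    using that trimming_in_span(3)[OF D(1) BE(1)] ix unfolding Z h_def by auto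
  ultimately show "\<exists>h. (\<forall>e\<in>Z. h e \<in> head_set F e) \<and>
      (\<forall>v\<in>?V. card {e \<in> Z. h e = v} + count_list (map fst P) v = k)" by blast
  have "set (map fst P) \<subseteq> ?V"
  proof
    fix v assume "v \<in> set (map fst P)"
    then obtain i where "i < length P" "v = fst (P ! i)" by (metis in_set_conv_nth length_map nth_map)
    with BE(2)[of i] len show "v \<in> ?V" by (simp add: r_def)
  qed
  then have "(\<Sum>v\<in>?V. count_list (map fst P) v) = length (map fst P)"
    using finV by (rule sum_count_set)
  then show "(\<Sum>v\<in>?V. count_list (map fst P) v) = k" by (simp add: len)
qed


section \<open>Count matroids\<close>

text \<open>The bound \<open>k (|X| - 1)\<close> satisfies the submodular inequality for
  intersecting sets but violates it for disjoint nonempty ones when \<open>k\<close> is positive.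
  This is why \<open>crossing\<close> speaks of intersecting pairs.\<close>

locale counting =
  fixes S :: "'e set" and U :: "'v set" and A :: "'e \<Rightarrow> 'v set"
    and F :: "'v set set" and b :: "'v set \<Rightarrow> nat"
  assumes finite_S: "finite S" and finite_U: "finite U" and FU: "F \<subseteq> Pow U"
    and A_nonempty: "e \<in> S \<Longrightarrow> A e \<noteq> {}"
    and crossing: "X \<in> F \<Longrightarrow> Y \<in> F \<Longrightarrow> X \<inter> Y \<noteq> {} \<Longrightarrow>
      X \<union> Y \<in> F \<and> X \<inter> Y \<in> F \<and> b (X \<union> Y) + b (X \<inter> Y) \<le> b X + b Y"
begin

definition count :: "'e set \<Rightarrow> 'v set \<Rightarrow> nat" where
  "count Z X = card {e \<in> Z. A e \<subseteq> X}"

definition sparse :: "'e set \<Rightarrow> bool" where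
  "sparse Z \<longleftrightarrow> Z \<subseteq> S \<and> (\<forall>X\<in>F. count Z X \<le> b X)"

lemma sparse_finite: "sparse Z \<Longrightarrow> finite Z"
  using finite_S finite_subset by (auto simp: sparse_def)

lemma count_supermodular:
  assumes "finite Z"
  shows "count Z X + count Z Y \<le> count Z (X \<union> Y) + count Z (X \<inter> Y)"
proof -
  let ?C = "\<lambda>X. {e \<in> Z. A e \<subseteq> X}"
  have "count Z X + count Z Y = card (?C X \<union> ?C Y) + card (?C X \<inter> ?C Y)"
    unfolding count_def using assms by (intro card_Un_Int) auto
  also have "card (?C X \<union> ?C Y) \<le> count Z (X \<union> Y)"
    unfolding count_def using assms by (intro card_mono) auto
  also have "card (?C X \<inter> ?C Y) \<le> count Z (X \<inter> Y)"
    unfolding count_def using assms by (intro card_mono) auto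
  finally show ?thesis by simp
qed

definition tight :: "'e set \<Rightarrow> 'v set \<Rightarrow> bool" where
  "tight Z X \<longleftrightarrow> X \<in> F \<and> count Z X = b X"

text \<open>Uncrossing: counts are supermodular and \<open>b\<close> is submodular on the pair, so
  the two bounds at union and intersection must hold with equality.\<close>

lemma tight_union:
  assumes "sparse Z" "tight Z X" "tight Z Y" "X \<inter> Y \<noteq> {}"
  shows "tight Z (X \<union> Y)"
proof -
  from assms crossing[of X Y] have "X \<union> Y \<in> F" "X \<inter> Y \<in> F" "b (X \<union> Y) + b (X \<inter> Y) \<le> b X + b Y"
    by (auto simp: tight_def)
  moreover from this assms(1) have "count Z (X \<union> Y) \<le> b (X \<union> Y)" "count Z (X \<inter> Y) \<le> b (X \<inter> Y)"
    by (auto simp: sparse_def)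
  ultimately show ?thesis
    using count_supermodular[OF sparse_finite[OF assms(1)], of X Y] assms(2,3) by (auto simp: tight_def)
qed

lemma not_addable:
  assumes "sparse Z" "e \<in> S" "e \<notin> Z" "\<not> sparse (insert e Z)"
  shows "\<exists>X. tight Z X \<and> A e \<subseteq> X"
proof -
  from assms obtain X where X: "X \<in> F" "b X < count (insert e Z) X" by (auto simp: sparse_def)
  have "count Z X \<le> b X" using assms(1) X(1) by (auto simp: sparse_def)
  have Ae: "A e \<subseteq> X"
  proof (rule ccontr)
    assume "\<not> A e \<subseteq> X"
    then have "{e' \<in> insert e Z. A e' \<subseteq> X} = {e' \<in> Z. A e' \<subseteq> X}" by auto
    with X(2) \<open>count Z X \<le> b X\<close> show False by (simp add: count_def)
  qed
  then have "{e' \<in> insert e Z. A e' \<subseteq> X} = insert e {e' \<in> Z. A e' \<subseteq> X}" by auto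
  then have "count (insert e Z) X = Suc (count Z X)"
    using assms(3) sparse_finite[OF assms(1)] by (simp add: count_def)
  with X \<open>count Z X \<le> b X\<close> Ae show ?thesis by (auto simp: tight_def)
qed

text \<open>
  If nothing of \<open>Z'\<close> can be added to \<open>Z\<close>, then every element of \<open>Z' - Z\<close> lies inside a maximal
  tight set. These sets are disjoint and hold at least as many elements of \<open>Z\<close> as of \<open>Z'\<close>.
\<close>

lemma sparse_augment:
  assumes Z: "sparse Z" and Z': "sparse Z'" and less: "card Z < card Z'"
  shows "\<exists>e\<in>Z' - Z. sparse (insert e Z)"
proof (rule ccontr)
  assume no: "\<not> ?thesis"
  define M where "M = {X. tight Z X \<and> (\<forall>Y. tight Z Y \<longrightarrow> X \<subseteq> Y \<longrightarrow> Y = X)}"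
  have finT: "finite {X. tight Z X}"
    by (rule finite_subset[of _ "Pow U"]) (use FU finite_U in \<open>auto simp: tight_def\<close>)
  then have finM: "finite M" unfolding M_def by (rule rev_finite_subset) auto
  have ext: "\<exists>Y\<in>M. X \<subseteq> Y" if "tight Z X" for X
  proof -
    have "finite {Y. tight Z Y \<and> X \<subseteq> Y}" using finT by (rule rev_finite_subset) auto
    moreover have "{Y. tight Z Y \<and> X \<subseteq> Y} \<noteq> {}" using that by auto
    ultimately obtain Y where Y: "Y \<in> {Y. tight Z Y \<and> X \<subseteq> Y}"
      "\<forall>W\<in>{Y. tight Z Y \<and> X \<subseteq> Y}. Y \<subseteq> W \<longrightarrow> Y = W"
      using finite_has_maximal by (metis (no_types, lifting))
    then have "Y \<in> M" unfolding M_def by blast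
    with Y show ?thesis by blast
  qed
  have disj: "X \<inter> Y = {}" if "X \<in> M" "Y \<in> M" "X \<noteq> Y" for X Y
  proof (rule ccontr)
    assume "X \<inter> Y \<noteq> {}"
    with tight_union[OF Z, of X Y] that have "tight Z (X \<union> Y)" by (auto simp: M_def)
    with that have "X \<union> Y = X" "X \<union> Y = Y" by (auto simp: M_def)
    with that show False by simp
  qed
  let ?in = "\<lambda>e. \<exists>X\<in>M. A e \<subseteq> X"
  have fin: "finite Z" "finite Z'" "Z \<subseteq> S" "Z' \<subseteq> S"
    using Z Z' sparse_finite by (auto simp: sparse_def)
  have inside: "card {e \<in> W. ?in e} = (\<Sum>X\<in>M. count W X)" if W: "finite W" "W \<subseteq> S" for W
  proof -
    have "{e \<in> W. ?in e} = (\<Union>X\<in>M. {e \<in> W. A e \<subseteq> X})" by blast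
    also have "card \<dots> = (\<Sum>X\<in>M. card {e \<in> W. A e \<subseteq> X})"
    proof (rule card_UN_disjoint)
      show "\<forall>X\<in>M. \<forall>Y\<in>M. X \<noteq> Y \<longrightarrow> {e \<in> W. A e \<subseteq> X} \<inter> {e \<in> W. A e \<subseteq> Y} = {}"
      proof (intro ballI impI)
        fix X Y assume "X \<in> M" "Y \<in> M" "X \<noteq> Y"
        from disj[OF this] have "A e = {}" if "A e \<subseteq> X" "A e \<subseteq> Y" for e using that by blast
        then show "{e \<in> W. A e \<subseteq> X} \<inter> {e \<in> W. A e \<subseteq> Y} = {}"
          using A_nonempty W(2) by blast
      qed
    qed (use finM W in auto)
    finally show ?thesis by (simp add: count_def)
  qed
  have dec: "card W = card {e \<in> W. ?in e} + card {e \<in> W. \<not> ?in e}" if "finite W" for W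
  proof -
    have "W = {e \<in> W. ?in e} \<union> {e \<in> W. \<not> ?in e}" by blast
    then show ?thesis using that card_Un_disjoint[of "{e \<in> W. ?in e}" "{e \<in> W. \<not> ?in e}"] by auto
  qed
  have "(\<Sum>X\<in>M. count Z' X) \<le> (\<Sum>X\<in>M. count Z X)"
    by (rule sum_mono) (use Z' in \<open>auto simp: M_def tight_def sparse_def\<close>)
  moreover have "card {e \<in> Z'. \<not> ?in e} \<le> card {e \<in> Z. \<not> ?in e}"
  proof (rule card_mono)
    show "{e \<in> Z'. \<not> ?in e} \<subseteq> {e \<in> Z. \<not> ?in e}"
    proof
      fix e assume "e \<in> {e \<in> Z'. \<not> ?in e}"
      then have e: "e \<in> Z'" "\<not> ?in e" by blast+
      show "e \<in> {e \<in> Z. \<not> ?in e}"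
      proof (rule ccontr)
        assume "\<not> ?thesis"
        with e have "e \<in> Z' - Z" by blast
        with no fin(4) not_addable[OF Z, of e] obtain X where "tight Z X" "A e \<subseteq> X" by blast
        with ext[of X] e(2) show False by blast
      qed
    qed
  qed (use fin in auto)
  ultimately have "card Z' \<le> card Z"
    unfolding dec[OF fin(1)] dec[OF fin(2)] inside[OF fin(1,3)] inside[OF fin(2,4)] by (rule add_mono)
  with less show False by simp
qed

lemma matroid_sparse: "matroid S sparse"
proof
  show "finite S" by (rule finite_S)
  show "sparse Z \<Longrightarrow> Z \<subseteq> S" for Z by (simp add: sparse_def)
  show "sparse {}" by (simp add: sparse_def count_def)
  show "sparse Y" if "sparse Z" "Y \<subseteq> Z" for Z Y
  proof -
    have "count Y X \<le> count Z X" for X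
      unfolding count_def using that sparse_finite by (intro card_mono) auto
    with that show ?thesis unfolding sparse_def by (meson order_trans)
  qed
qed (rule sparse_augment)

end


section \<open>Decomposition into spanning arborescences\<close>

locale rooted_dypergraph =
  fixes V :: "'v set" and s :: 'v and hv :: "'d \<Rightarrow> 'v" and A :: "'d \<Rightarrow> 'v set"
  assumes finite_V: "finite V" and s_V: "s \<notin> V"
begin

text \<open>For an edge, \<open>A d\<close> will be its whole span, including the head. The edge
  enters \<open>X\<close> if its head lies in \<open>X\<close> and some other element of the span,
  available as a tail, does not.\<close>

definition enter :: "'d set \<Rightarrow> 'v set \<Rightarrow> nat" where
  "enter D X = card {d \<in> D. hv d \<in> X \<and> \<not> A d \<subseteq> X}"

definition connected_by :: "nat \<Rightarrow> 'd set \<Rightarrow> bool" where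
  "connected_by q D \<longleftrightarrow> (\<forall>X. X \<subseteq> V \<longrightarrow> X \<noteq> {} \<longrightarrow> q \<le> enter D X)"

lemma enter_submodular:
  assumes "finite D"
  shows "enter D (X \<union> Y) + enter D (X \<inter> Y) \<le> enter D X + enter D Y"
proof -
  let ?E = "\<lambda>X. {d \<in> D. hv d \<in> X \<and> \<not> A d \<subseteq> X}"
  have fin: "finite (?E X)" for X using assms by auto
  have "enter D (X \<union> Y) + enter D (X \<inter> Y) = card (?E (X \<union> Y) \<union> ?E (X \<inter> Y)) + card (?E (X \<union> Y) \<inter> ?E (X \<inter> Y))"
    unfolding enter_def by (rule card_Un_Int[OF fin fin])
  also have "\<dots> \<le> card (?E X \<union> ?E Y) + card (?E X \<inter> ?E Y)"
    using fin by (intro add_mono card_mono) auto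
  also have "\<dots> = enter D X + enter D Y"
    unfolding enter_def by (rule card_Un_Int[OF fin fin, symmetric])
  finally show ?thesis .
qed

text \<open>
  Lovasz' argument: among the sets that no longer have an entering dyperedge to spare and are not
  contained in \<open>U\<close> take a minimal one, \<open>X\<close>. The set \<open>X - U\<close> still has one to spare, so some
  dyperedge enters \<open>X - U\<close> but not \<open>X\<close>; it can be used.
\<close>

lemma growth_step:
  assumes D: "finite D0" "D \<subseteq> D0" and c0: "connected_by (Suc q) D0" and c: "connected_by q D"
    and used: "\<And>d. d \<in> D0 - D \<Longrightarrow> hv d \<in> U" and U: "s \<in> U" "\<not> V \<subseteq> U"
    and A: "\<And>d. d \<in> D \<Longrightarrow> A d \<subseteq> insert s V"
  shows "\<exists>a\<in>D. hv a \<notin> U \<and> A a \<inter> U \<noteq> {} \<and> connected_by q (D - {a})"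
proof -
  have finD: "finite D" using D finite_subset by blast
  \<comment> \<open>All dyperedges used so far have their heads in \<open>U\<close>, so a set
    disjoint from \<open>U\<close> has lost none of those that enter it.\<close>
  have outside: "Suc q \<le> enter D Y" if "Y \<subseteq> V" "Y \<noteq> {}" "Y \<inter> U = {}" for Y
  proof -
    have "{d \<in> D0. hv d \<in> Y \<and> \<not> A d \<subseteq> Y} = {d \<in> D. hv d \<in> Y \<and> \<not> A d \<subseteq> Y}"
      using used that D by blast
    then have "enter D0 Y = enter D Y" by (simp add: enter_def)
    with c0 that show ?thesis unfolding connected_by_def by metis
  qed
  have removal: "connected_by q (D - {a})"
    if a: "a \<in> D" and safe: "\<And>Y. Y \<subseteq> V \<Longrightarrow> hv a \<in> Y \<Longrightarrow> \<not> A a \<subseteq> Y \<Longrightarrow> enter D Y \<noteq> q" for a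
    unfolding connected_by_def
  proof (intro allI impI)
    fix Y assume Y: "Y \<subseteq> V" "Y \<noteq> {}"
    with c have ge: "q \<le> enter D Y" by (simp add: connected_by_def)
    show "q \<le> enter (D - {a}) Y"
    proof (cases "hv a \<in> Y \<and> \<not> A a \<subseteq> Y")
      case True
      then have "enter D Y \<noteq> q" using safe[of Y] Y by blast
      moreover have "{d \<in> D - {a}. hv d \<in> Y \<and> \<not> A d \<subseteq> Y} = {d \<in> D. hv d \<in> Y \<and> \<not> A d \<subseteq> Y} - {a}"
        by blast
      then have "enter (D - {a}) Y = enter D Y - 1"
        using True a finD by (simp add: enter_def)
      ultimately show ?thesis using ge by simp
    next
      case False
      then have "{d \<in> D - {a}. hv d \<in> Y \<and> \<not> A d \<subseteq> Y} = {d \<in> D. hv d \<in> Y \<and> \<not> A d \<subseteq> Y}" by blast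
      then show ?thesis using ge by (simp add: enter_def)
    qed
  qed
  let ?crit = "\<lambda>X. X \<subseteq> V \<and> X \<noteq> {} \<and> \<not> X \<subseteq> U \<and> enter D X = q"
  show ?thesis
  proof (cases "\<exists>X. ?crit X")
    case False
    \<comment> \<open>No set that contains a head outside \<open>U\<close> is critical, so any
      dyperedge entering \<open>V - U\<close> can be removed. It meets \<open>U\<close>, since it
      leaves \<open>V - U\<close> within \<open>insert s V\<close> and \<open>s\<close> lies in
      \<open>U\<close>.\<close>
    have "Suc q \<le> enter D (V - U)" using U by (intro outside) auto
    then have "card {d \<in> D. hv d \<in> V - U \<and> \<not> A d \<subseteq> V - U} \<noteq> 0" by (simp add: enter_def)
    then have "{d \<in> D. hv d \<in> V - U \<and> \<not> A d \<subseteq> V - U} \<noteq> {}" by (metis card.empty)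
    then obtain a where a: "a \<in> D" "hv a \<in> V - U" "\<not> A a \<subseteq> V - U" by blast
    with A[of a] U have "A a \<inter> U \<noteq> {}" by blast
    moreover have "connected_by q (D - {a})" using False a(2) by (intro removal[OF a(1)]) blast
    ultimately show ?thesis using a by blast
  next
    case True
    define n where "n = (LEAST n. \<exists>X. ?crit X \<and> card X = n)"
    have "\<exists>n X. ?crit X \<and> card X = n" using True by blast
    then have "\<exists>X. ?crit X \<and> card X = n" unfolding n_def by (rule LeastI_ex)
    then obtain X where X: "?crit X" "card X = n" by blast
    have least: "n \<le> card Y" if "?crit Y" for Y
      unfolding n_def using that by (intro Least_le) blast
    have "Suc q \<le> enter D (X - U)" using X by (intro outside) auto
    then have "enter D X < enter D (X - U)" using X by simp
    have "\<not> {d \<in> D. hv d \<in> X - U \<and> \<not> A d \<subseteq> X - U} \<subseteq> {d \<in> D. hv d \<in> X \<and> \<not> A d \<subseteq> X}"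
    proof
      assume "{d \<in> D. hv d \<in> X - U \<and> \<not> A d \<subseteq> X - U} \<subseteq> {d \<in> D. hv d \<in> X \<and> \<not> A d \<subseteq> X}"
      then have "enter D (X - U) \<le> enter D X"
        unfolding enter_def using finD by (intro card_mono) auto
      with \<open>enter D X < enter D (X - U)\<close> show False by simp
    qed
    then obtain a where a: "a \<in> D" "hv a \<in> X - U" "\<not> A a \<subseteq> X - U" "A a \<subseteq> X" by blast
    have "connected_by q (D - {a})"
    proof (rule removal[OF a(1)])
      \<comment> \<open>If \<open>Y\<close> were critical, submodularity would make the intersection
        of \<open>X\<close> and \<open>Y\<close> critical. It contains the head of \<open>a\<close>
        outside \<open>U\<close> and is smaller than \<open>X\<close>, because \<open>A a\<close>
        lies within \<open>X\<close> but not within \<open>Y\<close>.\<close>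
      fix Y assume Y: "Y \<subseteq> V" "hv a \<in> Y" "\<not> A a \<subseteq> Y"
      show "enter D Y \<noteq> q"
      proof
        assume "enter D Y = q"
        have XY: "X \<inter> Y \<noteq> {}" "X \<union> Y \<subseteq> V" "X \<inter> Y \<subseteq> V" using a X Y by auto
        then have "q \<le> enter D (X \<union> Y)" "q \<le> enter D (X \<inter> Y)"
          using c unfolding connected_by_def by blast+
        with enter_submodular[OF finD, of X Y] X \<open>enter D Y = q\<close> have "enter D (X \<inter> Y) = q" by simp
        then have "?crit (X \<inter> Y)" using XY a Y by blast
        moreover have "X \<inter> Y \<subset> X" using a Y by blast
        then have "card (X \<inter> Y) < card X"
          using X finite_V finite_subset by (intro psubset_card_mono) auto
        ultimately show False using least[of "X \<inter> Y"] X by simp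
      qed
    qed
    moreover have "A a \<inter> U \<noteq> {}" using a by blast
    ultimately show ?thesis using a by blast
  qed
qed

inductive grown :: "'d list \<Rightarrow> 'v list \<Rightarrow> bool" where
  start: "grown [] [s]"
| add: "grown F U \<Longrightarrow> hv a \<notin> set U \<Longrightarrow> A a \<inter> set U \<noteq> {} \<Longrightarrow> grown (a # F) (hv a # U)"

lemma grown_set: "grown F U \<Longrightarrow> distinct U \<and> set U = insert s (hv ` set F) \<and> s \<notin> hv ` set F \<and> distinct (map hv F) \<and> length U = Suc (length F)"
  by (induction rule: grown.induct) auto

text \<open>A new vertex receives a rank above all earlier ones, and its tail is picked among the
  vertices present at that time. These ranks are made for \<open>arborescenceI\<close>.\<close>

lemma grown_rank:
  "grown F U \<Longrightarrow> \<exists>(t :: 'v \<Rightarrow> nat) tl. \<forall>a\<in>set F. tl a \<in> A a \<and> tl a \<in> set U \<and> t (tl a) < t (hv a)"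
proof (induction rule: grown.induct)
  case (add F U a)
  then obtain t :: "'v \<Rightarrow> nat" and tl where
    t: "\<forall>a\<in>set F. tl a \<in> A a \<and> tl a \<in> set U \<and> t (tl a) < t (hv a)" by blast
  obtain u where u: "u \<in> A a" "u \<in> set U" using add.hyps by blast
  define t' where "t' = t(hv a := Suc (Max (t ` set U)))"
  have sU: "hv ` set F \<subseteq> set U" using grown_set[OF add.hyps(1)] by auto
  have same: "t' v = t v" if "v \<in> set U" for v using that add.hyps(2) by (auto simp: t'_def)
  have top: "t' v < t' (hv a)" if "v \<in> set U" for v
    using same[OF that] that by (simp add: t'_def le_imp_less_Suc)
  have aF: "a \<notin> set F" using add.hyps(2) sU by blast
  show ?case
  proof (intro exI[of _ t'] exI[of _ "tl(a := u)"] ballI)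
    fix b assume "b \<in> set (a # F)"
    then consider "b = a" | "b \<in> set F" "b \<noteq> a" using aF by auto
    then show "(tl(a := u)) b \<in> A b \<and> (tl(a := u)) b \<in> set (hv a # U) \<and> t' ((tl(a := u)) b) < t' (hv b)"
    proof cases
      case 1
      then show ?thesis using u top by simp
    next
      case 2
      then have "hv b \<in> set U" using sU by blast
      with 2 t same show ?thesis by simp
    qed
  qed
qed simp

text \<open>At the time of the first arc, \<open>s\<close> is the only vertex to start from. For the
  table this means that every part uses a root arc.\<close>

lemma grown_root: "grown F U \<Longrightarrow> F \<noteq> [] \<Longrightarrow> \<exists>a\<in>set F. s \<in> A a"
proof (induction rule: grown.induct)
  case (add F U a)
  show ?case
  proof (cases "F = []")
    case True
    with add.hyps(1) have "U = [s]" by (cases rule: grown.cases) auto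
    with add.hyps show ?thesis by auto
  next
    case False
    then show ?thesis using add.IH by auto
  qed
qed simp

end


section \<open>The programs\<close>

text \<open>
  Vertices, edges and copies of root arcs are numbers. The extra vertex from which all
  arborescences grow is \<open>- 1\<close>, and negative numbers are the names of root arcs. A row of the table
  lists the name of an element, its weight, the set that it spans and its possible heads.
\<close>

type_synonym row = "real \<times> real \<times> real list \<times> real list"

text \<open>Lookup by a scan of the whole table: names are distinct, so one row contributes to the
  concatenation. \<open>weight_of\<close> does the same with a sum.\<close>

definition span_of :: "row list \<Rightarrow> real \<Rightarrow> real list" where
  "span_of T i = concat (map (\<lambda>r. if fst r = i then fst (snd (snd r)) else []) T)"

definition heads_of :: "row list \<Rightarrow> real \<Rightarrow> real list" where
  "heads_of T i = concat (map (\<lambda>r. if fst r = i then snd (snd (snd r)) else []) T)"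

definition weight_of :: "row list \<Rightarrow> real \<Rightarrow> real" where
  "weight_of T i = (\<Sum>r\<leftarrow>T. if fst r = i then fst (snd r) else 0)"

text \<open>
  The copies of \<open>{x}\<close>, one for each element of \<open>ks\<close>, turn Hall's bound \<open>k |X|\<close> on the number of spans
  inside a set \<open>X\<close> with \<open>x \<in> X\<close> into \<open>k (|X| - 1)\<close>.
\<close>

definition test_span :: "row list \<Rightarrow> real list \<Rightarrow> real list \<Rightarrow> real list \<Rightarrow> real list \<Rightarrow> bool" where
  "test_span T V ks slots I \<longleftrightarrow> (\<forall>x\<in>set V.
     fst (hall (map (\<lambda>i. (i, span_of T i)) I @ map (\<lambda>j. (j, [x])) ks) slots) = [])"

definition test_heads :: "row list \<Rightarrow> real list \<Rightarrow> real list \<Rightarrow> bool" where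
  "test_heads T slots I \<longleftrightarrow> fst (hall (map (\<lambda>i. (i, heads_of T i)) I) slots) = []"

definition tails_of :: "row list \<Rightarrow> real \<Rightarrow> real list" where
  "tails_of T i = (if i < 0 then [- 1] else span_of T i)"

text \<open>Connectivity as Hall's condition. The heads serve as slots; a set \<open>X\<close> with
  \<open>x \<in> X\<close> has room for the dyperedges inside it and for \<open>length ks\<close>
  copies of \<open>{x}\<close> iff at least \<open>length ks\<close> dyperedges enter
  \<open>X\<close>. Root arcs are never inside a subset of \<open>V\<close> and supply slots
  only.\<close>

definition test_conn :: "row list \<Rightarrow> real list \<Rightarrow> real list \<Rightarrow> (real \<times> real) list \<Rightarrow> bool" where
  "test_conn T V ks D \<longleftrightarrow> (\<forall>x\<in>set V.
     fst (hall (map (\<lambda>d. (fst d, span_of T (fst d))) (filter (\<lambda>d. 0 \<le> fst d) D) @ map (\<lambda>j. (j, [x])) ks)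
       (map snd D)) = [])"

definition grow :: "row list \<Rightarrow> real list \<Rightarrow> real list \<Rightarrow>
    (real \<times> real) list \<times> (real \<times> real) list \<times> real list \<Rightarrow> (real \<times> real) list \<times> (real \<times> real) list \<times> real list" where
  "grow T V ks st =
     (case filter (\<lambda>a. snd a \<notin> set (snd (snd st)) \<and> (\<exists>u\<in>set (tails_of T (fst a)). u \<in> set (snd (snd st))) \<and>
         test_conn T V ks (filter (\<lambda>d. fst d \<noteq> fst a) (fst st))) (fst st) of
       [] \<Rightarrow> st
     | a # _ \<Rightarrow> (filter (\<lambda>d. fst d \<noteq> fst a) (fst st), a # fst (snd st), snd a # snd (snd st)))"

text \<open>After one element of \<open>ks\<close> is removed, the rest is the number of
  arborescences still to come and hence the connectivity that must survive the growth of the present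
  one. Growth takes one step per vertex, as the extra vertex is there from the start.\<close>

definition stage :: "row list \<Rightarrow> real list \<Rightarrow>
    real list \<times> (real \<times> real) list \<times> (real \<times> real) list list \<Rightarrow> real list \<times> (real \<times> real) list \<times> (real \<times> real) list list" where
  "stage T V st = (case fst st of [] \<Rightarrow> st
     | _ # ks \<Rightarrow> (ks, fst ((grow T V ks ^^ length V) (fst (snd st), [], [- 1])),
         fst (snd ((grow T V ks ^^ length V) (fst (snd st), [], [- 1]))) # snd (snd st)))"

definition decompose :: "row list \<Rightarrow> real list \<Rightarrow> real list \<Rightarrow> (real \<times> real) list \<Rightarrow> (real \<times> real) list list" where
  "decompose T V ks D = snd (snd ((stage T V ^^ length ks) (ks, D, [])))"

section \<open>Correctness of the decomposition\<close>

locale decomposition =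
  fixes V :: "real list" and T :: "row list"
  assumes V: "distinct V" "V \<noteq> []" "- 1 \<notin> set V"
begin

abbreviation A :: "real \<times> real \<Rightarrow> real set" where "A d \<equiv> set (tails_of T (fst d))"

sublocale rooted_dypergraph "set V" "- 1" snd A
  by unfold_locales (use V in auto)

definition valid :: "(real \<times> real) list \<Rightarrow> bool" where
  "valid D \<longleftrightarrow> distinct (map fst D) \<and>
     (\<forall>d\<in>set D. snd d \<in> set V \<and> (0 \<le> fst d \<longrightarrow> A d \<subseteq> set V \<and> snd d \<in> A d))"

definition roots :: "(real \<times> real) set \<Rightarrow> nat" where
  "roots D = card {d \<in> D. fst d < 0}"

lemma root_tails: "fst d < 0 \<Longrightarrow> A d = {- 1}"
  by (simp add: tails_of_def)

lemma valid_tails: "valid D \<Longrightarrow> d \<in> set D \<Longrightarrow> A d \<subseteq> insert (- 1) (set V)"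
  by (cases "fst d < 0") (auto simp: root_tails valid_def)

lemma valid_filter: "valid D \<Longrightarrow> valid (filter P D)"
  by (auto simp: valid_def distinct_map_filter)

text \<open>A dyperedge with head in \<open>X\<close> either enters \<open>X\<close> or lies inside
  it, and a root arc always enters because \<open>- 1\<close> is not a vertex.\<close>

lemma enter_inside:
  assumes "valid D" "X \<subseteq> set V"
  shows "enter (set D) X + card {d \<in> set D. 0 \<le> fst d \<and> A d \<subseteq> X} = card {d \<in> set D. snd d \<in> X}"
proof -
  have "{d \<in> set D. snd d \<in> X} = {d \<in> set D. snd d \<in> X \<and> \<not> A d \<subseteq> X} \<union> {d \<in> set D. 0 \<le> fst d \<and> A d \<subseteq> X}"
  proof (intro equalityI subsetI)
    fix d assume d: "d \<in> {d \<in> set D. snd d \<in> X}"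
    show "d \<in> {d \<in> set D. snd d \<in> X \<and> \<not> A d \<subseteq> X} \<union> {d \<in> set D. 0 \<le> fst d \<and> A d \<subseteq> X}"
    proof (cases "fst d < 0")
      case True
      then have "\<not> A d \<subseteq> X" using root_tails assms(2) V(3) by auto
      then show ?thesis using d by simp
    qed (use d in auto)
  next
    fix d assume "d \<in> {d \<in> set D. snd d \<in> X \<and> \<not> A d \<subseteq> X} \<union> {d \<in> set D. 0 \<le> fst d \<and> A d \<subseteq> X}"
    then show "d \<in> {d \<in> set D. snd d \<in> X}" using assms(1) by (auto simp: valid_def)
  qed
  moreover have "{d \<in> set D. snd d \<in> X \<and> \<not> A d \<subseteq> X} \<inter> {d \<in> set D. 0 \<le> fst d \<and> A d \<subseteq> X} = {}" by blast
  ultimately show ?thesis unfolding enter_def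
    using card_Un_disjoint[of "{d \<in> set D. snd d \<in> X \<and> \<not> A d \<subseteq> X}" "{d \<in> set D. 0 \<le> fst d \<and> A d \<subseteq> X}"]
    by simp
qed

lemma length_filter_card: "distinct D \<Longrightarrow> length (filter P D) = card {d \<in> set D. P d}"
  by (metis distinct_card distinct_filter set_filter)

lemma test_conn_iff:
  assumes D: "valid D"
  shows "test_conn T V ks D \<longleftrightarrow> connected_by (length ks) (set D)"
proof -
  have dist: "distinct D" using D by (auto simp: valid_def distinct_map)
  define ins where "ins X = card {d \<in> set D. 0 \<le> fst d \<and> A d \<subseteq> X}" for X
  have tl: "set (span_of T (fst d)) = A d" if "0 \<le> fst d" for d using that by (simp add: tails_of_def)
  have lhs: "inside X (map (\<lambda>d. (fst d, span_of T (fst d))) (filter (\<lambda>d. 0 \<le> fst d) D) @ map (\<lambda>j. (j, [x])) ks) =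
      ins X + (if x \<in> X then length ks else 0)" for X x
  proof -
    have "filter (\<lambda>d. set (span_of T (fst d)) \<subseteq> X) (filter (\<lambda>d. 0 \<le> fst d) D) =
        filter (\<lambda>d. 0 \<le> fst d \<and> A d \<subseteq> X) D"
      unfolding filter_filter by (rule filter_cong) (simp_all add: tl cong: conj_cong)
    then show ?thesis
      by (simp add: filter_map comp_def length_filter_card[OF dist] ins_def)
  qed
  have rhs: "slots_in X (map snd D) = card {d \<in> set D. snd d \<in> X}" for X
    by (simp add: filter_map comp_def length_filter_card[OF dist])
  have VX: "ins X = ins (X \<inter> set V)" "card {d \<in> set D. snd d \<in> X} = card {d \<in> set D. snd d \<in> X \<inter> set V}" for X
  proof -
    have "{d \<in> set D. 0 \<le> fst d \<and> A d \<subseteq> X} = {d \<in> set D. 0 \<le> fst d \<and> A d \<subseteq> X \<inter> set V}"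
      using D by (auto simp: valid_def)
    then show "ins X = ins (X \<inter> set V)" by (simp add: ins_def)
    have "{d \<in> set D. snd d \<in> X} = {d \<in> set D. snd d \<in> X \<inter> set V}" using D by (auto simp: valid_def)
    then show "card {d \<in> set D. snd d \<in> X} = card {d \<in> set D. snd d \<in> X \<inter> set V}" by simp
  qed
  have test: "test_conn T V ks D \<longleftrightarrow> (\<forall>x\<in>set V. \<forall>X. ins X + (if x \<in> X then length ks else 0) \<le> card {d \<in> set D. snd d \<in> X})"
    unfolding test_conn_def hall_iff lhs rhs ..
  show ?thesis
  proof
    assume t: "test_conn T V ks D"
    show "connected_by (length ks) (set D)"
      unfolding connected_by_def
    proof (intro allI impI)
      fix X assume X: "X \<subseteq> set V" "X \<noteq> {}"
      then obtain x where "x \<in> X" "x \<in> set V" by blast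
      then have "ins X + (if x \<in> X then length ks else 0) \<le> card {d \<in> set D. snd d \<in> X}"
        using t unfolding test by blast
      with \<open>x \<in> X\<close> have "ins X + length ks \<le> card {d \<in> set D. snd d \<in> X}" by simp
      with enter_inside[OF D X(1)] show "length ks \<le> enter (set D) X" by (simp add: ins_def)
    qed
  next
    assume c: "connected_by (length ks) (set D)"
    show "test_conn T V ks D" unfolding test
    proof (intro ballI allI)
      fix x X assume x: "x \<in> set V"
      let ?X = "X \<inter> set V"
      have e: "enter (set D) ?X + ins ?X = card {d \<in> set D. snd d \<in> ?X}"
        using enter_inside[OF D, of ?X] by (simp add: ins_def)
      have "(if x \<in> X then length ks else 0) \<le> enter (set D) ?X"
      proof (cases "x \<in> X")
        case True
        with x have "?X \<noteq> {}" by blast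
        with c True show ?thesis unfolding connected_by_def by auto
      qed simp
      with e show "ins X + (if x \<in> X then length ks else 0) \<le> card {d \<in> set D. snd d \<in> X}"
        unfolding VX(1)[of X] VX(2)[of X] by linarith
    qed
  qed
qed

text \<open>Only root arcs can enter the whole of \<open>V\<close>.\<close>

lemma roots_ge: "valid D \<Longrightarrow> connected_by q (set D) \<Longrightarrow> q \<le> roots (set D)"
proof -
  assume D: "valid D" "connected_by q (set D)"
  have "{d \<in> set D. snd d \<in> set V \<and> \<not> A d \<subseteq> set V} \<subseteq> {d \<in> set D. fst d < 0}"
    using D(1) by (auto simp: valid_def not_less[symmetric])
  then have "enter (set D) (set V) \<le> roots (set D)"
    unfolding enter_def roots_def by (intro card_mono) auto
  moreover have "q \<le> enter (set D) (set V)" using D(2) V(2) unfolding connected_by_def by auto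
  ultimately show ?thesis by simp
qed

definition grow_inv :: "(real \<times> real) list \<Rightarrow> nat \<Rightarrow> nat \<Rightarrow> (real \<times> real) list \<times> (real \<times> real) list \<times> real list \<Rightarrow> bool" where
  "grow_inv D0 q j st \<longleftrightarrow> valid (fst st) \<and> connected_by q (set (fst st)) \<and>
     grown (fst (snd st)) (snd (snd st)) \<and> length (fst (snd st)) = j \<and>
     set (fst st) \<union> set (fst (snd st)) = set D0 \<and> set (fst st) \<inter> set (fst (snd st)) = {}"

lemma grow_step:
  assumes D0: "valid D0" "connected_by (Suc (length ks)) (set D0)"
    and inv: "grow_inv D0 (length ks) j st" and j: "j < length V"
  shows "grow_inv D0 (length ks) (Suc j) (grow T V ks st)"
proof -
  obtain D F U where st: "st = (D, F, U)" by (metis prod.collapse)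
  from inv have I: "valid D" "connected_by (length ks) (set D)" "grown F U" "length F = j"
    "set D \<union> set F = set D0" "set D \<inter> set F = {}" by (auto simp: grow_inv_def st)
  note G = grown_set[OF I(3)]
  have notall: "\<not> set V \<subseteq> set U"
  proof
    assume "set V \<subseteq> set U"
    then have "insert (- 1) (set V) \<subseteq> set U" using G by auto
    then have "card (insert (- 1) (set V)) \<le> card (set U)" by (intro card_mono) auto
    also have "card (set U) = Suc j" using G I(4) distinct_card[of U] by simp
    finally show False using V j by (simp add: distinct_card)
  qed
  have fil: "set (filter (\<lambda>d. fst d \<noteq> fst a) D) = set D - {a}" if "a \<in> set D" for a
  proof -
    have "inj_on fst (set D)" using I(1) by (simp add: valid_def distinct_map)
    then have "fst d = fst a \<longleftrightarrow> d = a" if "d \<in> set D" for d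
      using \<open>a \<in> set D\<close> that by (meson inj_on_contraD)
    then show ?thesis unfolding set_filter by blast
  qed
  define ok where "ok a \<longleftrightarrow> snd a \<notin> set U \<and> (\<exists>u\<in>set (tails_of T (fst a)). u \<in> set U) \<and>
         test_conn T V ks (filter (\<lambda>d. fst d \<noteq> fst a) D)" for a
  have ok: "ok a \<longleftrightarrow> snd a \<notin> set U \<and> A a \<inter> set U \<noteq> {} \<and> connected_by (length ks) (set D - {a})"
    if "a \<in> set D" for a
    unfolding ok_def test_conn_iff[OF valid_filter[OF I(1)]] fil[OF that] by blast
  have "\<exists>a\<in>set D. snd a \<notin> set U \<and> A a \<inter> set U \<noteq> {} \<and> connected_by (length ks) (set D - {a})"
  proof (rule growth_step[OF _ _ D0(2) I(2)])
    show "snd d \<in> set U" if "d \<in> set D0 - set D" for d using that I(5) G by auto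
    show "A d \<subseteq> insert (- 1) (set V)" if "d \<in> set D" for d by (rule valid_tails[OF I(1) that])
  qed (use I(5) G notall in auto)
  with ok have "\<exists>a\<in>set D. ok a" by blast
  then obtain a as where a: "filter ok D = a # as"
    by (metis filter_empty_conv list.exhaust)
  then have "a \<in> set (filter ok D)" by simp
  then have aD: "a \<in> set D" "ok a" by auto
  have "grow T V ks st = (filter (\<lambda>d. fst d \<noteq> fst a) D, a # F, snd a # U)"
    using a unfolding grow_def st ok_def by simp
  moreover have "grown (a # F) (snd a # U)"
    using aD ok by (intro grown.add I(3)) auto
  ultimately show ?thesis
    unfolding grow_inv_def using aD ok[OF aD(1)] fil[OF aD(1)] valid_filter[OF I(1)] I by auto
qed

lemma grow_all:
  assumes D0: "valid D0" "connected_by (Suc (length ks)) (set D0)"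
  shows "grow_inv D0 (length ks) (length V) ((grow T V ks ^^ length V) (D0, [], [- 1]))"
proof -
  have "connected_by (length ks) (set D0)"
    using D0(2) unfolding connected_by_def by (meson Suc_leD)
  then have init: "grow_inv D0 (length ks) 0 (D0, [], [- 1])"
    using D0(1) by (simp add: grow_inv_def grown.start)
  have "j \<le> length V \<Longrightarrow> grow_inv D0 (length ks) j ((grow T V ks ^^ j) (D0, [], [- 1]))" for j
    by (induction j) (use init grow_step[OF D0] in auto)
  then show ?thesis by blast
qed

definition part_ok :: "(real \<times> real) list \<Rightarrow> bool" where
  "part_ok F \<longleftrightarrow> (\<exists>U. grown F U) \<and> length F = length V \<and> roots (set F) = 1"

definition stage_inv :: "(real \<times> real) list \<Rightarrow> real list \<times> (real \<times> real) list \<times> (real \<times> real) list list \<Rightarrow> bool" where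
  "stage_inv D0 st \<longleftrightarrow> valid (fst (snd st)) \<and> connected_by (length (fst st)) (set (fst (snd st))) \<and>
     roots (set (fst (snd st))) = length (fst st) \<and> length (fst (snd st)) = length (fst st) * length V \<and>
     (\<forall>F\<in>set (snd (snd st)). part_ok F) \<and> distinct (concat (snd (snd st))) \<and>
     set (fst (snd st)) \<union> set (concat (snd (snd st))) = set D0 \<and>
     set (fst (snd st)) \<inter> set (concat (snd (snd st))) = {}"

lemma roots_union: "X \<inter> Y = {} \<Longrightarrow> finite X \<Longrightarrow> finite Y \<Longrightarrow> roots (X \<union> Y) = roots X + roots Y"
proof -
  assume a: "X \<inter> Y = {}" "finite X" "finite Y"
  have "{d \<in> X \<union> Y. fst d < 0} = {d \<in> X. fst d < 0} \<union> {d \<in> Y. fst d < 0}" by blast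
  then show ?thesis unfolding roots_def using a by (auto intro: card_Un_disjoint)
qed

text \<open>The new part contains at least one root arc, since growth starts at \<open>- 1\<close>.
  What remains keeps at least \<open>length ks\<close> of them by connectivity. The total is
  \<open>length ks + 1\<close>, so both bounds are attained.\<close>

lemma stage_step:
  assumes inv: "stage_inv D0 (k # ks, D, out)"
  shows "stage_inv D0 (stage T V (k # ks, D, out)) \<and> fst (stage T V (k # ks, D, out)) = ks \<and>
    length (snd (snd (stage T V (k # ks, D, out)))) = Suc (length out)"
proof -
  have I: "valid D" "connected_by (Suc (length ks)) (set D)" "roots (set D) = Suc (length ks)"
    "length D = Suc (length ks) * length V" "\<forall>F\<in>set out. part_ok F" "distinct (concat out)"
    "set D \<union> set (concat out) = set D0" "set D \<inter> set (concat out) = {}"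
    using inv by (auto simp: stage_inv_def)
  obtain D' F U where g: "(grow T V ks ^^ length V) (D, [], [- 1]) = (D', F, U)" by (metis prod.collapse)
  from grow_all[OF I(1,2)] have G: "valid D'" "connected_by (length ks) (set D')" "grown F U"
    "length F = length V" "set D' \<union> set F = set D" "set D' \<inter> set F = {}"
    unfolding g by (auto simp: grow_inv_def)
  have st: "stage T V (k # ks, D, out) = (ks, D', F # out)" by (simp add: stage_def g)
  have "F \<noteq> []" using G(4) V(2) by auto
  from grown_root[OF G(3) this] obtain a where a: "a \<in> set F" "- 1 \<in> A a" by blast
  have "fst a < 0"
  proof (rule ccontr)
    assume "\<not> fst a < 0"
    then have "0 \<le> fst a" "a \<in> set D" using a(1) G(5) by auto
    then have "A a \<subseteq> set V" using I(1) unfolding valid_def by blast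
    with a(2) V(3) show False by blast
  qed
  with a(1) have "{d \<in> set F. fst d < 0} \<noteq> {}" by blast
  then have "1 \<le> roots (set F)" unfolding roots_def by (simp add: Suc_le_eq card_gt_0_iff)
  moreover have "roots (set D) = roots (set D') + roots (set F)"
    using roots_union[OF G(6)] G(5) by simp
  moreover have "length ks \<le> roots (set D')" by (rule roots_ge[OF G(1,2)])
  ultimately have r: "roots (set F) = 1" "roots (set D') = length ks" using I(3) by auto
  have dF: "distinct F" using grown_set[OF G(3)] by (auto simp: distinct_map)
  have "distinct D" "distinct D'" using I(1) G(1) by (auto simp: valid_def distinct_map)
  then have "length D = length D' + length F"
    using G(5,6) dF by (metis card_Un_disjoint distinct_card finite_set)
  then have "length D' = length ks * length V" using I(4) G(4) by simp
  with G r dF I have "stage_inv D0 (ks, D', F # out)"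
    unfolding stage_inv_def part_ok_def by auto
  with st show ?thesis by simp
qed

theorem decompose_correct:
  assumes "valid D" "connected_by (length ks) (set D)" "roots (set D) = length ks"
    "length D = length ks * length V"
  defines "out \<equiv> decompose T V ks D"
  shows "length out = length ks" "\<And>F. F \<in> set out \<Longrightarrow> part_ok F" "distinct (concat out)" "set (concat out) = set D"
proof -
  have init: "stage_inv D (ks, D, [])" using assms(1-4) by (simp add: stage_inv_def)
  have "stage_inv D ((stage T V ^^ j) (ks, D, [])) \<and> fst ((stage T V ^^ j) (ks, D, [])) = drop j ks \<and>
      length (snd (snd ((stage T V ^^ j) (ks, D, [])))) = j" if "j \<le> length ks" for j
    using that
  proof (induction j)
    case (Suc j)
    let ?st = "(stage T V ^^ j) (ks, D, [])"
    obtain D' o' where st: "?st = (drop j ks, D', o')" using Suc by (metis Suc_leD prod.collapse)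
    have dr: "drop j ks = ks ! j # drop (Suc j) ks" using Suc.prems by (simp add: Cons_nth_drop_Suc)
    from stage_step[of D "ks ! j" "drop (Suc j) ks" D' o'] Suc st dr show ?case by simp
  qed (use init in simp)
  from this[of "length ks"] obtain D' where D': "stage_inv D ([], D', out)" "length out = length ks"
    unfolding out_def decompose_def by (metis drop_all order_refl prod.collapse)
  then show "length out = length ks" by simp
  from D'(1) have "D' = []" by (simp add: stage_inv_def)
  with D'(1) show "\<And>F. F \<in> set out \<Longrightarrow> part_ok F" "distinct (concat out)" "set (concat out) = set D"
    by (auto simp: stage_inv_def)
qed

end


section \<open>The two matroids of an instance\<close>

definition orient :: "row list \<Rightarrow> real list \<Rightarrow> real list \<Rightarrow> (real \<times> real) list" where
  "orient T slots I = concat (map (\<lambda>s. map (\<lambda>it. (fst it, svert s)) (socc s))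
     (snd (hall (map (\<lambda>i. (i, heads_of T i)) I) slots)))"

lemma length_filter_card: "distinct D \<Longrightarrow> length (filter P D) = card {d \<in> set D. P d}"
  by (metis distinct_card distinct_filter set_filter)

text \<open>\<open>cap v\<close> is the number of entering arcs allowed at \<open>v\<close> besides
  mandatory root arcs, and \<open>K\<close> limits the optional root arcs. The slot lists matter
  only through the number of slots that they offer to each set of vertices.\<close>

locale network =
  fixes V :: "real list" and T :: "row list" and ks sl1 sl2 :: "real list"
    and cap :: "real \<Rightarrow> nat" and K :: nat
  assumes V: "distinct V" "V \<noteq> []" "- 1 \<notin> set V"
    and ids: "distinct (map fst T)"
    and span_edge: "i \<in> set (map fst T) \<Longrightarrow> 0 \<le> i \<Longrightarrow> set (span_of T i) \<subseteq> set V \<and> span_of T i \<noteq> []"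
    and span_root: "i \<in> set (map fst T) \<Longrightarrow> i < 0 \<Longrightarrow> span_of T i = [- 1]"
    and heads: "i \<in> set (map fst T) \<Longrightarrow> set (heads_of T i) \<subseteq> set V \<and> heads_of T i \<noteq> []"
    and heads_span: "i \<in> set (map fst T) \<Longrightarrow> 0 \<le> i \<Longrightarrow> set (heads_of T i) \<subseteq> set (span_of T i)"
    and sl1: "slots_in X sl1 = length ks * card (X \<inter> set V) + (if - 1 \<in> X then K else 0)"
    and sl2: "slots_in X sl2 = (\<Sum>v\<in>X \<inter> set V. cap v)"
begin

abbreviation S where "S \<equiv> map fst T"
abbreviation k where "k \<equiv> length ks"

text \<open>The span of a root arc is \<open>{- 1}\<close>. This set meets no subset of
  \<open>V\<close>, so its separate bound \<open>K\<close> does not interfere with the inequality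
  for intersecting sets.\<close>

definition bound1 :: "real set \<Rightarrow> nat" where
  "bound1 X = (if X = {- 1} then K else k * (card X - 1))"

lemma span_cases:
  assumes "i \<in> set S"
  obtains "0 \<le> i" "set (span_of T i) \<subseteq> set V" "set (span_of T i) \<noteq> {}"
    "\<not> set (span_of T i) \<subseteq> {- 1}"
  | "i < 0" "set (span_of T i) = {- 1}"
proof (cases "i < 0")
  case True
  then show thesis using span_root[OF assms] that(2) by simp
next
  case False
  then have a: "set (span_of T i) \<subseteq> set V" "span_of T i \<noteq> []" using span_edge[OF assms] by auto
  then have "\<not> set (span_of T i) \<subseteq> {- 1}" using V(3) by (auto simp: subset_singleton_iff)
  then show thesis using a False that(1) by simp
qed

sublocale M1: counting "set S" "insert (- 1) (set V)" "\<lambda>i. set (span_of T i)"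
  "{X. X \<subseteq> set V \<and> X \<noteq> {}} \<union> {{- 1}}" bound1
proof
  show "{X. X \<subseteq> set V \<and> X \<noteq> {}} \<union> {{- 1}} \<subseteq> Pow (insert (- 1) (set V))" by auto
  show "set (span_of T i) \<noteq> {}" if "i \<in> set S" for i
    by (rule span_cases[OF that]) auto
  fix X Y :: "real set"
  assume XY: "X \<in> {X. X \<subseteq> set V \<and> X \<noteq> {}} \<union> {{- 1}}" "Y \<in> {X. X \<subseteq> set V \<and> X \<noteq> {}} \<union> {{- 1}}" "X \<inter> Y \<noteq> {}"
  show "X \<union> Y \<in> {X. X \<subseteq> set V \<and> X \<noteq> {}} \<union> {{- 1}} \<and> X \<inter> Y \<in> {X. X \<subseteq> set V \<and> X \<noteq> {}} \<union> {{- 1}} \<and>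
    bound1 (X \<union> Y) + bound1 (X \<inter> Y) \<le> bound1 X + bound1 Y"
  proof (cases "X = {- 1} \<or> Y = {- 1}")
    case True
    with XY V(3) have "X = {- 1}" "Y = {- 1}" by auto
    then show ?thesis by simp
  next
    case False
    with XY have s: "X \<subseteq> set V" "Y \<subseteq> set V" "X \<noteq> {}" "Y \<noteq> {}" by auto
    then have fin: "finite X" "finite Y" using finite_subset by blast+
    have ne: "X \<union> Y \<noteq> {- 1}" "X \<inter> Y \<noteq> {- 1}" using s V(3) by auto
    have pos: "0 < card X" "0 < card Y" "0 < card (X \<union> Y)" "0 < card (X \<inter> Y)"
      using fin s XY(3) by (auto simp: card_gt_0_iff)
    have "card (X \<union> Y) - 1 + (card (X \<inter> Y) - 1) = card X - 1 + (card Y - 1)"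
      using card_Un_Int[OF fin] pos by linarith
    then have "k * (card (X \<union> Y) - 1) + k * (card (X \<inter> Y) - 1) = k * (card X - 1) + k * (card Y - 1)"
      by (metis distrib_left)
    then show ?thesis using False ne s XY(3) by (auto simp: bound1_def)
  qed
qed simp_all

sublocale M2: counting "set S" "set V" "\<lambda>i. set (heads_of T i)" "Pow (set V)" "\<lambda>X. \<Sum>v\<in>X. cap v"
proof
  show "set (heads_of T i) \<noteq> {}" if "i \<in> set S" for i using heads[OF that] by simp
  fix X Y assume XY: "X \<in> Pow (set V)" "Y \<in> Pow (set V)"
  then have "finite X" "finite Y" using finite_subset by auto
  then have "(\<Sum>v\<in>X \<union> Y. cap v) + (\<Sum>v\<in>X \<inter> Y. cap v) = (\<Sum>v\<in>X. cap v) + (\<Sum>v\<in>Y. cap v)"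
    by (rule sum.union_inter)
  with XY show "X \<union> Y \<in> Pow (set V) \<and> X \<inter> Y \<in> Pow (set V) \<and>
      (\<Sum>v\<in>X \<union> Y. cap v) + (\<Sum>v\<in>X \<inter> Y. cap v) \<le> (\<Sum>v\<in>X. cap v) + (\<Sum>v\<in>Y. cap v)"
    by (simp add: le_infI1)
qed simp_all

lemma inside_map: "distinct I \<Longrightarrow> inside X (map (\<lambda>i. (i, L i)) I) = card {i \<in> set I. set (L i) \<subseteq> X}"
  by (simp add: filter_map comp_def length_filter_card)

lemma test_heads_iff:
  assumes I: "distinct I" "set I \<subseteq> set S"
  shows "test_heads T sl2 I \<longleftrightarrow> M2.sparse (set I)"
proof -
  have "inside X (map (\<lambda>i. (i, heads_of T i)) I) = M2.count (set I) (X \<inter> set V)" for X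
  proof -
    have "set (heads_of T i) \<subseteq> set V" if "i \<in> set I" for i using heads I(2) that by blast
    then have "{i \<in> set I. set (heads_of T i) \<subseteq> X} = {i \<in> set I. set (heads_of T i) \<subseteq> X \<inter> set V}"
      by blast
    then show ?thesis
      unfolding inside_map[OF I(1), of X "heads_of T"] M2.count_def by (rule arg_cong[of _ _ card])
  qed
  then have "test_heads T sl2 I \<longleftrightarrow> (\<forall>X. M2.count (set I) (X \<inter> set V) \<le> (\<Sum>v\<in>X \<inter> set V. cap v))"
    unfolding test_heads_def hall_iff sl2 by simp
  also have "\<dots> \<longleftrightarrow> (\<forall>X\<in>Pow (set V). M2.count (set I) X \<le> (\<Sum>v\<in>X. cap v))"
    by (metis Pow_iff inf.absorb1 inf_le2)
  finally show ?thesis unfolding M2.sparse_def using I(2) by blast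
qed

lemma span_count_split:
  assumes "set I \<subseteq> set S"
  shows "card {i \<in> set I. set (span_of T i) \<subseteq> X} =
    M1.count (set I) (X \<inter> set V) + (if - 1 \<in> X then M1.count (set I) {- 1} else 0)"
proof -
  let ?a = "{i \<in> set I. set (span_of T i) \<subseteq> X \<inter> set V}"
  let ?b = "if - 1 \<in> X then {i \<in> set I. set (span_of T i) \<subseteq> {- 1}} else {}"
  have "i \<in> {i \<in> set I. set (span_of T i) \<subseteq> X} \<longleftrightarrow> i \<in> ?a \<union> ?b" for i
  proof (cases "i \<in> set I")
    case True
    then have "i \<in> set S" using assms by blast
    then show ?thesis using True V(3) by (cases rule: span_cases) auto
  qed auto
  then have "{i \<in> set I. set (span_of T i) \<subseteq> X} = ?a \<union> ?b" by blast
  moreover have "?a \<inter> ?b = {}"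
  proof -
    have False if "i \<in> ?a" "i \<in> ?b" for i
    proof -
      from that(1) assms have "i \<in> set S" by blast
      then show False using that V(3) by (cases rule: span_cases) (auto split: if_splits)
    qed
    then show ?thesis by blast
  qed
  ultimately have "card {i \<in> set I. set (span_of T i) \<subseteq> X} = card ?a + card ?b"
    by (simp add: card_Un_disjoint del: if_image_distrib)
  then show ?thesis by (simp add: M1.count_def)
qed

text \<open>Running over all \<open>x\<close> in \<open>V\<close> covers every nonempty subset of
  \<open>V\<close>, and the set \<open>{- 1}\<close> in Hall's condition isolates the bound
  \<open>K\<close>.\<close>

lemma test_span_iff:
  assumes I: "distinct I" "set I \<subseteq> set S"
  shows "test_span T V ks sl1 I \<longleftrightarrow> M1.sparse (set I)"
proof -
  have ins: "inside X (map (\<lambda>i. (i, span_of T i)) I @ map (\<lambda>j. (j, [x])) ks) =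
      M1.count (set I) (X \<inter> set V) + (if - 1 \<in> X then M1.count (set I) {- 1} else 0) +
      (if x \<in> X then k else 0)" for X x
    using span_count_split[OF I(2), of X] inside_map[OF I(1), of X "span_of T"]
    by (simp add: filter_map comp_def)
  have test: "test_span T V ks sl1 I \<longleftrightarrow> (\<forall>x\<in>set V. \<forall>X.
      M1.count (set I) (X \<inter> set V) + (if - 1 \<in> X then M1.count (set I) {- 1} else 0) +
      (if x \<in> X then k else 0) \<le> k * card (X \<inter> set V) + (if - 1 \<in> X then K else 0))"
    unfolding test_span_def hall_iff ins sl1 ..
  have bV: "bound1 X = k * (card X - 1)" if "X \<subseteq> set V" for X
    using that V(3) by (auto simp: bound1_def)
  have sparse: "M1.sparse (set I) \<longleftrightarrow>
      (\<forall>X. X \<subseteq> set V \<longrightarrow> X \<noteq> {} \<longrightarrow> M1.count (set I) X \<le> k * (card X - 1)) \<and> M1.count (set I) {- 1} \<le> K"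
  proof -
    have "M1.sparse (set I) \<longleftrightarrow>
      (\<forall>X. X \<subseteq> set V \<longrightarrow> X \<noteq> {} \<longrightarrow> M1.count (set I) X \<le> bound1 X) \<and> M1.count (set I) {- 1} \<le> bound1 {- 1}"
      unfolding M1.sparse_def using I(2) by blast
    moreover have "bound1 {- 1} = K" by (simp add: bound1_def)
    ultimately show ?thesis using bV by simp
  qed
  show ?thesis
  proof
    assume t: "test_span T V ks sl1 I"
    have "M1.count (set I) X \<le> k * (card X - 1)" if X: "X \<subseteq> set V" "X \<noteq> {}" for X
    proof -
      from X obtain x where x: "x \<in> X" "x \<in> set V" by blast
      have e: "X \<inter> set V = X" "- 1 \<notin> X" using X V(3) by auto
      from t[unfolded test, rule_format, OF x(2), of X] x(1) e
      have "M1.count (set I) X + k \<le> k * card X" by simp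
      then show ?thesis by (simp add: right_diff_distrib')
    qed
    moreover have "M1.count (set I) {- 1} \<le> K"
    proof -
      obtain x where x: "x \<in> set V" using V(2) by (cases V) auto
      have "{- 1} \<inter> set V = {}" "x \<noteq> - 1" using x V(3) by auto
      with t[unfolded test, rule_format, OF x, of "{- 1}"] show ?thesis by simp
    qed
    ultimately show "M1.sparse (set I)" unfolding sparse by blast
  next
    assume sp: "M1.sparse (set I)"
    show "test_span T V ks sl1 I" unfolding test
    proof (intro ballI allI)
      fix x X assume x: "x \<in> set V"
      let ?X = "X \<inter> set V"
      have "M1.count (set I) ?X + (if x \<in> X then k else 0) \<le> k * card ?X"
      proof (cases "?X = {}")
        case True
        have "set (span_of T i) \<noteq> {}" if "i \<in> set I" for i using M1.A_nonempty I(2) that by blast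
        then have "{i \<in> set I. set (span_of T i) \<subseteq> {}} = {}" by auto
        with True x show ?thesis by (auto simp: M1.count_def)
      next
        case False
        with sp have "M1.count (set I) ?X \<le> k * (card ?X - 1)" unfolding sparse by blast
        moreover have "k * (card ?X - 1) + k = k * card ?X"
          using False by (simp add: right_diff_distrib' card_gt_0_iff Suc_le_eq)
        ultimately show ?thesis by simp
      qed
      moreover have "M1.count (set I) {- 1} \<le> K" using sp unfolding sparse by blast
      ultimately show "M1.count (set I) ?X + (if - 1 \<in> X then M1.count (set I) {- 1} else 0) +
          (if x \<in> X then k else 0) \<le> k * card ?X + (if - 1 \<in> X then K else 0)"
        by simp
    qed
  qed
qed

sublocale two_matroids S M1.sparse M2.sparse "test_span T V ks sl1" "test_heads T sl2" "weight_of T"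
proof -
  interpret m1: matroid "set S" M1.sparse by (rule M1.matroid_sparse)
  interpret m2: matroid "set S" M2.sparse by (rule M2.matroid_sparse)
  show "two_matroids S M1.sparse M2.sparse (test_span T V ks sl1) (test_heads T sl2)"
    by unfold_locales (use ids test_span_iff test_heads_iff in auto)
qed

text \<open>There are as many items as slots, so every slot has exactly one occupant and the heads
  are, in order, the slots themselves.\<close>

lemma orient_props:
  assumes I: "distinct I" "set I \<subseteq> set S" "M2.sparse (set I)" "length I = length sl2"
  defines "D \<equiv> orient T sl2 I"
  shows "mset (map fst D) = mset I" "map snd D = sl2" "\<And>d. d \<in> set D \<Longrightarrow> snd d \<in> set (heads_of T (fst d))"
proof -
  let ?items = "map (\<lambda>i. (i, heads_of T i)) I"
  define sl where "sl = snd (hall ?items sl2)"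
  have "test_heads T sl2 I" using test_heads_iff[OF I(1,2)] I(3) by simp
  then have "fst (hall ?items sl2) = []" by (simp add: test_heads_def)
  note H = hall_success[OF this, folded sl_def]
  have D: "D = concat (map (\<lambda>s. map (\<lambda>it. (fst it, svert s)) (socc s)) sl)"
    by (simp add: D_def orient_def sl_def)
  have "map fst D = map fst (concat (map socc sl))"
    unfolding D map_concat map_map comp_def fst_conv by simp
  then have "mset (map fst D) = image_mset fst (mset (concat (map socc sl)))" by simp
  also have "\<dots> = mset I" unfolding H(2) by (simp add: multiset.map_comp comp_def)
  finally show "mset (map fst D) = mset I" .
  have "length (concat (map socc sl)) = length sl"
    using arg_cong[OF H(2), of size] I(4) H(1) by (metis length_map size_mset)
  moreover have "length (socc s) \<le> 1" if "s \<in> set sl" for s using H(3)[OF that] by auto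
  ultimately have one: "length (socc s) = 1" if "s \<in> set sl" for s
  proof -
    assume le: "length (concat (map socc sl)) = length sl" "\<And>s. s \<in> set sl \<Longrightarrow> length (socc s) \<le> 1"
    from le that show "length (socc s) = 1"
    proof (induction sl)
      case (Cons a sl)
      have "length (concat (map socc sl)) \<le> length sl"
        using Cons.prems(2) by (simp add: length_concat comp_def sum_list_mono[of sl "\<lambda>s. length (socc s)" "\<lambda>_. 1", simplified sum_list_triv, simplified])
      with Cons.prems(1) Cons.prems(2)[of a] have "length (socc a) = 1" "length (concat (map socc sl)) = length sl"
        by auto
      with Cons show ?case by auto
    qed simp
  qed
  have "map (\<lambda>it. svert s) (socc s) = [svert s]" if "s \<in> set sl" for s
    using one[OF that] by (cases "socc s") auto
  then have "map (\<lambda>s. map (\<lambda>it. svert s) (socc s)) sl = map (\<lambda>s. [svert s]) sl" by simp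
  then have "concat (map (\<lambda>s. map (\<lambda>it. svert s) (socc s)) sl) = map svert sl"
    by (simp only: concat_map_singleton)
  then show "map snd D = sl2" unfolding D H(1)[symmetric] map_concat map_map comp_def by simp
  show "snd d \<in> set (heads_of T (fst d))" if d: "d \<in> set D" for d
  proof -
    from d obtain s it where s: "s \<in> set sl" "it \<in> set (socc s)" "d = (fst it, svert s)"
      unfolding D by auto
    from H(3)[OF s(1)] s(2) have "svert s \<in> set (snd it)" by auto
    moreover have "it \<in># mset (concat (map socc sl))" using s by auto
    then have "it \<in> set ?items" unfolding H(2) by simp
    then have "snd it = heads_of T (fst it)" by auto
    ultimately show ?thesis using s(3) by simp
  qed
qed

sublocale decomposition V T
  by unfold_locales (rule V)+

text \<open>\<open>M\<close> holds the mandatory root arcs. They complete the degree at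
  \<open>v\<close> from \<open>cap v\<close> to \<open>k\<close>, and with at most \<open>K\<close>
  optional ones there are at most \<open>k\<close> root arcs in all; connectivity shows that there
  are at least as many.\<close>

lemma common_base_decomposes:
  assumes I: "distinct I" "set I \<subseteq> set S" "M1.sparse (set I)" "M2.sparse (set I)" "length I = length sl2"
    and M: "distinct (map fst M)" "\<And>d. d \<in> set M \<Longrightarrow> fst d < 0 \<and> snd d \<in> set V \<and> fst d \<notin> set I"
    and deg: "\<And>v. v \<in> set V \<Longrightarrow> card {d \<in> set M. snd d = v} + cap v = k"
    and len: "length M + K = k"
  defines "D \<equiv> orient T sl2 I @ M"
  defines "out \<equiv> decompose T V ks D"
  shows "length out = k" "\<And>F. F \<in> set out \<Longrightarrow> part_ok F" "distinct (concat out)" "set (concat out) = set D"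
    and "inj_on fst (set D)" "\<And>d. d \<in> set D \<Longrightarrow> snd d \<in> set V"
    and "\<And>d. d \<in> set (orient T sl2 I) \<Longrightarrow> fst d \<in> set I \<and> snd d \<in> set (heads_of T (fst d))"
    and "fst ` set (orient T sl2 I) = set I"
proof -
  let ?O = "orient T sl2 I"
  note O = orient_props[OF I(1,2,4,5)]
  have sO: "set (map fst ?O) = set I" by (metis O(1) mset_eq_setD)
  have dO: "distinct (map fst ?O)" using O(1) I(1) by (metis mset_eq_imp_distinct_iff)
  have dD: "distinct (map fst D)"
    using dO M sO by (auto simp: D_def)
  then have distD: "distinct D" by (simp add: distinct_map)
  have distO: "distinct ?O" "distinct M" using dO M(1) by (simp_all add: distinct_map)
  have memO: "fst d \<in> set I" "fst d \<in> set S" "snd d \<in> set (heads_of T (fst d))" "snd d \<in> set V"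
    if d: "d \<in> set ?O" for d
  proof -
    show "fst d \<in> set I" using d sO by auto
    then show "fst d \<in> set S" using I(2) by blast
    from heads[OF this] O(3)[OF d] show "snd d \<in> set (heads_of T (fst d))" "snd d \<in> set V" by auto
  qed
  have valid: "valid D" unfolding valid_def
  proof (intro conjI ballI impI)
    fix d assume d: "d \<in> set D"
    then show "snd d \<in> set V" using M(2)[of d] memO(4)[of d] by (auto simp: D_def)
    assume pos: "0 \<le> fst d"
    with d M(2)[of d] have "d \<in> set ?O" by (auto simp: D_def)
    note m = memO[OF this]
    have A: "A d = set (span_of T (fst d))" using pos by (simp add: tails_of_def)
    show "A d \<subseteq> set V" using span_edge[OF m(2) pos] A by simp
    show "snd d \<in> A d" using heads_span[OF m(2) pos] m(3) A by blast
  qed (rule dD)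
  have deg1: "card {d \<in> set D. snd d = v} = k" if v: "v \<in> set V" for v
  proof -
    have "card {d \<in> set ?O. snd d = v} = length (filter (\<lambda>d. snd d = v) ?O)"
      using length_filter_card[OF distO(1)] by simp
    also have "\<dots> = slots_in {v} (map snd ?O)" by (simp add: filter_map comp_def)
    also have "\<dots> = cap v" unfolding O(2) sl2 using v by simp
    finally have c: "card {d \<in> set ?O. snd d = v} = cap v" .
    have "{d \<in> set D. snd d = v} = {d \<in> set ?O. snd d = v} \<union> {d \<in> set M. snd d = v}"
      by (auto simp: D_def)
    moreover have "{d \<in> set ?O. snd d = v} \<inter> {d \<in> set M. snd d = v} = {}"
      using memO(1) M(2) by blast
    ultimately show ?thesis using c deg[OF v] by (simp add: card_Un_disjoint)
  qed
  have degX: "card {d \<in> set D. snd d \<in> X} = k * card X" if X: "X \<subseteq> set V" for X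
  proof -
    have fX: "finite X" using X finite_subset by blast
    have "{d \<in> set D. snd d \<in> X} = (\<Union>v\<in>X. {d \<in> set D. snd d = v})" by blast
    also have "card \<dots> = (\<Sum>v\<in>X. card {d \<in> set D. snd d = v})"
      using fX by (intro card_UN_disjoint) auto
    also have "\<dots> = (\<Sum>v\<in>X. k)" using deg1 X by (intro sum.cong) auto
    finally show ?thesis by simp
  qed
  have conn: "connected_by k (set D)" unfolding connected_by_def
  proof (intro allI impI)
    fix X assume X: "X \<subseteq> set V" "X \<noteq> {}"
    let ?ins = "{d \<in> set D. 0 \<le> fst d \<and> A d \<subseteq> X}"
    have "fst ` ?ins \<subseteq> {i \<in> set I. set (span_of T i) \<subseteq> X}"
    proof
      fix i assume "i \<in> fst ` ?ins"
      then obtain d where d: "d \<in> set D" "0 \<le> fst d" "A d \<subseteq> X" "i = fst d" by blast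
      then have "d \<in> set ?O" using M(2)[of d] by (auto simp: D_def)
      with memO(1) d show "i \<in> {i \<in> set I. set (span_of T i) \<subseteq> X}" by (auto simp: tails_of_def)
    qed
    then have "card (fst ` ?ins) \<le> M1.count (set I) X"
      unfolding M1.count_def by (intro card_mono) auto
    moreover have "card (fst ` ?ins) = card ?ins"
      using dD by (intro card_image) (auto simp: distinct_map intro: inj_on_subset)
    moreover have "M1.count (set I) X \<le> k * (card X - 1)"
    proof -
      have "M1.count (set I) X \<le> bound1 X" using I(3) X unfolding M1.sparse_def by blast
      moreover have "X \<noteq> {- 1}" using X V(3) by auto
      ultimately show ?thesis by (simp add: bound1_def)
    qed
    moreover have "k * (card X - 1) + k = k * card X"
      using X finite_subset[OF X(1)] by (simp add: right_diff_distrib' card_gt_0_iff Suc_le_eq)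
    ultimately show "k \<le> enter (set D) X"
      using enter_inside[OF valid X(1)] degX[OF X(1)] by linarith
  qed
  have lenD: "length D = k * length V"
  proof -
    have "{d \<in> set D. snd d \<in> set V} = set D" using valid by (auto simp: valid_def)
    then have "card (set D) = k * card (set V)" using degX[of "set V"] by simp
    then show ?thesis using distD V(1) by (simp add: distinct_card)
  qed
  have "roots (set D) = k"
  proof (rule antisym)
    have "{d \<in> set D. fst d < 0} \<subseteq> {d \<in> set ?O. fst d < 0} \<union> set M" by (auto simp: D_def)
    then have "roots (set D) \<le> card ({d \<in> set ?O. fst d < 0} \<union> set M)"
      unfolding roots_def by (intro card_mono) auto
    also have "\<dots> \<le> card {d \<in> set ?O. fst d < 0} + card (set M)" by (rule card_Un_le)
    also have "card (set M) = length M" using distO(2) by (rule distinct_card)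
    also have "card {d \<in> set ?O. fst d < 0} = card (fst ` {d \<in> set ?O. fst d < 0})"
      using dO by (intro card_image[symmetric]) (auto simp: distinct_map intro: inj_on_subset)
    also have "\<dots> \<le> M1.count (set I) {- 1}"
      unfolding M1.count_def using memO(1,2) span_root by (intro card_mono) auto
    also have "\<dots> \<le> bound1 {- 1}" using I(3) unfolding M1.sparse_def by blast
    also have "\<dots> = K" by (simp add: bound1_def)
    finally show "roots (set D) \<le> k" using len by simp
    show "k \<le> roots (set D)" by (rule roots_ge[OF valid conn])
  qed
  note R = decompose_correct[OF valid conn this lenD, folded out_def]
  show "length out = k" "\<And>F. F \<in> set out \<Longrightarrow> part_ok F" "distinct (concat out)" "set (concat out) = set D"
    by (rule R; assumption)+
  show "inj_on fst (set D)" using dD by (simp add: distinct_map)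
  show "snd d \<in> set V" if "d \<in> set D" for d using valid that by (simp add: valid_def)
  show "fst d \<in> set I \<and> snd d \<in> set (heads_of T (fst d))" if "d \<in> set ?O" for d using memO(1,3)[OF that] by blast
  show "fst ` set ?O = set I" using sO by simp
qed

end


section \<open>The algorithm\<close>

type_synonym vrow = "real \<times> real \<times> real"
type_synonym drow = "real \<times> real \<times> real \<times> real list"
type_synonym hrow = "real \<times> real \<times> real list"

text \<open>
  Counting up to \<open>k\<close> takes time exponential in its binary length. With at least two vertices a
  packing uses at least \<open>k\<close> edges, so a list of \<open>k\<close> units can be cut out of the list of edges.
\<close>

definition units :: "drow list \<Rightarrow> hrow list \<Rightarrow> real \<Rightarrow> real list" where
  "units ds hs k = filter (\<lambda>j. j < k) (map fst (enum (map fst ds @ map fst hs)))"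

text \<open>For \<open>ks = 0, ..., k - 1\<close> the filter leaves \<open>min k (g v) - f v\<close>
  copies of the vertex. Filtering a list of units replaces the subtraction and the loops that would
  otherwise be needed.\<close>

definition free_roots :: "vrow list \<Rightarrow> real list \<Rightarrow> real list" where
  "free_roots vs ks = concat (map (\<lambda>r. map (\<lambda>_. fst r) (filter (\<lambda>j. fst (snd r) \<le> j \<and> j < snd (snd r)) ks)) vs)"

definition fixed_roots :: "vrow list \<Rightarrow> real list \<Rightarrow> real list" where
  "fixed_roots vs ks = concat (map (\<lambda>r. map (\<lambda>_. fst r) (filter (\<lambda>j. j < fst (snd r)) ks)) vs)"

definition demand :: "vrow list \<Rightarrow> real" where
  "demand vs = (\<Sum>r\<leftarrow>vs. fst (snd r))"

text \<open>The slots at \<open>- 1\<close> limit the optional root arcs to \<open>k\<close> minus the sum of \<open>f\<close>.\<close>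

definition slots1 :: "vrow list \<Rightarrow> real list \<Rightarrow> real list" where
  "slots1 vs ks = concat (map (\<lambda>r. map (\<lambda>_. fst r) ks) vs) @ map (\<lambda>_. - 1) (filter (\<lambda>j. demand vs \<le> j) ks)"

definition slots2 :: "vrow list \<Rightarrow> real list \<Rightarrow> real list" where
  "slots2 vs ks = concat (map (\<lambda>r. map (\<lambda>_. fst r) (filter (\<lambda>j. fst (snd r) \<le> j) ks)) vs)"

text \<open>Optional root arcs are named \<open>- 1, - 2, ...\<close>. They weigh 0, so that the
  weight of a common independent set is that of its edges. A name may equal the number of the extra
  vertex, but names and vertices are never compared.\<close>

definition table :: "drow list \<Rightarrow> hrow list \<Rightarrow> real list \<Rightarrow> row list" where
  "table ds hs os =
     map (\<lambda>d. (fst d, fst (snd d), fst (snd (snd d)) # snd (snd (snd d)), [fst (snd (snd d))])) ds @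
     map (\<lambda>h. (fst h, fst (snd h), snd (snd h), snd (snd h))) hs @
     map (\<lambda>p. (- 1 - fst p, 0, [- 1], [snd p])) (enum os)"

definition base :: "row list \<Rightarrow> real list \<Rightarrow> real list \<Rightarrow> real list \<Rightarrow> real list \<Rightarrow> real list" where
  "base T V ks sl1 sl2 = common_opt (test_span T V ks sl1) (test_heads T sl2) (weight_of T) (map fst T)"

definition len :: "'b list \<Rightarrow> real" where
  "len l = (\<Sum>_\<leftarrow>l. 1)"

text \<open>The names of the mandatory root arcs continue below those of the optional ones.\<close>

definition fixed_arcs :: "real list \<Rightarrow> real list \<Rightarrow> (real \<times> real) list" where
  "fixed_arcs os fs = map (\<lambda>p. (- 1 - fst p - len os, snd p)) (enum fs)"

text \<open>A part has exactly one root arc, so the sum is the head of that arc, the root. The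
  multiplicity is 1.\<close>

definition entry :: "(real \<times> real) list \<Rightarrow> data" where
  "entry P = Node (Num 1) (Node (Num (\<Sum>d\<leftarrow>P. if fst d < 0 then snd d else 0))
     (Node (eL Num (map fst (filter (\<lambda>d. 0 \<le> fst d) P))) Empty))"

text \<open>The list of units is shorter than \<open>k\<close> if there are too few edges. The
  conditions on \<open>f\<close> are necessary for a packing and ensure that the truncated
  differences behind the slot lists mean what they should. The last test asks whether the common
  independent set fills all slots.\<close>

definition solve_many :: "vrow list \<Rightarrow> real list \<Rightarrow> row list \<Rightarrow> real list \<Rightarrow> real list \<Rightarrow> real list \<Rightarrow> real list \<Rightarrow> real \<Rightarrow> data" where
  "solve_many vs ks T os fs sl2 I k =
     (if len ks = k \<and> (\<forall>r\<in>set vs. fst (snd r) \<le> k \<and> fst (snd r) \<le> snd (snd r)) \<and> demand vs \<le> k \<and> len I = len sl2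
      then Node (eL entry (decompose T (map fst vs) ks (orient T sl2 I @ fixed_arcs os fs))) Empty
      else Empty)"

definition solve :: "vrow list \<Rightarrow> drow list \<Rightarrow> hrow list \<Rightarrow> real \<Rightarrow> data" where
  "solve vs ds hs k = (case vs of [] \<Rightarrow> Empty | r # rs \<Rightarrow>
     if rs = [] then
       if fst (snd r) \<le> k \<and> k \<le> snd (snd r)
       then Node (Node (Node (Num k) (Node (Num (fst r)) (Node Empty Empty))) Empty) Empty
       else Empty
     else
       solve_many vs (units ds hs k) (table ds hs (free_roots vs (units ds hs k))) (free_roots vs (units ds hs k))
         (fixed_roots vs (units ds hs k)) (slots2 vs (units ds hs k))
         (base (table ds hs (free_roots vs (units ds hs k))) (map fst vs) (units ds hs k)
            (slots1 vs (units ds hs k)) (slots2 vs (units ds hs k))) k)"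

section \<open>Table rows and slot counts of an instance\<close>

lemma len_eq: "len l = real (length l)"
  by (simp add: len_def sum_list_triv)

lemma lookup_concat:
  "distinct (map fst T) \<Longrightarrow> r \<in> set T \<Longrightarrow> concat (map (\<lambda>r'. if fst r' = fst r then h r' else []) T) = h r"
proof (induction T)
  case (Cons a T)
  have "concat (map (\<lambda>r'. if fst r' = i then h r' else []) T) = []" if "i \<notin> fst ` set T" for i
    using that by (induction T) auto
  with Cons show ?case by (cases "a = r") (auto simp: image_iff)
qed simp

lemma span_of_row: "distinct (map fst T) \<Longrightarrow> (i, a, b, c) \<in> set T \<Longrightarrow> span_of T i = b"
  using lookup_concat[of T "(i, a, b, c)" "\<lambda>r. fst (snd (snd r))"] by (simp add: span_of_def)

lemma heads_of_row: "distinct (map fst T) \<Longrightarrow> (i, a, b, c) \<in> set T \<Longrightarrow> heads_of T i = c"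
  using lookup_concat[of T "(i, a, b, c)" "\<lambda>r. snd (snd (snd r))"] by (simp add: heads_of_def)

lemma weight_of_row: "distinct (map fst T) \<Longrightarrow> (i, a, b, c) \<in> set T \<Longrightarrow> weight_of T i = a"
proof -
  assume a: "distinct (map fst T)" "(i, a, b, c) \<in> set T"
  have "(\<Sum>r\<leftarrow>T. if fst r = i then fst (snd r) else 0) = sum_list (concat (map (\<lambda>r. if fst r = i then [fst (snd r)] else []) T))"
    by (induction T) auto
  also have "\<dots> = a" using lookup_concat[OF a, of "\<lambda>r. [fst (snd r)]"] by simp
  finally show ?thesis by (simp add: weight_of_def)
qed

lemma length_filter_real_upt: "length (filter (\<lambda>j. P j) (map real [0..<k])) = card {j. j < k \<and> P (real j)}"
  unfolding length_filter_conv_card by (rule arg_cong[of _ _ card]) auto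

lemma slots_in_copies:
  assumes "distinct (map fst vs)"
  shows "slots_in X (concat (map (\<lambda>r. map (\<lambda>_. fst r) (L r)) vs)) =
    (\<Sum>r\<in>{r \<in> set vs. fst r \<in> X}. length (L r))"
proof -
  have "slots_in X (concat (map (\<lambda>r. map (\<lambda>_. fst r) (L r)) vs)) = (\<Sum>r\<leftarrow>vs. if fst r \<in> X then length (L r) else 0)"
    by (induction vs) (auto simp: filter_map comp_def)
  also have "\<dots> = (\<Sum>r\<in>set vs. if fst r \<in> X then length (L r) else 0)"
    using assms by (simp add: sum_list_distinct_conv_sum_set distinct_map)
  also have "\<dots> = (\<Sum>r\<in>{r \<in> set vs. fst r \<in> X}. length (L r))"
    by (simp add: sum.inter_filter)
  finally show ?thesis .
qed

locale inst =
  fixes F :: "(nat, nat) mixed_hypergraph" and k :: nat and f g :: "nat \<Rightarrow> nat" and w :: "nat \<Rightarrow> real"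
  assumes wf: "wf_mixed_hypergraph F"
begin

definition "vl = sorted_list_of_set (mverts F)"
definition "dl = sorted_list_of_set (dyperedges F)"
definition "hl = sorted_list_of_set (hyperedges F)"
definition "vs = map (\<lambda>v. (real v, real (f v), real (g v))) vl"
definition "ds = map (\<lambda>a. (real a, w a, real (dhead F a), map real (sorted_list_of_set (dtail F a)))) dl"
definition "hs = map (\<lambda>e. (real e, w e, map real (sorted_list_of_set (ends F e)))) hl"
abbreviation "E \<equiv> dyperedges F \<union> hyperedges F"
definition "ks = units ds hs (real k)"
definition "os = free_roots vs ks"
definition "fs = fixed_roots vs ks"
definition "T = table ds hs os"
definition "sl1 = slots1 vs ks"
definition "sl2 = slots2 vs ks"
definition "V = map fst vs"
text \<open>Vertices are real numbers on the machine; the floor returns to the vertex of the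
  instance.\<close>

definition "cap r = k - f (nat \<lfloor>r\<rfloor>)"

lemma fin: "finite (mverts F)" "finite (dyperedges F)" "finite (hyperedges F)" "finite E"
  "dyperedges F \<inter> hyperedges F = {}" "mverts F \<noteq> {}"
  using wf by (auto simp: wf_mixed_hypergraph_def)

lemma lists: "set vl = mverts F" "distinct vl" "set dl = dyperedges F" "distinct dl"
  "set hl = hyperedges F" "distinct hl"
  using fin by (simp_all add: vl_def dl_def hl_def)

lemma dyper: "a \<in> dyperedges F \<Longrightarrow> dhead F a \<in> mverts F \<and> dtail F a \<noteq> {} \<and> finite (dtail F a) \<and>
    dtail F a \<subseteq> mverts F \<and> dhead F a \<notin> dtail F a"
  using wf finite_subset[OF _ fin(1)] unfolding wf_mixed_hypergraph_def by blast

lemma hyper: "e \<in> hyperedges F \<Longrightarrow> ends F e \<subseteq> mverts F \<and> finite (ends F e) \<and> 2 \<le> card (ends F e)"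
  using wf finite_subset[OF _ fin(1)] unfolding wf_mixed_hypergraph_def by blast

lemma V_facts: "V = map real vl" "set V = real ` mverts F" "distinct V" "V \<noteq> []" "- 1 \<notin> set V" "length V = card (mverts F)"
proof -
  show 1: "V = map real vl" by (simp add: V_def vs_def comp_def)
  show 2: "set V = real ` mverts F" unfolding 1 using lists by simp
  show "distinct V" unfolding 1 using lists by (simp add: distinct_map)
  show "V \<noteq> []" unfolding 1 using lists fin by auto
  show "- 1 \<notin> set V" unfolding 2 by auto
  show "length V = card (mverts F)" unfolding 1 using lists by (metis distinct_card length_map)
qed

lemma T_ids: "map fst T = map real dl @ map real hl @ map (\<lambda>p. - 1 - fst p) (enum os)"
  by (simp add: T_def table_def ds_def hs_def comp_def)

lemma enum_ids: "map (\<lambda>p. - 1 - fst p) (enum os) = map (\<lambda>j. - 1 - real j) [0..<length os]"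
proof -
  have "map (\<lambda>p. - 1 - fst p) (enum os) = map (\<lambda>x. - 1 - x) (map fst (enum os))" by simp
  also have "map fst (enum os) = map real [0..<length os]" by (simp add: enum_def)
  finally show ?thesis by simp
qed

lemma T_set: "set (map fst T) = real ` E \<union> (\<lambda>j. - 1 - real j) ` {..<length os}"
  unfolding T_ids enum_ids using lists by auto

lemma T_distinct: "distinct (map fst T)"
  unfolding T_ids enum_ids using lists fin(5) by (auto simp: distinct_map inj_on_def)

lemma edge_row:
  assumes "e \<in> E"
  shows "set (span_of T (real e)) = real ` span_set F e" "set (heads_of T (real e)) = real ` head_set F e"
    "weight_of T (real e) = w e"
proof -
  have "set (span_of T (real e)) = real ` span_set F e \<and> set (heads_of T (real e)) = real ` head_set F e \<and>
    weight_of T (real e) = w e"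
  proof (cases "e \<in> dyperedges F")
    case True
    let ?tl = "map real (sorted_list_of_set (dtail F e))"
    have r: "(real e, w e, real (dhead F e) # ?tl, [real (dhead F e)]) \<in> set T"
      using True lists unfolding T_def table_def ds_def by (auto intro!: image_eqI[of _ _ e])
    then show ?thesis
      using span_of_row[OF T_distinct r] heads_of_row[OF T_distinct r] weight_of_row[OF T_distinct r]
        True dyper[OF True] by (auto simp: span_set_def head_set_def)
  next
    case False
    then have e: "e \<in> hyperedges F" using assms by blast
    let ?l = "map real (sorted_list_of_set (ends F e))"
    have r: "(real e, w e, ?l, ?l) \<in> set T"
      using e lists unfolding T_def table_def hs_def by (auto intro!: image_eqI[of _ _ e])
    then show ?thesis
      using span_of_row[OF T_distinct r] heads_of_row[OF T_distinct r] weight_of_row[OF T_distinct r]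
        False hyper[OF e] by (auto simp: span_set_def head_set_def)
  qed
  then show "set (span_of T (real e)) = real ` span_set F e" "set (heads_of T (real e)) = real ` head_set F e"
    "weight_of T (real e) = w e" by auto
qed

lemma root_row:
  assumes "j < length os"
  shows "span_of T (- 1 - real j) = [- 1]" "heads_of T (- 1 - real j) = [os ! j]" "weight_of T (- 1 - real j) = 0"
proof -
  have "(real j, os ! j) \<in> set (enum os)" unfolding enum_def set_zip using assms by force
  then have r: "(- 1 - real j, 0, [- 1], [os ! j]) \<in> set T" unfolding T_def table_def by force
  show "span_of T (- 1 - real j) = [- 1]" "heads_of T (- 1 - real j) = [os ! j]" "weight_of T (- 1 - real j) = 0"
    by (rule span_of_row[OF T_distinct r] heads_of_row[OF T_distinct r] weight_of_row[OF T_distinct r])+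
qed

lemma span_set_sub: "e \<in> E \<Longrightarrow> span_set F e \<subseteq> mverts F \<and> span_set F e \<noteq> {} \<and> head_set F e \<noteq> {} \<and> head_set F e \<subseteq> span_set F e"
  using dyper[of e] hyper[of e] by (auto simp: span_set_def head_set_def)

lemma id_cases:
  assumes "i \<in> set (map fst T)"
  obtains e where "e \<in> E" "i = real e" | j where "j < length os" "i = - 1 - real j"
  using assms unfolding T_set by auto

lemma os_set: "set os \<subseteq> set V"
  by (auto simp: os_def free_roots_def V_def)

lemma vs_rows: "distinct (map fst vs)" "set vs = (\<lambda>v. (real v, real (f v), real (g v))) ` mverts F"
  using V_facts(3) lists by (simp_all add: V_def vs_def)

lemma sum_rows:
  "(\<Sum>r\<in>{r \<in> set vs. fst r \<in> X}. h r) = (\<Sum>v\<in>{v \<in> mverts F. real v \<in> X}. h (real v, real (f v), real (g v)))"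
proof -
  have eq: "{r \<in> set vs. fst r \<in> X} = (\<lambda>v. (real v, real (f v), real (g v))) ` {v \<in> mverts F. real v \<in> X}"
    unfolding vs_rows(2) by auto
  show ?thesis unfolding eq by (subst sum.reindex) (auto simp: inj_on_def)
qed

lemma demand_eq: "demand vs = real (\<Sum>v\<in>mverts F. f v)"
proof -
  have "demand vs = (\<Sum>v\<leftarrow>vl. real (f v))" by (simp add: demand_def vs_def comp_def)
  also have "\<dots> = (\<Sum>v\<in>mverts F. real (f v))"
    using lists by (simp add: sum_list_distinct_conv_sum_set)
  finally show ?thesis by simp
qed

end

text \<open>Here the list of units is complete, that is \<open>0, ..., k - 1\<close>. With more than
  one vertex the opposite case admits no packing.\<close>

locale inst_units = inst +
  assumes enough: "k \<le> card (dyperedges F \<union> hyperedges F)"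
begin

lemma ks: "ks = map real [0..<k]" "length ks = k"
proof -
  let ?m = "length (map fst ds @ map fst hs)"
  have m: "?m = card E"
    using lists fin by (simp add: ds_def hs_def card_Un_disjoint) (metis distinct_card)
  have "map fst (enum xs) = map real [0..<length xs]" for xs :: "real list" by (simp add: enum_def)
  then have "ks = filter (\<lambda>j. j < real k) (map real [0..<?m])"
    unfolding ks_def units_def by (simp only:)
  also have "\<dots> = map real (filter (\<lambda>j. j < k) [0..<?m])" by (simp add: filter_map comp_def)
  also have "[0..<?m] = [0..<k] @ [k..<?m]" using enough m by (metis le_add_diff_inverse upt_add_eq_append zero_le)
  also have "filter (\<lambda>j. j < k) ([0..<k] @ [k..<?m]) = [0..<k]" by (simp add: filter_id_conv)
  finally show "ks = map real [0..<k]" .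
  then show "length ks = k" by simp
qed

lemma count_range: "length (filter (\<lambda>j. real a \<le> j \<and> j < real b) ks) = min k b - a"
  "length (filter (\<lambda>j. real a \<le> j) ks) = k - a" "length (filter (\<lambda>j. j < real b) ks) = min k b"
proof -
  have "{j. j < k \<and> real a \<le> real j \<and> real j < real b} = {a..<min k b}" by auto
  then show "length (filter (\<lambda>j. real a \<le> j \<and> j < real b) ks) = min k b - a"
    unfolding ks(1) length_filter_real_upt by simp
  have "{j. j < k \<and> real a \<le> real j} = {a..<k}" by auto
  then show "length (filter (\<lambda>j. real a \<le> j) ks) = k - a"
    unfolding ks(1) length_filter_real_upt by simp
  have "{j. j < k \<and> real j < real b} = {..<min k b}" by auto
  then show "length (filter (\<lambda>j. j < real b) ks) = min k b"
    unfolding ks(1) length_filter_real_upt by simp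
qed

lemma roots_at:
  assumes "v \<in> mverts F"
  shows "slots_in {real v} os = min k (g v) - f v" "slots_in {real v} fs = min k (f v)"
proof -
  have s: "{u \<in> mverts F. real u \<in> {real v}} = {v}" using assms by auto
  show "slots_in {real v} os = min k (g v) - f v"
    unfolding os_def free_roots_def slots_in_copies[OF vs_rows(1)] sum_rows s by (simp add: count_range)
  show "slots_in {real v} fs = min k (f v)"
    unfolding fs_def fixed_roots_def slots_in_copies[OF vs_rows(1)] sum_rows s by (simp add: count_range)
qed

lemma slots:
  "slots_in X sl1 = length ks * card (X \<inter> set V) + (if - 1 \<in> X then k - (\<Sum>v\<in>mverts F. f v) else 0)"
  "slots_in X sl2 = (\<Sum>r\<in>X \<inter> set V. cap r)"
proof -
  have XV: "X \<inter> set V = real ` {v \<in> mverts F. real v \<in> X}" unfolding V_facts(2) by auto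
  have "slots_in X sl1 = (\<Sum>v\<in>{v \<in> mverts F. real v \<in> X}. length ks) +
      (if - 1 \<in> X then length (filter (\<lambda>j. demand vs \<le> j) ks) else 0)"
    unfolding sl1_def slots1_def filter_append length_append slots_in_copies[OF vs_rows(1)] sum_rows
    by (simp add: filter_map comp_def)
  also have "length (filter (\<lambda>j. demand vs \<le> j) ks) = k - (\<Sum>v\<in>mverts F. f v)"
    unfolding demand_eq by (rule count_range)
  also have "(\<Sum>v\<in>{v \<in> mverts F. real v \<in> X}. length ks) = length ks * card (X \<inter> set V)"
    unfolding XV by (simp add: card_image)
  finally show "slots_in X sl1 = length ks * card (X \<inter> set V) + (if - 1 \<in> X then k - (\<Sum>v\<in>mverts F. f v) else 0)" .
  have "slots_in X sl2 = (\<Sum>v\<in>{v \<in> mverts F. real v \<in> X}. k - f v)"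
    unfolding sl2_def slots2_def slots_in_copies[OF vs_rows(1)] sum_rows by (simp add: count_range)
  also have "\<dots> = (\<Sum>r\<in>X \<inter> set V. cap r)"
    unfolding XV by (subst sum.reindex) (auto simp: cap_def)
  finally show "slots_in X sl2 = (\<Sum>r\<in>X \<inter> set V. cap r)" .
qed

sublocale network V T ks sl1 sl2 cap "k - (\<Sum>v\<in>mverts F. f v)"
proof
  show "distinct V" "V \<noteq> []" "- 1 \<notin> set V" by (rule V_facts)+
  show "distinct (map fst T)" by (rule T_distinct)
  fix i assume i: "i \<in> set (map fst T)"
  show "set (span_of T i) \<subseteq> set V \<and> span_of T i \<noteq> []" if "0 \<le> i"
    using i
  proof (cases rule: id_cases)
    case (1 e)
    then show ?thesis using edge_row(1)[OF 1(1)] span_set_sub[OF 1(1)] V_facts(2) by force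
  qed (use that in simp)
  show "span_of T i = [- 1]" if "i < 0"
    using i by (cases rule: id_cases) (use that root_row in auto)
  show "set (heads_of T i) \<subseteq> set V \<and> heads_of T i \<noteq> []"
    using i
  proof (cases rule: id_cases)
    case (1 e)
    then show ?thesis using edge_row(2)[OF 1(1)] span_set_sub[OF 1(1)] V_facts(2) by force
  next
    case (2 j)
    then show ?thesis using root_row(2)[OF 2(1)] os_set by auto
  qed
  show "set (heads_of T i) \<subseteq> set (span_of T i)" if "0 \<le> i"
    using i
  proof (cases rule: id_cases)
    case (1 e)
    then show ?thesis using edge_row(1,2)[OF 1(1)] span_set_sub[OF 1(1)] by auto
  qed (use that in simp)
qed (rule slots)+

end


section \<open>Correctness of the algorithm\<close>

context inst_units
begin

section \<open>From a packing to a common independent set\<close>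

definition root_ids :: "nat \<Rightarrow> real set" where
  "root_ids v = {i \<in> set (map fst T). i < 0 \<and> heads_of T i = [real v]}"

lemma root_ids_eq: "root_ids v = (\<lambda>j. - 1 - real j) ` {j. j < length os \<and> os ! j = real v}"
proof
  show "root_ids v \<subseteq> (\<lambda>j. - 1 - real j) ` {j. j < length os \<and> os ! j = real v}"
  proof
    fix i assume i: "i \<in> root_ids v"
    then have "i \<in> set (map fst T)" by (simp add: root_ids_def)
    then show "i \<in> (\<lambda>j. - 1 - real j) ` {j. j < length os \<and> os ! j = real v}"
      by (cases rule: id_cases) (use i root_row in \<open>auto simp: root_ids_def\<close>)
  qed
  show "(\<lambda>j. - 1 - real j) ` {j. j < length os \<and> os ! j = real v} \<subseteq> root_ids v"
    unfolding root_ids_def T_set using root_row by auto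
qed

lemma card_root_ids: "v \<in> mverts F \<Longrightarrow> card (root_ids v) = min k (g v) - f v"
proof -
  assume v: "v \<in> mverts F"
  have "card (root_ids v) = card {j. j < length os \<and> os ! j = real v}"
    unfolding root_ids_eq by (rule card_image) (auto simp: inj_on_def)
  also have "\<dots> = slots_in {real v} os" by (simp add: length_filter_conv_card)
  finally show ?thesis using roots_at(1)[OF v] by simp
qed

lemma length_sl2: "length sl2 = (\<Sum>r\<in>set V. cap r)"
  using slots(2)[of UNIV] by simp

lemma cap_real [simp]: "cap (real v) = k - f v"
  by (simp add: cap_def)

text \<open>If \<open>\<rho> v\<close> members are rooted at \<open>v\<close>, take all edges of the
  packing and \<open>\<rho> v - f v\<close> of the optional root arcs at \<open>v\<close>. The heads
  of the trimmed edges then account for \<open>(k - \<rho> v) + (\<rho> v - f v) = k - f v\<close>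
  elements at \<open>v\<close>, and the optional root arcs number \<open>k\<close> minus the sum of
  \<open>f\<close>.\<close>

theorem packing_base:
  assumes P: "flexible_packing F k f g P"
  shows "\<exists>J. M1.sparse J \<and> M2.sparse J \<and> card J = length sl2 \<and> sum (weight_of T) J = packing_weight w P"
proof -
  note C = packing_counts[OF wf P]
  define Z where "Z = (\<Union>i<k. snd (P ! i))"
  define \<rho> where "\<rho> v = count_list (map fst P) v" for v
  obtain h where h: "\<And>e. e \<in> Z \<Longrightarrow> h e \<in> head_set F e"
    "\<And>v. v \<in> mverts F \<Longrightarrow> card {e \<in> Z. h e = v} + \<rho> v = k"
    using C(5) unfolding Z_def \<rho>_def by blast
  have \<rho>: "f v \<le> \<rho> v" "\<rho> v \<le> g v" "\<rho> v \<le> k" if "v \<in> mverts F" for v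
    using P h(2)[OF that] that unfolding flexible_packing_def \<rho>_def by auto
  have ZE: "Z \<subseteq> E" using C(1) by (simp add: Z_def)
  then have finZ: "finite Z" using fin(4) finite_subset by blast
  \<comment> \<open>There are enough optional root arcs at \<open>v\<close>, because
    \<open>\<rho> v\<close> exceeds neither \<open>k\<close> nor \<open>g v\<close>.\<close>
  have "\<exists>R. R \<subseteq> root_ids v \<and> card R = \<rho> v - f v" if "v \<in> mverts F" for v
    using obtain_subset_with_card_n[of "\<rho> v - f v" "root_ids v"] card_root_ids[OF that] \<rho>[OF that]
    by (metis diff_le_mono min.boundedI)
  then obtain R where R: "\<And>v. v \<in> mverts F \<Longrightarrow> R v \<subseteq> root_ids v" "\<And>v. v \<in> mverts F \<Longrightarrow> card (R v) = \<rho> v - f v"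
    by metis
  have Rid: "i < 0" "i \<in> set (map fst T)" "heads_of T i = [real v]" if "v \<in> mverts F" "i \<in> R v" for v i
    using R(1)[OF that(1)] that(2) by (auto simp: root_ids_def)
  have finR: "finite (R v)" if "v \<in> mverts F" for v
    by (rule finite_subset[OF R(1)[OF that]]) (simp add: root_ids_def)
  define RR where "RR = (\<Union>v\<in>mverts F. R v)"
  define J where "J = real ` Z \<union> RR"
  have RRneg: "i < 0" if "i \<in> RR" for i using that Rid(1) by (auto simp: RR_def)
  have finJ: "finite J" using finZ finR fin(1) by (auto simp: J_def RR_def)
  have JS: "J \<subseteq> set (map fst T)"
  proof -
    have "real ` Z \<subseteq> set (map fst T)" unfolding T_set using ZE by blast
    moreover have "RR \<subseteq> set (map fst T)" unfolding RR_def using Rid(2) by blast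
    ultimately show ?thesis by (simp add: J_def)
  qed
  \<comment> \<open>An orientation of the whole set: edges get the heads of the packing, root arcs
    their only possible head. It witnesses independence in the second matroid.\<close>
  define hh where "hh i = (if 0 \<le> i then real (h (nat \<lfloor>i\<rfloor>)) else hd (heads_of T i))" for i
  have hhe: "hh (real e) = real (h e)" for e by (simp add: hh_def)
  have hhr: "hh i = real v" if "v \<in> mverts F" "i \<in> R v" for v i
    using Rid[OF that] by (simp add: hh_def)
  have hh: "hh i \<in> set (heads_of T i)" if i: "i \<in> J" for i
  proof (cases "i \<in> RR")
    case True
    then obtain v where v: "v \<in> mverts F" "i \<in> R v" by (auto simp: RR_def)
    show ?thesis using hhr[OF v] Rid(3)[OF v] by simp
  next
    case False
    then obtain e where e: "e \<in> Z" "i = real e" using i unfolding J_def by blast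
    then show ?thesis using edge_row(2)[of e] ZE h(1)[OF e(1)] hhe by auto
  qed
  have fibre: "card {i \<in> J. hh i = real v} = k - f v" if v: "v \<in> mverts F" for v
  proof -
    have RvJ: "i \<in> J" if "i \<in> R v" for i using that v unfolding J_def RR_def by blast
    have ZJ: "real e \<in> J" if "e \<in> Z" for e using that unfolding J_def by blast
    have "{i \<in> J. hh i = real v} = real ` {e \<in> Z. h e = v} \<union> R v"
    proof (intro equalityI subsetI)
      fix i assume i: "i \<in> {i \<in> J. hh i = real v}"
      show "i \<in> real ` {e \<in> Z. h e = v} \<union> R v"
      proof (cases "i \<in> RR")
        case True
        then obtain u where u: "u \<in> mverts F" "i \<in> R u" by (auto simp: RR_def)
        with hhr[OF u] i have "u = v" by simp
        with u show ?thesis by simp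
      next
        case False
        then obtain e where "e \<in> Z" "i = real e" using i by (auto simp: J_def)
        then show ?thesis using i hhe by auto
      qed
    next
      fix i assume "i \<in> real ` {e \<in> Z. h e = v} \<union> R v"
      then show "i \<in> {i \<in> J. hh i = real v}" using hhe hhr[OF v] RvJ ZJ by auto
    qed
    moreover have "real ` {e \<in> Z. h e = v} \<inter> R v = {}" using Rid(1)[OF v] by force
    ultimately have "card {i \<in> J. hh i = real v} = card (real ` {e \<in> Z. h e = v}) + card (R v)"
      using finZ finR[OF v] by (simp add: card_Un_disjoint)
    also have "card (real ` {e \<in> Z. h e = v}) = card {e \<in> Z. h e = v}" by (rule card_image) simp
    finally show ?thesis using h(2)[OF v] R(2)[OF v] \<rho>[OF v] by simp
  qed
  have fibres: "card {i \<in> J. hh i \<in> X} = (\<Sum>r\<in>X. cap r)" if X: "X \<subseteq> set V" for X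
  proof -
    have fX: "finite X" using X finite_subset by blast
    have "{i \<in> J. hh i \<in> X} = (\<Union>r\<in>X. {i \<in> J. hh i = r})" by blast
    also have "card \<dots> = (\<Sum>r\<in>X. card {i \<in> J. hh i = r})"
      using fX finJ by (intro card_UN_disjoint) auto
    also have "\<dots> = (\<Sum>r\<in>X. cap r)"
      using X fibre unfolding V_facts(2) by (intro sum.cong) auto
    finally show ?thesis .
  qed
  have sp2: "M2.sparse J" unfolding M2.sparse_def
  proof (intro conjI ballI)
    show "J \<subseteq> set S" by (rule JS)
    fix X assume "X \<in> Pow (set V)"
    then have X: "X \<subseteq> set V" by blast
    have "M2.count J X \<le> card {i \<in> J. hh i \<in> X}"
      unfolding M2.count_def using finJ hh by (intro card_mono) auto
    then show "M2.count J X \<le> (\<Sum>v\<in>X. cap v)" using fibres[OF X] by simp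
  qed
  have "hh i \<in> set V" if "i \<in> J" for i
    using hh[OF that] heads JS that by blast
  then have "{i \<in> J. hh i \<in> set V} = J" by blast
  then have cJ: "card J = length sl2" using fibres[of "set V"] length_sl2 by simp
  have sp1: "M1.sparse J" unfolding M1.sparse_def
  proof (intro conjI ballI)
    show "J \<subseteq> set S" by (rule JS)
    fix X assume "X \<in> {X. X \<subseteq> set V \<and> X \<noteq> {}} \<union> {{- 1}}"
    then consider "X \<subseteq> set V" "X \<noteq> {}" | "X = {- 1}" by blast
    then show "M1.count J X \<le> bound1 X"
    proof cases
      case 1
      define Y where "Y = {v \<in> mverts F. real v \<in> X}"
      have XY: "X = real ` Y" using 1 unfolding V_facts(2) Y_def by auto
      have "Y \<subseteq> mverts F" unfolding Y_def by blast
      moreover have "Y \<noteq> {}" using 1(2) XY by blast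
      ultimately have Y: "Y \<subseteq> mverts F" "Y \<noteq> {}" .
      have "{i \<in> J. set (span_of T i) \<subseteq> X} \<subseteq> real ` {e \<in> Z. span_set F e \<subseteq> Y}"
      proof
        fix i assume i: "i \<in> {i \<in> J. set (span_of T i) \<subseteq> X}"
        have "i \<notin> RR"
        proof
          assume "i \<in> RR"
          then have "i < 0" by (rule RRneg)
          moreover have "i \<in> set S" using i JS by blast
          ultimately have "span_of T i = [- 1]" by (rule span_root[rotated])
          then have "- 1 \<in> X" using i by simp
          then show False using 1(1) V_facts(5) by blast
        qed
        then obtain e where e: "e \<in> Z" "i = real e" using i by (auto simp: J_def)
        then have "e \<in> E" using ZE by blast
        from edge_row(1)[OF this] have "real ` span_set F e \<subseteq> real ` Y"
          using i unfolding e(2) XY by simp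
        then have "span_set F e \<subseteq> Y" by (simp add: inj_image_subset_iff)
        with e show "i \<in> real ` {e \<in> Z. span_set F e \<subseteq> Y}" by blast
      qed
      then have "M1.count J X \<le> card (real ` {e \<in> Z. span_set F e \<subseteq> Y})"
        unfolding M1.count_def using finZ by (intro card_mono) auto
      also have "\<dots> = card {e \<in> Z. span_set F e \<subseteq> Y}" by (rule card_image) simp
      also have "\<dots> \<le> k * (card Y - 1)" using C(4)[OF Y] by (simp add: Z_def)
      also have "card Y = card X" unfolding XY by (simp add: card_image)
      also have "k * (card X - 1) = bound1 X" using 1 V_facts(5) ks(2) by (auto simp: bound1_def)
      finally show ?thesis .
    next
      case 2
      have "{i \<in> J. set (span_of T i) \<subseteq> X} \<subseteq> RR"
      proof
        fix i assume i: "i \<in> {i \<in> J. set (span_of T i) \<subseteq> X}"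
        show "i \<in> RR"
        proof (rule ccontr)
          assume "i \<notin> RR"
          then obtain e where e: "e \<in> Z" "i = real e" using i by (auto simp: J_def)
          moreover have "i \<in> set S" using i JS by blast
          ultimately have "set (span_of T i) \<subseteq> set V" "span_of T i \<noteq> []" using span_edge[of i] by simp_all
          then obtain r where "r \<in> set (span_of T i)" "r \<in> set V" by (cases "span_of T i") auto
          moreover have "r = - 1" using calculation(1) i 2 by blast
          ultimately show False using V_facts(5) by simp
        qed
      qed
      then have "M1.count J X \<le> card RR"
        unfolding M1.count_def using finJ by (intro card_mono) (auto simp: J_def)
      also have "\<dots> \<le> (\<Sum>v\<in>mverts F. card (R v))"
        unfolding RR_def by (rule card_UN_le[OF fin(1)])
      also have "\<dots> = (\<Sum>v\<in>mverts F. \<rho> v - f v)" using R(2) by simp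
      also have "\<dots> = (\<Sum>v\<in>mverts F. \<rho> v) - (\<Sum>v\<in>mverts F. f v)"
        using \<rho>(1) by (rule sum_subtractf_nat)
      also have "(\<Sum>v\<in>mverts F. \<rho> v) = k" using C(6) by (simp add: \<rho>_def)
      finally show ?thesis using 2 by (simp add: bound1_def)
    qed
  qed
  have "sum (weight_of T) J = sum (weight_of T) (real ` Z) + sum (weight_of T) RR"
    unfolding J_def
  proof (rule sum.union_disjoint)
    show "finite (real ` Z)" "finite RR" using finJ by (simp_all add: J_def)
    show "real ` Z \<inter> RR = {}" using RRneg by force
  qed
  also have "sum (weight_of T) RR = 0"
  proof (rule sum.neutral, rule ballI)
    fix i assume i: "i \<in> RR"
    then have "i \<in> set (map fst T)" using JS by (auto simp: J_def)
    then show "weight_of T i = 0"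
      by (cases rule: id_cases) (use RRneg[OF i] root_row in auto)
  qed
  also have "sum (weight_of T) (real ` Z) = sum w Z"
  proof -
    have "sum (weight_of T) (real ` Z) = (\<Sum>e\<in>Z. weight_of T (real e))" by (subst sum.reindex) (auto simp: comp_def)
    also have "\<dots> = sum w Z" using edge_row(3) ZE by (intro sum.cong) auto
    finally show ?thesis .
  qed
  also have "sum w Z = packing_weight w P" using C(3) by (simp add: Z_def)
  finally show ?thesis using sp1 sp2 cJ by auto
qed

section \<open>From a common independent set to a packing\<close>

definition root_of :: "(real \<times> real) list \<Rightarrow> nat" where
  "root_of P = nat \<lfloor>\<Sum>d\<leftarrow>P. if fst d < 0 then snd d else 0\<rfloor>"

definition edges_of :: "(real \<times> real) list \<Rightarrow> nat list" where
  "edges_of P = map (\<lambda>d. nat \<lfloor>fst d\<rfloor>) (filter (\<lambda>d. 0 \<le> fst d) P)"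

text \<open>Without its root arc, a grown part is trimmed to the recorded heads and to the tails
  found during growth. The heads are distinct and as many as the vertices; so every vertex is the
  head of exactly one arc, and the head of the root arc is the vertex that no edge enters.\<close>

lemma part_spanning:
  assumes P: "part_ok P" and inj: "inj_on fst (set P)"
    and heads_V: "\<And>d. d \<in> set P \<Longrightarrow> snd d \<in> set V"
    and edge: "\<And>d. d \<in> set P \<Longrightarrow> 0 \<le> fst d \<Longrightarrow> fst d \<in> set S \<and> snd d \<in> set (heads_of T (fst d))"
  shows "(\<Sum>d\<leftarrow>P. if fst d < 0 then snd d else 0) = real (root_of P)"
    and "map fst (filter (\<lambda>d. 0 \<le> fst d) P) = map real (edges_of P)"
    and "distinct (edges_of P)"
    and "\<exists>d. {d \<in> set P. fst d < 0} = {d} \<and> snd d = real (root_of P)"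
    and "spanning_mixed_hyperarborescence F (root_of P) (set (edges_of P))"
proof -
  from P obtain U where U: "grown P U" "length P = length V" "roots (set P) = 1" by (auto simp: part_ok_def)
  note G = grown_set[OF U(1)]
  have distP: "distinct P" using G by (simp add: distinct_map)
  from U(3) obtain d0 where d0: "{d \<in> set P. fst d < 0} = {d0}"
    unfolding roots_def by (auto simp: card_1_singleton_iff)
  then have d0P: "d0 \<in> set P" "fst d0 < 0" by auto
  have "(\<Sum>d\<leftarrow>P. if fst d < 0 then snd d else 0) = (\<Sum>d\<in>set P. if fst d < 0 then snd d else 0)"
    using distP by (simp add: sum_list_distinct_conv_sum_set)
  also have "\<dots> = (\<Sum>d\<in>{d \<in> set P. fst d < 0}. snd d)" by (simp add: sum.inter_filter)
  finally have sum: "(\<Sum>d\<leftarrow>P. if fst d < 0 then snd d else 0) = snd d0" unfolding d0 by simp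
  from heads_V[OF d0P(1)] obtain r where r: "r \<in> mverts F" "snd d0 = real r" unfolding V_facts(2) by auto
  have root: "root_of P = r" unfolding root_of_def sum r(2) by simp
  show "(\<Sum>d\<leftarrow>P. if fst d < 0 then snd d else 0) = real (root_of P)" unfolding sum root r(2) ..
  show "\<exists>d. {d \<in> set P. fst d < 0} = {d} \<and> snd d = real (root_of P)" using d0 r(2) root by blast
  have ex: "\<exists>e\<in>E. fst d = real e \<and> snd d \<in> real ` head_set F e \<and> A d = real ` span_set F e"
    if d: "d \<in> set P" "0 \<le> fst d" for d
  proof -
    from edge[OF d] have "fst d \<in> set S" by blast
    then show ?thesis
    proof (cases rule: id_cases)
      case (1 e)
      then show ?thesis using edge[OF d] edge_row(1,2)[OF 1(1)] d(2) by (intro bexI[of _ e]) (auto simp: tails_of_def)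
    qed (use d(2) in simp)
  qed
  have fl: "fst d = (real \<circ> (\<lambda>d. nat \<lfloor>fst d\<rfloor>)) d" if d: "d \<in> set P" "0 \<le> fst d" for d
  proof -
    from ex[OF d] obtain e where "fst d = real e" by blast
    then show ?thesis by simp
  qed
  show edges: "map fst (filter (\<lambda>d. 0 \<le> fst d) P) = map real (edges_of P)"
    unfolding edges_of_def map_map using fl by (intro map_cong[OF refl]) simp
  have "distinct (map fst (filter (\<lambda>d. 0 \<le> fst d) P))"
    using inj distP by (simp add: distinct_map inj_on_def)
  then show "distinct (edges_of P)" unfolding edges by (simp add: distinct_map)
  let ?B = "set (edges_of P)"
  have B: "e \<in> ?B \<longleftrightarrow> (\<exists>d\<in>set P. fst d = real e)" for e
  proof -
    have "e \<in> ?B \<longleftrightarrow> real e \<in> set (map real (edges_of P))" by (auto simp: image_iff)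
    also have "\<dots> \<longleftrightarrow> real e \<in> fst ` {d \<in> set P. 0 \<le> fst d}" unfolding edges[symmetric] by simp
    also have "\<dots> \<longleftrightarrow> (\<exists>d\<in>set P. fst d = real e)" by (force simp: image_iff)
    finally show ?thesis .
  qed
  from grown_rank[OF U(1)] obtain t :: "real \<Rightarrow> nat" and tl where
    t: "\<And>d. d \<in> set P \<Longrightarrow> tl d \<in> A d \<and> t (tl d) < t (snd d)" by blast
  define it where "it e = (THE d. d \<in> set P \<and> fst d = real e)" for e
  have it: "it e = d" if "d \<in> set P" "fst d = real e" for d e
    unfolding it_def
  proof (rule the_equality)
    show "d \<in> set P \<and> fst d = real e" using that by blast
    show "d' = d" if "d' \<in> set P \<and> fst d' = real e" for d'
      using inj_onD[OF inj, of d' d] that \<open>d \<in> set P\<close> \<open>fst d = real e\<close> by simp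
  qed
  \<comment> \<open>\<open>it e\<close> is the oriented edge with name \<open>e\<close>; floors turn
    machine numbers back into vertices.\<close>
  define D where "D = \<lparr>verts = mverts F, arcs = ?B, tail = (\<lambda>e. nat \<lfloor>tl (it e)\<rfloor>), head = (\<lambda>e. nat \<lfloor>snd (it e)\<rfloor>)\<rparr>"
  have arc: "\<exists>d\<in>set P. fst d = real e \<and> e \<in> E \<and> snd d = real (head D e) \<and> tl d = real (tail D e) \<and>
      head D e \<in> head_set F e \<and> tail D e \<in> span_set F e \<and> t (real (tail D e)) < t (real (head D e))"
    if e: "e \<in> ?B" for e
  proof -
    from e B obtain d where d: "d \<in> set P" "fst d = real e" by blast
    from ex[OF d(1)] d(2) have x: "e \<in> E" "snd d \<in> real ` head_set F e" "A d = real ` span_set F e" by auto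
    have i: "it e = d" by (rule it[OF d])
    have h: "snd d = real (head D e)" "head D e \<in> head_set F e" using x(2) by (auto simp: D_def i)
    have tl: "tl d = real (tail D e)" "tail D e \<in> span_set F e" using t[OF d(1)] x(3) by (auto simp: D_def i)
    have "t (real (tail D e)) < t (real (head D e))" using t[OF d(1)] h(1) tl(1) by simp
    with d x(1) h tl show ?thesis by blast
  qed
  have uniq: "d = d'" if "d \<in> set P" "d' \<in> set P" "snd d = snd d'" for d d'
    using G that by (auto simp: distinct_map dest: inj_onD)
  have BE: "?B \<subseteq> E" using arc by blast
  have "is_trimming F ?B D" unfolding is_trimming_def
  proof (intro conjI ballI)
    show "verts D = mverts F" "arcs D = ?B" by (simp_all add: D_def)
    fix a assume a: "a \<in> ?B \<inter> dyperedges F"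
    with arc[of a] have x: "head D a \<in> head_set F a" "tail D a \<in> span_set F a" "t (real (tail D a)) < t (real (head D a))"
      by auto
    show hd: "head D a = dhead F a" using x(1) a by (simp add: head_set_def)
    \<comment> \<open>The span of a dyperedge includes its head; the rank shows that the tail chosen
      is not the head and so is a genuine tail.\<close>
    have "tail D a \<noteq> head D a" using x(3) by auto
    with x(2) a hd show "tail D a \<in> dtail F a" by (auto simp: span_set_def)
  next
    fix e assume e: "e \<in> ?B \<inter> hyperedges F"
    with arc[of e] have x: "head D e \<in> head_set F e" "tail D e \<in> span_set F e" "t (real (tail D e)) < t (real (head D e))"
      by auto
    have "e \<notin> dyperedges F" using e fin(5) by blast
    with x show "tail D e \<in> ends F e" "head D e \<in> ends F e" "tail D e \<noteq> head D e"
      by (auto simp: span_set_def head_set_def)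
  qed
  moreover have "arborescence r D"
  proof (rule arborescenceI[where t = "\<lambda>v. t (real v)"])
    show "finite (verts D)" "finite (arcs D)" "r \<in> verts D" using fin(1) r(1) by (simp_all add: D_def)
    show "tail D e \<in> verts D \<and> head D e \<in> verts D - {r}" if "e \<in> arcs D" for e
    proof -
      from that have "e \<in> ?B" by (simp add: D_def)
      from arc[OF this] obtain d where d: "d \<in> set P" "fst d = real e" "e \<in> E" "snd d = real (head D e)"
        "head D e \<in> head_set F e" "tail D e \<in> span_set F e" by blast
      have "head D e \<noteq> r"
      proof
        assume "head D e = r"
        then have "d = d0" using uniq[OF d(1) d0P(1)] d(4) r(2) by simp
        then show False using d(2) d0P(2) by simp
      qed
      moreover have "verts D = mverts F" by (simp add: D_def)
      ultimately show ?thesis using span_set_sub[OF d(3)] d(5,6) by blast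
    qed
    show "inj_on (head D) (arcs D)"
    proof (rule inj_onI)
      fix e e' assume "e \<in> arcs D" "e' \<in> arcs D" and eq: "head D e = head D e'"
      then have "e \<in> ?B" "e' \<in> ?B" by (simp_all add: D_def)
      from arc[OF this(1)] arc[OF this(2)] obtain d d' where d: "d \<in> set P" "fst d = real e" "snd d = real (head D e)"
        "d' \<in> set P" "fst d' = real e'" "snd d' = real (head D e')" by blast
      have "snd d = snd d'" unfolding d(3,6) eq ..
      then have "d = d'" by (rule uniq[OF d(1,4)])
      then show "e = e'" using d(2,5) by simp
    qed
    show "verts D - {r} \<subseteq> head D ` arcs D"
    proof
      fix v assume v: "v \<in> verts D - {r}"
      have "snd ` set P = set V"
      proof (rule card_subset_eq)
        show "snd ` set P \<subseteq> set V" using heads_V by blast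
        have "card (snd ` set P) = length P" using G by (metis distinct_card length_map set_map)
        also have "\<dots> = card (set V)" using U(2) V_facts(3) by (simp add: distinct_card)
        finally show "card (snd ` set P) = card (set V)" .
      qed simp
      moreover have "real v \<in> set V" using v by (simp add: V_facts(2) D_def)
      ultimately have "real v \<in> snd ` set P" by simp
      then obtain d where d: "d \<in> set P" "snd d = real v" by force
      have "0 \<le> fst d"
      proof (rule ccontr)
        assume "\<not> 0 \<le> fst d"
        then have "d \<in> {d \<in> set P. fst d < 0}" using d(1) by simp
        then have "d = d0" unfolding d0 by simp
        with d(2) r(2) v show False by simp
      qed
      with ex[OF d(1)] obtain e where e: "fst d = real e" by blast
      then have "e \<in> ?B" using B d(1) by blast
      moreover have "head D e = v" using it[OF d(1) e] d(2) by (simp add: D_def)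
      ultimately show "v \<in> head D ` arcs D" by (auto simp: D_def)
    qed
    show "t (real (tail D e)) < t (real (head D e))" if "e \<in> arcs D" for e
      using arc[of e] that by (auto simp: D_def)
  qed
  ultimately show "spanning_mixed_hyperarborescence F (root_of P) ?B"
    unfolding spanning_mixed_hyperarborescence_def root using r(1) BE by blast
qed

text \<open>Members rooted at \<open>v\<close> correspond to the root arcs with head
  \<open>v\<close>: the \<open>f v\<close> mandatory ones are all present, and at most
  \<open>min k (g v) - f v\<close> optional ones join them. Edges of the set and edges of the
  packing agree, and root arcs weigh nothing.\<close>

theorem base_packing:
  assumes fk: "\<And>v. v \<in> mverts F \<Longrightarrow> f v \<le> k \<and> f v \<le> g v" and dk: "(\<Sum>v\<in>mverts F. f v) \<le> k"
    and I: "distinct I" "set I \<subseteq> set S" "M1.sparse (set I)" "M2.sparse (set I)" "length I = length sl2"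
  defines "out \<equiv> decompose T V ks (orient T sl2 I @ fixed_arcs os fs)"
  defines "P \<equiv> map (\<lambda>p. (root_of p, set (edges_of p))) out"
  shows "flexible_packing F k f g P" "packing_weight w P = sum (weight_of T) (set I)"
    "\<And>p. p \<in> set out \<Longrightarrow> (\<Sum>d\<leftarrow>p. if fst d < 0 then snd d else 0) = real (root_of p)"
    "\<And>p. p \<in> set out \<Longrightarrow> map fst (filter (\<lambda>d. 0 \<le> fst d) p) = map real (edges_of p)"
    "\<And>p. p \<in> set out \<Longrightarrow> distinct (edges_of p)"
proof -
  let ?M = "fixed_arcs os fs"
  let ?O = "orient T sl2 I"
  have M_fst: "map fst ?M = map (\<lambda>j. - 1 - real j - real (length os)) [0..<length fs]"
  proof -
    have "map fst ?M = map (\<lambda>x. - 1 - x - real (length os)) (map fst (enum fs))"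
      by (simp add: fixed_arcs_def len_eq comp_def)
    also have "map fst (enum fs) = map real [0..<length fs]" by (simp add: enum_def)
    finally show ?thesis by simp
  qed
  have M_snd: "map snd ?M = fs"
  proof -
    have "map snd ?M = map snd (enum fs)" by (simp add: fixed_arcs_def comp_def)
    then show ?thesis by (simp add: enum_def)
  qed
  have M_dist: "distinct (map fst ?M)" unfolding M_fst by (simp add: distinct_map inj_on_def)
  then have distM: "distinct ?M" by (simp add: distinct_map)
  \<comment> \<open>All names in the table lie above the names of mandatory root arcs, so the latter
    are new.\<close>
  have S_ge: "- 1 - real (length os) < i" if "i \<in> set S" for i
    using that by (cases rule: id_cases) auto
  have M_id: "fst d \<le> - 1 - real (length os)" if "d \<in> set ?M" for d
  proof -
    have "fst d \<in> set (map fst ?M)" using that by simp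
    then show ?thesis unfolding M_fst by auto
  qed
  have M_V: "snd d \<in> set V" if "d \<in> set ?M" for d
  proof -
    have "snd d \<in> set (map snd ?M)" using that by simp
    then show ?thesis unfolding M_snd by (auto simp: fs_def fixed_roots_def V_def)
  qed
  have M_ok: "fst d < 0 \<and> snd d \<in> set V \<and> fst d \<notin> set I" if "d \<in> set ?M" for d
    using M_id[OF that] M_V[OF that] S_ge[of "fst d"] I(2) by auto
  have M_deg: "card {d \<in> set ?M. snd d = real v} = f v" if v: "v \<in> mverts F" for v
  proof -
    have "card {d \<in> set ?M. snd d = real v} = length (filter (\<lambda>d. snd d = real v) ?M)"
      using length_filter_card[OF distM] by simp
    also have "\<dots> = slots_in {real v} (map snd ?M)" by (simp add: filter_map comp_def)
    also have "\<dots> = f v" unfolding M_snd using roots_at(2)[OF v] fk[OF v] by simp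
    finally show ?thesis .
  qed
  have M_len: "length ?M = (\<Sum>v\<in>mverts F. f v)"
  proof -
    have "length ?M = length fs" using M_snd by (metis length_map)
    also have "\<dots> = slots_in UNIV fs" by simp
    also have "\<dots> = (\<Sum>v\<in>mverts F. min k (f v))"
      unfolding fs_def fixed_roots_def slots_in_copies[OF vs_rows(1)] sum_rows by (simp add: count_range)
    also have "\<dots> = (\<Sum>v\<in>mverts F. f v)" using fk by (intro sum.cong) auto
    finally show ?thesis .
  qed
  have deg: "card {d \<in> set ?M. snd d = v} + cap v = length ks" if "v \<in> set V" for v
    using that M_deg fk unfolding V_facts(2) ks(2) by fastforce
  have lenk: "length ?M + (k - (\<Sum>v\<in>mverts F. f v)) = length ks" using M_len dk ks(2) by simp
  note R = common_base_decomposes[OF I M_dist M_ok deg lenk, folded out_def]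
  let ?D = "set (?O @ ?M)"
  have out: "length out = k" "\<And>p. p \<in> set out \<Longrightarrow> part_ok p" "distinct (concat out)" "set (concat out) = ?D"
    "inj_on fst ?D" "\<And>d. d \<in> ?D \<Longrightarrow> snd d \<in> set V"
    "\<And>d. d \<in> set ?O \<Longrightarrow> fst d \<in> set I \<and> snd d \<in> set (heads_of T (fst d))" "fst ` set ?O = set I"
    by (rule R[unfolded ks(2)]; assumption)+
  have pD: "set p \<subseteq> ?D" if "p \<in> set out" for p using that out(4) by auto
  have edge: "fst d \<in> set I \<and> snd d \<in> set (heads_of T (fst d))" if "d \<in> ?D" "0 \<le> fst d" for d
    using that out(7)[of d] M_ok[of d] by auto
  have part: "(\<Sum>d\<leftarrow>p. if fst d < 0 then snd d else 0) = real (root_of p)"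
    "map fst (filter (\<lambda>d. 0 \<le> fst d) p) = map real (edges_of p)" "distinct (edges_of p)"
    "\<exists>d. {d \<in> set p. fst d < 0} = {d} \<and> snd d = real (root_of p)"
    "spanning_mixed_hyperarborescence F (root_of p) (set (edges_of p))" if p: "p \<in> set out" for p
  proof -
    have i: "inj_on fst (set p)" using out(5) pD[OF p] by (rule inj_on_subset)
    have h: "snd d \<in> set V" if "d \<in> set p" for d using that pD[OF p] out(6) by blast
    have e: "fst d \<in> set S \<and> snd d \<in> set (heads_of T (fst d))" if "d \<in> set p" "0 \<le> fst d" for d
      using edge[of d] that pD[OF p] I(2) by blast
    show "(\<Sum>d\<leftarrow>p. if fst d < 0 then snd d else 0) = real (root_of p)"
      "map fst (filter (\<lambda>d. 0 \<le> fst d) p) = map real (edges_of p)" "distinct (edges_of p)"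
      "\<exists>d. {d \<in> set p. fst d < 0} = {d} \<and> snd d = real (root_of p)"
      "spanning_mixed_hyperarborescence F (root_of p) (set (edges_of p))"
      by (rule part_spanning[OF out(2)[OF p] i h e]; assumption)+
  qed
  show "\<And>p. p \<in> set out \<Longrightarrow> (\<Sum>d\<leftarrow>p. if fst d < 0 then snd d else 0) = real (root_of p)"
    "\<And>p. p \<in> set out \<Longrightarrow> map fst (filter (\<lambda>d. 0 \<le> fst d) p) = map real (edges_of p)"
    "\<And>p. p \<in> set out \<Longrightarrow> distinct (edges_of p)"
    using part by blast+
  have in_edges: "e \<in> set (edges_of p) \<longleftrightarrow> (\<exists>d\<in>set p. fst d = real e)" if "p \<in> set out" for p e
  proof -
    have "e \<in> set (edges_of p) \<longleftrightarrow> real e \<in> set (map real (edges_of p))" by (auto simp: image_iff)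
    also have "\<dots> \<longleftrightarrow> real e \<in> fst ` {d \<in> set p. 0 \<le> fst d}" unfolding part(2)[OF that, symmetric] by simp
    also have "\<dots> \<longleftrightarrow> (\<exists>d\<in>set p. fst d = real e)" by (force simp: image_iff)
    finally show ?thesis .
  qed
  have ne: "[] \<notin> set out"
  proof
    assume "[] \<in> set out"
    from part(4)[OF this] show False by simp
  qed
  have dist_out: "distinct out" using out(3) ne by (simp add: distinct_concat_iff removeAll_id)
  have disj: "set (out ! i) \<inter> set (out ! j) = {}" if "i < k" "j < k" "i \<noteq> j" for i j
  proof -
    have "out ! i \<noteq> out ! j" using that dist_out out(1) by (simp add: nth_eq_iff_index_eq)
    moreover have "out ! i \<in> set out" "out ! j \<in> set out" using that out(1) by simp_all
    ultimately show ?thesis using out(3) by (simp add: distinct_concat_iff)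
  qed
  have outi: "out ! i \<in> set out" if "i < k" for i using that out(1) by simp
  have in_out: "\<exists>i<k. d \<in> set (out ! i)" if "d \<in> ?D" for d
  proof -
    from that out(4) obtain p where p: "p \<in> set out" "d \<in> set p" by auto
    from p(1) obtain i where "i < k" "out ! i = p" unfolding in_set_conv_nth out(1) by blast
    with p(2) show ?thesis by blast
  qed
  have P: "length P = k" "\<And>i. i < k \<Longrightarrow> P ! i = (root_of (out ! i), set (edges_of (out ! i)))"
    using out(1) by (simp_all add: P_def)
  have "\<forall>i\<in>{..<k}. \<exists>d. {d \<in> set (out ! i). fst d < 0} = {d} \<and> snd d = real (root_of (out ! i))"
    using part(4) outi by blast
  then have "\<exists>q. \<forall>i\<in>{..<k}. {d \<in> set (out ! i). fst d < 0} = {q i} \<and> snd (q i) = real (root_of (out ! i))"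
    by (rule bchoice)
  \<comment> \<open>\<open>q i\<close> is the single root arc of the part with index
    \<open>i\<close>. Parts are disjoint, so \<open>q\<close> is injective and its range consists of
    all root arcs.\<close>
  then obtain q where q: "\<And>i. i < k \<Longrightarrow> {d \<in> set (out ! i). fst d < 0} = {q i}"
    "\<And>i. i < k \<Longrightarrow> snd (q i) = real (root_of (out ! i))" by blast
  have qi: "q i \<in> set (out ! i)" "fst (q i) < 0" if "i < k" for i using q(1)[OF that] by auto
  have cnt: "count_list (map fst P) v = card {d \<in> ?D. fst d < 0 \<and> snd d = real v}" for v
  proof -
    have "count_list (map fst P) v = card {i. i < k \<and> root_of (out ! i) = v}"
      unfolding count_list_card using P by (intro arg_cong[of _ _ card]) auto
    also have "\<dots> = card (q ` {i. i < k \<and> root_of (out ! i) = v})"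
    proof (rule card_image[symmetric], rule inj_onI)
      fix i j assume ij: "i \<in> {i. i < k \<and> root_of (out ! i) = v}" "j \<in> {i. i < k \<and> root_of (out ! i) = v}" "q i = q j"
      show "i = j"
      proof (rule ccontr)
        assume "i \<noteq> j"
        with disj[of i j] ij(1,2) have "set (out ! i) \<inter> set (out ! j) = {}" by blast
        moreover have "q i \<in> set (out ! i)" "q j \<in> set (out ! j)" using ij(1,2) qi(1) by blast+
        ultimately show False unfolding ij(3) by blast
      qed
    qed
    also have "q ` {i. i < k \<and> root_of (out ! i) = v} = {d \<in> ?D. fst d < 0 \<and> snd d = real v}"
    proof (intro equalityI subsetI)
      fix d assume "d \<in> q ` {i. i < k \<and> root_of (out ! i) = v}"
      then obtain i where i: "i < k" "root_of (out ! i) = v" "d = q i" by blast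
      then show "d \<in> {d \<in> ?D. fst d < 0 \<and> snd d = real v}"
        using qi[OF i(1)] q(2)[OF i(1)] pD[OF outi[OF i(1)]] by blast
    next
      fix d assume d: "d \<in> {d \<in> ?D. fst d < 0 \<and> snd d = real v}"
      with in_out obtain i where i: "i < k" "d \<in> set (out ! i)" by blast
      then have dq: "d = q i" using q(1)[OF i(1)] d by blast
      have "snd d = real v" using d by blast
      then have "real v = snd d" by (rule sym)
      also have "\<dots> = real (root_of (out ! i))" unfolding dq by (rule q(2)[OF i(1)])
      finally have "root_of (out ! i) = v" by linarith
      with dq show "d \<in> q ` {i. i < k \<and> root_of (out ! i) = v}" using i(1) by blast
    qed
    finally show ?thesis .
  qed
  have bounds: "f v \<le> count_list (map fst P) v" "count_list (map fst P) v \<le> g v" if v: "v \<in> mverts F" for v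
  proof -
    have "card {d \<in> set ?M. snd d = real v} \<le> card {d \<in> ?D. fst d < 0 \<and> snd d = real v}"
    proof (rule card_mono)
      show "{d \<in> set ?M. snd d = real v} \<subseteq> {d \<in> ?D. fst d < 0 \<and> snd d = real v}"
      proof
        fix d assume d: "d \<in> {d \<in> set ?M. snd d = real v}"
        then have "fst d < 0" using M_ok by blast
        with d show "d \<in> {d \<in> ?D. fst d < 0 \<and> snd d = real v}" by simp
      qed
    qed simp
    then show "f v \<le> count_list (map fst P) v" unfolding cnt M_deg[OF v] .
    have "{d \<in> ?D. fst d < 0 \<and> snd d = real v} \<subseteq>
        {d \<in> set ?O. fst d < 0 \<and> snd d = real v} \<union> {d \<in> set ?M. snd d = real v}" by auto
    then have "card {d \<in> ?D. fst d < 0 \<and> snd d = real v} \<le>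
        card ({d \<in> set ?O. fst d < 0 \<and> snd d = real v} \<union> {d \<in> set ?M. snd d = real v})"
      by (intro card_mono) auto
    also have "\<dots> \<le> card {d \<in> set ?O. fst d < 0 \<and> snd d = real v} + f v"
      unfolding M_deg[OF v, symmetric] by (rule card_Un_le)
    also have "card {d \<in> set ?O. fst d < 0 \<and> snd d = real v} \<le> card (root_ids v)"
    proof (rule card_inj_on_le)
      show "inj_on fst {d \<in> set ?O. fst d < 0 \<and> snd d = real v}"
        using out(5) by (rule inj_on_subset) auto
      show "fst ` {d \<in> set ?O. fst d < 0 \<and> snd d = real v} \<subseteq> root_ids v"
      proof
        fix i assume "i \<in> fst ` {d \<in> set ?O. fst d < 0 \<and> snd d = real v}"
        then obtain d where d: "d \<in> set ?O" "i < 0" "snd d = real v" "i = fst d" by blast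
        with out(7)[OF d(1)] I(2) have x: "i \<in> set S" "real v \<in> set (heads_of T i)" by auto
        from x(1) show "i \<in> root_ids v"
        proof (cases rule: id_cases)
          case (2 j)
          then have "heads_of T i = [real v]" using root_row(2)[OF 2(1)] x(2) by simp
          with x(1) d(2) show ?thesis unfolding root_ids_def by blast
        qed (use d(2) in simp)
      qed
      show "finite (root_ids v)" by (simp add: root_ids_def)
    qed
    finally show "count_list (map fst P) v \<le> g v"
      unfolding cnt card_root_ids[OF v] using fk[OF v] by simp
  qed
  show flex: "flexible_packing F k f g P"
    unfolding flexible_packing_def
  proof (intro conjI allI impI ballI)
    show "length P = k" by (rule P(1))
    show "case x of (r, B) \<Rightarrow> spanning_mixed_hyperarborescence F r B" if "x \<in> set P" for x
      using that part(5) unfolding P_def by auto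
    show "snd (P ! i) \<inter> snd (P ! j) = {}" if ij: "i < length P" "j < length P" "i \<noteq> j" for i j
    proof -
      have k: "i < k" "j < k" using ij P(1) by auto
      have False if "e \<in> set (edges_of (out ! i))" "e \<in> set (edges_of (out ! j))" for e
      proof -
        from that in_edges[OF outi[OF k(1)]] in_edges[OF outi[OF k(2)]]
        obtain d d' where d: "d \<in> set (out ! i)" "d' \<in> set (out ! j)" "fst d = real e" "fst d' = real e" by blast
        have "d \<in> ?D" "d' \<in> ?D" using d(1,2) pD[OF outi[OF k(1)]] pD[OF outi[OF k(2)]] by blast+
        moreover have "fst d = fst d'" unfolding d(3,4) ..
        ultimately have "d = d'" using out(5) by (simp add: inj_on_def)
        with d disj[OF k ij(3)] show False by blast
      qed
      then show ?thesis using P(2) k by auto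
    qed
    show "f v \<le> count_list (map fst P) v" "count_list (map fst P) v \<le> g v" if "v \<in> mverts F" for v
      using bounds[OF that] .
  qed
  define Z where "Z = (\<Union>i<k. snd (P ! i))"
  have "packing_weight w P = sum w Z" using packing_counts(3)[OF wf flex] by (simp add: Z_def)
  also have "\<dots> = sum (weight_of T) (real ` Z)"
  proof -
    have "Z \<subseteq> E" using packing_counts(1)[OF wf flex] by (simp add: Z_def)
    then have "sum w Z = (\<Sum>e\<in>Z. weight_of T (real e))" using edge_row(3) by (intro sum.cong) auto
    then show ?thesis by (subst sum.reindex) (auto simp: comp_def)
  qed
  also have "real ` Z = {i \<in> set I. 0 \<le> i}"
  proof (intro equalityI subsetI)
    fix i assume "i \<in> real ` Z"
    then obtain e j where e: "i = real e" "j < k" "e \<in> set (edges_of (out ! j))"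
      using P(2) by (auto simp: Z_def)
    with in_edges[OF outi[OF e(2)]] obtain d where d: "d \<in> set (out ! j)" "fst d = real e" by blast
    then have "d \<in> ?D" using pD[OF outi[OF e(2)]] by blast
    from edge[OF this] d(2) e(1) show "i \<in> {i \<in> set I. 0 \<le> i}" by simp
  next
    fix i assume i: "i \<in> {i \<in> set I. 0 \<le> i}"
    then have "i \<in> set S" using I(2) by blast
    then show "i \<in> real ` Z"
    proof (cases rule: id_cases)
      case (1 e)
      have "i \<in> fst ` set ?O" using i unfolding out(8) by simp
      then obtain d where d: "d \<in> set ?O" "fst d = i" by (elim imageE) simp
      then have "d \<in> ?D" by simp
      with in_out obtain j where j: "j < k" "d \<in> set (out ! j)" by blast
      then have "e \<in> set (edges_of (out ! j))" using in_edges[OF outi[OF j(1)]] d(2) 1(2) by blast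
      then have "e \<in> snd (P ! j)" using P(2)[OF j(1)] by simp
      then have "e \<in> Z" unfolding Z_def using j(1) by blast
      then show ?thesis unfolding 1(2) by (rule imageI)
    qed (use i in simp)
  qed
  also have "sum (weight_of T) {i \<in> set I. 0 \<le> i} = sum (weight_of T) (set I)"
  proof (rule sum.mono_neutral_left)
    show "\<forall>i\<in>set I - {i \<in> set I. 0 \<le> i}. weight_of T i = 0"
    proof
      fix i assume i: "i \<in> set I - {i \<in> set I. 0 \<le> i}"
      then have "i \<in> set S" using I(2) by blast
      then show "weight_of T i = 0"
      proof (cases rule: id_cases)
        case (1 e)
        then have "i \<in> {i \<in> set I. 0 \<le> i}" using i by simp
        then show ?thesis using i by blast
      qed (use root_row(3) in simp)
    qed
  qed auto
  finally show "packing_weight w P = sum (weight_of T) (set I)" .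
qed


lemma representation:
  assumes "\<And>p. p \<in> set out \<Longrightarrow> (\<Sum>d\<leftarrow>p. if fst d < 0 then snd d else 0) = real (root_of p)"
    and "\<And>p. p \<in> set out \<Longrightarrow> map fst (filter (\<lambda>d. 0 \<le> fst d) p) = map real (edges_of p)"
    and "\<And>p. p \<in> set out \<Longrightarrow> distinct (edges_of p)"
  shows "represents_packing (eL entry out) (map (\<lambda>p. (root_of p, set (edges_of p))) out)"
  unfolding represents_packing_def
proof (intro exI[of _ "map (\<lambda>p. (1, root_of p, edges_of p)) out"] conjI)
  show "\<forall>(m, r, es)\<in>set (map (\<lambda>p. (1, root_of p, edges_of p)) out). distinct es"
    using assms(3) by auto
  have "entry p = enc_list [enc_nat 1, enc_nat (root_of p), enc_list (map enc_nat (edges_of p))]" if "p \<in> set out" for p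
    unfolding entry_def assms(1)[OF that] assms(2)[OF that]
    by (simp add: enc_list_def eL_def enc_nat_def[abs_def] comp_def)
  then show "eL entry out = enc_list (map (\<lambda>(m, r, es).
      enc_list [enc_nat m, enc_nat r, enc_list (map enc_nat es)]) (map (\<lambda>p. (1, root_of p, edges_of p)) out))"
    unfolding eL_def map_map by (intro arg_cong[of _ _ enc_list] map_cong) simp_all
  show "map (\<lambda>p. (root_of p, set (edges_of p))) out =
      concat (map (\<lambda>(m, r, es). replicate m (r, set es)) (map (\<lambda>p. (1, root_of p, edges_of p)) out))"
    by (induction out) simp_all
qed

lemma base_props:
  defines "I \<equiv> base T V ks sl1 sl2"
  shows "distinct I" "set I \<subseteq> set S" "M1.sparse (set I)" "M2.sparse (set I)" "length I \<le> length sl2"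
    "\<And>J. M1.sparse J \<Longrightarrow> M2.sparse J \<Longrightarrow> card J \<le> length I"
    "\<And>J. M1.sparse J \<Longrightarrow> M2.sparse J \<Longrightarrow> card J = length I \<Longrightarrow> sum (weight_of T) (set I) \<le> sum (weight_of T) J"
proof -
  note C = common_opt[folded base_def, folded I_def]
  show I: "distinct I" "set I \<subseteq> set S" "M1.sparse (set I)" "M2.sparse (set I)" by (rule C)+
  have cI: "card (set I) = length I" using I(1) by (rule distinct_card)
  show "card J \<le> length I" if "M1.sparse J" "M2.sparse J" for J using C(5)[OF that] cI by simp
  show "sum (weight_of T) (set I) \<le> sum (weight_of T) J" if "M1.sparse J" "M2.sparse J" "card J = length I" for J
    using C(6)[OF that(1,2)] that(3) cI by simp
  have "{i \<in> set I. set (heads_of T i) \<subseteq> set V} = set I" using heads I(2) by blast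
  then have "card (set I) = M2.count (set I) (set V)" by (simp add: M2.count_def)
  also have "\<dots> \<le> (\<Sum>v\<in>set V. cap v)" using I(4) unfolding M2.sparse_def by blast
  finally show "length I \<le> length sl2" using cI length_sl2 by simp
qed

text \<open>Packings and common independent sets that fill all slots translate into each other with
  equal weight, so an optimum of one kind gives an optimum of the other. A failed test contradicts
  the counts of a packing or the size of the set derived from it.\<close>

lemma solve_many_correct:
  "correct_output (F, k, f, g, w) (solve_many vs ks T os fs sl2 (base T V ks sl1 sl2) (real k))"
proof -
  define I where "I = base T V ks sl1 sl2"
  note B = base_props[folded I_def]
  define ok where "ok \<longleftrightarrow> len ks = real k \<and> (\<forall>r\<in>set vs. fst (snd r) \<le> real k \<and> fst (snd r) \<le> snd (snd r)) \<and>
    demand vs \<le> real k \<and> len I = len sl2"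
  have ok: "ok \<longleftrightarrow> (\<forall>v\<in>mverts F. f v \<le> k \<and> f v \<le> g v) \<and> (\<Sum>v\<in>mverts F. f v) \<le> k \<and> length I = length sl2"
    unfolding ok_def len_eq ks(2) demand_eq vs_rows(2) by (auto simp del: of_nat_sum)
  show ?thesis
  proof (cases ok)
    case True
    define out where "out = decompose T V ks (orient T sl2 I @ fixed_arcs os fs)"
    define P where "P = map (\<lambda>p. (root_of p, set (edges_of p))) out"
    have y: "solve_many vs ks T os fs sl2 I (real k) = enc_list [eL entry out]"
      using True unfolding ok_def solve_many_def out_def V_def by (simp add: enc_list_def)
    have t: "\<And>v. v \<in> mverts F \<Longrightarrow> f v \<le> k \<and> f v \<le> g v" "(\<Sum>v\<in>mverts F. f v) \<le> k" "length I = length sl2"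
      using True unfolding ok by blast+
    note P = base_packing[OF t(1,2) B(1-4) t(3), folded out_def, folded P_def]
    have rep: "represents_packing (eL entry out) P" unfolding P_def by (rule representation[OF P(3-5)])
    have "packing_weight w P \<le> packing_weight w Q" if "flexible_packing F k f g Q" for Q
    proof -
      from packing_base[OF that] obtain J where J: "M1.sparse J" "M2.sparse J" "card J = length sl2"
        "sum (weight_of T) J = packing_weight w Q" by blast
      with B(7)[OF J(1,2)] t(3) P(2) show ?thesis by simp
    qed
    with P(1) have "min_weight_flexible_packing F k f g w P" by (simp add: min_weight_flexible_packing_def)
    with rep y P(1) show ?thesis unfolding I_def by auto
  next
    case False
    then have y: "solve_many vs ks T os fs sl2 I (real k) = Empty"
      unfolding ok_def solve_many_def by auto
    have no: "flexible_packing F k f g P \<Longrightarrow> False" for P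
    proof -
      assume P: "flexible_packing F k f g P"
      note C = packing_counts(5,6)[OF wf P]
      from C(1) have ck: "count_list (map fst P) v \<le> k" if "v \<in> mverts F" for v using that by (metis le_add2)
      have fc: "f v \<le> count_list (map fst P) v" "count_list (map fst P) v \<le> g v" if "v \<in> mverts F" for v
        using P that by (auto simp: flexible_packing_def)
      have "(\<Sum>v\<in>mverts F. f v) \<le> (\<Sum>v\<in>mverts F. count_list (map fst P) v)"
        using fc(1) by (rule sum_mono)
      then have s: "(\<Sum>v\<in>mverts F. f v) \<le> k" using C(2) by simp
      from packing_base[OF P] obtain J where J: "M1.sparse J" "M2.sparse J" "card J = length sl2" by blast
      have "length I = length sl2" using B(5) B(6)[OF J(1,2)] J(3) by simp
      moreover have "f v \<le> k \<and> f v \<le> g v" if "v \<in> mverts F" for v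
        using fc[OF that] ck[OF that] by linarith
      ultimately show False using False s unfolding ok by blast
    qed
    show ?thesis unfolding correct_output.simps using y[unfolded I_def] no by metis
  qed
qed

end

context inst
begin

lemma solve_many_scarce:
  assumes k: "card E < k" and n: "2 \<le> card (mverts F)"
  shows "correct_output (F, k, f, g, w) (solve_many vs ks T' os' fs' sl I (real k))"
proof -
  have "length ks \<le> length (map fst ds @ map fst hs)"
    unfolding ks_def units_def by (rule order_trans[OF length_filter_le]) (simp add: enum_def)
  also have "\<dots> = card E"
    using lists fin by (simp add: ds_def hs_def card_Un_disjoint) (metis distinct_card)
  finally have "len ks \<noteq> real k" using k by (simp add: len_eq)
  then have y: "solve_many vs ks T' os' fs' sl I (real k) = Empty" unfolding solve_many_def by simp
  have no: "flexible_packing F k f g P \<Longrightarrow> False" for P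
  proof -
    assume P: "flexible_packing F k f g P"
    have "k * 1 \<le> k * (card (mverts F) - 1)" using n by (intro mult_le_mono) simp_all
    also have "\<dots> = card (\<Union>i<k. snd (P ! i))" using packing_counts(2)[OF wf P] by simp
    also have "\<dots> \<le> card E" using packing_counts(1)[OF wf P] fin(4) by (rule card_mono[rotated])
    finally show False using k by simp
  qed
  show ?thesis unfolding correct_output.simps using y no by metis
qed

lemma single_vertex:
  assumes V: "mverts F = {v}"
  shows "flexible_packing F k f g P \<longleftrightarrow> P = replicate k (v, {}) \<and> f v \<le> k \<and> k \<le> g v"
proof -
  have E: "E = {}"
  proof -
    have False if "a \<in> dyperedges F" for a using dyper[OF that] V by auto
    moreover have False if e: "e \<in> hyperedges F" for e
    proof -
      have "ends F e \<subseteq> {v}" using hyper[OF e] V by simp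
      then have "card (ends F e) \<le> card {v}" by (intro card_mono) simp_all
      then show False using hyper[OF e] by simp
    qed
    ultimately show ?thesis by blast
  qed
  let ?D = "\<lparr>verts = {v}, arcs = {}, tail = (\<lambda>_. v), head = (\<lambda>_. v)\<rparr> :: (nat, nat) pre_digraph"
  have "arborescence v ?D" by (rule arborescenceI[where t = "\<lambda>_. 0"]) simp_all
  moreover have "is_trimming F {} ?D" using V by (simp add: is_trimming_def)
  ultimately have sp: "spanning_mixed_hyperarborescence F v {}"
    using V by (auto simp: spanning_mixed_hyperarborescence_def)
  have only: "r = v \<and> B = {}" if "spanning_mixed_hyperarborescence F r B" for r B
    using that V E by (auto simp: spanning_mixed_hyperarborescence_def)
  have cnt: "count_list (replicate n v) v = n" for n by (induction n) simp_all
  show ?thesis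
  proof
    assume P: "flexible_packing F k f g P"
    then have "x = (v, {})" if "x \<in> set P" for x
      using only[of "fst x" "snd x"] that by (cases x) (auto simp: flexible_packing_def)
    moreover have "length P = k" using P by (simp add: flexible_packing_def)
    ultimately have "P = replicate k (v, {})" using replicate_length_same[of P] by metis
    moreover have "f v \<le> k" "k \<le> g v"
      using P V unfolding calculation flexible_packing_def by (simp_all add: cnt)
    ultimately show "P = replicate k (v, {}) \<and> f v \<le> k \<and> k \<le> g v" by blast
  next
    assume "P = replicate k (v, {}) \<and> f v \<le> k \<and> k \<le> g v"
    then show "flexible_packing F k f g P"
      unfolding flexible_packing_def using V sp by (auto simp: cnt)
  qed
qed

lemma solve_single:
  assumes "mverts F = {v}"
  shows "correct_output (F, k, f, g, w) (solve vs ds hs (real k))"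
proof -
  let ?P = "replicate k (v, {}) :: (nat, nat) packing"
  let ?z = "enc_list [enc_list [enc_nat k, enc_nat v, enc_list []]]"
  have "vs = [(real v, real (f v), real (g v))]" unfolding vs_def vl_def assms by simp
  then have y: "solve vs ds hs (real k) = (if f v \<le> k \<and> k \<le> g v then enc_list [?z] else Empty)"
    by (simp add: solve_def enc_list_def enc_nat_def)
  have "represents_packing ?z ?P"
    unfolding represents_packing_def
    by (rule exI[of _ "[(k, v, [])]"]) simp
  then show ?thesis
    unfolding y by (auto simp: single_vertex[OF assms] min_weight_flexible_packing_def)
qed

theorem solve_correct: "correct_output (F, k, f, g, w) (solve vs ds hs (real k))"
proof (cases "card (mverts F) = 1")
  case True
  then obtain v where "mverts F = {v}" by (auto simp: card_1_singleton_iff)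
  then show ?thesis by (rule solve_single)
next
  case False
  moreover have "card (mverts F) \<noteq> 0" using fin(1,6) by simp
  ultimately have n: "2 \<le> card (mverts F)" by linarith
  have "length vs = card (mverts F)" using V_facts(6) by (simp add: V_def)
  with n obtain r rs where "vs = r # rs" "rs \<noteq> []" by (cases vs; cases "tl vs") auto
  then have y: "solve vs ds hs (real k) = solve_many vs ks T os fs sl2 (base T V ks sl1 sl2) (real k)"
    unfolding V_def T_def os_def fs_def sl1_def sl2_def ks_def solve_def by (simp split: list.split)
  show ?thesis
  proof (cases "k \<le> card E")
    case True
    interpret inst_units by unfold_locales (rule True)
    show ?thesis unfolding y by (rule solve_many_correct)
  next
    case False
    then show ?thesis unfolding y by (intro solve_many_scarce n) simp
  qed
qed

end


section \<open>Running times along the structure of the definitions\<close>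

section \<open>The algorithm runs in polynomial time\<close>

abbreviation eN :: "real list \<Rightarrow> data" where "eN \<equiv> eL Num"
abbreviation eA :: "(real \<times> real) list \<Rightarrow> data" where "eA \<equiv> eL (eP Num Num)"
abbreviation eRow :: "row \<Rightarrow> data" where "eRow \<equiv> eP Num (eP Num (eP eN eN))"
abbreviation eT :: "row list \<Rightarrow> data" where "eT \<equiv> eL eRow"
abbreviation eItem :: "real \<times> real list \<Rightarrow> data" where "eItem \<equiv> eP Num eN"
abbreviation eSlot :: "real slot \<Rightarrow> data" where "eSlot \<equiv> eP Num (eP Num (eP Num (eL eItem)))"
abbreviation eState :: "(real \<times> real list) list \<times> real slot list \<Rightarrow> data" where
  "eState \<equiv> eP (eL eItem) (eL eSlot)"

lemma data_size_nums [simp]: "data_size (eN l) = 1 + 2 * length l" "data_size (eA D) = 1 + 4 * length D"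
  by (simp_all add: data_size_eL sum_list_triv)

lemma ptime_span_of:
  assumes T: "ptime X N f (\<lambda>x. eT (T x))" and i: "ptime X N f (\<lambda>x. Num (i x))"
  shows "ptime X N f (\<lambda>x. eN (span_of (T x) (i x)))"
  unfolding span_of_def
  apply (rule ptime_concat_map[where h = "\<lambda>x r. if fst r = i x then fst (snd (snd r)) else []", OF T])
  subgoal premises p for Z u
    by (rule ptime_If[where e = eN]; intro ptime_eq ptime_fst[OF p(3)] p(2)[OF i]
        ptime_fst[OF ptime_snd[OF ptime_snd[OF p(3)]]] ptime_Nil[OF p(3)])
  done

lemma ptime_heads_of:
  assumes T: "ptime X N f (\<lambda>x. eT (T x))" and i: "ptime X N f (\<lambda>x. Num (i x))"
  shows "ptime X N f (\<lambda>x. eN (heads_of (T x) (i x)))"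
  unfolding heads_of_def
  apply (rule ptime_concat_map[where h = "\<lambda>x r. if fst r = i x then snd (snd (snd r)) else []", OF T])
  subgoal premises p for Z u
    by (rule ptime_If[where e = eN]; intro ptime_eq ptime_fst[OF p(3)] p(2)[OF i]
        ptime_snd[OF ptime_snd[OF ptime_snd[OF p(3)]]] ptime_Nil[OF p(3)])
  done

lemma ptime_weight_of:
  assumes T: "ptime X N f (\<lambda>x. eT (T x))" and i: "ptime X N f (\<lambda>x. Num (i x))"
  shows "ptime X N f (\<lambda>x. Num (weight_of (T x) (i x)))"
  unfolding weight_of_def
  apply (rule ptime_sum_list[where h = "\<lambda>x r. if fst r = i x then fst (snd r) else 0", OF T])
  subgoal premises p for Z u
    by (rule ptime_If[where e = Num]; intro ptime_eq ptime_fst[OF p(3)] p(2)[OF i]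
        ptime_fst[OF ptime_snd[OF p(3)]] ptime_0[OF p(3)])
  done

lemma ptime_tails_of:
  assumes T: "ptime X N f (\<lambda>x. eT (T x))" and i: "ptime X N f (\<lambda>x. Num (i x))"
  shows "ptime X N f (\<lambda>x. eN (tails_of (T x) (i x)))"
  unfolding tails_of_def
  by (rule ptime_If[where e = eN]; intro ptime_less i ptime_0[OF i] ptime_single ptime_m1[OF i]
      ptime_span_of T)

lemma ptime_bid:
  assumes n: "ptime X N f (\<lambda>x. Num (n x))" and st: "ptime X N f (\<lambda>x. eState (st x))"
  shows "ptime X N f (\<lambda>x. eState (bid (n x) (st x)))"
  unfolding bid_def
  apply (rule ptime_case_list[where ec = eState and e = eItem and l = "\<lambda>x. fst (st x)" and g = st and
      h = "\<lambda>x it q. case best (\<lambda>s t. slab s \<le> slab t) (filter (\<lambda>s. svert s \<in> set (snd it)) (snd (st x))) of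
        [] \<Rightarrow> st x
      | b # _ \<Rightarrow> if slab b \<le> n x
          then (socc b @ q, map (\<lambda>s. if sid s = sid b then (sid s, svert s, slab s + 1, [it]) else s) (snd (st x)))
          else st x",
      OF ptime_fst[OF st] ptime_subset[OF st]], blast)
  subgoal premises p for Z u
  proof (rule ptime_case_list[where ec = eState and e = eSlot and
      l = "\<lambda>z. best (\<lambda>s t. slab s \<le> slab t) (filter (\<lambda>s. svert s \<in> set (snd (fst (snd z)))) (snd (st (fst z))))" and
      g = "\<lambda>z. st (fst z)" and
      h = "\<lambda>z b _. if slab b \<le> n (fst z)
          then (socc b @ snd (snd z), map (\<lambda>s. if sid s = sid b then (sid s, svert s, slab s + 1, [fst (snd z)]) else s) (snd (st (fst z))))
          else st (fst z)"])
    show "ptime Z (\<lambda>z. N (fst z)) u (\<lambda>x. eL eSlot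
       (best (\<lambda>s t. slab s \<le> slab t) (filter (\<lambda>s. svert s \<in> set (snd (fst (snd x)))) (snd (st (fst x))))))"
    proof (rule ptime_best[where e = eSlot])
      show "ptime Z (\<lambda>z. N (fst z)) u
         (\<lambda>x. eL eSlot (filter (\<lambda>s. svert s \<in> set (snd (fst (snd x)))) (snd (st (fst x)))))"
        apply (rule ptime_filter[where P = "\<lambda>x s. svert s \<in> set (snd (fst (snd x)))", OF p(2)[OF ptime_snd[OF st]]])
        subgoal premises q for Z' u'
          by (intro ptime_mem ptime_fst[OF ptime_snd[OF q(3)]] q(2)[OF ptime_snd[OF p(3)]])
        done
    qed (intro ptime_le, (erule ptime_fst[OF ptime_snd[OF ptime_snd]])+)
    show "ptime {x \<in> Z. best (\<lambda>s t. slab s \<le> slab t)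
          (filter (\<lambda>s. svert s \<in> set (snd (fst (snd x)))) (snd (st (fst x)))) = []}
       (\<lambda>z. N (fst z)) u (\<lambda>x. eState (st (fst x)))"
      by (rule ptime_subset[OF p(2)[OF st]]) blast
    fix W v
    assume l: "\<And>g. ptime Z (\<lambda>z. N (fst z)) u g \<Longrightarrow> ptime W (\<lambda>z. N (fst (fst z))) v (\<lambda>z. g (fst z))"
      and b: "ptime W (\<lambda>z. N (fst (fst z))) v (\<lambda>z. eSlot (fst (snd z)))"
    note slab = ptime_fst[OF ptime_snd[OF ptime_snd[OF b]]]
    show "ptime W (\<lambda>z. N (fst (fst z))) v
           (\<lambda>z. eState
                 (if slab (fst (snd z)) \<le> n (fst (fst z))
                  then (socc (fst (snd z)) @ snd (snd (fst z)),
                        map (\<lambda>s. if sid s = sid (fst (snd z))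
                                  then (sid s, svert s, slab s + 1, [fst (snd (fst z))]) else s)
                         (snd (st (fst (fst z)))))
                  else st (fst (fst z))))"
    proof (rule ptime_If[where e = eState]; (intro ptime_pair)?)
      show "ptime W (\<lambda>z. N (fst (fst z))) v (\<lambda>z. eB (slab (fst (snd z)) \<le> n (fst (fst z))))"
        by (intro ptime_le slab l[OF p(2)[OF n]])
      show "ptime W (\<lambda>z. N (fst (fst z))) v (\<lambda>z. eL eItem (socc (fst (snd z)) @ snd (snd (fst z))))"
        by (intro ptime_append ptime_snd[OF ptime_snd[OF ptime_snd[OF b]]] l[OF p(4)])
      show "ptime W (\<lambda>z. N (fst (fst z))) v (\<lambda>z. eState (st (fst (fst z))))"
        by (rule l[OF p(2)[OF st]])
      show "ptime W (\<lambda>z. N (fst (fst z))) v (\<lambda>z. eL eSlot (map (\<lambda>s. if sid s = sid (fst (snd z))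
          then (sid s, svert s, slab s + 1, [fst (snd (fst z))]) else s) (snd (st (fst (fst z))))))"
        apply (rule ptime_map[where ec = eSlot and h = "\<lambda>z s. if sid s = sid (fst (snd z))
            then (sid s, svert s, slab s + 1, [fst (snd (fst z))]) else s", OF l[OF p(2)[OF ptime_snd[OF st]]]])
        subgoal premises q for Z' u'
          by (rule ptime_If[where e = eSlot]; (intro ptime_eq ptime_pair ptime_add ptime_single)?; (intro
              ptime_fst[OF q(3)] q(3) q(2)[OF ptime_fst[OF b]] ptime_fst[OF ptime_snd[OF q(3)]]
              ptime_fst[OF ptime_snd[OF ptime_snd[OF q(3)]]] ptime_1[OF q(3)] q(2)[OF l[OF p(3)]])?)
        done
    qed
  qed
  done

text \<open>Items are neither copied nor altered, so each item in a state is one of the given ones.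
  Prices do not matter, as a number has size 1 whatever its value.\<close>

lemma hall_state_size:
  assumes "hall_inv items slots st"
  shows "data_size (eState st) \<le> 3 + length items * (1 + data_size (eL eItem items)) +
    length slots * (9 + data_size (eL eItem items))"
proof -
  let ?B = "data_size (eL eItem items)"
  have m: "mset (fst st @ concat (map socc (snd st))) = mset items" and v: "map svert (snd st) = slots"
    and ok: "\<And>s. s \<in> set (snd st) \<Longrightarrow> slot_ok (real (length slots)) (snd st) s"
    using assms by (auto simp: hall_inv_def)
  have sub: "set (fst st @ concat (map socc (snd st))) = set items" using m by (rule mset_eq_setD)
  have "length (fst st @ concat (map socc (snd st))) = length items" using m by (rule mset_eq_length)
  then have "length (fst st) \<le> length items" by simp
  moreover have "data_size (eL eItem (fst st)) \<le> 1 + length (fst st) * (1 + ?B)"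
    by (rule data_size_eL_le, rule data_size_mem) (use sub in auto)
  ultimately have 1: "data_size (eL eItem (fst st)) \<le> 1 + length items * (1 + ?B)"
    by (meson add_left_mono mult_le_mono1 order_trans)
  have "data_size (eSlot s) \<le> 8 + ?B" if s: "s \<in> set (snd st)" for s
  proof -
    have "socc s = [] \<or> (\<exists>it. socc s = [it])" using ok[OF s] by (auto simp: slot_ok_def)
    moreover have "data_size (eItem it) \<le> ?B" if "it \<in> set (socc s)" for it
      by (rule data_size_mem) (use sub s that in auto)
    ultimately show ?thesis by fastforce
  qed
  then have "data_size (eL eSlot (snd st)) \<le> 1 + length (snd st) * (1 + (8 + ?B))" by (rule data_size_eL_le)
  also have "length (snd st) = length slots" using v by (metis length_map)
  finally show ?thesis using 1 by simp
qed

lemma ptime_hall: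
  assumes it: "ptime X N f (\<lambda>x. eL eItem (items x))" and sl: "ptime X N f (\<lambda>x. eN (slots x))"
  shows "ptime X N f (\<lambda>x. eState (hall (items x) (slots x)))"
  unfolding hall_def
proof (rule ptime_iterate[where h = "\<lambda>x. bid (real (length (slots x)))" and e = Num and
    ys = "\<lambda>x. concat (map (\<lambda>_. 0 # slots x) (0 # slots x))" and
    init = "\<lambda>x. (items x, map (\<lambda>p. (fst p, snd p, 0, [])) (enum (slots x)))"])
  have sl0: "ptime X N f (\<lambda>x. eN (0 # slots x))" by (intro ptime_Cons ptime_0[OF sl] sl)
  show "ptime X N f (\<lambda>x. eN (concat (map (\<lambda>_. 0 # slots x) (0 # slots x))))"
    by (rule ptime_concat_map[where h = "\<lambda>x _. 0 # slots x", OF sl0]) (use sl0 in blast)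
  show "ptime X N f (\<lambda>x. eState (items x, map (\<lambda>p. (fst p, snd p, 0, [])) (enum (slots x))))"
    apply (intro ptime_pair it)
    apply (rule ptime_map[where h = "\<lambda>x p. (fst p, snd p, 0, [])", OF ptime_enum[OF sl]])
    subgoal premises p for Z u
      by (intro ptime_pair ptime_fst[OF p(3)] ptime_snd[OF p(3)] ptime_0[OF p(3)] ptime_Nil[OF p(3)])
    done
  show "pbound X N (\<lambda>x. 3 + length (items x) * (1 + data_size (eL eItem (items x))) +
    length (slots x) * (9 + data_size (eL eItem (items x))))"
    by (intro pbound_intros ptime_length_bound[OF it] ptime_length_bound[OF sl] ptime_size[OF it])
  show "data_size (eState ((bid (real (length (slots x))) ^^ j)
      (items x, map (\<lambda>p. (fst p, snd p, 0, [])) (enum (slots x))))) \<le>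
      3 + length (items x) * (1 + data_size (eL eItem (items x))) +
        length (slots x) * (9 + data_size (eL eItem (items x)))" for x j
  proof (rule hall_state_size)
    show "hall_inv (items x) (slots x) ((bid (real (length (slots x))) ^^ j)
        (items x, map (\<lambda>p. (fst p, snd p, 0, [])) (enum (slots x))))"
      by (induction j) (auto intro: hall_inv_init hall_inv_bid)
  qed
  have n: "ptime X N f (\<lambda>x. Num (real (length (slots x))))"
  proof -
    have "ptime X N f (\<lambda>x. Num (\<Sum>_\<leftarrow>slots x. 1))"
      by (rule ptime_sum_list[where h = "\<lambda>_ _. 1", OF sl]) (rule ptime_1)
    then show ?thesis by (simp add: sum_list_triv)
  qed
  fix Z :: "('a \<times> real \<times> (real \<times> real list) list \<times> real slot list) set" and u
  assume "\<And>g. ptime X N f g \<Longrightarrow> ptime Z (\<lambda>z. N (fst z)) u (\<lambda>z. g (fst z))"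
    and "ptime Z (\<lambda>z. N (fst z)) u (\<lambda>z. eState (snd (snd z)))"
  then show "ptime Z (\<lambda>z. N (fst z)) u (\<lambda>z. eState (bid (real (length (slots (fst z)))) (snd (snd z))))"
    using n by (intro ptime_bid) blast+
qed

text \<open>The common form of \<open>test_span\<close> and \<open>test_conn\<close>: one auction
  for each vertex, with extra copies of that vertex among the items.\<close>

lemma ptime_covers:
  assumes V: "ptime X N f (\<lambda>x. eN (V x))" and it: "ptime X N f (\<lambda>x. eL eItem (items x))"
    and ks: "ptime X N f (\<lambda>x. eN (ks x))" and sl: "ptime X N f (\<lambda>x. eN (slots x))"
  shows "ptime X N f (\<lambda>x. eB (\<forall>r\<in>set (V x). fst (hall (items x @ map (\<lambda>j. (j, [r])) (ks x)) (slots x)) = []))"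
  apply (rule ptime_ball[where P = "\<lambda>x r. fst (hall (items x @ map (\<lambda>j. (j, [r])) (ks x)) (slots x)) = []", OF V])
  subgoal premises p for Z u
    apply (rule ptime_is_Nil[where e = eItem], intro ptime_fst[OF ptime_hall] ptime_append p(2)[OF it] p(2)[OF sl])
    apply (rule ptime_map[where h = "\<lambda>z j. (j, [snd z])", OF p(2)[OF ks]])
    subgoal premises q for Z' u' by (intro ptime_pair q(3) ptime_single q(2)[OF p(3)])
    done
  done

lemma ptime_test_span:
  assumes T: "ptime X N f (\<lambda>x. eT (T x))" and V: "ptime X N f (\<lambda>x. eN (V x))"
    and ks: "ptime X N f (\<lambda>x. eN (ks x))" and sl: "ptime X N f (\<lambda>x. eN (slots x))"
    and I: "ptime X N f (\<lambda>x. eN (I x))"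
  shows "ptime X N f (\<lambda>x. eB (test_span (T x) (V x) (ks x) (slots x) (I x)))"
  unfolding test_span_def
  apply (rule ptime_covers[where items = "\<lambda>x. map (\<lambda>i. (i, span_of (T x) i)) (I x)", OF V _ ks sl])
  apply (rule ptime_map[where h = "\<lambda>x i. (i, span_of (T x) i)", OF I])
  subgoal premises p for Z u by (intro ptime_pair ptime_span_of p(3) p(2)[OF T])
  done

lemma ptime_head_items:
  assumes T: "ptime X N f (\<lambda>x. eT (T x))" and I: "ptime X N f (\<lambda>x. eN (I x))"
  shows "ptime X N f (\<lambda>x. eL eItem (map (\<lambda>i. (i, heads_of (T x) i)) (I x)))"
  apply (rule ptime_map[where h = "\<lambda>x i. (i, heads_of (T x) i)", OF I])
  subgoal premises p for Z u by (intro ptime_pair ptime_heads_of p(3) p(2)[OF T])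
  done

lemma ptime_test_heads:
  assumes T: "ptime X N f (\<lambda>x. eT (T x))" and sl: "ptime X N f (\<lambda>x. eN (slots x))"
    and I: "ptime X N f (\<lambda>x. eN (I x))"
  shows "ptime X N f (\<lambda>x. eB (test_heads (T x) (slots x) (I x)))"
  unfolding test_heads_def
  by (rule ptime_is_Nil[where e = eItem], intro ptime_fst[OF ptime_hall] sl ptime_head_items T I)

lemma ptime_test_conn:
  assumes T: "ptime X N f (\<lambda>x. eT (T x))" and V: "ptime X N f (\<lambda>x. eN (V x))"
    and ks: "ptime X N f (\<lambda>x. eN (ks x))" and D: "ptime X N f (\<lambda>x. eA (D x))"
  shows "ptime X N f (\<lambda>x. eB (test_conn (T x) (V x) (ks x) (D x)))"
  unfolding test_conn_def
proof (rule ptime_covers[where items = "\<lambda>x. map (\<lambda>d. (fst d, span_of (T x) (fst d))) (filter (\<lambda>d. 0 \<le> fst d) (D x))", OF V _ ks])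
  have F: "ptime X N f (\<lambda>x. eA (filter (\<lambda>d. 0 \<le> fst d) (D x)))"
    apply (rule ptime_filter[where P = "\<lambda>x d. 0 \<le> fst d", OF D])
    subgoal premises p for Z u by (intro ptime_le ptime_0[OF p(3)] ptime_fst[OF p(3)])
    done
  show "ptime X N f (\<lambda>x. eL eItem (map (\<lambda>d. (fst d, span_of (T x) (fst d))) (filter (\<lambda>d. 0 \<le> fst d) (D x))))"
    apply (rule ptime_map[where h = "\<lambda>x d. (fst d, span_of (T x) (fst d))", OF F])
    subgoal premises p for Z u by (intro ptime_pair ptime_span_of p(2)[OF T] ptime_fst[OF p(3)])
    done
  show "ptime X N f (\<lambda>x. eN (map snd (D x)))"
    by (rule ptime_map[where h = "\<lambda>_. snd", OF D], rule ptime_snd)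
qed

section \<open>The exchange graph and the augmentation as programs\<close>

abbreviation eLab :: "real label \<Rightarrow> data" where "eLab \<equiv> eP Num (eP Num (eP Num eN))"

abbreviation exch_of where
  "exch_of T V ks sl1 sl2 I \<equiv> exch (test_span T V ks sl1) (test_heads T sl2) I"

abbreviation src_of where "src_of T V ks sl1 I v \<equiv> v \<notin> set I \<and> test_span T V ks sl1 (v # I)"

lemma ptime_remove:
  assumes I: "ptime X N f (\<lambda>x. eN (I x))" and u: "ptime X N f (\<lambda>x. Num (u x))"
  shows "ptime X N f (\<lambda>x. eN (filter (\<lambda>e. e \<noteq> u x) (I x)))"
  apply (rule ptime_filter[where P = "\<lambda>x e. e \<noteq> u x", OF I])
  subgoal premises p for Z u by (intro ptime_not ptime_eq p(3) p(2)[OF assms(2)])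
  done

lemma ptime_exch:
  assumes T: "ptime X N f (\<lambda>x. eT (T x))" and V: "ptime X N f (\<lambda>x. eN (V x))"
    and ks: "ptime X N f (\<lambda>x. eN (ks x))" and sl1: "ptime X N f (\<lambda>x. eN (sl1 x))"
    and sl2: "ptime X N f (\<lambda>x. eN (sl2 x))" and I: "ptime X N f (\<lambda>x. eN (I x))"
    and u: "ptime X N f (\<lambda>x. Num (u x))" and v: "ptime X N f (\<lambda>x. Num (v x))"
  shows "ptime X N f (\<lambda>x. eB (exch_of (T x) (V x) (ks x) (sl1 x) (sl2 x) (I x) (u x) (v x)))"
  unfolding exch_def
  by (rule ptime_If[where e = eB]; intro ptime_and ptime_not ptime_mem ptime_test_span ptime_test_heads
      ptime_Cons ptime_remove assms)

lemma ptime_src: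
  assumes T: "ptime X N f (\<lambda>x. eT (T x))" and V: "ptime X N f (\<lambda>x. eN (V x))"
    and ks: "ptime X N f (\<lambda>x. eN (ks x))" and sl1: "ptime X N f (\<lambda>x. eN (sl1 x))"
    and I: "ptime X N f (\<lambda>x. eN (I x))" and v: "ptime X N f (\<lambda>x. Num (v x))"
  shows "ptime X N f (\<lambda>x. eB (src_of (T x) (V x) (ks x) (sl1 x) (I x) (v x)))"
  by (intro ptime_and ptime_not ptime_mem ptime_test_span ptime_Cons assms)

lemma ptime_signed:
  assumes T: "ptime X N f (\<lambda>x. eT (T x))" and I: "ptime X N f (\<lambda>x. eN (I x))"
    and v: "ptime X N f (\<lambda>x. Num (v x))"
  shows "ptime X N f (\<lambda>x. Num (signed (weight_of (T x)) (I x) (v x)))"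
  unfolding signed_def
  by (rule ptime_If[where e = Num]; intro ptime_mem ptime_diff ptime_0[OF v] ptime_weight_of assms)

lemma ptime_cands:
  assumes T: "ptime X N f (\<lambda>x. eT (T x))" and V: "ptime X N f (\<lambda>x. eN (V x))"
    and ks: "ptime X N f (\<lambda>x. eN (ks x))" and sl1: "ptime X N f (\<lambda>x. eN (sl1 x))"
    and sl2: "ptime X N f (\<lambda>x. eN (sl2 x))" and I: "ptime X N f (\<lambda>x. eN (I x))"
    and L: "ptime X N f (\<lambda>x. eL eLab (L x))" and v: "ptime X N f (\<lambda>x. Num (v x))"
  shows "ptime X N f (\<lambda>x. eL eLab (cands (exch_of (T x) (V x) (ks x) (sl1 x) (sl2 x) (I x))
    (src_of (T x) (V x) (ks x) (sl1 x) (I x)) (signed (weight_of (T x)) (I x)) (L x) (v x)))"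
  unfolding cands_def
proof (rule ptime_append)
  show "ptime X N f (\<lambda>x. eL eLab (if src_of (T x) (V x) (ks x) (sl1 x) (I x) (v x)
      then [(v x, signed (weight_of (T x)) (I x) (v x), 1, [v x])] else []))"
    by (rule ptime_If[where e = "eL eLab"]; (intro ptime_src ptime_signed ptime_single ptime_pair assms
        ptime_1[OF v] ptime_Nil[OF v]))
  show "ptime X N f (\<lambda>x. eL eLab (concat (map (\<lambda>l. if exch_of (T x) (V x) (ks x) (sl1 x) (sl2 x) (I x) (fst l) (v x)
      then [(v x, fst (snd l) + signed (weight_of (T x)) (I x) (v x), fst (snd (snd l)) + 1, v x # snd (snd (snd l)))]
      else []) (L x))))"
    apply (rule ptime_concat_map[where h = "\<lambda>x l. if exch_of (T x) (V x) (ks x) (sl1 x) (sl2 x) (I x) (fst l) (v x)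
      then [(v x, fst (snd l) + signed (weight_of (T x)) (I x) (v x), fst (snd (snd l)) + 1, v x # snd (snd (snd l)))]
      else []", OF L])
    subgoal premises p for Z u
      by (rule ptime_If[where e = "eL eLab"]; (intro ptime_exch ptime_signed ptime_single ptime_pair ptime_Cons ptime_add
          p(2)[OF T] p(2)[OF V] p(2)[OF ks] p(2)[OF sl1] p(2)[OF sl2] p(2)[OF I] p(2)[OF v]
          ptime_fst[OF p(3)] ptime_fst[OF ptime_snd[OF p(3)]] ptime_fst[OF ptime_snd[OF ptime_snd[OF p(3)]]]
          ptime_snd[OF ptime_snd[OF ptime_snd[OF p(3)]]] ptime_1[OF p(3)] ptime_Nil[OF p(3)]))
    done
qed

lemma ptime_best_lab:
  assumes "ptime X N f (\<lambda>x. eL eLab (L x))"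
  shows "ptime X N f (\<lambda>x. eL eLab (best lab_le (L x)))"
  unfolding lab_le_def
  by (rule ptime_best[where e = eLab, OF assms]) (intro ptime_or ptime_and ptime_less ptime_le ptime_eq;
    (erule ptime_fst[OF ptime_snd] | erule ptime_fst[OF ptime_snd[OF ptime_snd]]))

lemma ptime_relax:
  assumes T: "ptime X N f (\<lambda>x. eT (T x))" and V: "ptime X N f (\<lambda>x. eN (V x))"
    and ks: "ptime X N f (\<lambda>x. eN (ks x))" and sl1: "ptime X N f (\<lambda>x. eN (sl1 x))"
    and sl2: "ptime X N f (\<lambda>x. eN (sl2 x))" and I: "ptime X N f (\<lambda>x. eN (I x))"
    and S: "ptime X N f (\<lambda>x. eN (S x))" and L: "ptime X N f (\<lambda>x. eL eLab (L x))"
  shows "ptime X N f (\<lambda>x. eL eLab (relax (exch_of (T x) (V x) (ks x) (sl1 x) (sl2 x) (I x))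
    (src_of (T x) (V x) (ks x) (sl1 x) (I x)) (signed (weight_of (T x)) (I x)) (S x) (L x)))"
  unfolding relax_def
  apply (rule ptime_concat_map[where h = "\<lambda>x v. best lab_le (cands (exch_of (T x) (V x) (ks x) (sl1 x) (sl2 x) (I x))
    (src_of (T x) (V x) (ks x) (sl1 x) (I x)) (signed (weight_of (T x)) (I x)) (L x) v)", OF S])
  subgoal premises p for Z u
    by (intro ptime_best_lab ptime_cands p(3) p(2)[OF T] p(2)[OF V] p(2)[OF ks] p(2)[OF sl1] p(2)[OF sl2] p(2)[OF I] p(2)[OF L])
  done

text \<open>A round keeps at most one label per node and lengthens the stored walks by at most one
  node. The size bound is thus free of any assumption on costs, where repeated nodes could still
  occur.\<close>

lemma labels_length:
  "length ((relax E src \<omega> S ^^ j) []) \<le> length S"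
  "l \<in> set ((relax E src \<omega> S ^^ j) []) \<Longrightarrow> length (snd (snd (snd l))) \<le> j"
proof -
  have rl: "length (relax E src \<omega> S L) \<le> length S" for L
    using sum_list_mono[of S "\<lambda>v. length (best lab_le (cands E src \<omega> L v))" "\<lambda>_. 1", OF length_best]
    by (simp add: relax_def length_concat comp_def sum_list_triv)
  show "length ((relax E src \<omega> S ^^ j) []) \<le> length S" by (cases j) (simp_all add: rl)
  show "l \<in> set ((relax E src \<omega> S ^^ j) []) \<Longrightarrow> length (snd (snd (snd l))) \<le> j"
  proof (induction j arbitrary: l)
    case (Suc j)
    then have "l \<in> set (relax E src \<omega> S ((relax E src \<omega> S ^^ j) []))" by simp
    then obtain v where "l \<in> set (best lab_le (cands E src \<omega> ((relax E src \<omega> S ^^ j) []) v))"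
      unfolding relax_def[of _ _ _ _ "(relax E src \<omega> S ^^ j) []"] by auto
    then have "l \<in> set (cands E src \<omega> ((relax E src \<omega> S ^^ j) []) v)" using set_best by fast
    then show ?case using Suc.IH by (auto simp: cands_def split: if_splits)
  qed simp
qed

lemma ptime_labels:
  assumes T: "ptime X N f (\<lambda>x. eT (T x))" and V: "ptime X N f (\<lambda>x. eN (V x))"
    and ks: "ptime X N f (\<lambda>x. eN (ks x))" and sl1: "ptime X N f (\<lambda>x. eN (sl1 x))"
    and sl2: "ptime X N f (\<lambda>x. eN (sl2 x))" and I: "ptime X N f (\<lambda>x. eN (I x))"
    and S: "ptime X N f (\<lambda>x. eN (S x))"
  shows "ptime X N f (\<lambda>x. eL eLab (labels (exch_of (T x) (V x) (ks x) (sl1 x) (sl2 x) (I x))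
    (src_of (T x) (V x) (ks x) (sl1 x) (I x)) (signed (weight_of (T x)) (I x)) (S x)))"
  unfolding labels_def
proof (rule ptime_iterate[where e = Num and ea = "eL eLab" and ys = S and init = "\<lambda>_. []" and
      h = "\<lambda>x. relax (exch_of (T x) (V x) (ks x) (sl1 x) (sl2 x) (I x))
    (src_of (T x) (V x) (ks x) (sl1 x) (I x)) (signed (weight_of (T x)) (I x)) (S x)", OF S ptime_Nil[OF S]])
  show "pbound X N (\<lambda>x. 1 + length (S x) * (1 + (7 + 2 * length (S x))))"
    by (intro pbound_intros ptime_length_bound[OF S])
  show "data_size (eL eLab ((relax (exch_of (T x) (V x) (ks x) (sl1 x) (sl2 x) (I x))
      (src_of (T x) (V x) (ks x) (sl1 x) (I x)) (signed (weight_of (T x)) (I x)) (S x) ^^ j) [])) \<le>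
      1 + length (S x) * (1 + (7 + 2 * length (S x)))"
    (is "data_size (eL eLab ?L) \<le> _") if "j \<le> length (S x)" for x j
  proof -
    have "data_size (eL eLab ?L) \<le> 1 + length ?L * (1 + (7 + 2 * length (S x)))"
      by (rule data_size_eL_le) (use labels_length(2) that in \<open>fastforce dest: order_trans\<close>)
    then show ?thesis using labels_length(1) by (meson add_left_mono mult_le_mono1 order_trans)
  qed
  fix Z :: "('a \<times> real \<times> real label list) set" and u
  assume l: "\<And>g. ptime X N f g \<Longrightarrow> ptime Z (\<lambda>z. N (fst z)) u (\<lambda>z. g (fst z))"
    and a: "ptime Z (\<lambda>z. N (fst z)) u (\<lambda>z. eL eLab (snd (snd z)))"
  show "ptime Z (\<lambda>z. N (fst z)) u (\<lambda>z. eL eLab (relax (exch_of (T (fst z)) (V (fst z)) (ks (fst z)) (sl1 (fst z)) (sl2 (fst z)) (I (fst z)))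
    (src_of (T (fst z)) (V (fst z)) (ks (fst z)) (sl1 (fst z)) (I (fst z))) (signed (weight_of (T (fst z))) (I (fst z))) (S (fst z)) (snd (snd z))))"
    by (intro ptime_relax a l[OF T] l[OF V] l[OF ks] l[OF sl1] l[OF sl2] l[OF I] l[OF S])
qed

lemma ptime_aug:
  assumes T: "ptime X N f (\<lambda>x. eT (T x))" and V: "ptime X N f (\<lambda>x. eN (V x))"
    and ks: "ptime X N f (\<lambda>x. eN (ks x))" and sl1: "ptime X N f (\<lambda>x. eN (sl1 x))"
    and sl2: "ptime X N f (\<lambda>x. eN (sl2 x))" and S: "ptime X N f (\<lambda>x. eN (S x))"
    and I: "ptime X N f (\<lambda>x. eN (I x))"
  shows "ptime X N f (\<lambda>x. eN (aug (test_span (T x) (V x) (ks x) (sl1 x)) (test_heads (T x) (sl2 x)) (weight_of (T x)) (S x) (I x)))"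
  unfolding aug_def
  apply (rule ptime_case_list[where ec = eN and e = eLab and g = I and
      l = "\<lambda>x. best lab_le (filter (\<lambda>l. fst l \<notin> set (I x) \<and> test_heads (T x) (sl2 x) (fst l # I x))
        (labels (exch_of (T x) (V x) (ks x) (sl1 x) (sl2 x) (I x))
          (src_of (T x) (V x) (ks x) (sl1 x) (I x)) (signed (weight_of (T x)) (I x)) (S x)))" and
      h = "\<lambda>x l _. filter (\<lambda>e. (e \<in> set (I x)) \<noteq> (e \<in> set (snd (snd (snd l))))) (S x)"])
    apply (rule ptime_best_lab)
    apply (rule ptime_filter[where e = eLab and P = "\<lambda>x l. fst l \<notin> set (I x) \<and> test_heads (T x) (sl2 x) (fst l # I x)",
        OF ptime_labels[OF T V ks sl1 sl2 I S]])
  subgoal premises p for Z u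
    by (intro ptime_and ptime_not ptime_mem ptime_test_heads ptime_Cons ptime_fst[OF p(3)]
        p(2)[OF T] p(2)[OF sl2] p(2)[OF I])
   apply (rule ptime_subset[OF I], blast)
  subgoal premises p for Z u
    apply (rule ptime_filter[where P = "\<lambda>z e. (e \<in> set (I (fst z))) \<noteq> (e \<in> set (snd (snd (snd (fst (snd z))))))", OF p(2)[OF S]])
    subgoal premises q for Z' u'
    proof -
      note m1 = ptime_mem[OF q(3) q(2)[OF p(2)[OF I]]]
        and m2 = ptime_mem[OF q(3) q(2)[OF ptime_snd[OF ptime_snd[OF ptime_snd[OF p(3)]]]]]
      show ?thesis
        by (rule ptime_out[OF ptime_or[OF ptime_and[OF m1 ptime_not[OF m2]] ptime_and[OF ptime_not[OF m1] m2]]], rule arg_cong[of _ _ eB]) auto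
    qed
    done
  done

lemma aug_length: "length ((aug i1 i2 w S ^^ j) []) \<le> length S"
  by (induction j) (simp_all add: aug_def split: list.split)

lemma ptime_base:
  assumes T: "ptime X N f (\<lambda>x. eT (T x))" and V: "ptime X N f (\<lambda>x. eN (V x))"
    and ks: "ptime X N f (\<lambda>x. eN (ks x))" and sl1: "ptime X N f (\<lambda>x. eN (sl1 x))"
    and sl2: "ptime X N f (\<lambda>x. eN (sl2 x))"
  shows "ptime X N f (\<lambda>x. eN (base (T x) (V x) (ks x) (sl1 x) (sl2 x)))"
  unfolding base_def common_opt_def
proof -
  have S: "ptime X N f (\<lambda>x. eN (map fst (T x)))"
    by (rule ptime_map[where h = "\<lambda>_. fst", OF T], rule ptime_fst)
  show "ptime X N f (\<lambda>x. eN ((aug (test_span (T x) (V x) (ks x) (sl1 x)) (test_heads (T x) (sl2 x)) (weight_of (T x))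
      (map fst (T x)) ^^ length (map fst (T x))) []))"
  proof (rule ptime_iterate[where e = Num and ea = eN and ys = "\<lambda>x. map fst (T x)" and init = "\<lambda>_. []" and
        h = "\<lambda>x. aug (test_span (T x) (V x) (ks x) (sl1 x)) (test_heads (T x) (sl2 x)) (weight_of (T x)) (map fst (T x))",
        OF S ptime_Nil[OF S]])
    show "pbound X N (\<lambda>x. 1 + 2 * length (map fst (T x)))" by (intro pbound_intros ptime_length_bound[OF S])
    show "data_size (eN ((aug (test_span (T x) (V x) (ks x) (sl1 x)) (test_heads (T x) (sl2 x)) (weight_of (T x))
        (map fst (T x)) ^^ j) [])) \<le> 1 + 2 * length (map fst (T x))" for x j
      unfolding data_size_nums by (intro add_left_mono mult_left_mono aug_length) simp
    fix Z :: "('a \<times> real \<times> real list) set" and u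
    assume l: "\<And>g. ptime X N f g \<Longrightarrow> ptime Z (\<lambda>z. N (fst z)) u (\<lambda>z. g (fst z))"
      and a: "ptime Z (\<lambda>z. N (fst z)) u (\<lambda>z. eN (snd (snd z)))"
    show "ptime Z (\<lambda>z. N (fst z)) u (\<lambda>z. eN (aug (test_span (T (fst z)) (V (fst z)) (ks (fst z)) (sl1 (fst z)))
        (test_heads (T (fst z)) (sl2 (fst z))) (weight_of (T (fst z))) (map fst (T (fst z))) (snd (snd z))))"
      by (intro ptime_aug a l[OF T] l[OF V] l[OF ks] l[OF sl1] l[OF sl2] l[OF S])
  qed
qed

lemma ptime_orient:
  assumes T: "ptime X N f (\<lambda>x. eT (T x))" and sl: "ptime X N f (\<lambda>x. eN (sl x))"
    and I: "ptime X N f (\<lambda>x. eN (I x))"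
  shows "ptime X N f (\<lambda>x. eA (orient (T x) (sl x) (I x)))"
  unfolding orient_def
  apply (rule ptime_concat_map[where h = "\<lambda>_ s. map (\<lambda>it. (fst it, svert s)) (socc s)",
      OF ptime_snd[OF ptime_hall[OF ptime_head_items[OF T I] sl]]])
  subgoal premises p for Z u
    apply (rule ptime_map[where h = "\<lambda>z it. (fst it, svert (snd z))", OF ptime_snd[OF ptime_snd[OF ptime_snd[OF p(3)]]]])
    subgoal premises q for Z' u'
      by (intro ptime_pair ptime_fst[OF q(3)] q(2)[OF ptime_fst[OF ptime_snd[OF p(3)]]])
    done
  done

section \<open>The decomposition as a program\<close>

abbreviation eGrow :: "(real \<times> real) list \<times> (real \<times> real) list \<times> real list \<Rightarrow> data" where
  "eGrow \<equiv> eP eA (eP eA eN)"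

lemma ptime_grow:
  assumes T: "ptime X N f (\<lambda>x. eT (T x))" and V: "ptime X N f (\<lambda>x. eN (V x))"
    and ks: "ptime X N f (\<lambda>x. eN (ks x))" and st: "ptime X N f (\<lambda>x. eGrow (st x))"
  shows "ptime X N f (\<lambda>x. eGrow (grow (T x) (V x) (ks x) (st x)))"
proof -
  note D = ptime_fst[OF st] and F = ptime_fst[OF ptime_snd[OF st]] and U = ptime_snd[OF ptime_snd[OF st]]
  have without: "ptime Z M u (\<lambda>z. eA (filter (\<lambda>d. fst d \<noteq> a z) (E z)))"
    if "ptime Z M u (\<lambda>z. Num (a z))" "ptime Z M u (\<lambda>z. eA (E z))" for Z :: "('a \<times> 'c) set" and M u a E
    apply (rule ptime_filter[where P = "\<lambda>z d. fst d \<noteq> a z", OF that(2)])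
    subgoal premises p for Z' u' by (intro ptime_not ptime_eq ptime_fst[OF p(3)] p(2)[OF that(1)])
    done
  show ?thesis
    unfolding grow_def
    apply (rule ptime_case_list[where ec = eGrow and e = "eP Num Num" and g = st and
        l = "\<lambda>x. filter (\<lambda>a. snd a \<notin> set (snd (snd (st x))) \<and>
          (\<exists>u\<in>set (tails_of (T x) (fst a)). u \<in> set (snd (snd (st x)))) \<and>
          test_conn (T x) (V x) (ks x) (filter (\<lambda>d. fst d \<noteq> fst a) (fst (st x)))) (fst (st x))" and
        h = "\<lambda>x a _. (filter (\<lambda>d. fst d \<noteq> fst a) (fst (st x)), a # fst (snd (st x)), snd a # snd (snd (st x)))"])
      apply (rule ptime_filter[where P = "\<lambda>x a. snd a \<notin> set (snd (snd (st x))) \<and>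
          (\<exists>u\<in>set (tails_of (T x) (fst a)). u \<in> set (snd (snd (st x)))) \<and>
          test_conn (T x) (V x) (ks x) (filter (\<lambda>d. fst d \<noteq> fst a) (fst (st x)))", OF D])
    subgoal premises p for Z u
    proof (intro ptime_and ptime_not ptime_mem ptime_test_conn without)
      show "ptime Z (\<lambda>z. N (fst z)) u
         (\<lambda>z. eB (\<exists>u\<in>set (tails_of (T (fst z)) (fst (snd z))). u \<in> set (snd (snd (st (fst z))))))"
        apply (rule ptime_bex[where P = "\<lambda>z u. u \<in> set (snd (snd (st (fst z))))", OF ptime_tails_of[OF p(2)[OF T] ptime_fst[OF p(3)]]])
        subgoal premises q for Z' u' by (intro ptime_mem q(3) q(2)[OF p(2)[OF U]])
        done
    qed (intro p(2)[OF U] p(2)[OF D] p(2)[OF T] p(2)[OF V] p(2)[OF ks] ptime_fst[OF p(3)] ptime_snd[OF p(3)])+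
     apply (rule ptime_subset[OF st], blast)
    subgoal premises p for Z u
      by (intro ptime_pair ptime_Cons without p(2)[OF D] p(2)[OF F] p(2)[OF U] p(3) ptime_fst[OF p(3)] ptime_snd[OF p(3)])
    done
qed

lemma grow_lengths:
  assumes "st = (grow T V ks ^^ j) (D, [], [- 1])"
  shows "length (fst st) \<le> length D \<and> length (fst (snd st)) \<le> j \<and> length (snd (snd st)) \<le> Suc j"
  using assms
proof (induction j arbitrary: st)
  case (Suc j)
  define st' where "st' = (grow T V ks ^^ j) (D, [], [- 1])"
  have "st = grow T V ks st'" using Suc.prems by (simp add: st'_def)
  moreover have "length (filter P (fst st')) \<le> length D" for P
    using Suc.IH[OF st'_def] length_filter_le[of P "fst st'"] by linarith
  ultimately show ?case using Suc.IH[OF st'_def] by (simp add: grow_def split: list.split)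
qed simp

lemma ptime_grown:
  assumes T: "ptime X N f (\<lambda>x. eT (T x))" and V: "ptime X N f (\<lambda>x. eN (V x))"
    and ks: "ptime X N f (\<lambda>x. eN (ks x))" and D: "ptime X N f (\<lambda>x. eA (D x))"
  shows "ptime X N f (\<lambda>x. eGrow ((grow (T x) (V x) (ks x) ^^ length (V x)) (D x, [], [- 1])))"
proof (rule ptime_iterate[where e = Num and ea = eGrow and ys = V and init = "\<lambda>x. (D x, [], [- 1])" and
      h = "\<lambda>x. grow (T x) (V x) (ks x)", OF V])
  show "ptime X N f (\<lambda>x. eGrow (D x, [], [- 1]))"
    by (intro ptime_pair D ptime_Nil[OF D] ptime_single ptime_m1[OF D])
  show "pbound X N (\<lambda>x. 10 + 4 * length (D x) + 6 * length (V x))"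
    by (intro pbound_intros ptime_length_bound[OF D] ptime_length_bound[OF V])
  show "data_size (eGrow ((grow (T x) (V x) (ks x) ^^ j) (D x, [], [- 1]))) \<le> 10 + 4 * length (D x) + 6 * length (V x)"
    if "j \<le> length (V x)" for x j
    using grow_lengths[OF refl, of j "T x" "V x" "ks x" "D x"] that by simp
  fix Z :: "('a \<times> real \<times> (real \<times> real) list \<times> (real \<times> real) list \<times> real list) set" and u
  assume l: "\<And>g. ptime X N f g \<Longrightarrow> ptime Z (\<lambda>z. N (fst z)) u (\<lambda>z. g (fst z))"
    and a: "ptime Z (\<lambda>z. N (fst z)) u (\<lambda>z. eGrow (snd (snd z)))"
  show "ptime Z (\<lambda>z. N (fst z)) u (\<lambda>z. eGrow (grow (T (fst z)) (V (fst z)) (ks (fst z)) (snd (snd z))))"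
    by (intro ptime_grow a l[OF T] l[OF V] l[OF ks])
qed

abbreviation eStage :: "real list \<times> (real \<times> real) list \<times> (real \<times> real) list list \<Rightarrow> data" where
  "eStage \<equiv> eP eN (eP eA (eL eA))"

lemma ptime_stage:
  assumes T: "ptime X N f (\<lambda>x. eT (T x))" and V: "ptime X N f (\<lambda>x. eN (V x))"
    and st: "ptime X N f (\<lambda>x. eStage (st x))"
  shows "ptime X N f (\<lambda>x. eStage (stage (T x) (V x) (st x)))"
  unfolding stage_def
  apply (rule ptime_case_list[where ec = eStage and e = Num and l = "\<lambda>x. fst (st x)" and g = st and
      h = "\<lambda>x _ ks. (ks, fst ((grow (T x) (V x) ks ^^ length (V x)) (fst (snd (st x)), [], [- 1])),
         fst (snd ((grow (T x) (V x) ks ^^ length (V x)) (fst (snd (st x)), [], [- 1]))) # snd (snd (st x)))", OF ptime_fst[OF st] ptime_subset[OF st]], blast)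
  subgoal premises p for Z u
  proof -
    note G = ptime_grown[OF p(2)[OF T] p(2)[OF V] p(4) p(2)[OF ptime_fst[OF ptime_snd[OF st]]]]
    show ?thesis
      by (intro ptime_pair ptime_Cons p(4) ptime_fst[OF G] ptime_fst[OF ptime_snd[OF G]]
          p(2)[OF ptime_snd[OF ptime_snd[OF st]]])
  qed
  done

lemma stage_lengths:
  assumes "st = (stage T V ^^ j) (ks, D, [])"
  shows "length (fst st) \<le> length ks \<and> length (fst (snd st)) \<le> length D \<and> length (snd (snd st)) \<le> j \<and>
    (\<forall>p\<in>set (snd (snd st)). length p \<le> length V)"
  using assms
proof (induction j arbitrary: st)
  case (Suc j)
  define st' where "st' = (stage T V ^^ j) (ks, D, [])"
  note IH = Suc.IH[OF st'_def]
  have st: "st = stage T V st'" using Suc.prems by (simp add: st'_def)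
  show ?case
  proof (cases "fst st'")
    case Nil
    then show ?thesis using IH st by (simp add: stage_def le_SucI)
  next
    case (Cons r ks')
    then show ?thesis using IH st grow_lengths[OF refl, of "length V" T V ks' "fst (snd st')"]
      by (auto simp: stage_def)
  qed
qed simp

lemma ptime_decompose:
  assumes T: "ptime X N f (\<lambda>x. eT (T x))" and V: "ptime X N f (\<lambda>x. eN (V x))"
    and ks: "ptime X N f (\<lambda>x. eN (ks x))" and D: "ptime X N f (\<lambda>x. eA (D x))"
  shows "ptime X N f (\<lambda>x. eL eA (decompose (T x) (V x) (ks x) (D x)))"
  unfolding decompose_def
proof (rule ptime_snd, rule ptime_snd, rule ptime_iterate[where e = Num and ea = eStage and ys = ks and
      init = "\<lambda>x. (ks x, D x, [])" and h = "\<lambda>x. stage (T x) (V x)", OF ks])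
  show "ptime X N f (\<lambda>x. eStage (ks x, D x, []))"
    by (intro ptime_pair ks D ptime_Nil[OF D])
  show "pbound X N (\<lambda>x. 5 + 2 * length (ks x) + 4 * length (D x) + length (ks x) * (1 + (1 + 4 * length (V x))))"
    by (intro pbound_intros ptime_length_bound[OF D] ptime_length_bound[OF V] ptime_length_bound[OF ks])
  show "data_size (eStage ((stage (T x) (V x) ^^ j) (ks x, D x, []))) \<le>
      5 + 2 * length (ks x) + 4 * length (D x) + length (ks x) * (1 + (1 + 4 * length (V x)))"
    if "j \<le> length (ks x)" for x j
  proof -
    define st where "st = (stage (T x) (V x) ^^ j) (ks x, D x, [])"
    note L = stage_lengths[OF st_def]
    have "data_size (eL eA (snd (snd st))) \<le> 1 + length (snd (snd st)) * (1 + (1 + 4 * length (V x)))"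
      by (rule data_size_eL_le) (use L in simp)
    also have "\<dots> \<le> 1 + length (ks x) * (1 + (1 + 4 * length (V x)))"
      using L that by (intro add_left_mono mult_le_mono1) simp
    finally show ?thesis using L unfolding st_def[symmetric] by simp
  qed
  fix Z :: "('a \<times> real \<times> real list \<times> (real \<times> real) list \<times> (real \<times> real) list list) set" and u
  assume l: "\<And>g. ptime X N f g \<Longrightarrow> ptime Z (\<lambda>z. N (fst z)) u (\<lambda>z. g (fst z))"
    and a: "ptime Z (\<lambda>z. N (fst z)) u (\<lambda>z. eStage (snd (snd z)))"
  show "ptime Z (\<lambda>z. N (fst z)) u (\<lambda>z. eStage (stage (T (fst z)) (V (fst z)) (snd (snd z))))"
    by (intro ptime_stage a l[OF T] l[OF V])
qed

section \<open>From the encoded instance to the output\<close>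

text \<open>Rows of the input are lists closed by \<open>Empty\<close>, whereas \<open>eP\<close>
  makes plain pairs. This encodes the last component together with the closing
  \<open>Empty\<close>.\<close>

definition eLast :: "('b \<Rightarrow> data) \<Rightarrow> 'b \<Rightarrow> data" where
  "eLast e y = Node (e y) Empty"

lemma ptime_eLast: "ptime X N f (\<lambda>x. eLast e (y x)) \<Longrightarrow> ptime X N f (\<lambda>x. e (y x))"
  unfolding eLast_def by (rule ptime_Left)

abbreviation eV :: "vrow \<Rightarrow> data" where "eV \<equiv> eP Num (eP Num (eLast Num))"
abbreviation eD :: "drow \<Rightarrow> data" where "eD \<equiv> eP Num (eP Num (eP Num (eLast eN)))"
abbreviation eH :: "hrow \<Rightarrow> data" where "eH \<equiv> eP Num (eP Num (eLast eN))"

lemma ptime_units: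
  assumes ds: "ptime X N f (\<lambda>x. eL eD (ds x))" and hs: "ptime X N f (\<lambda>x. eL eH (hs x))"
    and k: "ptime X N f (\<lambda>x. Num (k x))"
  shows "ptime X N f (\<lambda>x. eN (units (ds x) (hs x) (k x)))"
proof -
  have d: "ptime X N f (\<lambda>x. eN (map fst (ds x)))" by (rule ptime_map[where h = "\<lambda>_. fst", OF ds], rule ptime_fst)
  have h: "ptime X N f (\<lambda>x. eN (map fst (hs x)))" by (rule ptime_map[where h = "\<lambda>_. fst", OF hs], rule ptime_fst)
  have e: "ptime X N f (\<lambda>x. eN (map fst (enum (map fst (ds x) @ map fst (hs x)))))"
    by (rule ptime_map[where h = "\<lambda>_. fst", OF ptime_enum[OF ptime_append[OF d h]]], rule ptime_fst)
  show ?thesis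
    unfolding units_def
    apply (rule ptime_filter[where P = "\<lambda>x j. j < k x", OF e])
    subgoal premises p for Z u by (intro ptime_less p(3) p(2)[OF k])
    done
qed

lemma ptime_copies:
  assumes vs: "ptime X N f (\<lambda>x. eL eV (vs x))" and ks: "ptime X N f (\<lambda>x. eN (ks x))"
    and P: "\<And>(Z :: (('a \<times> vrow) \<times> real) set) M u r j. ptime Z M u (\<lambda>z. eV (r z)) \<Longrightarrow>
      ptime Z M u (\<lambda>z. Num (j z)) \<Longrightarrow> ptime Z M u (\<lambda>z. eB (P (r z) (j z)))"
  shows "ptime (X :: 'a set) N f (\<lambda>x. eN (concat (map (\<lambda>r. map (\<lambda>_. fst r) (filter (P r) (ks x))) (vs x))))"
  apply (rule ptime_concat_map[where h = "\<lambda>x r. map (\<lambda>_. fst r) (filter (P r) (ks x))", OF vs])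
  subgoal premises p for Z u
  proof (rule ptime_map[where h = "\<lambda>z _. fst (snd z)"])
    show "ptime Z (\<lambda>z. N (fst z)) u (\<lambda>z. eN (filter (P (snd z)) (ks (fst z))))"
      apply (rule ptime_filter[where P = "\<lambda>z. P (snd z)", OF p(2)[OF ks]])
      subgoal premises q for Z' u' by (rule P[OF q(2)[OF p(3)] q(3)])
      done
    show "(\<And>g. ptime Z (\<lambda>z. N (fst z)) u g \<Longrightarrow> ptime Z' M u' (\<lambda>z. g (fst z))) \<Longrightarrow>
        ptime Z' M u' (\<lambda>z. Num (fst (snd (fst z))))"
      for Z' :: "(('a \<times> vrow) \<times> real) set" and M u' using ptime_fst[OF p(3)] by blast
  qed
  done

lemma ptime_free_roots:
  assumes "ptime X N f (\<lambda>x. eL eV (vs x))" "ptime X N f (\<lambda>x. eN (ks x))"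
  shows "ptime X N f (\<lambda>x. eN (free_roots (vs x) (ks x)))"
  unfolding free_roots_def
  by (rule ptime_copies[OF assms]) (intro ptime_and ptime_le ptime_less,
    (assumption | erule ptime_fst[OF ptime_snd] | erule ptime_eLast[OF ptime_snd[OF ptime_snd]])+)

lemma ptime_fixed_roots:
  assumes "ptime X N f (\<lambda>x. eL eV (vs x))" "ptime X N f (\<lambda>x. eN (ks x))"
  shows "ptime X N f (\<lambda>x. eN (fixed_roots (vs x) (ks x)))"
  unfolding fixed_roots_def
  by (rule ptime_copies[OF assms]) (intro ptime_less, (assumption | erule ptime_fst[OF ptime_snd])+)

lemma ptime_demand:
  assumes "ptime X N f (\<lambda>x. eL eV (vs x))"
  shows "ptime X N f (\<lambda>x. Num (demand (vs x)))"
  unfolding demand_def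
  by (rule ptime_sum_list[where h = "\<lambda>_ r. fst (snd r)", OF assms]) (erule ptime_fst[OF ptime_snd])

lemma ptime_slots1:
  assumes vs: "ptime X N f (\<lambda>x. eL eV (vs x))" and ks: "ptime X N f (\<lambda>x. eN (ks x))"
  shows "ptime X N f (\<lambda>x. eN (slots1 (vs x) (ks x)))"
  unfolding slots1_def
proof (rule ptime_append)
  have "ptime X N f (\<lambda>x. eN (concat (map (\<lambda>r. map (\<lambda>_. fst r) (filter (\<lambda>_. True) (ks x))) (vs x))))"
    by (rule ptime_copies[OF vs ks]) (rule ptime_True)
  then show "ptime X N f (\<lambda>x. eN (concat (map (\<lambda>r. map (\<lambda>_. fst r) (ks x)) (vs x))))" by simp
  have F: "ptime X N f (\<lambda>x. eN (filter (\<lambda>j. demand (vs x) \<le> j) (ks x)))"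
    apply (rule ptime_filter[where P = "\<lambda>x j. demand (vs x) \<le> j", OF ks])
    subgoal premises p for Z u by (intro ptime_le p(3) p(2)[OF ptime_demand[OF vs]])
    done
  show "ptime X N f (\<lambda>x. eN (map (\<lambda>_. - 1) (filter (\<lambda>j. demand (vs x) \<le> j) (ks x))))"
    by (rule ptime_map[where h = "\<lambda>_ _. - 1", OF F], rule ptime_m1)
qed

lemma ptime_slots2:
  assumes "ptime X N f (\<lambda>x. eL eV (vs x))" "ptime X N f (\<lambda>x. eN (ks x))"
  shows "ptime X N f (\<lambda>x. eN (slots2 (vs x) (ks x)))"
  unfolding slots2_def
  by (rule ptime_copies[OF assms]) (intro ptime_le, (assumption | erule ptime_fst[OF ptime_snd])+)

lemma ptime_table:
  assumes ds: "ptime X N f (\<lambda>x. eL eD (ds x))" and hs: "ptime X N f (\<lambda>x. eL eH (hs x))"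
    and os: "ptime X N f (\<lambda>x. eN (os x))"
  shows "ptime X N f (\<lambda>x. eT (table (ds x) (hs x) (os x)))"
  unfolding table_def
proof (intro ptime_append)
  show "ptime X N f (\<lambda>x. eT (map (\<lambda>d. (fst d, fst (snd d), fst (snd (snd d)) # snd (snd (snd d)), [fst (snd (snd d))])) (ds x)))"
    apply (rule ptime_map[where h = "\<lambda>_ d. (fst d, fst (snd d), fst (snd (snd d)) # snd (snd (snd d)), [fst (snd (snd d))])", OF ds])
    subgoal premises p for Z u
      by (intro ptime_pair ptime_Cons ptime_single ptime_fst[OF p(3)] ptime_fst[OF ptime_snd[OF p(3)]]
          ptime_fst[OF ptime_snd[OF ptime_snd[OF p(3)]]] ptime_eLast[OF ptime_snd[OF ptime_snd[OF ptime_snd[OF p(3)]]]])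
    done
  show "ptime X N f (\<lambda>x. eT (map (\<lambda>h. (fst h, fst (snd h), snd (snd h), snd (snd h))) (hs x)))"
    apply (rule ptime_map[where h = "\<lambda>_ h. (fst h, fst (snd h), snd (snd h), snd (snd h))", OF hs])
    subgoal premises p for Z u
      by (intro ptime_pair ptime_fst[OF p(3)] ptime_fst[OF ptime_snd[OF p(3)]] ptime_eLast[OF ptime_snd[OF ptime_snd[OF p(3)]]])
    done
  show "ptime X N f (\<lambda>x. eT (map (\<lambda>p. (- 1 - fst p, 0, [- 1], [snd p])) (enum (os x))))"
    apply (rule ptime_map[where h = "\<lambda>_ p. (- 1 - fst p, 0, [- 1], [snd p])", OF ptime_enum[OF os]])
    subgoal premises p for Z u
      by (intro ptime_pair ptime_diff ptime_single ptime_m1[OF p(3)] ptime_0[OF p(3)] ptime_fst[OF p(3)] ptime_snd[OF p(3)])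
    done
qed

lemma ptime_len:
  assumes "ptime X N f (\<lambda>x. eL e (l x))"
  shows "ptime X N f (\<lambda>x. Num (len (l x)))"
  unfolding len_def by (rule ptime_sum_list[where h = "\<lambda>_ _. 1", OF assms]) (rule ptime_1)

lemma ptime_fixed_arcs:
  assumes os: "ptime X N f (\<lambda>x. eN (os x))" and fs: "ptime X N f (\<lambda>x. eN (fs x))"
  shows "ptime X N f (\<lambda>x. eA (fixed_arcs (os x) (fs x)))"
  unfolding fixed_arcs_def
  apply (rule ptime_map[where h = "\<lambda>x p. (- 1 - fst p - len (os x), snd p)", OF ptime_enum[OF fs]])
  subgoal premises p for Z u
    by (intro ptime_pair ptime_diff ptime_m1[OF p(3)] ptime_fst[OF p(3)] ptime_snd[OF p(3)] p(2)[OF ptime_len[OF os]])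
  done

lemma ptime_entry:
  assumes P: "ptime X N f (\<lambda>x. eA (P x))"
  shows "ptime X N f (\<lambda>x. entry (P x))"
  unfolding entry_def
proof (intro ptime_Node ptime_1[OF P] ptime_Empty[OF P])
  show "ptime X N f (\<lambda>x. Num (\<Sum>d\<leftarrow>P x. if fst d < 0 then snd d else 0))"
    apply (rule ptime_sum_list[where h = "\<lambda>_ d. if fst d < 0 then snd d else 0", OF P])
    subgoal premises p for Z u
      by (rule ptime_If[where e = Num]; intro ptime_less ptime_0[OF p(3)] ptime_fst[OF p(3)] ptime_snd[OF p(3)])
    done
  have F: "ptime X N f (\<lambda>x. eA (filter (\<lambda>d. 0 \<le> fst d) (P x)))"
    apply (rule ptime_filter[where P = "\<lambda>x d. 0 \<le> fst d", OF P])
    subgoal premises p for Z u by (intro ptime_le ptime_0[OF p(3)] ptime_fst[OF p(3)])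
    done
  show "ptime X N f (\<lambda>x. eN (map fst (filter (\<lambda>d. 0 \<le> fst d) (P x))))"
    by (rule ptime_map[where h = "\<lambda>_. fst", OF F], rule ptime_fst)
qed

lemma ptime_solve_many:
  assumes vs: "ptime X N f (\<lambda>x. eL eV (vs x))" and ks: "ptime X N f (\<lambda>x. eN (ks x))"
    and T: "ptime X N f (\<lambda>x. eT (T x))" and os: "ptime X N f (\<lambda>x. eN (os x))"
    and fs: "ptime X N f (\<lambda>x. eN (fs x))" and sl2: "ptime X N f (\<lambda>x. eN (sl2 x))"
    and I: "ptime X N f (\<lambda>x. eN (I x))" and k: "ptime X N f (\<lambda>x. Num (k x))"
  shows "ptime X N f (\<lambda>x. solve_many (vs x) (ks x) (T x) (os x) (fs x) (sl2 x) (I x) (k x))"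
proof -
  have V: "ptime X N f (\<lambda>x. eN (map fst (vs x)))" by (rule ptime_map[where h = "\<lambda>_. fst", OF vs], rule ptime_fst)
  have rows: "ptime X N f (\<lambda>x. eB (\<forall>r\<in>set (vs x). fst (snd r) \<le> k x \<and> fst (snd r) \<le> snd (snd r)))"
    apply (rule ptime_ball[where P = "\<lambda>x r. fst (snd r) \<le> k x \<and> fst (snd r) \<le> snd (snd r)", OF vs])
    subgoal premises p for Z u
      by (intro ptime_and ptime_le ptime_fst[OF ptime_snd[OF p(3)]] ptime_eLast[OF ptime_snd[OF ptime_snd[OF p(3)]]] p(2)[OF k])
    done
  have out: "ptime X N f (\<lambda>x. eL entry (decompose (T x) (map fst (vs x)) (ks x) (orient (T x) (sl2 x) (I x) @ fixed_arcs (os x) (fs x))))"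
  proof -
    note D = ptime_decompose[OF T V ks ptime_append[OF ptime_orient[OF T sl2 I] ptime_fixed_arcs[OF os fs]]]
    have "ptime X N f (\<lambda>x. eL (\<lambda>d. d) (map entry (decompose (T x) (map fst (vs x)) (ks x) (orient (T x) (sl2 x) (I x) @ fixed_arcs (os x) (fs x)))))"
      by (rule ptime_map[where h = "\<lambda>_. entry", OF D]) (rule ptime_entry)
    then show ?thesis by (simp add: eL_def)
  qed
  show ?thesis
    unfolding solve_many_def
    by (rule ptime_If[where e = "\<lambda>d. d"]; intro ptime_and ptime_eq ptime_le ptime_len[OF ks] ptime_len[OF I]
        ptime_len[OF sl2] ptime_demand ptime_Node rows out assms
        ptime_Empty[OF k])
qed

theorem ptime_solve:
  assumes vs: "ptime X N f (\<lambda>x. eL eV (vs x))" and ds: "ptime X N f (\<lambda>x. eL eD (ds x))"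
    and hs: "ptime X N f (\<lambda>x. eL eH (hs x))" and k: "ptime X N f (\<lambda>x. Num (k x))"
  shows "ptime X N f (\<lambda>x. solve (vs x) (ds x) (hs x) (k x))"
proof -
  note ks = ptime_units[OF ds hs k]
  note os = ptime_free_roots[OF vs ks] and sl2 = ptime_slots2[OF vs ks]
  note T = ptime_table[OF ds hs os]
  have V: "ptime X N f (\<lambda>x. eN (map fst (vs x)))" by (rule ptime_map[where h = "\<lambda>_. fst", OF vs], rule ptime_fst)
  note many = ptime_solve_many[OF vs ks T os ptime_fixed_roots[OF vs ks] sl2 ptime_base[OF T V ks ptime_slots1[OF vs ks] sl2] k]
  show ?thesis
    unfolding solve_def
    apply (rule ptime_case_list[where ec = "\<lambda>d. d" and e = eV and l = vs and g = "\<lambda>_. Empty" and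
        h = "\<lambda>x r rs. if rs = [] then
         if fst (snd r) \<le> k x \<and> k x \<le> snd (snd r)
         then Node (Node (Node (Num (k x)) (Node (Num (fst r)) (Node Empty Empty))) Empty) Empty
         else Empty
       else
         solve_many (vs x) (units (ds x) (hs x) (k x)) (table (ds x) (hs x) (free_roots (vs x) (units (ds x) (hs x) (k x))))
           (free_roots (vs x) (units (ds x) (hs x) (k x))) (fixed_roots (vs x) (units (ds x) (hs x) (k x)))
           (slots2 (vs x) (units (ds x) (hs x) (k x)))
           (base (table (ds x) (hs x) (free_roots (vs x) (units (ds x) (hs x) (k x)))) (map fst (vs x)) (units (ds x) (hs x) (k x))
              (slots1 (vs x) (units (ds x) (hs x) (k x))) (slots2 (vs x) (units (ds x) (hs x) (k x)))) (k x)", OF vs])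
     apply (rule ptime_subset[OF ptime_Empty[OF k]], blast)
    subgoal premises p for Z u
    proof (rule ptime_If[where e = "\<lambda>d. d"])
      show "ptime Z (\<lambda>z. N (fst z)) u (\<lambda>z. eB (snd (snd z) = []))" by (rule ptime_is_Nil[OF p(4)])
      note k = p(2)[OF k]
      show "ptime Z (\<lambda>z. N (fst z)) u (\<lambda>z. if fst (snd (fst (snd z))) \<le> k (fst z) \<and> k (fst z) \<le> snd (snd (fst (snd z)))
         then Node (Node (Node (Num (k (fst z))) (Node (Num (fst (fst (snd z)))) (Node Empty Empty))) Empty) Empty
         else Empty)"
        by (rule ptime_If[where e = "\<lambda>d. d"]; intro ptime_and ptime_le ptime_Node k ptime_Empty[OF k] ptime_fst[OF p(3)]
            ptime_fst[OF ptime_snd[OF p(3)]] ptime_eLast[OF ptime_snd[OF ptime_snd[OF p(3)]]])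
    qed (rule p(2)[OF many])
    done
qed


lemma (in inst) enc_instance_eq:
  "enc_instance (F, k, f, g, w) =
     Node (eL eV vs) (Node (eL eD ds) (Node (eL eH hs) (Node (Num (real k)) Empty)))"
  by (simp add: vs_def ds_def hs_def vl_def dl_def hl_def eL_def enc_list_def enc_nat_def[abs_def]
      enc_set_def eP_def eLast_def comp_def)

lemma poly_time_solvableI:
  assumes pt: "ptime I (\<lambda>i. data_size (enc i)) enc out" and out: "\<And>i. i \<in> I \<Longrightarrow> correct i (out i)"
  shows "poly_time_solvable I enc correct"
  using pt
proof (rule ptimeE)
  fix c T
  assume T: "pbound I (\<lambda>i. data_size (enc i)) T"
    and run: "\<And>i (s :: state). i \<in> I \<Longrightarrow> s 0 = enc i \<Longrightarrow> \<exists>t s'. exec c s t s' \<and> s' 0 = out i \<and> s' 1 = s 1 \<and> t \<le> T i"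
  from T obtain d where d: "\<And>i. i \<in> I \<Longrightarrow> T i \<le> (data_size (enc i) + 2) ^ d" unfolding pbound_def by blast
  show ?thesis
    unfolding poly_time_solvable_def
  \<comment> \<open>\<open>[:2, 1:]\<close> is the polynomial \<open>x + 2\<close>, the base used in
    \<open>pbound\<close>.\<close>
  proof (intro exI[of _ c] exI[of _ "[:2, 1:] ^ d"] ballI)
    fix i assume i: "i \<in> I"
    from run[OF i, of "(\<lambda>_. Empty)(0 := enc i)"] obtain t s where
      "exec c ((\<lambda>_. Empty)(0 := enc i)) t s" "s 0 = out i" "t \<le> T i" by auto
    with d[OF i] out[OF i] show "\<exists>t s. exec c ((\<lambda>_. Empty)(0 := enc i)) t s \<and>
        t \<le> poly ([:2, 1:] ^ d) (data_size (enc i)) \<and> correct i (s 0)"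
      by (intro exI[of _ t] exI[of _ s]) (auto simp: poly_power add.commute)
  qed
qed

theorem theorem7:
  "poly_time_solvable
     {(F, k, f, g, w). wf_mixed_hypergraph F}
     enc_instance
     correct_output"
proof -
  let ?X = "{(F, k, f, g, w). wf_mixed_hypergraph F} :: nat packing_instance set"
  define vs' where "vs' = (\<lambda>(F :: (nat, nat) mixed_hypergraph, k :: nat, f, g, w :: nat \<Rightarrow> real). inst.vs F f g)"
  define ds' where "ds' = (\<lambda>(F :: (nat, nat) mixed_hypergraph, k :: nat, f :: nat \<Rightarrow> nat, g :: nat \<Rightarrow> nat, w). inst.ds F w)"
  define hs' where "hs' = (\<lambda>(F :: (nat, nat) mixed_hypergraph, k :: nat, f :: nat \<Rightarrow> nat, g :: nat \<Rightarrow> nat, w). inst.hs F w)"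
  define k' where "k' = (\<lambda>(F :: (nat, nat) mixed_hypergraph, k :: nat, f :: nat \<Rightarrow> nat, g :: nat \<Rightarrow> nat, w :: nat \<Rightarrow> real). real k)"
  let ?N = "\<lambda>x. data_size (enc_instance x)"
  have "ptime ?X ?N enc_instance enc_instance" by (rule ptime_id, rule pbound_self)
  then have enc: "ptime ?X ?N enc_instance (\<lambda>x. Node (eL eV (vs' x)) (Node (eL eD (ds' x)) (Node (eL eH (hs' x)) (Node (Num (k' x)) Empty))))"
  proof (rule ptime_out)
    fix x assume "x \<in> ?X"
    then obtain F k f g w where x: "x = (F, k, f, g, w)" "wf_mixed_hypergraph F" by auto
    then interpret inst F k f g w by unfold_locales
    show "Node (eL eV (vs' x)) (Node (eL eD (ds' x)) (Node (eL eH (hs' x)) (Node (Num (k' x)) Empty))) = enc_instance x"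
      unfolding x(1) enc_instance_eq by (simp add: vs'_def ds'_def hs'_def k'_def)
  qed
  have "ptime ?X ?N enc_instance (\<lambda>x. solve (vs' x) (ds' x) (hs' x) (k' x))"
    by (rule ptime_solve[OF ptime_Left[OF enc] ptime_Left[OF ptime_Right[OF enc]]
        ptime_Left[OF ptime_Right[OF ptime_Right[OF enc]]]
        ptime_Left[OF ptime_Right[OF ptime_Right[OF ptime_Right[OF enc]]]]])
  then show ?thesis
  proof (rule poly_time_solvableI)
    fix x assume "x \<in> ?X"
    then obtain F k f g w where x: "x = (F, k, f, g, w)" "wf_mixed_hypergraph F" by auto
    then interpret inst F k f g w by unfold_locales
    show "correct_output x (solve (vs' x) (ds' x) (hs' x) (k' x))"
      using solve_correct unfolding x(1) vs'_def ds'_def hs'_def k'_def by simp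
  qed
qed

end
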